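(* Let $A,B$ be two antisymmetric real $(3\times3)$-matrices with $B\neq0$, let $W$ be a standard one-dimensional Wiener process, and consider the Stratonovich SDE $$dZ=AZ\,dt+BZ\circ dW$$ on the special orthogonal group $SO_3$. Let $\lambda$ be the normalized bi-invariant Riemannian volume measure on $SO_3$. If $[A,B]=AB-BA\neq0$, then $\lambda$ is an attractive probability measure and the unique invariant probability measure for the Feller semigroup generated by this SDE.
   Context: For a compact manifold $M$ and an SDE on $M$ whose solution started at $x\in M$ is $u^x$, the Feller semigroup is $P_tf(x)=\mathbb E f(u^x(t))$, and the transition kernel is $p(t,x,J)=\mathbb P(u^x(t)\in J)$, $J\in\mathscr B(M)$. A Borel probability measure $\nu$ on $M$ is invariant if $\int_M p(t,x,J)\,d\nu(x)=\nu(J)$ for all $t\ge0$, $J\in\mathscr B(M)$. It is attractive if $\lim_{t\to\infty}P_tf(x)=\int_M f\,d\nu$ for all $x\in M$ and $f\in C(M)$. $SO_3$ is the group of orthogonal real $(3\times 3)$-matrices with determinant $1$, equipped with a bi-invariant Riemannian metric; $\lambda$ is the corresponding normalized ($\lambda(SO_3)=1$) Riemannian volume measure. *)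

theory Defs
  imports "HOL-Probability.Probability"
begin

section \<open>The group and its Riemannian volume\<close>

definition SO3 :: "(real^3^3) set" where
  "SO3 = {Q. orthogonal_matrix Q \<and> det Q = 1}"

definition antisymmetric :: "real^'n^'n \<Rightarrow> bool" where
  "antisymmetric X \<longleftrightarrow> transpose X = - X"

text \<open>The tangent space at \<open>Q\<close> is realised inside the space of all matrices.\<close>

definition tangent_SO3 :: "real^3^3 \<Rightarrow> (real^3^3) set" where
  "tangent_SO3 Q = {Q ** X |X. antisymmetric X}"

text \<open>Left invariance gives \<open>g Q (Q ** X) (Q ** Y) = g 1 X Y\<close>, so smooth dependence of the
  metric on the base point is automatic and is not listed. The values of \<open>g Q\<close> outside the
  tangent space at \<open>Q\<close> are irrelevant. The differential of \<open>Q \<mapsto> P ** Q ** R\<close>,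
  a linear map, is that map itself.\<close>

definition biinvariant_metric_SO3 :: "(real^3^3 \<Rightarrow> real^3^3 \<Rightarrow> real^3^3 \<Rightarrow> real) \<Rightarrow> bool" where
  "biinvariant_metric_SO3 g \<longleftrightarrow>
     (\<forall>Q\<in>SO3. \<forall>\<xi>\<in>tangent_SO3 Q. \<forall>\<eta>\<in>tangent_SO3 Q. \<forall>\<zeta>\<in>tangent_SO3 Q. \<forall>a b.
        g Q (a *\<^sub>R \<xi> + b *\<^sub>R \<eta>) \<zeta> = a * g Q \<xi> \<zeta> + b * g Q \<eta> \<zeta>) \<and>
     (\<forall>Q\<in>SO3. \<forall>\<xi>\<in>tangent_SO3 Q. \<forall>\<eta>\<in>tangent_SO3 Q. g Q \<xi> \<eta> = g Q \<eta> \<xi>) \<and>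
     (\<forall>Q\<in>SO3. \<forall>\<xi>\<in>tangent_SO3 Q. \<xi> \<noteq> 0 \<longrightarrow> g Q \<xi> \<xi> > 0) \<and>
     (\<forall>P\<in>SO3. \<forall>Q\<in>SO3. \<forall>R\<in>SO3. \<forall>\<xi>\<in>tangent_SO3 Q. \<forall>\<eta>\<in>tangent_SO3 Q.
        g (P ** Q ** R) (P ** \<xi> ** R) (P ** \<eta> ** R) = g Q \<xi> \<eta>)"

definition local_parametrization_SO3 ::
    "(real^3) set \<Rightarrow> (real^3 \<Rightarrow> real^3^3) \<Rightarrow> (real^3 \<Rightarrow> real^3 \<Rightarrow> real^3^3) \<Rightarrow> bool" where
  "local_parametrization_SO3 U \<phi> \<phi>' \<longleftrightarrow>
     open U \<and> \<phi> ` U \<subseteq> SO3 \<and> openin (top_of_set SO3) (\<phi> ` U) \<and>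
     (\<exists>\<psi>. homeomorphism U (\<phi> ` U) \<phi> \<psi>) \<and>
     (\<forall>x\<in>U. (\<phi> has_derivative \<phi>' x) (at x) \<and> inj (\<phi>' x)) \<and>
     (\<forall>v. continuous_on U (\<lambda>x. \<phi>' x v))"

text \<open>In local coordinates the volume element is the square root of the Gram determinant
  of the coordinate vector fields.\<close>

definition riemannian_volume_SO3 ::
    "(real^3^3 \<Rightarrow> real^3^3 \<Rightarrow> real^3^3 \<Rightarrow> real) \<Rightarrow> (real^3^3) measure \<Rightarrow> bool" where
  "riemannian_volume_SO3 g vol \<longleftrightarrow>
     sets vol = sets (restrict_space borel SO3) \<and>
     (\<forall>U \<phi> \<phi>'. local_parametrization_SO3 U \<phi> \<phi>' \<longrightarrow>
        (\<forall>V. V \<in> sets borel \<and> V \<subseteq> U \<longrightarrow>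
           emeasure vol (\<phi> ` V) =
           (\<integral>\<^sup>+x\<in>V. ennreal (sqrt (det ((\<chi> i j. g (\<phi> x) (\<phi>' x (axis i 1)) (\<phi>' x (axis j 1))) :: real^3^3)))
              \<partial>lborel)))"

definition normalized_measure :: "'a measure \<Rightarrow> 'a measure" where
  "normalized_measure \<mu> = scale_measure (1 / emeasure \<mu> (space \<mu>)) \<mu>"


section \<open>Stochastic processes\<close>

text \<open>Processes are indexed by \<open>[0, \<infinity>)\<close>, rendered as real times \<open>t \<ge> 0\<close>. Path
  properties are required almost surely. No usual conditions are imposed on the filtration.\<close>

definition filtration_on :: "'w measure \<Rightarrow> (real \<Rightarrow> 'w measure) \<Rightarrow> bool" where
  "filtration_on M F \<longleftrightarrow> filtration (space M) F \<and> (\<forall>t. subalgebra M (F t))"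

definition adapted :: "(real \<Rightarrow> 'w measure) \<Rightarrow> (real \<Rightarrow> 'w \<Rightarrow> 'b::topological_space) \<Rightarrow> bool" where
  "adapted F X \<longleftrightarrow> (\<forall>t\<ge>0. X t \<in> borel_measurable (F t))"

definition continuous_process :: "'w measure \<Rightarrow> (real \<Rightarrow> 'w \<Rightarrow> 'b::topological_space) \<Rightarrow> bool" where
  "continuous_process M X \<longleftrightarrow> (AE \<omega> in M. continuous_on {0..} (\<lambda>t. X t \<omega>))"

definition wiener_process ::
    "'w measure \<Rightarrow> (real \<Rightarrow> 'w measure) \<Rightarrow> (real \<Rightarrow> 'w \<Rightarrow> real) \<Rightarrow> bool" where
  "wiener_process M F W \<longleftrightarrow>
     adapted F W \<and> continuous_process M W \<and> (AE \<omega> in M. W 0 \<omega> = 0) \<and>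
     (\<forall>s t. 0 \<le> s \<and> s < t \<longrightarrow>
        distributed M lborel (\<lambda>\<omega>. W t \<omega> - W s \<omega>) (normal_density 0 (sqrt (t - s))) \<and>
        prob_space.indep_set M (sets (F s))
          {(\<lambda>\<omega>. W t \<omega> - W s \<omega>) -` S \<inter> space M |S. S \<in> sets borel})"

definition martingale ::
    "'w measure \<Rightarrow> (real \<Rightarrow> 'w measure) \<Rightarrow> (real \<Rightarrow> 'w \<Rightarrow> real) \<Rightarrow> bool" where
  "martingale M F X \<longleftrightarrow>
     adapted F X \<and> (\<forall>t\<ge>0. integrable M (X t)) \<and>
     (\<forall>s t. 0 \<le> s \<and> s \<le> t \<longrightarrow> (AE \<omega> in M. real_cond_exp M (F s) (X t) \<omega> = X s \<omega>))"

definition continuous_local_martingale ::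
    "'w measure \<Rightarrow> (real \<Rightarrow> 'w measure) \<Rightarrow> (real \<Rightarrow> 'w \<Rightarrow> real) \<Rightarrow> bool" where
  "continuous_local_martingale M F X \<longleftrightarrow>
     adapted F X \<and> continuous_process M X \<and>
     (\<exists>\<tau> :: nat \<Rightarrow> 'w \<Rightarrow> real.
        (\<forall>n. stopping_time F (\<tau> n) \<and> (\<forall>\<omega>\<in>space M. 0 \<le> \<tau> n \<omega>)) \<and>
        (AE \<omega> in M. incseq (\<lambda>n. \<tau> n \<omega>) \<and> filterlim (\<lambda>n. \<tau> n \<omega>) at_top sequentially) \<and>
        (\<forall>n. martingale M F (\<lambda>t \<omega>. X (min t (\<tau> n \<omega>)) \<omega> - X 0 \<omega>)))"

definition partition_of :: "real \<Rightarrow> nat \<Rightarrow> (nat \<Rightarrow> real) \<Rightarrow> bool" where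
  "partition_of t n \<pi> \<longleftrightarrow> \<pi> 0 = 0 \<and> \<pi> n = t \<and> (\<forall>i<n. \<pi> i \<le> \<pi> (Suc i))"

definition continuous_finite_variation ::
    "'w measure \<Rightarrow> (real \<Rightarrow> 'w measure) \<Rightarrow> (real \<Rightarrow> 'w \<Rightarrow> real) \<Rightarrow> bool" where
  "continuous_finite_variation M F D \<longleftrightarrow>
     adapted F D \<and> continuous_process M D \<and>
     (AE \<omega> in M. \<forall>t\<ge>0. \<exists>C. \<forall>n \<pi>. partition_of t n \<pi> \<longrightarrow>
        (\<Sum>i<n. \<bar>D (\<pi> (Suc i)) \<omega> - D (\<pi> i) \<omega>\<bar>) \<le> C)"

definition continuous_semimartingale ::
    "'w measure \<Rightarrow> (real \<Rightarrow> 'w measure) \<Rightarrow> (real \<Rightarrow> 'w \<Rightarrow> real) \<Rightarrow> bool" where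
  "continuous_semimartingale M F X \<longleftrightarrow>
     adapted F X \<and> continuous_process M X \<and>
     (\<exists>N D. continuous_local_martingale M F N \<and> continuous_finite_variation M F D \<and>
        (AE \<omega> in M. \<forall>t\<ge>0. X t \<omega> = N t \<omega> + D t \<omega>))"


section \<open>Stratonovich equations\<close>

definition stratonovich_sum ::
    "(real \<Rightarrow> 'w \<Rightarrow> 'b::real_normed_vector) \<Rightarrow> (real \<Rightarrow> 'w \<Rightarrow> real) \<Rightarrow> nat \<Rightarrow> (nat \<Rightarrow> real) \<Rightarrow> 'w \<Rightarrow> 'b" where
  "stratonovich_sum Y X n \<pi> \<omega> =
     (\<Sum>i<n. (X (\<pi> (Suc i)) \<omega> - X (\<pi> i) \<omega>) *\<^sub>R ((1 / 2) *\<^sub>R (Y (\<pi> i) \<omega> + Y (\<pi> (Suc i)) \<omega>)))"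

text \<open>\<open>I\<close> is a version of the integral of \<open>Y\<close> against \<open>\<circ> dX\<close> over \<open>[0, t]\<close>: the limit
  in probability of the symmetric Riemann sums as the mesh of the partition tends to zero
  (the Fisk--Stratonovich integral, in Kunita's formulation). The limit exists whenever
  \<open>Y\<close> and \<open>X\<close> are continuous semimartingales, and then equals the Ito integral plus half
  the quadratic covariation.\<close>

definition has_stratonovich_integral ::
    "'w measure \<Rightarrow> (real \<Rightarrow> 'w \<Rightarrow> 'b::real_normed_vector) \<Rightarrow> (real \<Rightarrow> 'w \<Rightarrow> real) \<Rightarrow> real \<Rightarrow> ('w \<Rightarrow> 'b) \<Rightarrow> bool" where
  "has_stratonovich_integral M Y X t I \<longleftrightarrow>
     I \<in> borel_measurable M \<and>
     (\<forall>\<epsilon>>0. \<forall>\<eta>>0. \<exists>\<delta>>0. \<forall>n \<pi>.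
        partition_of t n \<pi> \<and> (\<forall>i<n. \<pi> (Suc i) - \<pi> i < \<delta>) \<longrightarrow>
        measure M {\<omega> \<in> space M. norm (stratonovich_sum Y X n \<pi> \<omega> - I \<omega>) > \<epsilon>} < \<eta>)"

text \<open>A solution of \<open>dZ = A Z dt + B Z \<circ> dW\<close> on \<open>SO3\<close> with \<open>Z 0 = x\<close>.\<close>

definition solution_SO3 ::
    "'w measure \<Rightarrow> (real \<Rightarrow> 'w measure) \<Rightarrow> (real \<Rightarrow> 'w \<Rightarrow> real) \<Rightarrow> real^3^3 \<Rightarrow> real^3^3 \<Rightarrow>
     real^3^3 \<Rightarrow> (real \<Rightarrow> 'w \<Rightarrow> real^3^3) \<Rightarrow> bool" where
  "solution_SO3 M F W A B x Z \<longleftrightarrow>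
     (\<forall>t\<ge>0. \<forall>\<omega>\<in>space M. Z t \<omega> \<in> SO3) \<and>
     adapted F Z \<and> continuous_process M Z \<and>
     (\<forall>i j. continuous_semimartingale M F (\<lambda>t \<omega>. Z t \<omega> $ i $ j)) \<and>
     (\<forall>t\<ge>0. \<exists>I. has_stratonovich_integral M (\<lambda>s \<omega>. B ** Z s \<omega>) W t I \<and>
        (AE \<omega> in M. Z t \<omega> = x + integral {0..t} (\<lambda>s. A ** Z s \<omega>) + I \<omega>))"


section \<open>Transition kernel, invariant and attractive measures\<close>

text \<open>Here \<open>u x\<close> is the solution started at \<open>x\<close>.\<close>

definition transition_kernel ::
    "'w measure \<Rightarrow> ('s \<Rightarrow> real \<Rightarrow> 'w \<Rightarrow> 's) \<Rightarrow> real \<Rightarrow> 's \<Rightarrow> 's set \<Rightarrow> real" where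
  "transition_kernel M u t x J = measure M {\<omega> \<in> space M. u x t \<omega> \<in> J}"

definition feller_semigroup ::
    "'w measure \<Rightarrow> ('s \<Rightarrow> real \<Rightarrow> 'w \<Rightarrow> 's) \<Rightarrow> real \<Rightarrow> ('s \<Rightarrow> real) \<Rightarrow> 's \<Rightarrow> real" where
  "feller_semigroup M u t f x = (\<integral>\<omega>. f (u x t \<omega>) \<partial>M)"

definition borel_probability_on :: "'s::topological_space set \<Rightarrow> 's measure \<Rightarrow> bool" where
  "borel_probability_on S \<nu> \<longleftrightarrow> sets \<nu> = sets (restrict_space borel S) \<and> prob_space \<nu>"

definition invariant_measure ::
    "'s::topological_space set \<Rightarrow> (real \<Rightarrow> 's \<Rightarrow> 's set \<Rightarrow> real) \<Rightarrow> 's measure \<Rightarrow> bool" where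
  "invariant_measure S p \<nu> \<longleftrightarrow>
     borel_probability_on S \<nu> \<and>
     (\<forall>t\<ge>0. \<forall>J\<in>sets (restrict_space borel S). (\<integral>x. p t x J \<partial>\<nu>) = measure \<nu> J)"

definition attractive_measure ::
    "'s::topological_space set \<Rightarrow> (real \<Rightarrow> ('s \<Rightarrow> real) \<Rightarrow> 's \<Rightarrow> real) \<Rightarrow> 's measure \<Rightarrow> bool" where
  "attractive_measure S P \<nu> \<longleftrightarrow>
     borel_probability_on S \<nu> \<and>
     (\<forall>x\<in>S. \<forall>f. continuous_on S f \<longrightarrow> ((\<lambda>t. P t f x) \<longlongrightarrow> (\<integral>y. f y \<partial>\<nu>)) at_top)"

end

theory Submission
  imports Defs
begin

text \<open>Expectations \<open>m t f\<close> of polynomials \<open>f\<close> in the matrix entries solve the linear equation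
  \<open>(d/dt) m t f = m t (G f)\<close> with \<open>G = A + B\<^sup>2 / 2\<close>, where a matrix \<open>X\<close> also denotes the derivation
  along the vector field \<open>z \<mapsto> X ** z\<close>. As \<open>A\<close> and \<open>B\<close> are antisymmetric, the sum of the squares of
  \<open>m t\<close> over all monomials of degree \<open>n\<close> is a Lyapunov function whose dissipation is the sum of the squares of
  \<open>m t (B f)\<close>. It follows that \<open>m t\<close> is determined by \<open>m 0\<close>, and by Barbalat's lemma that \<open>m t (B f)\<close>
  and its time derivative tend to zero, whence so do \<open>m t (A (B f))\<close> and \<open>m t ([A, B] f)\<close>. As \<open>[A, B] \<noteq> 0\<close>,
  the matrices \<open>B\<close>, \<open>[A, B]\<close> and \<open>[B, [A, B]]\<close> span the antisymmetric matrices, so \<open>m t\<close> becomes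
  asymptotically invariant under left translations; averaging over the group gives convergence to the
  Haar integral. The uniqueness also shows that the solution from \<open>x\<close> has the law of the solution from the
  identity translated by \<open>x\<close> on the right, which yields the invariance of the volume. That volume is
  bi-invariant because, in translated Cayley charts, its density does not depend on the translation.\<close>

section \<open>Brownian increments\<close>

text \<open>The evolution equation is obtained directly from Riemann sums. The symmetric sums
  converge only in probability, and of \<open>Z\<close> one knows a priori merely that it is
  bounded, continuous and a semimartingale. The correction B^2/2 is half the covariation of
  \<open>W\<close> and \<open>B ** Z\<close>. To find it, each increment of \<open>Z\<close> over a
  coarse cell is in turn replaced by a symmetric sum over a much finer grid: its left-point part is
  an orthogonal sum with computable moments, and the rest is bounded by a maximal increment of
  \<open>W\<close> times a tight family.

  The Lyapunov function is natural because the monomials of degree n reproduce the kernel (z . w)^n: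
  for expectations the sum of squares is the mean of (Z . Z')^n with an independent copy Z', and the
  kernel is unchanged when one rotation acts on both arguments.

  A further obstacle is that nothing is assumed about how \<open>Z x t\<close> depends on
  \<open>x\<close>, in particular no joint measurability. The equality in law with
  \<open>Z (mat 1) t ** x\<close> provides a version that is continuous in \<open>x\<close>, and
  integrals over starting points go through it.\<close>

locale brownian = prob_space M for M :: "'w measure" +
  fixes F :: "real \<Rightarrow> 'w measure" and W :: "real \<Rightarrow> 'w \<Rightarrow> real"
  assumes filt: "filtration_on M F" and wien: "wiener_process M F W"
begin

lemma subalg: "subalgebra M (F t)"
  using filt by (simp add: filtration_on_def)

lemma F_meas: "X \<in> measurable (F t) N \<Longrightarrow> X \<in> measurable M N"
  using measurable_from_subalg[OF subalg] .

lemma F_mono: "X \<in> measurable (F s) N \<Longrightarrow> s \<le> t \<Longrightarrow> X \<in> measurable (F t) N"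
  using filt by (intro measurable_from_subalg[of "F t" "F s"])
    (auto simp: filtration_on_def subalgebra_def filtration_def)

lemma W_F: "0 \<le> t \<Longrightarrow> W t \<in> borel_measurable (F t)"
  using wien by (simp add: wiener_process_def adapted_def)

lemma W_meas: "0 \<le> t \<Longrightarrow> W t \<in> borel_measurable M"
  using W_F F_meas by blast

lemma dW_dist:
  assumes "0 \<le> s" "s < t"
  shows "distributed M lborel (\<lambda>\<omega>. W t \<omega> - W s \<omega>) (normal_density 0 (sqrt (t - s)))"
  using wien assms by (simp add: wiener_process_def)

text \<open>Moments of a centred normal variable of variance t - s. The fourth moment enters through
  the variance of squared increments and through the sum that dominates the largest
  increment.\<close>

lemma
  assumes st: "0 \<le> s" "s < t"
  shows dW_int1: "integrable M (\<lambda>\<omega>. W t \<omega> - W s \<omega>)"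
    and dW_1: "expectation (\<lambda>\<omega>. W t \<omega> - W s \<omega>) = 0"
    and dW_int2: "integrable M (\<lambda>\<omega>. (W t \<omega> - W s \<omega>)\<^sup>2)"
    and dW_2: "expectation (\<lambda>\<omega>. (W t \<omega> - W s \<omega>)\<^sup>2) = t - s"
    and dW_int4: "integrable M (\<lambda>\<omega>. (W t \<omega> - W s \<omega>)^4)"
    and dW_4: "expectation (\<lambda>\<omega>. (W t \<omega> - W s \<omega>)^4) = 3 * (t - s)\<^sup>2"
proof -
  let ?\<sigma> = "sqrt (t - s)"
  have pos: "0 < ?\<sigma>" using st by simp
  have I: "integrable M (\<lambda>\<omega>. \<phi> (W t \<omega> - W s \<omega>)) \<and> expectation (\<lambda>\<omega>. \<phi> (W t \<omega> - W s \<omega>)) = c"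
    if "has_bochner_integral lborel (\<lambda>x. normal_density 0 ?\<sigma> x * \<phi> x) c" "\<phi> \<in> borel_measurable borel"
    for \<phi> :: "real \<Rightarrow> real" and c
    using distributed_integrable[OF dW_dist[OF st], of \<phi>] distributed_integral[OF dW_dist[OF st], of \<phi>] that
    by (auto simp: has_bochner_integral_iff)
  have "has_bochner_integral lborel (\<lambda>x. normal_density 0 ?\<sigma> x * x) 0"
    using normal_moment_odd[OF pos, of 0 0] by simp
  from I[OF this] show "integrable M (\<lambda>\<omega>. W t \<omega> - W s \<omega>)" "expectation (\<lambda>\<omega>. W t \<omega> - W s \<omega>) = 0" by auto
  have "has_bochner_integral lborel (\<lambda>x. normal_density 0 ?\<sigma> x * x^2) (t - s)"
  proof -
    have "fact (2 * 1) / ((2 / ?\<sigma>\<^sup>2) ^ 1 * fact 1) = t - s" using st by (simp add: fact_numeral)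
    with normal_moment_even[OF pos, of 0 1] show ?thesis by simp
  qed
  from I[OF this] show "integrable M (\<lambda>\<omega>. (W t \<omega> - W s \<omega>)\<^sup>2)" "expectation (\<lambda>\<omega>. (W t \<omega> - W s \<omega>)\<^sup>2) = t - s" by auto
  have "has_bochner_integral lborel (\<lambda>x. normal_density 0 ?\<sigma> x * x^4) (3 * (t - s)\<^sup>2)"
  proof -
    have "fact (2 * 2) / ((2 / ?\<sigma>\<^sup>2) ^ 2 * fact 2) = 3 * (t - s)\<^sup>2"
      using st by (simp add: fact_numeral power_divide)
    with normal_moment_even[OF pos, of 0 2] show ?thesis by simp
  qed
  from I[OF this] show "integrable M (\<lambda>\<omega>. (W t \<omega> - W s \<omega>)^4)" "expectation (\<lambda>\<omega>. (W t \<omega> - W s \<omega>)^4) = 3 * (t - s)\<^sup>2" by auto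
qed

text \<open>The increment is independent of the whole sigma-algebra \<open>F s\<close>, so functions
  of it are independent of every \<open>F s\<close>-measurable variable. All later cancellations and
  isometries for sums of increments rest on this factorization.\<close>

lemma
  assumes st: "0 \<le> s" "s < t" and X: "X \<in> borel_measurable (F s)" "integrable M X"
    and \<phi>: "\<phi> \<in> borel_measurable borel" "integrable M (\<lambda>\<omega>. \<phi> (W t \<omega> - W s \<omega>) :: real)"
  shows indep_mult_int: "integrable M (\<lambda>\<omega>. X \<omega> * \<phi> (W t \<omega> - W s \<omega>))"
    and indep_mult: "expectation (\<lambda>\<omega>. X \<omega> * \<phi> (W t \<omega> - W s \<omega>)) = expectation X * expectation (\<lambda>\<omega>. \<phi> (W t \<omega> - W s \<omega>))"
proof -
  let ?D = "\<lambda>\<omega>. W t \<omega> - W s \<omega>"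
  have D: "?D \<in> borel_measurable M" using st by (intro borel_measurable_diff W_meas) auto
  let ?G = "{?D -` S \<inter> space M |S. S \<in> sets borel}"
  have ind: "indep_set (sets (F s)) ?G"
    using wien st by (simp add: wiener_process_def)
  \<comment> \<open>The preimages of Borel sets under the increment already form a sigma-algebra,
    which contains the one generated by any function of the increment; independence then passes to
    smaller families.\<close>
  have G_alg: "sigma_sets (space M) ?G = ?G"
  proof -
    have "sets (vimage_algebra (space M) ?D borel) = ?G"
      by (intro sets_vimage_algebra2) auto
    then show ?thesis
      using sets.sigma_sets_eq[of "vimage_algebra (space M) ?D borel"] by simp
  qed
  have F_sp: "space (F s) = space M" using subalg[of s] by (simp add: subalgebra_def)
  have "indep_var borel X borel (\<lambda>\<omega>. \<phi> (?D \<omega>))"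
    unfolding indep_var_eq
  proof (intro conjI)
    show "random_variable borel X" using X F_meas by blast
    show "random_variable borel (\<lambda>\<omega>. \<phi> (?D \<omega>))" using D \<phi> by measurable
    have A: "sigma_sets (space M) {X -` A \<inter> space M |A. A \<in> sets borel} \<subseteq> sets (F s)"
    proof -
      have "{X -` A \<inter> space M |A. A \<in> sets borel} \<subseteq> sets (F s)"
        using measurable_sets[OF X(1)] unfolding F_sp by auto
      from sets.sigma_sets_subset[OF this] show ?thesis unfolding F_sp .
    qed
    have B: "sigma_sets (space M) {(\<lambda>\<omega>. \<phi> (?D \<omega>)) -` A \<inter> space M |A. A \<in> sets borel} \<subseteq> ?G"
    proof -
      have "{(\<lambda>\<omega>. \<phi> (?D \<omega>)) -` A \<inter> space M |A. A \<in> sets borel} \<subseteq> ?G"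
      proof clarify
        fix A :: "real set" assume "A \<in> sets borel"
        then have "\<phi> -` A \<in> sets borel" using \<phi>(1) measurable_sets[OF \<phi>(1)] by auto
        then show "\<exists>S. (\<lambda>\<omega>. \<phi> (?D \<omega>)) -` A \<inter> space M = ?D -` S \<inter> space M \<and> S \<in> sets borel"
          by (intro exI[of _ "\<phi> -` A"]) auto
      qed
      from sigma_sets_mono'[OF this, of "space M"] show ?thesis unfolding G_alg .
    qed
    show "indep_set (sigma_sets (space M) {X -` A \<inter> space M |A. A \<in> sets borel})
       (sigma_sets (space M) {(\<lambda>\<omega>. \<phi> (?D \<omega>)) -` A \<inter> space M |A. A \<in> sets borel})"
      unfolding indep_set_def
      by (rule indep_sets_mono_sets[OF ind[unfolded indep_set_def]])
        (auto split: bool.splits dest: subsetD[OF A] subsetD[OF B])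
  qed
  then show "integrable M (\<lambda>\<omega>. X \<omega> * \<phi> (?D \<omega>))"
    "expectation (\<lambda>\<omega>. X \<omega> * \<phi> (?D \<omega>)) = expectation X * expectation (\<lambda>\<omega>. \<phi> (?D \<omega>))"
    using indep_var_lebesgue_integral indep_var_integrable X \<phi> by auto
qed

lemma sq_int_imp_int: "X \<in> borel_measurable M \<Longrightarrow> integrable M (\<lambda>\<omega>. (X \<omega>)\<^sup>2 :: real) \<Longrightarrow> integrable M X"
  using square_integrable_imp_integrable by blast

lemma bdd_int: "X \<in> borel_measurable M \<Longrightarrow> (\<And>\<omega>. \<omega> \<in> space M \<Longrightarrow> norm (X \<omega>) \<le> K) \<Longrightarrow> integrable M X"
  for X :: "'w \<Rightarrow> 'b::{banach, second_countable_topology}"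
  by (rule integrable_const_bound[where B=K]) auto

lemma bdd_mult_int:
  assumes "X \<in> borel_measurable M" "\<And>\<omega>. \<omega> \<in> space M \<Longrightarrow> \<bar>X \<omega>\<bar> \<le> K" "integrable M Y"
  shows "integrable M (\<lambda>\<omega>. X \<omega> * Y \<omega> :: real)"
proof (rule Bochner_Integration.integrable_bound)
  show "integrable M (\<lambda>\<omega>. K * Y \<omega>)" using assms by simp
  show "AE \<omega> in M. norm (X \<omega> * Y \<omega>) \<le> norm (K * Y \<omega>)"
  proof (intro AE_I2)
    fix \<omega> assume "\<omega> \<in> space M"
    then have "\<bar>X \<omega>\<bar> \<le> \<bar>K\<bar>" using assms(2) by fastforce
    then show "norm (X \<omega> * Y \<omega>) \<le> norm (K * Y \<omega>)" by (simp add: abs_mult mult_right_mono)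
  qed
qed (use assms in measurable)

text \<open>Ito isometry in discrete form. The coefficient at step k is known at time
  \<open>\<tau> k\<close>, and the function of the next increment is centred and independent of the
  past, so the summands are orthogonal to one another and to bounded variables known at the start.
  The functions \<open>\<phi>\<close> are general because the lemma serves both for the increments
  themselves and for their squares minus the mean. The claims share one induction, since the step
  needs measurability and integrability of the preceding sum.\<close>

lemma orth_sum:
  fixes \<beta> :: "nat \<Rightarrow> 'w \<Rightarrow> real" and \<phi> :: "nat \<Rightarrow> real \<Rightarrow> real"
  assumes \<tau>: "0 \<le> \<tau> 0" "\<And>k. \<tau> k < \<tau> (Suc k)"
    and \<beta>: "\<And>k. \<beta> k \<in> borel_measurable (F (\<tau> k))" "\<And>k \<omega>. \<omega> \<in> space M \<Longrightarrow> \<bar>\<beta> k \<omega>\<bar> \<le> K"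
    and \<phi>: "\<And>k. \<phi> k \<in> borel_measurable borel"
      "\<And>k. integrable M (\<lambda>\<omega>. (\<phi> k (W (\<tau> (Suc k)) \<omega> - W (\<tau> k) \<omega>))\<^sup>2)"
      "\<And>k. expectation (\<lambda>\<omega>. \<phi> k (W (\<tau> (Suc k)) \<omega> - W (\<tau> k) \<omega>)) = 0"
      "\<And>k. expectation (\<lambda>\<omega>. (\<phi> k (W (\<tau> (Suc k)) \<omega> - W (\<tau> k) \<omega>))\<^sup>2) = v k"
  defines "S \<equiv> \<lambda>n \<omega>. \<Sum>k<n. \<beta> k \<omega> * \<phi> k (W (\<tau> (Suc k)) \<omega> - W (\<tau> k) \<omega>)"
  shows "S n \<in> borel_measurable (F (\<tau> n)) \<and> integrable M (\<lambda>\<omega>. (S n \<omega>)\<^sup>2) \<and>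
    expectation (\<lambda>\<omega>. (S n \<omega>)\<^sup>2) = (\<Sum>k<n. v k * expectation (\<lambda>\<omega>. (\<beta> k \<omega>)\<^sup>2)) \<and>
    (\<forall>\<xi> C. \<xi> \<in> borel_measurable (F (\<tau> 0)) \<and> (\<forall>\<omega>\<in>space M. \<bar>\<xi> \<omega>\<bar> \<le> C) \<longrightarrow> expectation (\<lambda>\<omega>. \<xi> \<omega> * S n \<omega>) = 0)"
proof (induction n)
  case 0
  show ?case by (simp add: S_def)
next
  case (Suc n)
  let ?d = "\<lambda>\<omega>. \<phi> n (W (\<tau> (Suc n)) \<omega> - W (\<tau> n) \<omega>)"
  have mono: "\<tau> i \<le> \<tau> j" if "i \<le> j" for i j
    using lift_Suc_mono_le[of \<tau> i j] \<tau>(2) that less_imp_le by blast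
  have nn: "0 \<le> \<tau> k" for k using mono[of 0 k] \<tau>(1) by simp
  have S_Suc: "S (Suc n) = (\<lambda>\<omega>. S n \<omega> + \<beta> n \<omega> * ?d \<omega>)" by (simp add: S_def)
  note b = \<beta>(1)[of n]
  have bM[measurable]: "\<beta> n \<in> borel_measurable M" using b F_meas by blast
  have SF: "S n \<in> borel_measurable (F (\<tau> n))" and SM[measurable]: "S n \<in> borel_measurable M"
    using Suc F_meas by blast+
  have dW: "(\<lambda>\<omega>. W (\<tau> (Suc n)) \<omega> - W (\<tau> n) \<omega>) \<in> borel_measurable (F (\<tau> (Suc n)))"
    using mono[of n "Suc n"] by (intro borel_measurable_diff W_F nn F_mono[OF W_F[OF nn[of n]]]) auto
  then have dF: "?d \<in> borel_measurable (F (\<tau> (Suc n)))"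
    using \<phi>(1)[of n] by measurable
  then have dM[measurable]: "?d \<in> borel_measurable M" using F_meas by blast
  have di: "integrable M ?d" using sq_int_imp_int[OF dM \<phi>(2)] .
  have m1: "S (Suc n) \<in> borel_measurable (F (\<tau> (Suc n)))"
    unfolding S_Suc using mono[of n "Suc n"]
    by (intro borel_measurable_add borel_measurable_times F_mono[OF b] F_mono[OF SF] dF) auto
  have Si: "integrable M (S n)" using sq_int_imp_int[OF SM] Suc by blast
  have Sb: "integrable M (\<lambda>\<omega>. \<beta> n \<omega> * S n \<omega>)" by (rule bdd_mult_int[OF bM \<beta>(2) Si])
  have bb: "integrable M (\<lambda>\<omega>. (\<beta> n \<omega>)\<^sup>2)"
    proof (rule bdd_int[where K="K\<^sup>2"])
    fix \<omega> assume "\<omega> \<in> space M"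
    then show "norm ((\<beta> n \<omega>)\<^sup>2) \<le> K\<^sup>2" using power_mono[OF \<beta>(2), of \<omega> n 2] by simp
  qed measurable
  note c1 = indep_mult_int[OF nn[of n] \<tau>(2)[of n] _ Sb \<phi>(1) di] indep_mult[OF nn[of n] \<tau>(2)[of n] _ Sb \<phi>(1) di]
  have Sbm: "(\<lambda>\<omega>. \<beta> n \<omega> * S n \<omega>) \<in> borel_measurable (F (\<tau> n))" using b SF by measurable
  have bbm: "(\<lambda>\<omega>. (\<beta> n \<omega>)\<^sup>2) \<in> borel_measurable (F (\<tau> n))" using b by measurable
  have \<phi>2: "(\<lambda>x. (\<phi> n x)\<^sup>2) \<in> borel_measurable borel" using \<phi>(1)[of n] by measurable
  note c2 = indep_mult_int[OF nn[of n] \<tau>(2)[of n] bbm bb \<phi>2 \<phi>(2)] indep_mult[OF nn[of n] \<tau>(2)[of n] bbm bb \<phi>2 \<phi>(2)]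
  \<comment> \<open>In the cross term the new factor is centred and independent of
    \<open>\<beta> n \<omega> * S n \<omega>\<close>, so this term vanishes in the mean.\<close>
  have eq: "(S (Suc n) \<omega>)\<^sup>2 = (S n \<omega>)\<^sup>2 + 2 * ((\<beta> n \<omega> * S n \<omega>) * ?d \<omega>) + (\<beta> n \<omega>)\<^sup>2 * (?d \<omega>)\<^sup>2" for \<omega>
    by (simp add: S_Suc power2_eq_square algebra_simps)
  have i2: "integrable M (\<lambda>\<omega>. (S (Suc n) \<omega>)\<^sup>2)"
    unfolding eq using Suc c1(1)[OF Sbm] c2(1) by (intro Bochner_Integration.integrable_add integrable_mult_right) auto
  have "expectation (\<lambda>\<omega>. (S (Suc n) \<omega>)\<^sup>2) = expectation (\<lambda>\<omega>. (S n \<omega>)\<^sup>2) + 2 * expectation (\<lambda>\<omega>. (\<beta> n \<omega> * S n \<omega>) * ?d \<omega>)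
     + expectation (\<lambda>\<omega>. (\<beta> n \<omega>)\<^sup>2 * (?d \<omega>)\<^sup>2)"
    unfolding eq using Suc c1(1)[OF Sbm] c2(1) by simp
  also have "\<dots> = (\<Sum>k<Suc n. v k * expectation (\<lambda>\<omega>. (\<beta> k \<omega>)\<^sup>2))"
    using Suc c1(2)[OF Sbm] c2(2) \<phi>(3,4) by (simp add: mult.commute)
  finally have e2: "expectation (\<lambda>\<omega>. (S (Suc n) \<omega>)\<^sup>2) = (\<Sum>k<Suc n. v k * expectation (\<lambda>\<omega>. (\<beta> k \<omega>)\<^sup>2))" .
  have "expectation (\<lambda>\<omega>. \<xi> \<omega> * S (Suc n) \<omega>) = 0"
    if \<xi>: "\<xi> \<in> borel_measurable (F (\<tau> 0))" "\<And>\<omega>. \<omega> \<in> space M \<Longrightarrow> \<bar>\<xi> \<omega>\<bar> \<le> C" for \<xi> C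
  proof -
    have \<xi>m[measurable]: "\<xi> \<in> borel_measurable M" using \<xi> F_meas by blast
    have \<xi>F: "(\<lambda>\<omega>. \<xi> \<omega> * \<beta> n \<omega>) \<in> borel_measurable (F (\<tau> n))"
      using F_mono[OF \<xi>(1) mono[of 0 n]] b by measurable
    have \<xi>b: "integrable M (\<lambda>\<omega>. \<xi> \<omega> * \<beta> n \<omega>)"
      by (intro bdd_mult_int[OF \<xi>m \<xi>(2)] bdd_int[OF bM, where K=K]) (use \<beta>(2) in auto)
    note c3 = indep_mult_int[OF nn[of n] \<tau>(2)[of n] \<xi>F \<xi>b \<phi>(1) di] indep_mult[OF nn[of n] \<tau>(2)[of n] \<xi>F \<xi>b \<phi>(1) di]
    have "expectation (\<lambda>\<omega>. \<xi> \<omega> * S (Suc n) \<omega>) = expectation (\<lambda>\<omega>. \<xi> \<omega> * S n \<omega> + (\<xi> \<omega> * \<beta> n \<omega>) * ?d \<omega>)"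
      by (simp add: S_Suc algebra_simps)
    also have "\<dots> = expectation (\<lambda>\<omega>. \<xi> \<omega> * S n \<omega>) + expectation (\<lambda>\<omega>. (\<xi> \<omega> * \<beta> n \<omega>) * ?d \<omega>)"
      by (intro Bochner_Integration.integral_add bdd_mult_int[OF \<xi>m \<xi>(2)] Si c3(1)) auto
    also have "\<dots> = 0"
    proof -
      have "expectation (\<lambda>\<omega>. \<xi> \<omega> * S n \<omega>) = 0" using Suc \<xi> by blast
      then show ?thesis using c3(2) \<phi>(3) by simp
    qed
    finally show ?thesis .
  qed
  with m1 i2 e2 show ?case by blast
qed

end

section \<open>Convergence in probability and tightness\<close>

text \<open>Convergence to zero in probability, with measurability built in so that limit statements
  carry it along.\<close>

definition (in prob_space) null_in_prob :: "(nat \<Rightarrow> 'a \<Rightarrow> 'b::real_normed_vector) \<Rightarrow> bool" where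
  "null_in_prob X \<longleftrightarrow> (\<forall>n. X n \<in> borel_measurable M) \<and>
     (\<forall>\<epsilon>>0. (\<lambda>n. prob {\<omega> \<in> space M. norm (X n \<omega>) > \<epsilon>}) \<longlonglongrightarrow> 0)"

text \<open>Boundedness in probability, uniformly in the index: the property by which a family may
  multiply a null sequence and leave it null.\<close>

definition (in prob_space) tight_family :: "('i \<Rightarrow> 'a \<Rightarrow> 'b::real_normed_vector) \<Rightarrow> bool" where
  "tight_family X \<longleftrightarrow> (\<forall>i. X i \<in> borel_measurable M) \<and>
     (\<forall>\<eta>>0. \<exists>K. \<forall>i. prob {\<omega> \<in> space M. norm (X i \<omega>) > K} \<le> \<eta>)"

section \<open>Calculus of null sequences and tight families\<close>

context prob_space begin

lemma prob_mono_AE: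
  assumes "AE \<omega> in M. P \<omega> \<longrightarrow> Q \<omega>" "Measurable.pred M P" "Measurable.pred M Q"
  shows "prob {\<omega> \<in> space M. P \<omega>} \<le> prob {\<omega> \<in> space M. Q \<omega>}"
  using assms by (intro finite_measure_mono_AE) auto

lemma prob_Un_le:
  assumes "AE \<omega> in M. P \<omega> \<longrightarrow> Q \<omega> \<or> R \<omega>"
    "Measurable.pred M P" "Measurable.pred M Q" "Measurable.pred M R"
  shows "prob {\<omega> \<in> space M. P \<omega>} \<le> prob {\<omega> \<in> space M. Q \<omega>} + prob {\<omega> \<in> space M. R \<omega>}"
proof -
  note [measurable] = assms(2-)
  have "prob {\<omega> \<in> space M. P \<omega>} \<le> prob {\<omega> \<in> space M. Q \<omega> \<or> R \<omega>}"
    using assms(1) by (intro prob_mono_AE) auto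
  also have "{\<omega> \<in> space M. Q \<omega> \<or> R \<omega>} = {\<omega> \<in> space M. Q \<omega>} \<union> {\<omega> \<in> space M. R \<omega>}" by auto
  also have "prob \<dots> \<le> prob {\<omega> \<in> space M. Q \<omega>} + prob {\<omega> \<in> space M. R \<omega>}"
    by (intro measure_Un_le) auto
  finally show ?thesis .
qed

lemma markov_prob:
  fixes X :: "'a \<Rightarrow> 'b::real_normed_vector"
  assumes [measurable]: "X \<in> borel_measurable M" and "integrable M (\<lambda>\<omega>. norm (X \<omega>))" "0 < c"
  shows "prob {\<omega> \<in> space M. norm (X \<omega>) > c} \<le> expectation (\<lambda>\<omega>. norm (X \<omega>)) / c"
proof -
  have "prob {\<omega> \<in> space M. norm (X \<omega>) > c} \<le> prob {\<omega> \<in> space M. norm (X \<omega>) \<ge> c}"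
    by (intro prob_mono_AE) auto
  also have "\<dots> \<le> expectation (\<lambda>\<omega>. norm (X \<omega>)) / c"
    using integral_Markov_inequality_measure[OF assms(2), of "space M" c] assms(3) by simp
  finally show ?thesis .
qed

lemma null_in_probI:
  fixes X :: "nat \<Rightarrow> 'a \<Rightarrow> 'b::real_normed_vector"
  assumes "\<And>n. X n \<in> borel_measurable M"
    "\<And>\<epsilon> \<eta>. \<epsilon> > 0 \<Longrightarrow> \<eta> > 0 \<Longrightarrow> eventually (\<lambda>n. prob {\<omega> \<in> space M. norm (X n \<omega>) > \<epsilon>} \<le> \<eta>) sequentially"
  shows "null_in_prob X"
  unfolding null_in_prob_def
proof (intro conjI allI impI assms(1))
  fix \<epsilon> :: real assume "0 < \<epsilon>"
  show "(\<lambda>n. prob {\<omega> \<in> space M. norm (X n \<omega>) > \<epsilon>}) \<longlonglongrightarrow> 0"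
    unfolding tendsto_iff
  proof (intro allI impI)
    fix e :: real assume "0 < e"
    then show "eventually (\<lambda>n. dist (prob {\<omega> \<in> space M. norm (X n \<omega>) > \<epsilon>}) 0 < e) sequentially"
      using assms(2)[OF \<open>0 < \<epsilon>\<close>, of "e/2"] by (auto elim!: eventually_mono)
  qed
qed

lemma null_in_probD:
  fixes X :: "nat \<Rightarrow> 'a \<Rightarrow> 'b::real_normed_vector"
  assumes "null_in_prob X" "\<epsilon> > 0" "\<eta> > 0"
  shows "eventually (\<lambda>n. prob {\<omega> \<in> space M. norm (X n \<omega>) > \<epsilon>} < \<eta>) sequentially"
  using order_tendstoD(2)[of _ 0 sequentially \<eta>] assms by (auto simp: null_in_prob_def)

lemma tight_familyD:
  assumes "tight_family X" "0 < \<eta>"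
  shows "\<exists>K. \<forall>i. prob {\<omega> \<in> space M. norm (X i \<omega>) > K} \<le> \<eta>"
  using assms unfolding tight_family_def by simp

lemma null_in_prob_dom:
  fixes X :: "nat \<Rightarrow> 'a \<Rightarrow> 'b::real_normed_vector" and Y :: "nat \<Rightarrow> 'a \<Rightarrow> 'c::real_normed_vector"
  assumes Y: "null_in_prob Y" and X[measurable]: "\<And>n. X n \<in> borel_measurable M"
    and le: "\<And>n. AE \<omega> in M. norm (X n \<omega>) \<le> C * norm (Y n \<omega>)"
  shows "null_in_prob X"
proof (rule null_in_probI[OF X])
  fix \<epsilon> \<eta> :: real assume e: "\<epsilon> > 0" "\<eta> > 0"
  have [measurable]: "Y n \<in> borel_measurable M" for n using Y by (simp add: null_in_prob_def)
  define D where "D = max C 1"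
  have D: "D \<ge> 1" "C \<le> D" by (auto simp: D_def)
  have "prob {\<omega> \<in> space M. norm (X n \<omega>) > \<epsilon>} \<le> prob {\<omega> \<in> space M. norm (Y n \<omega>) > \<epsilon> / D}" for n
  proof (rule prob_mono_AE)
    show "AE \<omega> in M. norm (X n \<omega>) > \<epsilon> \<longrightarrow> norm (Y n \<omega>) > \<epsilon> / D"
      using le[of n]
    proof (eventually_elim, intro impI)
      fix \<omega> assume a: "norm (X n \<omega>) \<le> C * norm (Y n \<omega>)" "norm (X n \<omega>) > \<epsilon>"
      have "C * norm (Y n \<omega>) \<le> D * norm (Y n \<omega>)" using D by (intro mult_right_mono) auto
      then show "norm (Y n \<omega>) > \<epsilon> / D" using a D by (simp add: field_simps)
    qed
  qed measurable
  moreover have "eventually (\<lambda>n. prob {\<omega> \<in> space M. norm (Y n \<omega>) > \<epsilon> / D} < \<eta>) sequentially"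
    using null_in_probD[OF Y, of "\<epsilon>/D" \<eta>] e D by simp
  ultimately show "eventually (\<lambda>n. prob {\<omega> \<in> space M. norm (X n \<omega>) > \<epsilon>} \<le> \<eta>) sequentially"
    by (auto elim!: eventually_mono intro: order_trans less_imp_le)
qed

lemma null_in_prob_add:
  fixes X Y :: "nat \<Rightarrow> 'a \<Rightarrow> 'b::{real_normed_vector, second_countable_topology}"
  assumes X: "null_in_prob X" and Y: "null_in_prob Y"
  shows "null_in_prob (\<lambda>n \<omega>. X n \<omega> + Y n \<omega>)"
proof (rule null_in_probI)
  have [measurable]: "X n \<in> borel_measurable M" "Y n \<in> borel_measurable M" for n
    using X Y by (auto simp: null_in_prob_def)
  show "(\<lambda>\<omega>. X n \<omega> + Y n \<omega>) \<in> borel_measurable M" for n by measurable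
  fix \<epsilon> \<eta> :: real assume e: "\<epsilon> > 0" "\<eta> > 0"
  have le: "prob {\<omega> \<in> space M. norm (X n \<omega> + Y n \<omega>) > \<epsilon>} \<le>
     prob {\<omega> \<in> space M. norm (X n \<omega>) > \<epsilon>/2} + prob {\<omega> \<in> space M. norm (Y n \<omega>) > \<epsilon>/2}" for n
  proof (rule prob_Un_le)
    show "AE \<omega> in M. \<epsilon> < norm (X n \<omega> + Y n \<omega>) \<longrightarrow> \<epsilon> / 2 < norm (X n \<omega>) \<or> \<epsilon> / 2 < norm (Y n \<omega>)"
    proof (intro AE_I2 impI)
      fix \<omega> assume "\<epsilon> < norm (X n \<omega> + Y n \<omega>)"
      with norm_triangle_ineq[of "X n \<omega>" "Y n \<omega>"]
      show "\<epsilon> / 2 < norm (X n \<omega>) \<or> \<epsilon> / 2 < norm (Y n \<omega>)" by argo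
    qed
  qed measurable
  show "eventually (\<lambda>n. prob {\<omega> \<in> space M. norm (X n \<omega> + Y n \<omega>) > \<epsilon>} \<le> \<eta>) sequentially"
    using null_in_probD[OF X half_gt_zero[OF e(1)] half_gt_zero[OF e(2)]]
      null_in_probD[OF Y half_gt_zero[OF e(1)] half_gt_zero[OF e(2)]]
  proof eventually_elim
    case (elim n)
    then show ?case using le[of n] by linarith
  qed
qed

lemma null_in_prob_scaleR:
  fixes X :: "nat \<Rightarrow> 'a \<Rightarrow> 'b::{real_normed_vector, second_countable_topology}"
  assumes X: "null_in_prob X"
  shows "null_in_prob (\<lambda>n \<omega>. c *\<^sub>R X n \<omega>)"
proof (rule null_in_prob_dom[OF X, where C="\<bar>c\<bar>"])
  have [measurable]: "X n \<in> borel_measurable M" for n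
    using X by (auto simp: null_in_prob_def)
  show "(\<lambda>\<omega>. c *\<^sub>R X n \<omega>) \<in> borel_measurable M" for n by measurable
qed simp

lemma null_in_prob_L1:
  fixes X :: "nat \<Rightarrow> 'a \<Rightarrow> 'b::real_normed_vector"
  assumes [measurable]: "\<And>n. X n \<in> borel_measurable M"
    and i: "\<And>n. integrable M (\<lambda>\<omega>. norm (X n \<omega>))"
    and l: "(\<lambda>n. expectation (\<lambda>\<omega>. norm (X n \<omega>))) \<longlonglongrightarrow> 0"
  shows "null_in_prob X"
  unfolding null_in_prob_def
proof (intro conjI allI impI assms(1))
  fix \<epsilon> :: real assume e: "0 < \<epsilon>"
  have "(\<lambda>n. expectation (\<lambda>\<omega>. norm (X n \<omega>)) / \<epsilon>) \<longlonglongrightarrow> 0" using tendsto_divide[OF l tendsto_const, of \<epsilon>] e by simp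
  then show "(\<lambda>n. prob {\<omega> \<in> space M. norm (X n \<omega>) > \<epsilon>}) \<longlonglongrightarrow> 0"
    by (rule tendsto_sandwich[OF _ _ tendsto_const, rotated 2])
      (auto intro!: always_eventually markov_prob[OF assms(1) i e])
qed

lemma null_in_prob_AE:
  fixes X :: "nat \<Rightarrow> 'a \<Rightarrow> 'b::{banach, second_countable_topology}"
  assumes [measurable]: "\<And>n. X n \<in> borel_measurable M"
    and l: "AE \<omega> in M. (\<lambda>n. X n \<omega>) \<longlonglongrightarrow> 0"
  shows "null_in_prob X"
  unfolding null_in_prob_def
proof (intro conjI allI impI assms(1))
  fix \<epsilon> :: real assume e: "0 < \<epsilon>"
  have "(\<lambda>n. expectation (indicat_real {\<omega> \<in> space M. norm (X n \<omega>) > \<epsilon>})) \<longlonglongrightarrow> expectation (\<lambda>_. 0)"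
  proof (rule integral_dominated_convergence[where w="\<lambda>_. 1"])
    show "AE \<omega> in M. (\<lambda>n. indicat_real {\<omega> \<in> space M. norm (X n \<omega>) > \<epsilon>} \<omega>) \<longlonglongrightarrow> 0"
      using l
    proof eventually_elim
      fix \<omega> assume "(\<lambda>n. X n \<omega>) \<longlonglongrightarrow> 0"
      then have "eventually (\<lambda>n. norm (X n \<omega>) < \<epsilon>) sequentially"
        using e by (simp add: tendsto_iff)
      then show "(\<lambda>n. indicat_real {\<omega> \<in> space M. norm (X n \<omega>) > \<epsilon>} \<omega>) \<longlonglongrightarrow> 0"
        by (intro tendsto_eventually) (auto elim!: eventually_mono)
    qed
  qed auto
  then show "(\<lambda>n. prob {\<omega> \<in> space M. norm (X n \<omega>) > \<epsilon>}) \<longlonglongrightarrow> 0"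
    by simp
qed

text \<open>Truncating the norms at 1 turns convergence in probability into convergence in L1, for
  which an almost surely convergent subsequence exists. Where the truncated norms tend to 0 they are
  eventually below 1 and hence equal to the norms.\<close>

lemma null_in_prob_subseq:
  fixes X :: "nat \<Rightarrow> 'a \<Rightarrow> 'b::{banach, second_countable_topology}"
  assumes X: "null_in_prob X"
  shows "\<exists>r. strict_mono (r :: nat \<Rightarrow> nat) \<and> (AE \<omega> in M. (\<lambda>n. X (r n) \<omega>) \<longlonglongrightarrow> 0)"
proof -
  have [measurable]: "X n \<in> borel_measurable M" for n
    using X by (auto simp: null_in_prob_def)
  define u where "u n \<omega> = min 1 (norm (X n \<omega>))" for n \<omega>
  have um[measurable]: "u n \<in> borel_measurable M" for n unfolding u_def by measurable
  have ui: "integrable M (u n)" for n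
    by (rule integrable_const_bound[where B=1]) (auto simp: u_def)
  have "(\<lambda>n. \<integral>\<omega>. norm (u n \<omega>) \<partial>M) \<longlonglongrightarrow> 0"
    unfolding tendsto_iff
  proof (intro allI impI)
    fix e :: real assume e: "0 < e"
    define d where "d = e/2"
    have d: "0 < d" using e by (simp add: d_def)
    have le: "expectation (\<lambda>\<omega>. norm (u n \<omega>)) \<le> d + prob {\<omega> \<in> space M. norm (X n \<omega>) > d}" for n
    proof -
      have "expectation (\<lambda>\<omega>. norm (u n \<omega>)) \<le> expectation (\<lambda>\<omega>. d + indicat_real {\<omega> \<in> space M. norm (X n \<omega>) > d} \<omega>)"
      proof (rule integral_mono_AE)
        show "AE \<omega> in M. norm (u n \<omega>) \<le> d + indicat_real {\<omega> \<in> space M. norm (X n \<omega>) > d} \<omega>"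
          using d by (intro AE_I2) (auto simp: u_def indicator_def)
      qed (use ui d in \<open>auto intro!: integrable_const_bound[where B="d+1"] simp: indicator_def\<close>)
      also have "\<dots> = d + prob {\<omega> \<in> space M. norm (X n \<omega>) > d}"
        proof -
        have "integrable M (indicat_real {\<omega> \<in> space M. norm (X n \<omega>) > d})"
          by (rule integrable_const_bound[where B=1]) auto
        then show ?thesis by (subst Bochner_Integration.integral_add) (auto simp: prob_space)
      qed
      finally show ?thesis .
    qed
    show "eventually (\<lambda>n. dist (\<integral>\<omega>. norm (u n \<omega>) \<partial>M) 0 < e) sequentially"
      using null_in_probD[OF X d d]
    proof eventually_elim
      case (elim n)
      then show ?case using le[of n] d_def by simp
    qed
  qed
  from tendsto_L1_AE_subseq[OF ui this] obtain r where r: "strict_mono (r :: nat \<Rightarrow> nat)" "AE \<omega> in M. (\<lambda>n. u (r n) \<omega>) \<longlonglongrightarrow> 0"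
    by auto
  have "AE \<omega> in M. (\<lambda>n. X (r n) \<omega>) \<longlonglongrightarrow> 0"
    using r(2)
  proof eventually_elim
    fix \<omega> assume a: "(\<lambda>n. u (r n) \<omega>) \<longlonglongrightarrow> 0"
    have "eventually (\<lambda>n. u (r n) \<omega> < 1) sequentially" using order_tendstoD(2)[OF a, of 1] by simp
    then have "eventually (\<lambda>n. norm (X (r n) \<omega>) = u (r n) \<omega>) sequentially"
      by (auto elim!: eventually_mono simp: u_def)
    then have "(\<lambda>n. norm (X (r n) \<omega>)) \<longlonglongrightarrow> 0"
      using a by (simp cong: tendsto_cong)
    then show "(\<lambda>n. X (r n) \<omega>) \<longlonglongrightarrow> 0" by (rule tendsto_norm_zero_cancel)
  qed
  with r(1) show ?thesis by blast
qed

text \<open>Fatou's lemma along an almost surely convergent subsequence. It transfers second-moment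
  bounds from approximating sums to increments of the solution, for which no direct bound is at
  hand.\<close>

lemma null_in_prob_Fatou:
  fixes X :: "nat \<Rightarrow> 'a \<Rightarrow> 'b::{banach, second_countable_topology}"
  assumes X: "null_in_prob (\<lambda>n \<omega>. X n \<omega> - Y \<omega>)"
    and [measurable]: "\<And>n. X n \<in> borel_measurable M" "Y \<in> borel_measurable M"
    and i: "\<And>n. integrable M (\<lambda>\<omega>. (norm (X n \<omega>))\<^sup>2)"
    and c: "\<And>n. expectation (\<lambda>\<omega>. (norm (X n \<omega>))\<^sup>2) \<le> c"
  shows "integrable M (\<lambda>\<omega>. (norm (Y \<omega>))\<^sup>2) \<and> expectation (\<lambda>\<omega>. (norm (Y \<omega>))\<^sup>2) \<le> c"
proof -
  obtain r where r: "strict_mono (r :: nat \<Rightarrow> nat)" "AE \<omega> in M. (\<lambda>n. X (r n) \<omega> - Y \<omega>) \<longlonglongrightarrow> 0"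
    using null_in_prob_subseq[OF X] by auto
  have c0: "0 \<le> c" using c[of 0] by (rule order_trans[rotated]) simp
  have "(\<integral>\<^sup>+\<omega>. ennreal ((norm (Y \<omega>))\<^sup>2) \<partial>M) = (\<integral>\<^sup>+\<omega>. liminf (\<lambda>n. ennreal ((norm (X (r n) \<omega>))\<^sup>2)) \<partial>M)"
  proof (rule nn_integral_cong_AE)
    show "AE \<omega> in M. ennreal ((norm (Y \<omega>))\<^sup>2) = liminf (\<lambda>n. ennreal ((norm (X (r n) \<omega>))\<^sup>2))"
      using r(2)
    proof eventually_elim
      fix \<omega> assume "(\<lambda>n. X (r n) \<omega> - Y \<omega>) \<longlonglongrightarrow> 0"
      then have "(\<lambda>n. X (r n) \<omega>) \<longlonglongrightarrow> Y \<omega>" by (simp add: LIM_zero_iff)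
      then have "(\<lambda>n. ennreal ((norm (X (r n) \<omega>))\<^sup>2)) \<longlonglongrightarrow> ennreal ((norm (Y \<omega>))\<^sup>2)"
        by (intro tendsto_ennrealI tendsto_power tendsto_norm)
      then show "ennreal ((norm (Y \<omega>))\<^sup>2) = liminf (\<lambda>n. ennreal ((norm (X (r n) \<omega>))\<^sup>2))"
        by (intro lim_imp_Liminf[symmetric]) auto
    qed
  qed
  also have "\<dots> \<le> liminf (\<lambda>n. \<integral>\<^sup>+\<omega>. ennreal ((norm (X (r n) \<omega>))\<^sup>2) \<partial>M)"
    by (rule nn_integral_liminf) measurable
  also have "\<dots> \<le> ennreal c"
  proof -
    have "(\<integral>\<^sup>+\<omega>. ennreal ((norm (X (r n) \<omega>))\<^sup>2) \<partial>M) \<le> ennreal c" for n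
      using c[of "r n"] i[of "r n"] by (subst nn_integral_eq_integral) (auto intro: ennreal_leI)
    then have "liminf (\<lambda>n. \<integral>\<^sup>+\<omega>. ennreal ((norm (X (r n) \<omega>))\<^sup>2) \<partial>M) \<le> liminf (\<lambda>n::nat. ennreal c)"
      by (intro Liminf_mono) auto
    then show ?thesis by (simp add: Liminf_const)
  qed
  finally have le: "(\<integral>\<^sup>+\<omega>. ennreal ((norm (Y \<omega>))\<^sup>2) \<partial>M) \<le> ennreal c" .
  have int: "integrable M (\<lambda>\<omega>. (norm (Y \<omega>))\<^sup>2)"
    using le by (intro integrableI_nonneg) (auto simp: ennreal_less_top intro: order.strict_trans1)
  then show ?thesis
    using le c0 by (subst (asm) nn_integral_eq_integral) auto
qed

lemma null_in_prob_imp_L1: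
  fixes X :: "nat \<Rightarrow> 'a \<Rightarrow> 'b::{banach, second_countable_topology}"
  assumes X: "null_in_prob X"
    and i: "\<And>n. integrable M (\<lambda>\<omega>. (norm (X n \<omega>))\<^sup>2)"
    and c: "\<And>n. expectation (\<lambda>\<omega>. (norm (X n \<omega>))\<^sup>2) \<le> c"
  shows "(\<lambda>n. expectation (\<lambda>\<omega>. norm (X n \<omega>))) \<longlonglongrightarrow> 0"
  unfolding tendsto_iff
proof (intro allI impI)
  have [measurable]: "X n \<in> borel_measurable M" for n
    using X by (auto simp: null_in_prob_def)
  have c0: "0 \<le> c" using c[of 0] by (rule order_trans[rotated]) simp
  have ni: "integrable M (\<lambda>\<omega>. norm (X n \<omega>))" for n
    by (rule square_integrable_imp_integrable[OF _ i]) measurable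
  fix e :: real assume e: "0 < e"
  define d where "d = e/3"
  have d: "0 < d" using e by (simp add: d_def)
  \<comment> \<open>The norm is at most d on the bulk, at most K where it lies between d and K, and
    at most its square divided by K beyond K. This K makes c / K smaller than d = e / 3; afterwards
    the probability of exceeding d is taken below d / K.\<close>
  define K where "K = 3 * (c + 1) / e"
  have K: "0 < K" using c0 e by (simp add: K_def)
  have ii: "integrable M (indicat_real {\<omega> \<in> space M. norm (X n \<omega>) > d})" for n
    by (rule integrable_const_bound[where B=1]) auto
  have le: "expectation (\<lambda>\<omega>. norm (X n \<omega>)) \<le> d + K * prob {\<omega> \<in> space M. norm (X n \<omega>) > d} + c / K" for n
  proof -
    let ?A = "{\<omega> \<in> space M. norm (X n \<omega>) > d}"
    have "expectation (\<lambda>\<omega>. norm (X n \<omega>)) \<le> expectation (\<lambda>\<omega>. d + K * indicat_real ?A \<omega> + (norm (X n \<omega>))\<^sup>2 / K)"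
    proof (rule integral_mono[OF ni])
      show "integrable M (\<lambda>\<omega>. d + K * indicat_real ?A \<omega> + (norm (X n \<omega>))\<^sup>2 / K)"
        by (intro Bochner_Integration.integrable_add integrable_divide_zero integrable_mult_right i ii) auto
      fix \<omega> assume w: "\<omega> \<in> space M"
      have "norm (X n \<omega>) \<le> K + (norm (X n \<omega>))\<^sup>2 / K"
      proof (cases "norm (X n \<omega>) \<le> K")
        case True then show ?thesis using K by (simp add: add_increasing2)
      next
        case False
        then have "norm (X n \<omega>) * K \<le> (norm (X n \<omega>))\<^sup>2" by (simp add: power2_eq_square mult_left_mono)
        then have "norm (X n \<omega>) \<le> (norm (X n \<omega>))\<^sup>2 / K" using K by (simp add: field_simps)
        then show ?thesis using K by simp
      qed
      then show "norm (X n \<omega>) \<le> d + K * indicat_real ?A \<omega> + (norm (X n \<omega>))\<^sup>2 / K"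
        using w d K by (auto simp: indicator_def add_increasing add_increasing2)
    qed
    also have "\<dots> = d + K * prob ?A + expectation (\<lambda>\<omega>. (norm (X n \<omega>))\<^sup>2) / K"
      by (subst Bochner_Integration.integral_add)
        (auto simp: prob_space i ii simp del: integrable_indicator_iff
          intro!: Bochner_Integration.integrable_add integrable_mult_right integrable_divide_zero)
    also have "\<dots> \<le> d + K * prob ?A + c / K"
      using c[of n] K by (simp add: divide_right_mono)
    finally show ?thesis .
  qed
  have cK: "c / K < d" using c0 e by (simp add: K_def d_def field_simps)
  show "eventually (\<lambda>n. dist (expectation (\<lambda>\<omega>. norm (X n \<omega>))) 0 < e) sequentially"
    using null_in_probD[OF X d divide_pos_pos[OF d K]]
  proof (eventually_elim)
    case (elim n)
    then have "K * prob {\<omega> \<in> space M. norm (X n \<omega>) > d} < d"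
      using K by (simp add: pos_less_divide_eq mult.commute)
    then have "expectation (\<lambda>\<omega>. norm (X n \<omega>)) < e" using le[of n] cK d_def by linarith
    then show ?case by simp
  qed
qed

lemma null_in_prob_mult_tight:
  fixes X Y :: "nat \<Rightarrow> 'a \<Rightarrow> real"
  assumes X: "null_in_prob X" and Y: "tight_family Y"
  shows "null_in_prob (\<lambda>n \<omega>. X n \<omega> * Y n \<omega>)"
proof (rule null_in_probI)
  have [measurable]: "X n \<in> borel_measurable M" "Y n \<in> borel_measurable M" for n
    using X Y by (auto simp: null_in_prob_def tight_family_def)
  show "(\<lambda>\<omega>. X n \<omega> * Y n \<omega>) \<in> borel_measurable M" for n by measurable
  fix \<epsilon> \<eta> :: real assume e: "\<epsilon> > 0" "\<eta> > 0"
  obtain K0 where K0: "\<And>n. prob {\<omega> \<in> space M. norm (Y n \<omega>) > K0} \<le> \<eta>/2"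
    using tight_familyD[OF Y half_gt_zero[OF e(2)]] by blast
  define K where "K = max K0 1"
  have K: "1 \<le> K" "K0 \<le> K" by (auto simp: K_def)
  have "0 < \<epsilon>/K" using K e by simp
  have le: "prob {\<omega> \<in> space M. norm (X n \<omega> * Y n \<omega>) > \<epsilon>} \<le>
     prob {\<omega> \<in> space M. norm (X n \<omega>) > \<epsilon>/K} + prob {\<omega> \<in> space M. norm (Y n \<omega>) > K0}" for n
  proof (rule prob_Un_le)
    show "AE \<omega> in M. \<epsilon> < norm (X n \<omega> * Y n \<omega>) \<longrightarrow> \<epsilon> / K < norm (X n \<omega>) \<or> K0 < norm (Y n \<omega>)"
    proof (intro AE_I2 impI, rule ccontr)
      fix \<omega> assume a: "\<epsilon> < norm (X n \<omega> * Y n \<omega>)" "\<not> (\<epsilon> / K < norm (X n \<omega>) \<or> K0 < norm (Y n \<omega>))"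
      then have "norm (X n \<omega>) \<le> \<epsilon>/K" "norm (Y n \<omega>) \<le> K" using K by auto
      then have "norm (X n \<omega>) * norm (Y n \<omega>) \<le> \<epsilon>/K * K" using K e by (intro mult_mono) auto
      with a(1) K show False by (simp add: abs_mult)
    qed
  qed measurable
  show "eventually (\<lambda>n. prob {\<omega> \<in> space M. norm (X n \<omega> * Y n \<omega>) > \<epsilon>} \<le> \<eta>) sequentially"
    using null_in_probD[OF X \<open>0 < \<epsilon>/K\<close> half_gt_zero[OF e(2)]]
  proof (eventually_elim)
    case (elim n)
    then show ?case using le[of n] K0[of n] by linarith
  qed
qed

text \<open>The index type is countable, which makes the event that some member exceeds k
  measurable. For integers k these events decrease to a null set, so one threshold controls all
  members at once outside a small event.\<close>

lemma tight_AE_bounded: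
  fixes X :: "'i::countable \<Rightarrow> 'a \<Rightarrow> 'b::real_normed_vector"
  assumes [measurable]: "\<And>i. X i \<in> borel_measurable M"
    and b: "AE \<omega> in M. \<exists>C. \<forall>i. norm (X i \<omega>) \<le> C" and \<eta>: "\<eta> > 0"
  shows "\<exists>K>0. prob {\<omega> \<in> space M. \<exists>i. norm (X i \<omega>) > K} \<le> \<eta>"
proof -
  define A where "A k = {\<omega> \<in> space M. \<exists>i. norm (X i \<omega>) > real k}" for k :: nat
  have A[measurable]: "A k \<in> sets M" for k unfolding A_def by measurable
  have decseqA: "decseq A"
    unfolding decseq_def
  proof (intro allI impI subsetI)
    fix k l :: nat and \<omega> assume "k \<le> l" and "\<omega> \<in> A l"
    then obtain i where "\<omega> \<in> space M" "real l < norm (X i \<omega>)" by (auto simp: A_def)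
    moreover have "real k \<le> real l" using \<open>k \<le> l\<close> by simp
    ultimately have "real k < norm (X i \<omega>)" by linarith
    then show "\<omega> \<in> A k" using \<open>\<omega> \<in> space M\<close> unfolding A_def by blast
  qed
  have "(\<lambda>k. prob (A k)) \<longlonglongrightarrow> prob (\<Inter>k. A k)"
    by (rule finite_Lim_measure_decseq) (use A in \<open>auto intro!: decseqA\<close>)
  moreover have "prob (\<Inter>k. A k) = 0"
  proof -
    have "AE \<omega> in M. \<omega> \<notin> (\<Inter>k. A k)"
      using b
    proof eventually_elim
      fix \<omega> assume "\<exists>C. \<forall>i. norm (X i \<omega>) \<le> C"
      then obtain C where C: "\<And>i. norm (X i \<omega>) \<le> C" by auto
      obtain k where "C \<le> real k" using real_arch_simple by blast
      then have "\<omega> \<notin> A k" using C by (auto simp: A_def not_less intro: order_trans)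
      then show "\<omega> \<notin> (\<Inter>k. A k)" by auto
    qed
    then show ?thesis by (subst prob_eq_0) auto
  qed
  ultimately have "(\<lambda>k. prob (A k)) \<longlonglongrightarrow> 0" by simp
  then have "eventually (\<lambda>k. prob (A k) < \<eta>) sequentially" using \<eta> order_tendstoD(2) by blast
  then obtain N where "\<And>k. k \<ge> N \<Longrightarrow> prob (A k) < \<eta>" by (auto simp: eventually_sequentially)
  then have "prob (A (Suc N)) < \<eta>" by auto
  then show ?thesis by (intro exI[of _ "real (Suc N)"]) (auto simp: A_def)
qed

lemma tight_familyI_AE_bounded:
  fixes X :: "'i::countable \<Rightarrow> 'a \<Rightarrow> 'b::real_normed_vector"
  assumes [measurable]: "\<And>i. X i \<in> borel_measurable M"
    and b: "AE \<omega> in M. \<exists>C. \<forall>i. norm (X i \<omega>) \<le> C"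
  shows "tight_family X"
  unfolding tight_family_def
proof (intro conjI allI impI assms(1))
  fix \<eta> :: real assume "0 < \<eta>"
  from tight_AE_bounded[OF assms(1) b this] obtain K where K: "prob {\<omega> \<in> space M. \<exists>i. norm (X i \<omega>) > K} \<le> \<eta>" by auto
  have "prob {\<omega> \<in> space M. norm (X i \<omega>) > K} \<le> prob {\<omega> \<in> space M. \<exists>i. norm (X i \<omega>) > K}" for i
    by (intro prob_mono_AE) auto
  then show "\<exists>K. \<forall>i. prob {\<omega> \<in> space M. norm (X i \<omega>) > K} \<le> \<eta>"
    using K order_trans by blast
qed

lemma tight_family_dom2:
  fixes X :: "'i \<Rightarrow> 'a \<Rightarrow> 'b::real_normed_vector" and Y Z :: "'i \<Rightarrow> 'a \<Rightarrow> real"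
  assumes Y: "tight_family Y" and Z: "tight_family Z" and X[measurable]: "\<And>i. X i \<in> borel_measurable M"
    and le: "\<And>i. AE \<omega> in M. norm (X i \<omega>) \<le> C * (\<bar>Y i \<omega>\<bar> + \<bar>Z i \<omega>\<bar>)"
  shows "tight_family X"
  unfolding tight_family_def
proof (intro conjI allI impI X)
  have [measurable]: "Y n \<in> borel_measurable M" "Z n \<in> borel_measurable M" for n
    using Y Z by (auto simp: tight_family_def)
  fix \<eta> :: real assume e: "0 < \<eta>"
  obtain K where K: "\<And>n. prob {\<omega> \<in> space M. norm (Y n \<omega>) > K} \<le> \<eta>/2"
    using tight_familyD[OF Y half_gt_zero[OF e]] by blast
  obtain L where L: "\<And>n. prob {\<omega> \<in> space M. norm (Z n \<omega>) > L} \<le> \<eta>/2"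
    using tight_familyD[OF Z half_gt_zero[OF e]] by blast
  have "prob {\<omega> \<in> space M. norm (X i \<omega>) > \<bar>C\<bar> * (K + L)} \<le> \<eta>" for i
  proof -
    have "prob {\<omega> \<in> space M. norm (X i \<omega>) > \<bar>C\<bar> * (K + L)} \<le>
       prob {\<omega> \<in> space M. norm (Y i \<omega>) > K} + prob {\<omega> \<in> space M. norm (Z i \<omega>) > L}"
    proof (rule prob_Un_le)
      show "AE \<omega> in M. \<bar>C\<bar> * (K + L) < norm (X i \<omega>) \<longrightarrow> K < norm (Y i \<omega>) \<or> L < norm (Z i \<omega>)"
        using le[of i]
      proof (eventually_elim, intro impI)
        fix \<omega> assume a: "norm (X i \<omega>) \<le> C * (\<bar>Y i \<omega>\<bar> + \<bar>Z i \<omega>\<bar>)" "\<bar>C\<bar> * (K + L) < norm (X i \<omega>)"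
        show "K < norm (Y i \<omega>) \<or> L < norm (Z i \<omega>)"
        proof (rule ccontr)
        assume n: "\<not> (K < norm (Y i \<omega>) \<or> L < norm (Z i \<omega>))"
        have "C * (\<bar>Y i \<omega>\<bar> + \<bar>Z i \<omega>\<bar>) \<le> \<bar>C\<bar> * (\<bar>Y i \<omega>\<bar> + \<bar>Z i \<omega>\<bar>)" by (intro mult_right_mono) auto
        also have "\<dots> \<le> \<bar>C\<bar> * (K + L)" using n by (intro mult_left_mono) auto
        finally show False using a by simp
        qed
      qed
    qed measurable
    then show ?thesis using K[of i] L[of i] by linarith
  qed
  then show "\<exists>K. \<forall>i. prob {\<omega> \<in> space M. norm (X i \<omega>) > K} \<le> \<eta>" by blast
qed

lemma tight_family_L1:
  fixes X :: "'i \<Rightarrow> 'a \<Rightarrow> 'b::real_normed_vector"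
  assumes X[measurable]: "\<And>i. X i \<in> borel_measurable M"
    and i: "\<And>n. integrable M (\<lambda>\<omega>. norm (X n \<omega>))"
    and c: "\<And>n. expectation (\<lambda>\<omega>. norm (X n \<omega>)) \<le> c"
  shows "tight_family X"
  unfolding tight_family_def
proof (intro conjI allI impI X)
  fix \<eta> :: real assume e: "0 < \<eta>"
  define K where "K = (\<bar>c\<bar> + 1) / \<eta>"
  have K: "0 < K" using e by (simp add: K_def)
  have "prob {\<omega> \<in> space M. norm (X n \<omega>) > K} \<le> \<eta>" for n
  proof -
    have "prob {\<omega> \<in> space M. norm (X n \<omega>) > K} \<le> expectation (\<lambda>\<omega>. norm (X n \<omega>)) / K"
      by (rule markov_prob[OF X i K])
    also have "\<dots> \<le> c / K" using c K by (simp add: divide_right_mono)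
    also have "\<dots> \<le> \<eta>" 
    proof -
      have "\<eta> * K = \<bar>c\<bar> + 1" using e by (simp add: K_def)
      then show ?thesis using K by (simp add: pos_divide_le_eq)
    qed
    finally show ?thesis .
  qed
  then show "\<exists>K. \<forall>i. prob {\<omega> \<in> space M. norm (X i \<omega>) > K} \<le> \<eta>" by blast
qed

end

section \<open>Squared increments of semimartingales\<close>

text \<open>For n = 0, division by zero makes every point equal to s.\<close>

definition grid :: "real \<Rightarrow> real \<Rightarrow> nat \<Rightarrow> nat \<Rightarrow> real" where
  "grid s t n k = s + real k * (t - s) / real n"

lemma grid_0 [simp]: "grid s t n 0 = s"
  by (simp add: grid_def)

lemma grid_n: "0 < n \<Longrightarrow> grid s t n n = t"
  by (simp add: grid_def)

lemma grid_Suc: "grid s t n (Suc k) = grid s t n k + (t - s) / real n"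
  by (simp add: grid_def add_divide_distrib[symmetric] algebra_simps)

lemma grid_strict: "s < t \<Longrightarrow> 0 < n \<Longrightarrow> grid s t n k < grid s t n (Suc k)"
  by (simp add: grid_Suc)

lemma grid_ge: "s \<le> t \<Longrightarrow> s \<le> grid s t n k"
  by (simp add: grid_def)

lemma grid_le: "s \<le> t \<Longrightarrow> k \<le> n \<Longrightarrow> grid s t n k \<le> t"
proof (cases "n = 0")
  case False
  assume "s \<le> t" "k \<le> n"
  then have "real k * (t - s) / real n \<le> real n * (t - s) / real n"
    by (intro divide_right_mono mult_right_mono) auto
  then show ?thesis using False by (simp add: grid_def)
qed (simp add: grid_def)

lemma grid_mono: "s \<le> t \<Longrightarrow> k \<le> l \<Longrightarrow> grid s t n k \<le> grid s t n l"
  by (auto simp: grid_def intro!: divide_right_mono mult_right_mono)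

text \<open>Cutting each of the n cells into m parts gives again a uniform grid, with n * m cells. A
  sum over all fine cells is therefore a member of the same family of grid sums whose tightness is
  known.\<close>

lemma grid_refine:
  assumes "0 < n" "0 < m"
  shows "grid (grid s t n k) (grid s t n (Suc k)) m j = grid s t (n * m) (k * m + j)"
  using assms unfolding grid_Suc unfolding grid_def by (simp add: add_divide_distrib distrib_right)

text \<open>The Bregman divergence of the Huber function controls the truncated squared increments of a
  martingale that is merely integrable.\<close>

definition huber :: "real \<Rightarrow> real \<Rightarrow> real" where
  "huber K x = (if \<bar>x\<bar> \<le> K then x\<^sup>2 else 2 * K * \<bar>x\<bar> - K\<^sup>2)"

text \<open>Twice the clipped value of x is the derivative of the convex function
  \<open>huber K\<close> at x, so the right-hand side is a Bregman divergence and nonnegative. Where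
  both points lie in [-K, K] the function is the square, and the divergence is exactly
  \<open>(y - x)\<^sup>2\<close>.\<close>

lemma huber_bregman:
  assumes "0 \<le> K"
  shows "(if \<bar>x\<bar> \<le> K \<and> \<bar>y\<bar> \<le> K then (y - x)\<^sup>2 else 0) \<le>
    huber K y - huber K x - 2 * max (-K) (min K x) * (y - x)"
proof -
  \<comment> \<open>Supporting lines: \<open>huber K y\<close> lies above 2cy - c^2 whenever |c|
    \<le> K, and equality holds at x for c the clipped value of x.\<close>
  have lin: "huber K y \<ge> 2 * c * y - c\<^sup>2" if "\<bar>c\<bar> \<le> K" for c
  proof (cases "\<bar>y\<bar> \<le> K")
    case True
    have "0 \<le> (y - c)\<^sup>2" by simp
    then show ?thesis using True by (simp add: huber_def power2_eq_square algebra_simps)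
  next
    case False
    have "c * y \<le> \<bar>c\<bar> * \<bar>y\<bar>" by (metis abs_ge_self abs_mult)
    moreover have "0 \<le> (K - \<bar>c\<bar>) * (2 * \<bar>y\<bar> - (K + \<bar>c\<bar>))"
      using False that by (intro mult_nonneg_nonneg) auto
    ultimately have "2 * (c * y) - c\<^sup>2 \<le> 2 * (K * \<bar>y\<bar>) - K\<^sup>2"
      by (simp add: power2_eq_square algebra_simps)
    then show ?thesis using False by (simp add: huber_def)
  qed
  define c where "c = max (-K) (min K x)"
  have c: "\<bar>c\<bar> \<le> K" using assms by (auto simp: c_def)
  have "huber K x = 2 * c * x - c\<^sup>2"
    using assms by (auto simp: huber_def c_def max_def min_def power2_eq_square)
  then have "0 \<le> huber K y - huber K x - 2 * c * (y - x)"
    using lin[OF c] by (simp add: algebra_simps)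
  moreover have "(y - x)\<^sup>2 = huber K y - huber K x - 2 * c * (y - x)" if "\<bar>x\<bar> \<le> K" "\<bar>y\<bar> \<le> K"
    using that by (auto simp: huber_def c_def max_def min_def power2_eq_square algebra_simps)
  ultimately show ?thesis by (auto simp: c_def)
qed

lemma huber_bounds: "0 \<le> K \<Longrightarrow> 0 \<le> huber K x \<and> huber K x \<le> 2 * K * \<bar>x\<bar>"
proof (cases "\<bar>x\<bar> \<le> K")
  case True
  assume "0 \<le> K"
  have "\<bar>x\<bar> * \<bar>x\<bar> \<le> K * \<bar>x\<bar>" using True by (intro mult_right_mono) auto
  moreover have "0 \<le> K * \<bar>x\<bar>" using \<open>0 \<le> K\<close> by simp
  ultimately have "x\<^sup>2 \<le> 2 * K * \<bar>x\<bar>" by (simp add: power2_eq_square)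
  then show ?thesis using True by (simp add: huber_def)
next
  case False
  assume "0 \<le> K"
  then have "K * K \<le> K * \<bar>x\<bar>" "0 \<le> K * \<bar>x\<bar>" using False by (auto intro!: mult_left_mono)
  then show ?thesis using False by (auto simp: huber_def power2_eq_square)
qed

lemma huber_meas [measurable]: "huber K \<in> borel_measurable borel"
  unfolding huber_def by measurable

section \<open>Squared increments of martingales, of processes of finite variation and of
  semimartingales\<close>

context prob_space begin

lemma filtration_measD:
  assumes "filtration_on M F" "X \<in> borel_measurable (F t)"
  shows "X \<in> borel_measurable M"
  using assms measurable_from_subalg unfolding filtration_on_def by blast

lemma martingale_increment:
  assumes F: "filtration_on M F" and X: "martingale M F X" and st: "0 \<le> s" "s \<le> t"
    and b: "b \<in> borel_measurable (F s)" "\<And>\<omega>. \<bar>b \<omega>\<bar> \<le> K"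
  shows "integrable M (\<lambda>\<omega>. b \<omega> * (X t \<omega> - X s \<omega>)) \<and> expectation (\<lambda>\<omega>. b \<omega> * (X t \<omega> - X s \<omega>)) = 0"
proof -
  have sub: "subalgebra M (F s)" using F by (simp add: filtration_on_def)
  interpret finite_measure_subalgebra M "F s" by unfold_locales (rule sub)
  have bM[measurable]: "b \<in> borel_measurable M" using filtration_measD[OF F b(1)] .
  have i: "integrable M (X r)" if "0 \<le> r" for r using X that by (simp add: martingale_def)
  have xm[measurable]: "X t \<in> borel_measurable M" "X s \<in> borel_measurable M" using i st by auto
  have bi: "integrable M (\<lambda>\<omega>. b \<omega> * X r \<omega>)" if "0 \<le> r" for r
  proof (rule Bochner_Integration.integrable_bound)
    show "integrable M (\<lambda>\<omega>. K * X r \<omega>)" using i[OF that] by simp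
    show "(\<lambda>\<omega>. b \<omega> * X r \<omega>) \<in> borel_measurable M" using i[OF that] by measurable
    have "\<bar>b \<omega>\<bar> \<le> \<bar>K\<bar>" for \<omega> using b(2)[of \<omega>] by linarith
    then show "AE \<omega> in M. norm (b \<omega> * X r \<omega>) \<le> norm (K * X r \<omega>)"
      by (simp add: abs_mult mult_right_mono)
  qed
  have "expectation (\<lambda>\<omega>. b \<omega> * X t \<omega>) = expectation (\<lambda>\<omega>. b \<omega> * real_cond_exp M (F s) (X t) \<omega>)"
    using bi st b by (intro real_cond_exp_intg(2)[symmetric]) auto
  also have "\<dots> = expectation (\<lambda>\<omega>. b \<omega> * X s \<omega>)"
  proof (rule integral_cong_AE)
    have "AE \<omega> in M. real_cond_exp M (F s) (X t) \<omega> = X s \<omega>" using X st by (simp add: martingale_def)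
    then show "AE \<omega> in M. b \<omega> * real_cond_exp M (F s) (X t) \<omega> = b \<omega> * X s \<omega>" by auto
  qed measurable
  finally have "expectation (\<lambda>\<omega>. b \<omega> * X t \<omega>) = expectation (\<lambda>\<omega>. b \<omega> * X s \<omega>)" .
  then show ?thesis using bi st by (simp add: right_diff_distrib)
qed

text \<open>When the Bregman inequality is summed, the linear terms vanish in the mean by the
  martingale property and the Huber terms telescope. As the Huber function grows only linearly, a
  first moment at the last time gives the bound, however many points lie in between.\<close>

lemma martingale_truncated_squares:
  assumes F: "filtration_on M F" and X: "martingale M F X" and \<tau>: "0 \<le> \<tau> 0" "\<And>k. \<tau> k \<le> \<tau> (Suc k)" and K: "0 \<le> K"
  defines "T \<equiv> \<lambda>k \<omega>. if \<bar>X (\<tau> k) \<omega>\<bar> \<le> K \<and> \<bar>X (\<tau> (Suc k)) \<omega>\<bar> \<le> K then (X (\<tau> (Suc k)) \<omega> - X (\<tau> k) \<omega>)\<^sup>2 else 0"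
  shows "integrable M (\<lambda>\<omega>. \<Sum>k<n. T k \<omega>) \<and> expectation (\<lambda>\<omega>. \<Sum>k<n. T k \<omega>) \<le> 2 * K * expectation (\<lambda>\<omega>. \<bar>X (\<tau> n) \<omega>\<bar>)"
proof -
  have nn: "0 \<le> \<tau> k" for k using \<tau> by (induction k) (auto intro: order_trans)
  have i[measurable]: "integrable M (X (\<tau> k))" for k using X nn by (simp add: martingale_def)
  have xm[measurable]: "X (\<tau> k) \<in> borel_measurable M" for k using i by auto
  have hi: "integrable M (\<lambda>\<omega>. huber K (X (\<tau> k) \<omega>))" for k
  proof (rule Bochner_Integration.integrable_bound)
    show "integrable M (\<lambda>\<omega>. 2 * K * \<bar>X (\<tau> k) \<omega>\<bar>)" using i by simp
    show "AE \<omega> in M. norm (huber K (X (\<tau> k) \<omega>)) \<le> norm (2 * K * \<bar>X (\<tau> k) \<omega>\<bar>)"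
      using huber_bounds[OF K] K by (auto simp: abs_mult)
  qed measurable
  have Ti: "integrable M (T k)" for k
  proof (rule integrable_const_bound[where B="(2*K)\<^sup>2"])
    show "AE \<omega> in M. norm (T k \<omega>) \<le> (2*K)\<^sup>2"
    proof (intro AE_I2)
      fix \<omega>
      have "(x - y)\<^sup>2 \<le> (2*K)\<^sup>2" if "\<bar>y\<bar> \<le> K" "\<bar>x\<bar> \<le> K" for x y :: real
        using that K by (subst abs_le_square_iff[symmetric]) linarith
      then show "norm (T k \<omega>) \<le> (2*K)\<^sup>2" by (simp add: T_def)
    qed
    show "T k \<in> borel_measurable M" unfolding T_def by measurable
  qed
  define D where "D k \<omega> = 2 * max (-K) (min K (X (\<tau> k) \<omega>)) * (X (\<tau> (Suc k)) \<omega> - X (\<tau> k) \<omega>)" for k \<omega>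
  have D: "integrable M (D k) \<and> expectation (D k) = 0" for k
    unfolding D_def
  proof (rule martingale_increment[OF F X nn \<tau>(2)])
    have "X (\<tau> k) \<in> borel_measurable (F (\<tau> k))" using X nn by (simp add: martingale_def adapted_def)
    then show "(\<lambda>\<omega>. 2 * max (-K) (min K (X (\<tau> k) \<omega>))) \<in> borel_measurable (F (\<tau> k))" by measurable
    show "\<bar>2 * max (-K) (min K (X (\<tau> k) \<omega>))\<bar> \<le> 2 * K" for \<omega> using K by auto
  qed
  have "expectation (\<lambda>\<omega>. \<Sum>k<n. T k \<omega>) = (\<Sum>k<n. expectation (T k))"
    using Ti by simp
  also have "\<dots> \<le> (\<Sum>k<n. expectation (\<lambda>\<omega>. huber K (X (\<tau> (Suc k)) \<omega>)) - expectation (\<lambda>\<omega>. huber K (X (\<tau> k) \<omega>)))"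
  proof (rule sum_mono)
    fix k
    have "expectation (T k) \<le> expectation (\<lambda>\<omega>. huber K (X (\<tau> (Suc k)) \<omega>) - huber K (X (\<tau> k) \<omega>) - D k \<omega>)"
    proof (rule integral_mono[OF Ti])
      show "integrable M (\<lambda>\<omega>. huber K (X (\<tau> (Suc k)) \<omega>) - huber K (X (\<tau> k) \<omega>) - D k \<omega>)"
        using D hi by simp
      show "T k \<omega> \<le> huber K (X (\<tau> (Suc k)) \<omega>) - huber K (X (\<tau> k) \<omega>) - D k \<omega>" for \<omega>
        unfolding T_def D_def by (rule huber_bregman[OF K])
    qed
    then show "expectation (T k) \<le> expectation (\<lambda>\<omega>. huber K (X (\<tau> (Suc k)) \<omega>)) - expectation (\<lambda>\<omega>. huber K (X (\<tau> k) \<omega>))"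
      using D hi by simp
  qed
  also have "\<dots> = expectation (\<lambda>\<omega>. huber K (X (\<tau> n) \<omega>)) - expectation (\<lambda>\<omega>. huber K (X (\<tau> 0) \<omega>))"
    by (rule sum_lessThan_telescope)
  also have "\<dots> \<le> expectation (\<lambda>\<omega>. huber K (X (\<tau> n) \<omega>))"
    using huber_bounds[OF K] by simp
  also have "\<dots> \<le> expectation (\<lambda>\<omega>. 2 * K * \<bar>X (\<tau> n) \<omega>\<bar>)"
    using huber_bounds[OF K] hi i by (intro integral_mono) auto
  finally show ?thesis using Ti by simp
qed

text \<open>Localization in time and in space: outside small events the localizing time exceeds t,
  and the stopped path stays below a level K at the points of all grids. There the squares coincide
  with the truncated squares, whose mean is bounded uniformly in n.\<close>

lemma local_martingale_tight:
  assumes F: "filtration_on M F" and N: "continuous_local_martingale M F N" and st: "0 \<le> s" "s \<le> t"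
  shows "tight_family (\<lambda>n \<omega>. \<Sum>k<n. (N (grid s t n (Suc k)) \<omega> - N (grid s t n k) \<omega>)\<^sup>2)"
  unfolding tight_family_def
proof (intro conjI allI impI)
  let ?Q = "\<lambda>n \<omega>. \<Sum>k<n. (N (grid s t n (Suc k)) \<omega> - N (grid s t n k) \<omega>)\<^sup>2"
  have gn: "0 \<le> grid s t n k" for n k using grid_ge[of s t n k] st by simp
  have Nm: "N r \<in> borel_measurable M" if "0 \<le> r" for r
    using N that filtration_measD[OF F] unfolding continuous_local_martingale_def adapted_def by blast
  have Ngm[measurable]: "N (grid s t n k) \<in> borel_measurable M" for n k using Nm gn by simp
  show Qm[measurable]: "?Q n \<in> borel_measurable M" for n by measurable
  obtain \<tau> where stop: "\<And>n. stopping_time F (\<tau> n)"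
    and \<tau>lim: "AE \<omega> in M. incseq (\<lambda>n. \<tau> n \<omega>) \<and> filterlim (\<lambda>n. \<tau> n \<omega>) at_top sequentially"
    and \<tau>0: "\<And>n \<omega>. \<omega> \<in> space M \<Longrightarrow> 0 \<le> \<tau> n \<omega>"
    and mart: "\<And>n. martingale M F (\<lambda>t \<omega>. N (min t (\<tau> n \<omega>)) \<omega> - N 0 \<omega>)"
    using N unfolding continuous_local_martingale_def by blast
  have \<tau>m: "Measurable.pred M (\<lambda>\<omega>. \<tau> j \<omega> \<le> t)" for j
    using stop[of j] F measurable_from_subalg unfolding stopping_time_def filtration_on_def by blast
  fix \<eta> :: real assume \<eta>: "0 < \<eta>"
  \<comment> \<open>One third of the allowed probability for each exceptional event: stopping before
    t, leaving [-K, K], and a large truncated sum.\<close>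
  define e where "e = \<eta> / 3"
  have e: "0 < e" using \<eta> by (simp add: e_def)
  have "(\<lambda>j. expectation (indicat_real {\<omega> \<in> space M. \<tau> j \<omega> \<le> t})) \<longlonglongrightarrow> expectation (\<lambda>_. 0)"
  proof (rule integral_dominated_convergence[where w="\<lambda>_. 1"])
    show "AE \<omega> in M. (\<lambda>j. indicat_real {\<omega> \<in> space M. \<tau> j \<omega> \<le> t} \<omega>) \<longlonglongrightarrow> 0"
      using \<tau>lim
    proof eventually_elim
      fix \<omega> assume "incseq (\<lambda>n. \<tau> n \<omega>) \<and> filterlim (\<lambda>n. \<tau> n \<omega>) at_top sequentially"
      then have "eventually (\<lambda>j. \<tau> j \<omega> > t) sequentially"
        by (simp add: filterlim_at_top_dense)
      then show "(\<lambda>j. indicat_real {\<omega> \<in> space M. \<tau> j \<omega> \<le> t} \<omega>) \<longlonglongrightarrow> 0"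
        by (intro tendsto_eventually) (auto elim!: eventually_mono)
    qed
  qed (use \<tau>m in auto)
  then have "(\<lambda>j. prob {\<omega> \<in> space M. \<tau> j \<omega> \<le> t}) \<longlonglongrightarrow> 0"
    using \<tau>m by simp
  then have "eventually (\<lambda>j. prob {\<omega> \<in> space M. \<tau> j \<omega> \<le> t} < e) sequentially" using e order_tendstoD(2) by blast
  then obtain j where j: "prob {\<omega> \<in> space M. \<tau> j \<omega> \<le> t} < e" by (auto simp: eventually_sequentially)
  define X where "X r \<omega> = N (min r (\<tau> j \<omega>)) \<omega> - N 0 \<omega>" for r \<omega>
  have X: "martingale M F X" using mart[of j] by (simp add: X_def[abs_def])
  have Xi: "integrable M (X r)" if "0 \<le> r" for r using X that by (simp add: martingale_def)
  have Xm[measurable]: "X (grid s t n k) \<in> borel_measurable M" for n k using Xi gn by auto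
  \<comment> \<open>The values at all grid points as one countable family. The minimum keeps the
    second index at most n, so that the point stays in [s, t].\<close>
  define Y where "Y p \<omega> = X (grid s t (fst p) (min (fst p) (snd p))) \<omega>" for p :: "nat \<times> nat" and \<omega>
  have "AE \<omega> in M. \<exists>C. \<forall>p. norm (Y p \<omega>) \<le> C"
  proof -
    have "AE \<omega> in M. continuous_on {0..} (\<lambda>t. N t \<omega>)"
      using N by (simp add: continuous_local_martingale_def continuous_process_def)
    then show ?thesis
      using AE_space
    proof eventually_elim
      fix \<omega> assume c: "continuous_on {0..} (\<lambda>t. N t \<omega>)" and w: "\<omega> \<in> space M"
      have "continuous_on {0..t} (\<lambda>r. X r \<omega>)"
        unfolding X_def
        by (intro continuous_intros continuous_on_compose2[OF c]) (use \<tau>0[OF w] in auto)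
      then have "compact ((\<lambda>r. X r \<omega>) ` {0..t})" by (intro compact_continuous_image) auto
      then have "bounded ((\<lambda>r. X r \<omega>) ` {0..t})" by (rule compact_imp_bounded)
      then obtain C where "\<forall>x\<in>(\<lambda>r. X r \<omega>) ` {0..t}. norm x \<le> C"
        unfolding bounded_iff by blast
      then have C: "\<And>r. r \<in> {0..t} \<Longrightarrow> norm (X r \<omega>) \<le> C" by blast
      have "norm (Y p \<omega>) \<le> C" for p
        unfolding Y_def using gn grid_le[OF st(2)] by (intro C) auto
      then show "\<exists>C. \<forall>p. norm (Y p \<omega>) \<le> C" by blast
    qed
  qed
  moreover have Ym: "Y p \<in> borel_measurable M" for p unfolding Y_def by measurable
  ultimately obtain K where K: "K > 0" "prob {\<omega> \<in> space M. \<exists>p. norm (Y p \<omega>) > K} \<le> e"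
    using tight_AE_bounded[of Y e] e by blast
  define T where "T n k \<omega> = (if \<bar>X (grid s t n k) \<omega>\<bar> \<le> K \<and> \<bar>X (grid s t n (Suc k)) \<omega>\<bar> \<le> K
     then (X (grid s t n (Suc k)) \<omega> - X (grid s t n k) \<omega>)\<^sup>2 else 0)" for n k \<omega>
  have Tm[measurable]: "T n k \<in> borel_measurable M" for n k unfolding T_def by measurable
  define c where "c = 2 * K * expectation (\<lambda>\<omega>. \<bar>X t \<omega>\<bar>)"
  have c: "0 \<le> c" using K by (simp add: c_def)
  have T: "integrable M (\<lambda>\<omega>. \<Sum>k<n. T n k \<omega>) \<and> expectation (\<lambda>\<omega>. \<Sum>k<n. T n k \<omega>) \<le> c" for n
  proof (cases "n = 0")
    case False
    then show ?thesis
      using martingale_truncated_squares[OF F X, of "grid s t n" K n] gn[of n] grid_mono[OF st(2)] K(1) grid_n[of n s t] st(1)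
      by (simp add: T_def c_def)
  qed (simp add: c)
  define L where "L = (c + 1) / e"
  have L: "0 < L" using c e by (simp add: L_def)
  have "prob {\<omega> \<in> space M. norm (?Q n \<omega>) > L} \<le> \<eta>" for n
  proof -
    have "prob {\<omega> \<in> space M. norm (?Q n \<omega>) > L} \<le> prob {\<omega> \<in> space M. \<tau> j \<omega> \<le> t}
      + prob {\<omega> \<in> space M. (\<exists>p. norm (Y p \<omega>) > K) \<or> norm (\<Sum>k<n. T n k \<omega>) > L}"
    proof (rule prob_Un_le)
      show "AE \<omega> in M. L < norm (?Q n \<omega>) \<longrightarrow> \<tau> j \<omega> \<le> t \<or> ((\<exists>p. norm (Y p \<omega>) > K) \<or> norm (\<Sum>k<n. T n k \<omega>) > L)"
      proof (intro AE_I2 impI)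
        fix \<omega> assume w: "\<omega> \<in> space M" "L < norm (?Q n \<omega>)"
        show "\<tau> j \<omega> \<le> t \<or> ((\<exists>p. norm (Y p \<omega>) > K) \<or> norm (\<Sum>k<n. T n k \<omega>) > L)"
        proof (rule ccontr)
          assume a: "\<not> ?thesis"
          have XN: "X (grid s t n k) \<omega> = N (grid s t n k) \<omega> - N 0 \<omega>" if "k \<le> n" for k
            using grid_le[OF st(2) that] a by (simp add: X_def min_def)
          have XK: "\<bar>X (grid s t n k) \<omega>\<bar> \<le> K" if "k \<le> n" for k
          proof -
            have "norm (Y (n, k) \<omega>) \<le> K" using a by (auto simp: not_less)
            then show ?thesis using that by (simp add: Y_def min_absorb2)
          qed
          have "(\<Sum>k<n. T n k \<omega>) = ?Q n \<omega>"
            by (intro sum.cong refl) (simp add: T_def XK, simp add: XN)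
          with w a show False by simp
        qed
      qed
    qed (use \<tau>m Ym in measurable)
    also have "prob {\<omega> \<in> space M. (\<exists>p. norm (Y p \<omega>) > K) \<or> norm (\<Sum>k<n. T n k \<omega>) > L} \<le>
       prob {\<omega> \<in> space M. \<exists>p. norm (Y p \<omega>) > K} + prob {\<omega> \<in> space M. norm (\<Sum>k<n. T n k \<omega>) > L}"
      by (rule prob_Un_le) (use Ym in measurable)
    also have "prob {\<omega> \<in> space M. norm (\<Sum>k<n. T n k \<omega>) > L} \<le> expectation (\<lambda>\<omega>. norm (\<Sum>k<n. T n k \<omega>)) / L"
      using T L by (intro markov_prob) auto
    also have "(\<lambda>\<omega>. norm (\<Sum>k<n. T n k \<omega>)) = (\<lambda>\<omega>. \<Sum>k<n. T n k \<omega>)"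
      by (auto simp: T_def intro!: ext abs_of_nonneg sum_nonneg)
    also have "expectation (\<lambda>\<omega>. \<Sum>k<n. T n k \<omega>) / L \<le> c / L" using T L by (simp add: divide_right_mono)
    also have "c / L \<le> e" using e c by (simp add: L_def pos_divide_le_eq field_simps)
    finally show ?thesis using j K(2) by (simp add: e_def)
  qed
  then show "\<exists>K. \<forall>i. prob {\<omega> \<in> space M. norm (?Q i \<omega>) > K} \<le> \<eta>" by blast
qed

text \<open>The sum of squares is at most the largest increment times the total variation, hence at
  most \<open>C\<^sup>2\<close> for each path.\<close>

lemma finite_variation_tight:
  assumes F: "filtration_on M F" and D: "continuous_finite_variation M F D" and st: "0 \<le> s" "s \<le> t"
  shows "tight_family (\<lambda>n \<omega>. \<Sum>k<n. (D (grid s t n (Suc k)) \<omega> - D (grid s t n k) \<omega>)\<^sup>2)"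
proof (rule tight_familyI_AE_bounded)
  have gn: "0 \<le> grid s t n k" for n k using grid_ge[of s t n k] st by simp
  have Dm[measurable]: "D (grid s t n k) \<in> borel_measurable M" for n k
    using D gn filtration_measD[OF F] unfolding continuous_finite_variation_def adapted_def by blast
  show "(\<lambda>\<omega>. \<Sum>k<n. (D (grid s t n (Suc k)) \<omega> - D (grid s t n k) \<omega>)\<^sup>2) \<in> borel_measurable M" for n
    by measurable
  have "AE \<omega> in M. \<forall>t\<ge>0. \<exists>C. \<forall>n \<pi>. partition_of t n \<pi> \<longrightarrow> (\<Sum>i<n. \<bar>D (\<pi> (Suc i)) \<omega> - D (\<pi> i) \<omega>\<bar>) \<le> C"
    using D by (simp add: continuous_finite_variation_def)
  then show "AE \<omega> in M. \<exists>C. \<forall>n. norm (\<Sum>k<n. (D (grid s t n (Suc k)) \<omega> - D (grid s t n k) \<omega>)\<^sup>2) \<le> C"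
  proof eventually_elim
    fix \<omega> assume "\<forall>t\<ge>0. \<exists>C. \<forall>n \<pi>. partition_of t n \<pi> \<longrightarrow> (\<Sum>i<n. \<bar>D (\<pi> (Suc i)) \<omega> - D (\<pi> i) \<omega>\<bar>) \<le> C"
    then obtain C where C: "\<And>n \<pi>. partition_of t n \<pi> \<Longrightarrow> (\<Sum>i<n. \<bar>D (\<pi> (Suc i)) \<omega> - D (\<pi> i) \<omega>\<bar>) \<le> C"
      using st by (meson order_trans)
    have "norm (\<Sum>k<n. (D (grid s t n (Suc k)) \<omega> - D (grid s t n k) \<omega>)\<^sup>2) \<le> C\<^sup>2" for n
    proof (cases "n = 0")
      case False
      \<comment> \<open>Partitions in the definition of finite variation start at 0 while the grid
        starts at s, hence the additional first point.\<close>
      define \<pi> where "\<pi> k = (case k of 0 \<Rightarrow> 0 | Suc i \<Rightarrow> grid s t n i)" for k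
      have "partition_of t (Suc n) \<pi>"
        using False st grid_mono[OF st(2)] by (auto simp: partition_of_def \<pi>_def grid_n split: nat.split)
      from C[OF this] have "\<bar>D s \<omega> - D 0 \<omega>\<bar> + (\<Sum>i<n. \<bar>D (grid s t n (Suc i)) \<omega> - D (grid s t n i) \<omega>\<bar>) \<le> C"
        unfolding sum.lessThan_Suc_shift by (simp add: \<pi>_def)
      then have le: "(\<Sum>i<n. \<bar>D (grid s t n (Suc i)) \<omega> - D (grid s t n i) \<omega>\<bar>) \<le> C" by linarith
      have "(\<Sum>k<n. (D (grid s t n (Suc k)) \<omega> - D (grid s t n k) \<omega>)\<^sup>2) \<le>
        (\<Sum>k<n. \<bar>D (grid s t n (Suc k)) \<omega> - D (grid s t n k) \<omega>\<bar> * C)"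
      proof (rule sum_mono)
        fix k assume k: "k \<in> {..<n}"
        have "\<bar>D (grid s t n (Suc k)) \<omega> - D (grid s t n k) \<omega>\<bar> \<le> (\<Sum>i<n. \<bar>D (grid s t n (Suc i)) \<omega> - D (grid s t n i) \<omega>\<bar>)"
          by (rule member_le_sum[OF k]) auto
        then have "\<bar>D (grid s t n (Suc k)) \<omega> - D (grid s t n k) \<omega>\<bar> \<le> C" using le by linarith
        then have "\<bar>D (grid s t n (Suc k)) \<omega> - D (grid s t n k) \<omega>\<bar> * \<bar>D (grid s t n (Suc k)) \<omega> - D (grid s t n k) \<omega>\<bar> \<le>
          \<bar>D (grid s t n (Suc k)) \<omega> - D (grid s t n k) \<omega>\<bar> * C" by (intro mult_left_mono) auto
        then show "(D (grid s t n (Suc k)) \<omega> - D (grid s t n k) \<omega>)\<^sup>2 \<le> \<bar>D (grid s t n (Suc k)) \<omega> - D (grid s t n k) \<omega>\<bar> * C"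
          by (simp add: power2_eq_square)
      qed
      also have "\<dots> \<le> C * C"
      proof -
        have "0 \<le> (\<Sum>i<n. \<bar>D (grid s t n (Suc i)) \<omega> - D (grid s t n i) \<omega>\<bar>)" by (intro sum_nonneg) auto
        then show ?thesis unfolding sum_distrib_right[symmetric] using le by (intro mult_right_mono) linarith+
      qed
      finally show ?thesis by (simp add: power2_eq_square abs_of_nonneg sum_nonneg)
    qed simp
    then show "\<exists>C. \<forall>n. norm (\<Sum>k<n. (D (grid s t n (Suc k)) \<omega> - D (grid s t n k) \<omega>)\<^sup>2) \<le> C" by blast
  qed
qed

lemma semimartingale_tight:
  assumes F: "filtration_on M F" and X: "continuous_semimartingale M F X" and st: "0 \<le> s" "s \<le> t"
  shows "tight_family (\<lambda>n \<omega>. \<Sum>k<n. (X (grid s t n (Suc k)) \<omega> - X (grid s t n k) \<omega>)\<^sup>2)"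
proof -
  obtain N D where N: "continuous_local_martingale M F N" and D: "continuous_finite_variation M F D"
    and XND: "AE \<omega> in M. \<forall>t\<ge>0. X t \<omega> = N t \<omega> + D t \<omega>"
    using X unfolding continuous_semimartingale_def by blast
  have gn: "0 \<le> grid s t n k" for n k using grid_ge[of s t n k] st by simp
  have Xm[measurable]: "X (grid s t n k) \<in> borel_measurable M" for n k
    using X gn filtration_measD[OF F] unfolding continuous_semimartingale_def adapted_def by blast
  show ?thesis
  proof (rule tight_family_dom2[OF local_martingale_tight[OF F N st] finite_variation_tight[OF F D st], where C=2])
    show "(\<lambda>\<omega>. \<Sum>k<n. (X (grid s t n (Suc k)) \<omega> - X (grid s t n k) \<omega>)\<^sup>2) \<in> borel_measurable M" for n
      by measurable
    fix n
    show "AE \<omega> in M. norm (\<Sum>k<n. (X (grid s t n (Suc k)) \<omega> - X (grid s t n k) \<omega>)\<^sup>2)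
         \<le> 2 * (\<bar>\<Sum>k<n. (N (grid s t n (Suc k)) \<omega> - N (grid s t n k) \<omega>)\<^sup>2\<bar> +
                 \<bar>\<Sum>k<n. (D (grid s t n (Suc k)) \<omega> - D (grid s t n k) \<omega>)\<^sup>2\<bar>)"
      using XND
    proof eventually_elim
      fix \<omega> assume a: "\<forall>t\<ge>0. X t \<omega> = N t \<omega> + D t \<omega>"
      have sq: "(a + b)\<^sup>2 \<le> 2 * (a\<^sup>2 + b\<^sup>2)" for a b :: real
        using sum_squares_bound[of a b] by (simp add: power2_sum)
      have "(\<Sum>k<n. (X (grid s t n (Suc k)) \<omega> - X (grid s t n k) \<omega>)\<^sup>2) \<le>
        (\<Sum>k<n. 2 * ((N (grid s t n (Suc k)) \<omega> - N (grid s t n k) \<omega>)\<^sup>2 + (D (grid s t n (Suc k)) \<omega> - D (grid s t n k) \<omega>)\<^sup>2))"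
        using sq[of "N (grid s t n (Suc k)) \<omega> - N (grid s t n k) \<omega>" "D (grid s t n (Suc k)) \<omega> - D (grid s t n k) \<omega>" for k]
        by (intro sum_mono) (simp add: a gn add_diff_add)
      then show "norm (\<Sum>k<n. (X (grid s t n (Suc k)) \<omega> - X (grid s t n k) \<omega>)\<^sup>2)
         \<le> 2 * (\<bar>\<Sum>k<n. (N (grid s t n (Suc k)) \<omega> - N (grid s t n k) \<omega>)\<^sup>2\<bar> +
                 \<bar>\<Sum>k<n. (D (grid s t n (Suc k)) \<omega> - D (grid s t n k) \<omega>)\<^sup>2\<bar>)"
        by (simp add: sum_nonneg abs_of_nonneg sum_distrib_left[symmetric] sum.distrib)
    qed
  qed
qed

end

section \<open>Linear Stratonovich equations\<close>

lemma sum_lessThan_add: "(\<Sum>k<n + m. f k) = (\<Sum>k<n. f k) + (\<Sum>k<m. f (n + k :: nat) :: 'a::comm_monoid_add)"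
  by (induction m) (auto simp: add.assoc)

lemma riemann_sum_tendsto:
  fixes g :: "real \<Rightarrow> 'b::euclidean_space"
  assumes st: "s < t" and g: "continuous_on {s..t} g"
  shows "(\<lambda>n. ((t - s) / real n) *\<^sub>R (\<Sum>k<n. g (grid s t n k))) \<longlonglongrightarrow> integral {s..t} g"
  unfolding LIMSEQ_iff
proof (intro allI impI)
  fix e :: real assume e: "0 < e"
  define h where "h = t - s"
  have h: "0 < h" using st by (simp add: h_def)
  have "uniformly_continuous_on {s..t} g" by (rule compact_uniformly_continuous[OF g]) simp
  then obtain d where d: "0 < d" "\<And>x y. x \<in> {s..t} \<Longrightarrow> y \<in> {s..t} \<Longrightarrow> dist y x < d \<Longrightarrow> dist (g y) (g x) < e / (2 * h)"
    unfolding uniformly_continuous_on_def using e h by (metis divide_pos_pos mult_pos_pos zero_less_numeral)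
  obtain N where N: "h / d < real N" using reals_Archimedean2 by blast
  show "\<exists>no. \<forall>n\<ge>no. norm (((t - s) / real n) *\<^sub>R (\<Sum>k<n. g (grid s t n k)) - integral {s..t} g) < e"
  proof (intro exI allI impI)
    fix n assume n: "Suc N \<le> n"
    have n0: "0 < n" using n by simp
    have hn: "h / real n < d"
    proof -
      have "h < d * real N" using N d(1) by (simp add: field_simps)
      also have "\<dots> \<le> d * real n" using n d(1) by (intro mult_left_mono) auto
      finally show ?thesis using n0 by (simp add: pos_divide_less_eq)
    qed
    have sub: "{grid s t n k..grid s t n (Suc k)} \<subseteq> {s..t}" if "k < n" for k
      using grid_ge[of s t n k] grid_le[of s t "Suc k" n] st that by auto
    have int: "integral {s..grid s t n i} g = (\<Sum>k<i. integral {grid s t n k..grid s t n (Suc k)} g)" if "i \<le> n" for i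
      using that
    proof (induction i)
      case (Suc i)
      have "g integrable_on {s..grid s t n (Suc i)}"
        using grid_le[of s t "Suc i" n] st Suc.prems
        by (intro integrable_continuous_real continuous_on_subset[OF g]) auto
      then have "integral {s..grid s t n (Suc i)} g = integral {s..grid s t n i} g + integral {grid s t n i..grid s t n (Suc i)} g"
        using grid_ge[of s t n i] grid_strict[OF st n0, of i] st by (intro Henstock_Kurzweil_Integration.integral_combine[symmetric]) auto
      then show ?case using Suc by simp
    qed simp
    have "norm ((h / real n) *\<^sub>R (\<Sum>k<n. g (grid s t n k)) - integral {s..t} g)
      = norm (\<Sum>k<n. (h / real n) *\<^sub>R g (grid s t n k) - integral {grid s t n k..grid s t n (Suc k)} g)"
      using int[of n] grid_n[OF n0, of s t] by (simp add: sum_subtractf scaleR_sum_right)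
    also have "\<dots> \<le> (\<Sum>k<n. e / (2 * h) * (h / real n))"
    proof (rule order_trans[OF norm_sum sum_mono])
      fix k assume "k \<in> {..<n}"
      then have k: "k < n" by simp
      let ?a = "grid s t n k" and ?b = "grid s t n (Suc k)"
      have ab: "?a < ?b" by (rule grid_strict[OF st n0])
      have ba: "?b - ?a = h / real n" by (simp add: grid_Suc h_def)
      have gc: "continuous_on {?a..?b} g" by (rule continuous_on_subset[OF g sub[OF k]])
      have "norm (integral {?a..?b} (\<lambda>r. g r - g ?a)) \<le> e / (2 * h) * (?b - ?a)"
      proof (rule integral_bound)
        fix r assume r: "r \<in> {?a..?b}"
        have "dist r ?a < d" using r ba hn by (auto simp: dist_real_def)
        then show "norm (g r - g ?a) \<le> e / (2 * h)"
          using d(2)[of ?a r] sub[OF k] r ab by (force simp: dist_norm)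
      qed (use ab gc in \<open>auto intro!: continuous_intros\<close>)
      also have "integral {?a..?b} (\<lambda>r. g r - g ?a) = integral {?a..?b} g - (?b - ?a) *\<^sub>R g ?a"
        using ab by (subst Henstock_Kurzweil_Integration.integral_diff) (auto intro: integrable_continuous_real gc)
      finally show "norm ((h / real n) *\<^sub>R g ?a - integral {?a..?b} g) \<le> e / (2 * h) * (h / real n)"
        by (simp add: ba norm_minus_commute)
    qed
    also have "\<dots> = e / 2" using n0 h by simp
    also have "\<dots> < e" using e by simp
    finally show "norm (((t - s) / real n) *\<^sub>R (\<Sum>k<n. g (grid s t n k)) - integral {s..t} g) < e"
      by (simp add: h_def)
  qed
qed

context prob_space begin

lemma null_in_prob_sum:
  fixes X :: "'i \<Rightarrow> nat \<Rightarrow> 'a \<Rightarrow> 'b::{real_normed_vector, second_countable_topology}"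
  assumes "finite I" "\<And>i. i \<in> I \<Longrightarrow> null_in_prob (X i)"
  shows "null_in_prob (\<lambda>n \<omega>. \<Sum>i\<in>I. X i n \<omega>)"
  using assms
proof (induction I rule: finite_induct)
  case empty
  show ?case by (auto simp: null_in_prob_def)
next
  case (insert i I)
  then show ?case using null_in_prob_add[of "X i" "\<lambda>n \<omega>. \<Sum>i\<in>I. X i n \<omega>"] by simp
qed

lemma tight_family_sum:
  fixes X :: "'i \<Rightarrow> 'j \<Rightarrow> 'a \<Rightarrow> real"
  assumes "finite I" "\<And>i. i \<in> I \<Longrightarrow> tight_family (X i)"
  shows "tight_family (\<lambda>n \<omega>. \<Sum>i\<in>I. X i n \<omega>)"
  using assms
proof (induction I rule: finite_induct)
  case empty
  show ?case by (auto simp: tight_family_def intro!: exI[of _ 0])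
next
  case (insert i I)
  have T: "tight_family (X i)" "tight_family (\<lambda>n \<omega>. \<Sum>i\<in>I. X i n \<omega>)" using insert by auto
  have [measurable]: "X i n \<in> borel_measurable M" "(\<lambda>\<omega>. \<Sum>i\<in>I. X i n \<omega>) \<in> borel_measurable M" for n
    using T by (auto simp: tight_family_def)
  have "tight_family (\<lambda>n \<omega>. X i n \<omega> + (\<Sum>i\<in>I. X i n \<omega>))"
    by (rule tight_family_dom2[OF T, where C=1]) auto
  then show ?case using insert by simp
qed

lemma tight_family_const:
  fixes X :: "'a \<Rightarrow> real"
  assumes "X \<in> borel_measurable M"
  shows "tight_family (\<lambda>_::nat. X)"
  by (rule tight_familyI_AE_bounded) (use assms in auto)

end

section \<open>Orthogonal sums with vector-valued coefficients\<close>

context brownian begin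

abbreviation "\<Delta>W s t n k \<equiv> \<lambda>\<omega>. W (grid s t n (Suc k)) \<omega> - W (grid s t n k) \<omega>"

text \<open>\<open>orth_sum\<close> is applied in each coordinate, and the squares of the
  coordinates add up to the squared norm.\<close>

lemma orth_vec:
  fixes \<beta> :: "nat \<Rightarrow> 'w \<Rightarrow> 'b::euclidean_space" and \<phi> :: "nat \<Rightarrow> real \<Rightarrow> real"
  assumes \<tau>: "0 \<le> \<tau> 0" "\<And>k. \<tau> k < \<tau> (Suc k)"
    and \<beta>: "\<And>k. \<beta> k \<in> borel_measurable (F (\<tau> k))" "\<And>k \<omega>. \<omega> \<in> space M \<Longrightarrow> norm (\<beta> k \<omega>) \<le> K"
    and \<phi>: "\<And>k. \<phi> k \<in> borel_measurable borel"
      "\<And>k. integrable M (\<lambda>\<omega>. (\<phi> k (W (\<tau> (Suc k)) \<omega> - W (\<tau> k) \<omega>))\<^sup>2)"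
      "\<And>k. expectation (\<lambda>\<omega>. \<phi> k (W (\<tau> (Suc k)) \<omega> - W (\<tau> k) \<omega>)) = 0"
      "\<And>k. expectation (\<lambda>\<omega>. (\<phi> k (W (\<tau> (Suc k)) \<omega> - W (\<tau> k) \<omega>))\<^sup>2) = v k"
  defines "S \<equiv> \<lambda>n \<omega>. \<Sum>k<n. \<phi> k (W (\<tau> (Suc k)) \<omega> - W (\<tau> k) \<omega>) *\<^sub>R \<beta> k \<omega>"
  shows "integrable M (\<lambda>\<omega>. (norm (S n \<omega>))\<^sup>2) \<and>
    expectation (\<lambda>\<omega>. (norm (S n \<omega>))\<^sup>2) = (\<Sum>k<n. v k * expectation (\<lambda>\<omega>. (norm (\<beta> k \<omega>))\<^sup>2))"
proof -
  let ?s = "\<lambda>b \<omega>. \<Sum>k<n. (\<beta> k \<omega> \<bullet> b) * \<phi> k (W (\<tau> (Suc k)) \<omega> - W (\<tau> k) \<omega>)"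
  have O: "integrable M (\<lambda>\<omega>. (?s b \<omega>)\<^sup>2) \<and>
    expectation (\<lambda>\<omega>. (?s b \<omega>)\<^sup>2) = (\<Sum>k<n. v k * expectation (\<lambda>\<omega>. (\<beta> k \<omega> \<bullet> b)\<^sup>2))" if b: "b \<in> Basis" for b
  proof -
    have m: "(\<lambda>\<omega>. \<beta> k \<omega> \<bullet> b) \<in> borel_measurable (F (\<tau> k))" for k using \<beta>(1)[of k] by measurable
    have bd: "\<bar>\<beta> k \<omega> \<bullet> b\<bar> \<le> K" if "\<omega> \<in> space M" for k \<omega>
      using order_trans[OF Basis_le_norm[OF b] \<beta>(2)[OF that]] .
    show ?thesis using orth_sum[where \<tau>=\<tau> and \<phi>=\<phi> and \<beta>="\<lambda>k \<omega>. \<beta> k \<omega> \<bullet> b" and n=n and v=v, OF \<tau> m bd \<phi>] by blast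
  qed
  have bm[measurable]: "\<beta> k \<in> borel_measurable M" for k using \<beta>(1) F_meas by blast
  have bi: "integrable M (\<lambda>\<omega>. (\<beta> k \<omega> \<bullet> b)\<^sup>2)" if b: "b \<in> Basis" for k b
  proof (rule bdd_int[where K="K\<^sup>2"])
    fix \<omega> assume "\<omega> \<in> space M"
    from order_trans[OF Basis_le_norm[OF b] \<beta>(2)[OF this]]
    have "\<bar>\<beta> k \<omega> \<bullet> b\<bar>\<^sup>2 \<le> K\<^sup>2" by (intro power_mono) auto
    then show "norm ((\<beta> k \<omega> \<bullet> b)\<^sup>2) \<le> K\<^sup>2" by simp
  qed measurable
  have nsq: "(norm y)\<^sup>2 = (\<Sum>b\<in>Basis. (y \<bullet> b)\<^sup>2)" for y :: 'b
    by (subst power2_norm_eq_inner) (simp add: euclidean_inner[of y y] power2_eq_square)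
  have eq: "(norm (S n \<omega>))\<^sup>2 = (\<Sum>b\<in>Basis. (?s b \<omega>)\<^sup>2)" for \<omega>
    unfolding nsq S_def by (intro sum.cong refl) (simp add: inner_sum_left mult.commute)
  have "expectation (\<lambda>\<omega>. (norm (S n \<omega>))\<^sup>2) = (\<Sum>b\<in>Basis. (\<Sum>k<n. v k * expectation (\<lambda>\<omega>. (\<beta> k \<omega> \<bullet> b)\<^sup>2)))"
    unfolding eq using O by simp
  also have "\<dots> = (\<Sum>k<n. v k * expectation (\<lambda>\<omega>. (norm (\<beta> k \<omega>))\<^sup>2))"
    unfolding nsq using bi by (subst sum.swap) (simp add: sum_distrib_left)
  finally show ?thesis using O unfolding eq by simp
qed

text \<open>The variance is the fourth moment minus the square of the second: 3 - 1 = 2 times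
  \<open>(t - s)\<^sup>2\<close>.\<close>

lemma dW_sq_moments:
  assumes st: "0 \<le> s" "s < t"
  shows "integrable M (\<lambda>\<omega>. ((W t \<omega> - W s \<omega>)\<^sup>2 - (t - s))\<^sup>2)"
    and "expectation (\<lambda>\<omega>. (W t \<omega> - W s \<omega>)\<^sup>2 - (t - s)) = 0"
    and "expectation (\<lambda>\<omega>. ((W t \<omega> - W s \<omega>)\<^sup>2 - (t - s))\<^sup>2) = 2 * (t - s)\<^sup>2"
proof -
  have eq: "((W t \<omega> - W s \<omega>)\<^sup>2 - (t - s))\<^sup>2 = (W t \<omega> - W s \<omega>)^4 - 2 * (t - s) * (W t \<omega> - W s \<omega>)\<^sup>2 + (t - s)\<^sup>2" for \<omega>
    by (simp add: power2_eq_square power4_eq_xxxx algebra_simps)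
  show "integrable M (\<lambda>\<omega>. ((W t \<omega> - W s \<omega>)\<^sup>2 - (t - s))\<^sup>2)"
    unfolding eq using dW_int2[OF st] dW_int4[OF st] by simp
  show "expectation (\<lambda>\<omega>. (W t \<omega> - W s \<omega>)\<^sup>2 - (t - s)) = 0"
    using dW_int2[OF st] dW_2[OF st] by (simp add: prob_space)
  show "expectation (\<lambda>\<omega>. ((W t \<omega> - W s \<omega>)\<^sup>2 - (t - s))\<^sup>2) = 2 * (t - s)\<^sup>2"
    unfolding eq using dW_int2[OF st] dW_int4[OF st] dW_2[OF st] dW_4[OF st]
    by (simp add: prob_space) (simp add: power2_eq_square algebra_simps)
qed

end

text \<open>The passage from the equation to moments uses only that linear coefficients act on a
  bounded process in a Euclidean space, and it is carried out in this generality. Boundedness by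
  \<open>R\<close> makes polynomials in \<open>Z t\<close> integrable and supplies dominating
  constants.\<close>

locale stratonovich_linear = brownian M F W
  for M :: "'w measure" and F W +
  fixes LA LB :: "'b::euclidean_space \<Rightarrow> 'b" and x :: 'b and Z :: "real \<Rightarrow> 'w \<Rightarrow> 'b" and R :: real
  assumes LA: "bounded_linear LA" and LB: "bounded_linear LB"
    and Z_bd: "\<And>t \<omega>. 0 \<le> t \<Longrightarrow> \<omega> \<in> space M \<Longrightarrow> norm (Z t \<omega>) \<le> R"
    and Z_ad: "adapted F Z" and Z_cont: "continuous_process M Z"
    and Z_semi: "\<And>b. b \<in> Basis \<Longrightarrow> continuous_semimartingale M F (\<lambda>t \<omega>. Z t \<omega> \<bullet> b)"
    and Z_eq: "\<And>t. 0 \<le> t \<Longrightarrow> \<exists>I. has_stratonovich_integral M (\<lambda>s \<omega>. LB (Z s \<omega>)) W t I \<and>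
      (AE \<omega> in M. Z t \<omega> = x + integral {0..t} (\<lambda>s. LA (Z s \<omega>)) + I \<omega>)"
begin

lemma Z_F: "0 \<le> t \<Longrightarrow> Z t \<in> borel_measurable (F t)"
  using Z_ad by (simp add: adapted_def)

lemma Z_meas: "0 \<le> t \<Longrightarrow> Z t \<in> borel_measurable M"
  using Z_F F_meas by blast

lemma R_nonneg: "0 \<le> R"
proof -
  obtain \<omega> where "\<omega> \<in> space M" using not_empty by blast
  then have "norm (Z 0 \<omega>) \<le> R" by (intro Z_bd) auto
  then show ?thesis using norm_ge_zero[of "Z 0 \<omega>"] by linarith
qed

lemma grid_nonneg: "0 \<le> s \<Longrightarrow> s \<le> t \<Longrightarrow> 0 \<le> grid s t n k"
  using grid_ge[of s t n k] by linarith

lemma bl_meas: "bounded_linear L \<Longrightarrow> X \<in> borel_measurable N \<Longrightarrow> (\<lambda>\<omega>. L (X \<omega>)) \<in> borel_measurable N"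
  for L :: "'c::euclidean_space \<Rightarrow> 'd::euclidean_space"
  using measurable_compose[of X N borel L borel] borel_measurable_continuous_onI[of L] linear_continuous_on[of L UNIV] by blast

lemma Z_diff_bd: "0 \<le> r \<Longrightarrow> 0 \<le> s \<Longrightarrow> \<omega> \<in> space M \<Longrightarrow> norm (Z r \<omega> - Z s \<omega>) \<le> 2 * R"
  using norm_triangle_ineq4[of "Z r \<omega>" "Z s \<omega>"] Z_bd[of r \<omega>] Z_bd[of s \<omega>] by linarith

lemma Z_diff_sq_int: "0 \<le> r \<Longrightarrow> 0 \<le> s \<Longrightarrow> integrable M (\<lambda>\<omega>. (norm (Z r \<omega> - Z s \<omega>))\<^sup>2)"
  using Z_meas[of r] Z_meas[of s] power_mono[OF Z_diff_bd, of r s _ 2]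
  by (intro bdd_int[where K="(2 * R)\<^sup>2"]) auto

text \<open>Bounded continuous paths make the mean square distance, by dominated convergence, a
  continuous function of (r, s) on a compact square; uniform continuity compares it with the
  diagonal, where it vanishes. No rate is obtained at this stage, so the later error terms carry an
  unspecified modulus.\<close>

lemma L2_modulus:
  assumes "0 < e"
  shows "\<exists>d>0. \<forall>r s. 0 \<le> r \<and> r \<le> T \<and> 0 \<le> s \<and> s \<le> T \<and> \<bar>r - s\<bar> < d \<longrightarrow> expectation (\<lambda>\<omega>. (norm (Z r \<omega> - Z s \<omega>))\<^sup>2) \<le> e"
proof -
  define f where "f p = expectation (\<lambda>\<omega>. (norm (Z (fst p) \<omega> - Z (snd p) \<omega>))\<^sup>2)" for p
  have "continuous_on ({0..T} \<times> {0..T}) f"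
  proof (rule continuous_on_sequentiallyI)
    fix u :: "nat \<Rightarrow> real \<times> real" and a
    assume u: "\<forall>n. u n \<in> {0..T} \<times> {0..T}" and a: "a \<in> {0..T} \<times> {0..T}" and ua: "u \<longlonglongrightarrow> a"
    have un: "0 \<le> fst (u n)" "0 \<le> snd (u n)" for n using u[rule_format, of n] by (auto simp: mem_Times_iff)
    show "(\<lambda>n. f (u n)) \<longlonglongrightarrow> f a"
      unfolding f_def
    proof (rule integral_dominated_convergence[where w="\<lambda>_. (2 * R)\<^sup>2"])
      show "AE \<omega> in M. (\<lambda>n. (norm (Z (fst (u n)) \<omega> - Z (snd (u n)) \<omega>))\<^sup>2) \<longlonglongrightarrow> (norm (Z (fst a) \<omega> - Z (snd a) \<omega>))\<^sup>2"
        using Z_cont unfolding continuous_process_def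
      proof eventually_elim
        fix \<omega> assume c: "continuous_on {0..} (\<lambda>t. Z t \<omega>)"
        have "(\<lambda>n. Z (fst (u n)) \<omega>) \<longlonglongrightarrow> Z (fst a) \<omega>" "(\<lambda>n. Z (snd (u n)) \<omega>) \<longlonglongrightarrow> Z (snd a) \<omega>"
          using continuous_on_tendsto_compose[OF c tendsto_fst[OF ua]] continuous_on_tendsto_compose[OF c tendsto_snd[OF ua]] a un
          by (auto simp: mem_Times_iff)
        then show "(\<lambda>n. (norm (Z (fst (u n)) \<omega> - Z (snd (u n)) \<omega>))\<^sup>2) \<longlonglongrightarrow> (norm (Z (fst a) \<omega> - Z (snd a) \<omega>))\<^sup>2"
          by (intro tendsto_intros)
      qed
      show "AE \<omega> in M. norm ((norm (Z (fst (u n)) \<omega> - Z (snd (u n)) \<omega>))\<^sup>2) \<le> (2 * R)\<^sup>2" for n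
        using power_mono[OF Z_diff_bd[OF un(1)[of n] un(2)[of n]], of _ 2] by (intro AE_I2) auto
      show "(\<lambda>\<omega>. (norm (Z (fst (u n)) \<omega> - Z (snd (u n)) \<omega>))\<^sup>2) \<in> borel_measurable M" for n
        using Z_meas[OF un(1)[of n]] Z_meas[OF un(2)[of n]] by measurable
      have "0 \<le> fst a" "0 \<le> snd a" using a by auto
      then show "(\<lambda>\<omega>. (norm (Z (fst a) \<omega> - Z (snd a) \<omega>))\<^sup>2) \<in> borel_measurable M"
        using Z_meas[of "fst a"] Z_meas[of "snd a"] by measurable
    qed simp
  qed
  then have "uniformly_continuous_on ({0..T} \<times> {0..T}) f"
    by (rule compact_uniformly_continuous) (auto intro: compact_Times)
  then obtain d where d: "d > 0" "\<And>p q. p \<in> {0..T} \<times> {0..T} \<Longrightarrow> q \<in> {0..T} \<times> {0..T} \<Longrightarrow> dist q p < d \<Longrightarrow> dist (f q) (f p) < e"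
    unfolding uniformly_continuous_on_def using assms by metis
  show ?thesis
  proof (intro exI[of _ d] conjI d(1) allI impI)
    fix r s assume a: "0 \<le> r \<and> r \<le> T \<and> 0 \<le> s \<and> s \<le> T \<and> \<bar>r - s\<bar> < d"
    have "dist (f (r, s)) (f (s, s)) < e"
      using a by (intro d(2)) (auto simp: dist_Pair_Pair dist_real_def)
    then show "expectation (\<lambda>\<omega>. (norm (Z r \<omega> - Z s \<omega>))\<^sup>2) \<le> e"
      by (simp add: f_def dist_real_def)
  qed
qed

text \<open>The symmetric sums of the integral on the uniform grid of an interval that need not
  start at 0.\<close>

definition strat_sum :: "real \<Rightarrow> real \<Rightarrow> nat \<Rightarrow> 'w \<Rightarrow> 'b" where
  "strat_sum s t n \<omega> = (\<Sum>k<n. \<Delta>W s t n k \<omega> *\<^sub>R ((1 / 2) *\<^sub>R (LB (Z (grid s t n k) \<omega>) + LB (Z (grid s t n (Suc k)) \<omega>))))"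

lemma strat_sum_meas: "0 \<le> s \<Longrightarrow> s \<le> t \<Longrightarrow> strat_sum s t n \<in> borel_measurable M"
  unfolding strat_sum_def[abs_def]
  by (intro borel_measurable_sum borel_measurable_scaleR borel_measurable_diff borel_measurable_add
      W_meas grid_nonneg bl_meas[OF LB] Z_meas borel_measurable_const) auto

text \<open>The equation supplies, separately for each t, an integral over [0, t]. One version
  \<open>I t\<close> is chosen for each t. Its increments are limits of sums over [s, t], because
  such a sum is the difference of the sums over two partitions, of [0, t] and of [0, s], that agree
  on [0, s].\<close>

lemma integral_process:
  obtains I where "\<And>t. 0 \<le> t \<Longrightarrow> I t \<in> borel_measurable M"
    and "\<And>s t. 0 \<le> s \<Longrightarrow> s \<le> t \<Longrightarrow> AE \<omega> in M. Z t \<omega> - Z s \<omega> = integral {s..t} (\<lambda>r. LA (Z r \<omega>)) + (I t \<omega> - I s \<omega>)"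
    and "\<And>s t. 0 \<le> s \<Longrightarrow> s < t \<Longrightarrow> null_in_prob (\<lambda>n \<omega>. strat_sum s t n \<omega> - (I t \<omega> - I s \<omega>))"
proof -
  have "\<exists>I. \<forall>t. 0 \<le> t \<longrightarrow> has_stratonovich_integral M (\<lambda>s \<omega>. LB (Z s \<omega>)) W t (I t) \<and>
      (AE \<omega> in M. Z t \<omega> = x + integral {0..t} (\<lambda>s. LA (Z s \<omega>)) + I t \<omega>)"
    using Z_eq by metis
  then obtain I where I: "\<And>t. 0 \<le> t \<Longrightarrow> has_stratonovich_integral M (\<lambda>s \<omega>. LB (Z s \<omega>)) W t (I t)"
    "\<And>t. 0 \<le> t \<Longrightarrow> AE \<omega> in M. Z t \<omega> = x + integral {0..t} (\<lambda>s. LA (Z s \<omega>)) + I t \<omega>" by blast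
  have Im: "I t \<in> borel_measurable M" if "0 \<le> t" for t using I(1)[OF that] by (simp add: has_stratonovich_integral_def)
  show thesis
  proof (rule that[of I])
    show "AE \<omega> in M. Z t \<omega> - Z s \<omega> = integral {s..t} (\<lambda>r. LA (Z r \<omega>)) + (I t \<omega> - I s \<omega>)" if st: "0 \<le> s" "s \<le> t" for s t
      using I(2)[OF st(1)] I(2)[OF order_trans[OF st]] Z_cont[unfolded continuous_process_def]
    proof eventually_elim
      case (elim \<omega>)
      have "continuous_on {0..} (\<lambda>r. LA (Z r \<omega>))" using elim(3) bounded_linear.continuous_on[OF LA] by blast
      then have "continuous_on {0..t} (\<lambda>r. LA (Z r \<omega>))" by (rule continuous_on_subset) auto
      then have int: "(\<lambda>r. LA (Z r \<omega>)) integrable_on {0..t}" by (rule integrable_continuous_real)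
      then have "integral {0..t} (\<lambda>r. LA (Z r \<omega>)) = integral {0..s} (\<lambda>r. LA (Z r \<omega>)) + integral {s..t} (\<lambda>r. LA (Z r \<omega>))"
        using Henstock_Kurzweil_Integration.integral_combine[OF st int] by simp
      then show ?case using elim by (simp add: algebra_simps)
    qed
    fix s t :: real assume st: "0 \<le> s" "s < t"
    have t0: "0 \<le> t" using st by simp
    show "null_in_prob (\<lambda>n \<omega>. strat_sum s t n \<omega> - (I t \<omega> - I s \<omega>))"
    proof (rule null_in_probI)
      have Sm[measurable]: "strat_sum s t n \<in> borel_measurable M" for n using st by (intro strat_sum_meas) auto
      have [measurable]: "I t \<in> borel_measurable M" "I s \<in> borel_measurable M" using Im st by auto
      show "(\<lambda>\<omega>. strat_sum s t n \<omega> - (I t \<omega> - I s \<omega>)) \<in> borel_measurable M" for n by measurable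
      have S0m[measurable]: "strat_sum 0 s n \<in> borel_measurable M" for n using st by (intro strat_sum_meas) auto
      fix \<epsilon> \<eta> :: real assume e: "\<epsilon> > 0" "\<eta> > 0"
      let ?Y = "\<lambda>s \<omega>. LB (Z s \<omega>)"
      have D: "\<exists>\<delta>>0. \<forall>n \<pi>. partition_of r n \<pi> \<and> (\<forall>i<n. \<pi> (Suc i) - \<pi> i < \<delta>) \<longrightarrow>
        prob {\<omega> \<in> space M. norm (stratonovich_sum ?Y W n \<pi> \<omega> - I r \<omega>) > \<epsilon>/2} < \<eta>/2" if "0 \<le> r" for r
        using I(1)[OF that] half_gt_zero[OF e(1)] half_gt_zero[OF e(2)] unfolding has_stratonovich_integral_def by blast
      obtain d1 where d1: "d1 > 0" "\<forall>n \<pi>. partition_of t n \<pi> \<and> (\<forall>i<n. \<pi> (Suc i) - \<pi> i < d1) \<longrightarrow>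
        prob {\<omega> \<in> space M. norm (stratonovich_sum ?Y W n \<pi> \<omega> - I t \<omega>) > \<epsilon>/2} < \<eta>/2"
        using D[OF t0] by blast
      obtain d2 where d2: "d2 > 0" "\<forall>n \<pi>. partition_of s n \<pi> \<and> (\<forall>i<n. \<pi> (Suc i) - \<pi> i < d2) \<longrightarrow>
        prob {\<omega> \<in> space M. norm (stratonovich_sum ?Y W n \<pi> \<omega> - I s \<omega>) > \<epsilon>/2} < \<eta>/2"
        using D[OF st(1)] by blast
      define d where "d = min d1 d2"
      have d: "d > 0" using d1 d2 by (simp add: d_def)
      \<comment> \<open>The cells of both grids, of [0, s] and of [s, t], have length at most t /
        n.\<close>
      obtain N where N: "t / d < real N" using reals_Archimedean2 by blast
      show "eventually (\<lambda>n. prob {\<omega> \<in> space M. norm (strat_sum s t n \<omega> - (I t \<omega> - I s \<omega>)) > \<epsilon>} \<le> \<eta>) sequentially"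
        unfolding eventually_sequentially
      proof (intro exI allI impI)
        fix n assume n: "Suc N \<le> n"
        have n0: "0 < n" using n by simp
        have tn: "t / real n < d"
        proof -
          have "t < d * real N" using N d by (simp add: field_simps)
          also have "\<dots> \<le> d * real n" using n d by (intro mult_left_mono) auto
          finally show ?thesis using n0 by (simp add: pos_divide_less_eq)
        qed
        \<comment> \<open>The n cells of [0, s] followed by the n cells of [s, t]; both expressions
          give s at k = n.\<close>
        define \<pi> where "\<pi> k = (if k \<le> n then grid 0 s n k else grid s t n (k - n))" for k
        have \<pi>1: "\<pi> k = grid 0 s n k" if "k \<le> n" for k using that by (simp add: \<pi>_def)
        have \<pi>2: "\<pi> (n + k) = grid s t n k" for k
          using grid_n[OF n0, of 0 s] by (cases k) (auto simp: \<pi>_def)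
        have \<pi>2': "\<pi> k = grid s t n (k - n)" if "n \<le> k" for k using \<pi>2[of "k - n"] that by simp
        have inc: "0 \<le> \<pi> (Suc i) - \<pi> i \<and> \<pi> (Suc i) - \<pi> i < d" if "i < n + n" for i
        proof (cases "i < n")
          case True
          have "s / real n \<le> t / real n" using st by (intro divide_right_mono) auto
          then have "s / real n < d" using tn by linarith
          then show ?thesis using True st n0 by (simp add: \<pi>1 grid_Suc)
        next
          case False
          have "(t - s) / real n \<le> t / real n" using st by (intro divide_right_mono) auto
          then have "(t - s) / real n < d" using tn by linarith
          then show ?thesis using False st n0 by (simp add: \<pi>2' Suc_diff_le grid_Suc)
        qed
        have P1: "partition_of t (n + n) \<pi>"
          unfolding partition_of_def using inc \<pi>1[of 0] \<pi>2[of n] grid_n[OF n0, of s t] by auto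
        have P2: "partition_of s n (grid 0 s n)"
          unfolding partition_of_def using inc \<pi>1 grid_n[OF n0, of 0 s] grid_mono[of 0 s] st by auto
        have S1: "stratonovich_sum ?Y W (n + n) \<pi> \<omega> = strat_sum 0 s n \<omega> + strat_sum s t n \<omega>" for \<omega>
          unfolding stratonovich_sum_def strat_sum_def sum_lessThan_add
        proof (intro arg_cong2[of _ _ _ _ "(+)"] sum.cong refl)
          fix k assume "k \<in> {..<n}"
          then show "(W (\<pi> (Suc k)) \<omega> - W (\<pi> k) \<omega>) *\<^sub>R (1 / 2) *\<^sub>R (LB (Z (\<pi> k) \<omega>) + LB (Z (\<pi> (Suc k)) \<omega>)) =
            (W (grid 0 s n (Suc k)) \<omega> - W (grid 0 s n k) \<omega>) *\<^sub>R (1 / 2) *\<^sub>R (LB (Z (grid 0 s n k) \<omega>) + LB (Z (grid 0 s n (Suc k)) \<omega>))"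
            by (simp add: \<pi>1)
          show "(W (\<pi> (Suc (n + k))) \<omega> - W (\<pi> (n + k)) \<omega>) *\<^sub>R (1 / 2) *\<^sub>R (LB (Z (\<pi> (n + k)) \<omega>) + LB (Z (\<pi> (Suc (n + k))) \<omega>)) =
            (W (grid s t n (Suc k)) \<omega> - W (grid s t n k) \<omega>) *\<^sub>R (1 / 2) *\<^sub>R (LB (Z (grid s t n k) \<omega>) + LB (Z (grid s t n (Suc k)) \<omega>))"
            using \<pi>2[of k] \<pi>2[of "Suc k"] by simp
        qed
        have S2: "stratonovich_sum ?Y W n (grid 0 s n) \<omega> = strat_sum 0 s n \<omega>" for \<omega>
          by (simp add: stratonovich_sum_def strat_sum_def)
        have Q1: "prob {\<omega> \<in> space M. norm (strat_sum 0 s n \<omega> + strat_sum s t n \<omega> - I t \<omega>) > \<epsilon>/2} < \<eta>/2"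
        proof -
          have "\<forall>i<n + n. \<pi> (Suc i) - \<pi> i < d1" using inc by (simp add: d_def)
          with P1 d1(2) show ?thesis unfolding S1[symmetric] by blast
        qed
        have Q2: "prob {\<omega> \<in> space M. norm (strat_sum 0 s n \<omega> - I s \<omega>) > \<epsilon>/2} < \<eta>/2"
        proof -
          have "grid 0 s n (Suc i) - grid 0 s n i < d2" if "i < n" for i
            using inc[of i] that by (simp add: \<pi>1 d_def)
          with P2 d2(2) show ?thesis unfolding S2[symmetric] by blast
        qed
        have "prob {\<omega> \<in> space M. norm (strat_sum s t n \<omega> - (I t \<omega> - I s \<omega>)) > \<epsilon>} \<le>
          prob {\<omega> \<in> space M. norm (strat_sum 0 s n \<omega> + strat_sum s t n \<omega> - I t \<omega>) > \<epsilon>/2} +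
          prob {\<omega> \<in> space M. norm (strat_sum 0 s n \<omega> - I s \<omega>) > \<epsilon>/2}"
        proof (rule prob_Un_le)
          show "AE \<omega> in M. \<epsilon> < norm (strat_sum s t n \<omega> - (I t \<omega> - I s \<omega>)) \<longrightarrow>
            \<epsilon> / 2 < norm (strat_sum 0 s n \<omega> + strat_sum s t n \<omega> - I t \<omega>) \<or> \<epsilon> / 2 < norm (strat_sum 0 s n \<omega> - I s \<omega>)"
          proof (intro AE_I2 impI)
            fix \<omega> assume a: "\<epsilon> < norm (strat_sum s t n \<omega> - (I t \<omega> - I s \<omega>))"
            have eq: "strat_sum s t n \<omega> - (I t \<omega> - I s \<omega>) =
              (strat_sum 0 s n \<omega> + strat_sum s t n \<omega> - I t \<omega>) - (strat_sum 0 s n \<omega> - I s \<omega>)" by simp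
            have "norm (strat_sum s t n \<omega> - (I t \<omega> - I s \<omega>)) \<le>
              norm (strat_sum 0 s n \<omega> + strat_sum s t n \<omega> - I t \<omega>) + norm (strat_sum 0 s n \<omega> - I s \<omega>)"
              unfolding eq by (rule norm_triangle_ineq4)
            with a show "\<epsilon> / 2 < norm (strat_sum 0 s n \<omega> + strat_sum s t n \<omega> - I t \<omega>) \<or> \<epsilon> / 2 < norm (strat_sum 0 s n \<omega> - I s \<omega>)"
              by argo
          qed
        qed measurable
        then show "prob {\<omega> \<in> space M. norm (strat_sum s t n \<omega> - (I t \<omega> - I s \<omega>)) > \<epsilon>} \<le> \<eta>"
          using Q1 Q2 by linarith
      qed
    qed
  qed (rule Im)
qed

end

section \<open>Moment bounds and tightness on grids\<close>

context stratonovich_linear begin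

abbreviation "\<Delta>Z s t n k \<equiv> \<lambda>\<omega>. Z (grid s t n (Suc k)) \<omega> - Z (grid s t n k) \<omega>"

lemma L_bound: "bounded_linear L \<Longrightarrow> \<exists>c>0. \<forall>v. norm (L v) \<le> c * norm v"
  for L :: "'c::real_normed_vector \<Rightarrow> 'd::real_normed_vector"
  using bounded_linear.pos_bounded[of L] by (auto simp: mult.commute)

lemma dW_meas: "0 \<le> s \<Longrightarrow> s \<le> t \<Longrightarrow> \<Delta>W s t n k \<in> borel_measurable M"
  by (intro borel_measurable_diff W_meas grid_nonneg) auto

lemma dZ_meas: "0 \<le> s \<Longrightarrow> s \<le> t \<Longrightarrow> \<Delta>Z s t n k \<in> borel_measurable M"
  by (intro borel_measurable_diff Z_meas grid_nonneg) auto

lemma grid_dW: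
  assumes "0 \<le> s" "s < t" "0 < n"
  shows "integrable M (\<lambda>\<omega>. (\<Delta>W s t n k \<omega>)\<^sup>2)" "expectation (\<lambda>\<omega>. (\<Delta>W s t n k \<omega>)\<^sup>2) = (t - s) / real n"
    "integrable M (\<lambda>\<omega>. (\<Delta>W s t n k \<omega>)^4)" "expectation (\<lambda>\<omega>. (\<Delta>W s t n k \<omega>)^4) = 3 * ((t - s) / real n)\<^sup>2"
    "expectation (\<Delta>W s t n k) = 0"
proof -
  have g: "0 \<le> grid s t n k" "grid s t n k < grid s t n (Suc k)" using assms grid_nonneg grid_strict by auto
  have q: "grid s t n (Suc k) - grid s t n k = (t - s) / real n" by (simp add: grid_Suc)
  show "integrable M (\<lambda>\<omega>. (\<Delta>W s t n k \<omega>)\<^sup>2)" by (rule dW_int2[OF g])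
  show "expectation (\<lambda>\<omega>. (\<Delta>W s t n k \<omega>)\<^sup>2) = (t - s) / real n" using dW_2[OF g] unfolding q .
  show "integrable M (\<lambda>\<omega>. (\<Delta>W s t n k \<omega>)^4)" by (rule dW_int4[OF g])
  show "expectation (\<lambda>\<omega>. (\<Delta>W s t n k \<omega>)^4) = 3 * ((t - s) / real n)\<^sup>2" using dW_4[OF g] unfolding q .
  show "expectation (\<Delta>W s t n k) = 0" by (rule dW_1[OF g])
qed

lemma tight_QW:
  assumes st: "0 \<le> s" "s < t"
  shows "tight_family (\<lambda>n \<omega>. \<Sum>k<n. (\<Delta>W s t n k \<omega>)\<^sup>2)"
proof (rule tight_family_L1[where c="t - s"])
  have [measurable]: "\<Delta>W s t n k \<in> borel_measurable M" for n k using st by (intro dW_meas) auto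
  show "(\<lambda>\<omega>. \<Sum>k<n. (\<Delta>W s t n k \<omega>)\<^sup>2) \<in> borel_measurable M" for n by measurable
  have eq: "(\<lambda>\<omega>. norm (\<Sum>k<n. (\<Delta>W s t n k \<omega>)\<^sup>2)) = (\<lambda>\<omega>. \<Sum>k<n. (\<Delta>W s t n k \<omega>)\<^sup>2)" for n
    by (auto intro!: ext abs_of_nonneg sum_nonneg)
  have i: "integrable M (\<lambda>\<omega>. (\<Delta>W s t n k \<omega>)\<^sup>2)" if "k < n" for n k
    using grid_dW(1)[OF st, of n k] that by simp
  show "integrable M (\<lambda>\<omega>. norm (\<Sum>k<n. (\<Delta>W s t n k \<omega>)\<^sup>2))" for n
    unfolding eq using i by (intro Bochner_Integration.integrable_sum) auto
  show "expectation (\<lambda>\<omega>. norm (\<Sum>k<n. (\<Delta>W s t n k \<omega>)\<^sup>2)) \<le> t - s" for n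
  proof -
    have "expectation (\<lambda>\<omega>. \<Sum>k<n. (\<Delta>W s t n k \<omega>)\<^sup>2) = (\<Sum>k<n. expectation (\<lambda>\<omega>. (\<Delta>W s t n k \<omega>)\<^sup>2))"
      using i by (intro Bochner_Integration.integral_sum) auto
    also have "\<dots> = (\<Sum>k<n. (t - s) / real n)" using grid_dW(2)[OF st, of n] by (intro sum.cong) auto
    also have "\<dots> \<le> t - s" using st by simp
    finally show ?thesis unfolding eq .
  qed
qed

text \<open>The semimartingale property of the solution enters here, and only as tightness of the
  squared increments of each coordinate.\<close>

lemma tight_QZ:
  assumes st: "0 \<le> s" "s < t"
  shows "tight_family (\<lambda>n \<omega>. \<Sum>k<n. (norm (\<Delta>Z s t n k \<omega>))\<^sup>2)"
proof -
  have nsq: "(norm y)\<^sup>2 = (\<Sum>b\<in>Basis. (y \<bullet> b)\<^sup>2)" for y :: 'b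
    by (subst power2_norm_eq_inner) (simp add: euclidean_inner[of y y] power2_eq_square)
  have "tight_family (\<lambda>n \<omega>. \<Sum>b\<in>Basis. \<Sum>k<n. (Z (grid s t n (Suc k)) \<omega> \<bullet> b - Z (grid s t n k) \<omega> \<bullet> b)\<^sup>2)"
    by (intro tight_family_sum semimartingale_tight[OF filt Z_semi st(1) less_imp_le[OF st(2)]]) auto
  moreover have "(\<Sum>b\<in>Basis. \<Sum>k<n. (Z (grid s t n (Suc k)) \<omega> \<bullet> b - Z (grid s t n k) \<omega> \<bullet> b)\<^sup>2) =
    (\<Sum>k<n. (norm (\<Delta>Z s t n k \<omega>))\<^sup>2)" for n \<omega>
    unfolding nsq by (subst sum.swap) (simp add: inner_diff_left)
  ultimately show ?thesis by simp
qed

text \<open>The fourth root of the sum of fourth powers dominates the largest increment and, unlike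
  a maximum, its fourth power has a computable mean, namely
  \<open>3 * (t - s)\<^sup>2 / real n\<close>.\<close>

lemma null_max_dW:
  assumes st: "0 \<le> s" "s < t"
  shows "null_in_prob (\<lambda>n \<omega>. sqrt (sqrt (\<Sum>k<n. (\<Delta>W s t n k \<omega>)^4)))"
proof -
  have [measurable]: "\<Delta>W s t n k \<in> borel_measurable M" for n k using st by (intro dW_meas) auto
  let ?V = "\<lambda>n \<omega>. \<Sum>k<n. (\<Delta>W s t n k \<omega>)^4"
  have Vnn: "0 \<le> ?V n \<omega>" for n \<omega> by (intro sum_nonneg) (simp add: zero_le_even_power)
  have i: "integrable M (\<lambda>\<omega>. (\<Delta>W s t n k \<omega>)^4)" if "k < n" for n k
    using grid_dW(3)[OF st, of n k] that by simp
  have E: "expectation (\<lambda>\<omega>. norm (?V n \<omega>)) = 3 * (t - s)\<^sup>2 / real n" for n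
  proof -
    have "expectation (\<lambda>\<omega>. norm (?V n \<omega>)) = (\<Sum>k<n. expectation (\<lambda>\<omega>. (\<Delta>W s t n k \<omega>)^4))"
      unfolding real_norm_def abs_of_nonneg[OF Vnn] using i by (intro Bochner_Integration.integral_sum) auto
    also have "\<dots> = (\<Sum>k<n. 3 * ((t - s) / real n)\<^sup>2)" using grid_dW(4)[OF st, of n] by (intro sum.cong) auto
    also have "\<dots> = 3 * (t - s)\<^sup>2 / real n" by (simp add: power_divide power2_eq_square)
    finally show ?thesis .
  qed
  have "null_in_prob ?V"
  proof (rule null_in_prob_L1)
    show "?V n \<in> borel_measurable M" for n by measurable
    show "integrable M (\<lambda>\<omega>. norm (?V n \<omega>))" for n
      unfolding real_norm_def abs_of_nonneg[OF Vnn] using i by (intro Bochner_Integration.integrable_sum) auto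
    show "(\<lambda>n. expectation (\<lambda>\<omega>. norm (?V n \<omega>))) \<longlonglongrightarrow> 0" unfolding E by (rule lim_const_over_n)
  qed
  then show ?thesis
  proof (subst null_in_prob_def, intro conjI allI impI)
    show "(\<lambda>\<omega>. sqrt (sqrt (?V n \<omega>))) \<in> borel_measurable M" for n by measurable
    fix \<epsilon> :: real assume e: "0 < \<epsilon>" and V: "null_in_prob ?V"
    have "(\<epsilon> < norm (sqrt (sqrt v))) = (\<epsilon>^4 < norm v)" if "0 \<le> v" for v
    proof -
      have "(\<epsilon> < sqrt (sqrt v)) = (\<epsilon>\<^sup>2 < sqrt v)" using real_sqrt_less_iff[of "\<epsilon>\<^sup>2" "sqrt v"] e by simp
      also have "\<dots> = ((\<epsilon>\<^sup>2)\<^sup>2 < v)" by (metis abs_of_nonneg real_sqrt_abs real_sqrt_less_iff zero_le_power2)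
      finally show ?thesis using that by simp
    qed
    then show "(\<lambda>n. prob {\<omega> \<in> space M. \<epsilon> < norm (sqrt (sqrt (?V n \<omega>)))}) \<longlonglongrightarrow> 0"
      using V e Vnn unfolding null_in_prob_def by simp
  qed
qed

lemma dW_le_max:
  assumes "k < n"
  shows "\<bar>\<Delta>W s t n k \<omega>\<bar> \<le> sqrt (sqrt (\<Sum>k<n. (\<Delta>W s t n k \<omega>)^4))"
proof -
  have "(\<Delta>W s t n k \<omega>)^4 \<le> (\<Sum>k<n. (\<Delta>W s t n k \<omega>)^4)"
    using assms by (intro member_le_sum) (auto simp: zero_le_even_power)
  then have "sqrt (sqrt ((\<Delta>W s t n k \<omega>)^4)) \<le> sqrt (sqrt (\<Sum>k<n. (\<Delta>W s t n k \<omega>)^4))" by simp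
  moreover have "sqrt (sqrt (y^4)) = \<bar>y\<bar>" for y :: real
  proof -
    have "sqrt (y^4) = y\<^sup>2" by (rule real_sqrt_unique) auto
    then show ?thesis by simp
  qed
  ultimately show ?thesis by simp
qed

text \<open>The inequality between arithmetic and geometric mean with a free weight, which is later
  adjusted to the sizes of the two factors.\<close>

lemma young: "0 < a \<Longrightarrow> \<bar>d\<bar> * u \<le> (a * d\<^sup>2 + u\<^sup>2 / a) / 2" for a d u :: real
proof -
  assume a: "0 < a"
  have "0 \<le> (a * \<bar>d\<bar> - u)\<^sup>2 / a" using a by simp
  also have "\<dots> = a * d\<^sup>2 - 2 * (\<bar>d\<bar> * u) + u\<^sup>2 / a"
    using a by (simp add: power2_diff diff_divide_distrib add_divide_distrib power_mult_distrib) (simp add: power2_eq_square)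
  finally show ?thesis by simp
qed

text \<open>\<open>U\<close> is the error made inside a coarse cell [p, q] by freezing the integrand
  at the left end. The isometry gives it a second moment of order (q - p) * w. Young's inequality
  with weight a, against the increment of \<open>W\<close>, then gives a first moment of order (q -
  p) * a as soon as w is at most \<open>a\<^sup>2\<close>, and summation over the cells keeps the
  order a.\<close>

lemma fine_step:
  assumes p: "0 \<le> p" "p < q" and m: "0 < m" and a: "0 < a"
    and c: "0 < c" "\<And>v. norm (LB v) \<le> c * norm v"
    and w: "\<And>r. p \<le> r \<Longrightarrow> r \<le> q \<Longrightarrow> expectation (\<lambda>\<omega>. (norm (Z r \<omega> - Z p \<omega>))\<^sup>2) \<le> w"
  defines "U \<equiv> \<lambda>\<omega>. \<Sum>j<m. \<Delta>W p q m j \<omega> *\<^sub>R LB (Z (grid p q m j) \<omega> - Z p \<omega>)"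
  shows "U \<in> borel_measurable M" "integrable M (\<lambda>\<omega>. (norm (U \<omega>))\<^sup>2)"
    "expectation (\<lambda>\<omega>. (norm (U \<omega>))\<^sup>2) \<le> (q - p) * (c\<^sup>2 * w)"
    "integrable M (\<lambda>\<omega>. norm ((W q \<omega> - W p \<omega>) *\<^sub>R U \<omega>))"
    "expectation (\<lambda>\<omega>. norm ((W q \<omega> - W p \<omega>) *\<^sub>R U \<omega>)) \<le> (q - p) * (a + c\<^sup>2 * w / a) / 2"
proof -
  have gm[measurable]: "\<Delta>W p q m j \<in> borel_measurable M" for j using p by (intro dW_meas) auto
  have gn: "0 \<le> grid p q m j" for j using p by (intro grid_nonneg) auto
  have q0: "0 \<le> q" using p by simp
  have Zm[measurable]: "Z (grid p q m j) \<in> borel_measurable M" "Z p \<in> borel_measurable M" for j using Z_meas gn p by auto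
  have Wm[measurable]: "W p \<in> borel_measurable M" "W q \<in> borel_measurable M" using W_meas p q0 by auto
  show Um[measurable]: "U \<in> borel_measurable M" unfolding U_def
    by (intro borel_measurable_sum borel_measurable_scaleR gm bl_meas[OF LB] borel_measurable_diff Zm)
  have bF: "(\<lambda>\<omega>. LB (Z (grid p q m j) \<omega> - Z p \<omega>)) \<in> borel_measurable (F (grid p q m j))" for j
    using gn[of j] p grid_ge[of p q m j]
    by (intro bl_meas[OF LB] borel_measurable_diff Z_F F_mono[OF Z_F]) auto
  have bK: "norm (LB (Z (grid p q m j) \<omega> - Z p \<omega>)) \<le> c * (2 * R)" if "\<omega> \<in> space M" for j \<omega>
    using c(2)[of "Z (grid p q m j) \<omega> - Z p \<omega>"] Z_diff_bd[OF gn[of j] p(1) that] c(1)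
    by (meson mult_left_mono order_trans less_imp_le)
  have O: "integrable M (\<lambda>\<omega>. (norm (U \<omega>))\<^sup>2) \<and> expectation (\<lambda>\<omega>. (norm (U \<omega>))\<^sup>2) =
    (\<Sum>j<m. (q - p) / real m * expectation (\<lambda>\<omega>. (norm (LB (Z (grid p q m j) \<omega> - Z p \<omega>)))\<^sup>2))"
    unfolding U_def
    by (rule orth_vec[where \<phi>="\<lambda>_ x. x" and \<tau>="grid p q m", OF _ _ bF bK])
      (use p m grid_strict grid_dW[OF p(1,2) m] in auto)
  then show Ui: "integrable M (\<lambda>\<omega>. (norm (U \<omega>))\<^sup>2)" by blast
  have "(\<Sum>j<m. (q - p) / real m * expectation (\<lambda>\<omega>. (norm (LB (Z (grid p q m j) \<omega> - Z p \<omega>)))\<^sup>2))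
    \<le> (\<Sum>j<m. (q - p) / real m * (c\<^sup>2 * w))"
  proof (intro sum_mono mult_left_mono)
    fix j assume j: "j \<in> {..<m}"
    have "expectation (\<lambda>\<omega>. (norm (LB (Z (grid p q m j) \<omega> - Z p \<omega>)))\<^sup>2) \<le> expectation (\<lambda>\<omega>. c\<^sup>2 * (norm (Z (grid p q m j) \<omega> - Z p \<omega>))\<^sup>2)"
    proof (rule integral_mono)
      show "integrable M (\<lambda>\<omega>. (norm (LB (Z (grid p q m j) \<omega> - Z p \<omega>)))\<^sup>2)"
      proof (rule bdd_int[where K="(c * (2 * R))\<^sup>2"])
        have [measurable]: "(\<lambda>\<omega>. LB (Z (grid p q m j) \<omega> - Z p \<omega>)) \<in> borel_measurable M"
          by (intro bl_meas[OF LB] borel_measurable_diff Zm)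
        show "(\<lambda>\<omega>. (norm (LB (Z (grid p q m j) \<omega> - Z p \<omega>)))\<^sup>2) \<in> borel_measurable M" by measurable
        show "norm ((norm (LB (Z (grid p q m j) \<omega> - Z p \<omega>)))\<^sup>2) \<le> (c * (2 * R))\<^sup>2" if "\<omega> \<in> space M" for \<omega>
          using power_mono[OF bK[OF that], of j 2] by simp
      qed
      show "integrable M (\<lambda>\<omega>. c\<^sup>2 * (norm (Z (grid p q m j) \<omega> - Z p \<omega>))\<^sup>2)"
        by (intro integrable_mult_right Z_diff_sq_int gn p)
      show "(norm (LB (Z (grid p q m j) \<omega> - Z p \<omega>)))\<^sup>2 \<le> c\<^sup>2 * (norm (Z (grid p q m j) \<omega> - Z p \<omega>))\<^sup>2" for \<omega>
        using power_mono[OF c(2), of _ 2] by (simp add: power_mult_distrib)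
    qed
    also have "\<dots> \<le> c\<^sup>2 * w"
      using w[of "grid p q m j"] grid_ge[of p q m j] grid_le[of p q j m] j p
      by (simp add: mult_left_mono)
    finally show "expectation (\<lambda>\<omega>. (norm (LB (Z (grid p q m j) \<omega> - Z p \<omega>)))\<^sup>2) \<le> c\<^sup>2 * w" .
  qed (use p in auto)
  also have "\<dots> = (q - p) * (c\<^sup>2 * w)" using m by simp
  finally show Ub: "expectation (\<lambda>\<omega>. (norm (U \<omega>))\<^sup>2) \<le> (q - p) * (c\<^sup>2 * w)" using O by simp
  let ?d = "\<lambda>\<omega>. W q \<omega> - W p \<omega>"
  have le: "norm (?d \<omega> *\<^sub>R U \<omega>) \<le> (a * (?d \<omega>)\<^sup>2 + (norm (U \<omega>))\<^sup>2 / a) / 2" for \<omega>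
    using young[OF a, of "?d \<omega>" "norm (U \<omega>)"] by simp
  have i2: "integrable M (\<lambda>\<omega>. (a * (?d \<omega>)\<^sup>2 + (norm (U \<omega>))\<^sup>2 / a) / 2)"
    using dW_int2[OF p] Ui by simp
  show i3: "integrable M (\<lambda>\<omega>. norm (?d \<omega> *\<^sub>R U \<omega>))"
    using le by (intro Bochner_Integration.integrable_bound[OF i2] AE_I2) (auto intro: order_trans[OF _ abs_ge_self])
  have "expectation (\<lambda>\<omega>. norm (?d \<omega> *\<^sub>R U \<omega>)) \<le> expectation (\<lambda>\<omega>. (a * (?d \<omega>)\<^sup>2 + (norm (U \<omega>))\<^sup>2 / a) / 2)"
    by (rule integral_mono[OF i3 i2 le])
  also have "\<dots> = (a * (q - p) + expectation (\<lambda>\<omega>. (norm (U \<omega>))\<^sup>2) / a) / 2"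
    using dW_int2[OF p] Ui dW_2[OF p] by simp
  also have "\<dots> \<le> (a * (q - p) + (q - p) * (c\<^sup>2 * w) / a) / 2"
    using Ub a by (simp add: divide_right_mono)
  also have "\<dots> = (q - p) * (a + c\<^sup>2 * w / a) / 2" by (simp add: algebra_simps)
  finally show "expectation (\<lambda>\<omega>. norm (?d \<omega> *\<^sub>R U \<omega>)) \<le> (q - p) * (a + c\<^sup>2 * w / a) / 2" .
qed

text \<open>The squared increments minus their means are orthogonal, each of variance twice the
  squared cell length, so that n of them have a total second moment of order 1 / n. Young's
  inequality converts this into a bound of the first moment.\<close>

lemma square_variation_L1:
  assumes st: "0 \<le> s" "s < t" and n: "0 < n" and a: "0 < a"
    and c: "0 < c" "\<And>v. norm (LB v) \<le> c * norm v"
  defines "V \<equiv> \<lambda>\<omega>. \<Sum>k<n. ((\<Delta>W s t n k \<omega>)\<^sup>2 - (t - s) / real n) *\<^sub>R LB (Z (grid s t n k) \<omega>)"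
  shows "V \<in> borel_measurable M" "integrable M (\<lambda>\<omega>. norm (V \<omega>))"
    "expectation (\<lambda>\<omega>. norm (V \<omega>)) \<le> (a + 2 * (t - s)\<^sup>2 / real n * (c * R)\<^sup>2 / a) / 2"
proof -
  let ?\<delta> = "(t - s) / real n"
  have gn: "0 \<le> grid s t n j" for j using st by (intro grid_nonneg) auto
  have dm[measurable]: "\<Delta>W s t n k \<in> borel_measurable M" for k using st by (intro dW_meas) auto
  show Vm[measurable]: "V \<in> borel_measurable M" unfolding V_def
    by (intro borel_measurable_sum borel_measurable_scaleR bl_meas[OF LB] borel_measurable_diff borel_measurable_power dm
        Z_meas gn borel_measurable_const)
  have bF: "(\<lambda>\<omega>. LB (Z (grid s t n j) \<omega>)) \<in> borel_measurable (F (grid s t n j))" for j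
    by (intro bl_meas[OF LB] Z_F gn)
  have bK: "norm (LB (Z (grid s t n j) \<omega>)) \<le> c * R" if "\<omega> \<in> space M" for j \<omega>
    using c(2)[of "Z (grid s t n j) \<omega>"] Z_bd[OF gn[of j] that] c(1)
    by (meson mult_left_mono order_trans less_imp_le)
  have mom: "integrable M (\<lambda>\<omega>. ((\<Delta>W s t n k \<omega>)\<^sup>2 - ?\<delta>)\<^sup>2)" "expectation (\<lambda>\<omega>. (\<Delta>W s t n k \<omega>)\<^sup>2 - ?\<delta>) = 0"
    "expectation (\<lambda>\<omega>. ((\<Delta>W s t n k \<omega>)\<^sup>2 - ?\<delta>)\<^sup>2) = 2 * ?\<delta>\<^sup>2" for k
    using dW_sq_moments[OF gn grid_strict[OF st(2) n], of k] grid_Suc[of s t n k] by auto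
  have O: "integrable M (\<lambda>\<omega>. (norm (V \<omega>))\<^sup>2) \<and> expectation (\<lambda>\<omega>. (norm (V \<omega>))\<^sup>2) =
    (\<Sum>j<n. 2 * ?\<delta>\<^sup>2 * expectation (\<lambda>\<omega>. (norm (LB (Z (grid s t n j) \<omega>)))\<^sup>2))"
    unfolding V_def
    by (rule orth_vec[where \<phi>="\<lambda>_ x. x\<^sup>2 - ?\<delta>" and \<tau>="grid s t n", OF _ _ bF bK])
      (use st n grid_strict mom in auto)
  have "(\<Sum>j<n. 2 * ?\<delta>\<^sup>2 * expectation (\<lambda>\<omega>. (norm (LB (Z (grid s t n j) \<omega>)))\<^sup>2)) \<le> (\<Sum>j<n. 2 * ?\<delta>\<^sup>2 * (c * R)\<^sup>2)"
  proof (intro sum_mono mult_left_mono)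
    fix j
    have LBm: "(\<lambda>\<omega>. LB (Z (grid s t n j) \<omega>)) \<in> borel_measurable M" using bF F_meas by blast
    have sq: "(norm (LB (Z (grid s t n j) \<omega>)))\<^sup>2 \<le> (c * R)\<^sup>2" if "\<omega> \<in> space M" for \<omega>
      by (intro power_mono bK that) auto
    have "expectation (\<lambda>\<omega>. (norm (LB (Z (grid s t n j) \<omega>)))\<^sup>2) \<le> expectation (\<lambda>\<omega>. (c * R)\<^sup>2)"
      by (intro integral_mono bdd_int[where K="(c * R)\<^sup>2"]) (use LBm sq in auto)
    then show "expectation (\<lambda>\<omega>. (norm (LB (Z (grid s t n j) \<omega>)))\<^sup>2) \<le> (c * R)\<^sup>2" by (simp add: prob_space)
  qed auto
  also have "\<dots> = 2 * (t - s)\<^sup>2 / real n * (c * R)\<^sup>2" using n by (simp add: power_divide power2_eq_square)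
  finally have E2: "expectation (\<lambda>\<omega>. (norm (V \<omega>))\<^sup>2) \<le> 2 * (t - s)\<^sup>2 / real n * (c * R)\<^sup>2" using O by simp
  have le: "norm (V \<omega>) \<le> (a + (norm (V \<omega>))\<^sup>2 / a) / 2" for \<omega>
    using young[OF a, of 1 "norm (V \<omega>)"] by simp
  show i: "integrable M (\<lambda>\<omega>. norm (V \<omega>))"
    by (rule sq_int_imp_int) (use O in auto)
  have "expectation (\<lambda>\<omega>. norm (V \<omega>)) \<le> expectation (\<lambda>\<omega>. (a + (norm (V \<omega>))\<^sup>2 / a) / 2)"
    using O by (intro integral_mono i le) auto
  also have "\<dots> = (a + expectation (\<lambda>\<omega>. (norm (V \<omega>))\<^sup>2) / a) / 2" using O by (simp add: prob_space)
  also have "\<dots> \<le> (a + 2 * (t - s)\<^sup>2 / real n * (c * R)\<^sup>2 / a) / 2"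
    by (intro divide_right_mono add_left_mono) (use E2 a in auto)
  finally show "expectation (\<lambda>\<omega>. norm (V \<omega>)) \<le> (a + 2 * (t - s)\<^sup>2 / real n * (c * R)\<^sup>2 / a) / 2" .
qed

text \<open>Left-point sums. Orthogonality of the summands is available for these and not for the
  symmetric sums.\<close>

definition ito_part :: "real \<Rightarrow> real \<Rightarrow> nat \<Rightarrow> 'w \<Rightarrow> 'b" where
  "ito_part s t n \<omega> = (\<Sum>k<n. \<Delta>W s t n k \<omega> *\<^sub>R LB (Z (grid s t n k) \<omega>))"

text \<open>Covariation sums of \<open>W\<close> with the image of \<open>Z\<close> under
  \<open>LB\<close>; half of this separates the symmetric from the left-point sums.\<close>

definition cross_part :: "real \<Rightarrow> real \<Rightarrow> nat \<Rightarrow> 'w \<Rightarrow> 'b" where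
  "cross_part s t n \<omega> = (\<Sum>k<n. \<Delta>W s t n k \<omega> *\<^sub>R LB (\<Delta>Z s t n k \<omega>))"

lemma strat_sum_split: "strat_sum s t n \<omega> = ito_part s t n \<omega> + (1 / 2) *\<^sub>R cross_part s t n \<omega>"
proof -
  interpret LB: bounded_linear LB by (rule LB)
  have half: "(1/2) *\<^sub>R (u + v) = u + (1/2) *\<^sub>R (v - u)" for u v :: 'b
  proof -
    have "u - (1/2) *\<^sub>R u = (1/2) *\<^sub>R u" using scaleR_diff_left[of 1 "1/2" u] by simp
    then show ?thesis by (simp add: scaleR_diff_right scaleR_add_right algebra_simps)
  qed
  show ?thesis
    unfolding strat_sum_def ito_part_def cross_part_def scaleR_sum_right sum.distrib[symmetric] half
    by (intro sum.cong refl) (simp add: LB.diff scaleR_add_right mult.commute)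
qed

lemma ito_part_meas: "0 \<le> s \<Longrightarrow> s \<le> t \<Longrightarrow> ito_part s t n \<in> borel_measurable M"
  unfolding ito_part_def[abs_def]
  by (intro borel_measurable_sum borel_measurable_scaleR dW_meas grid_nonneg bl_meas[OF LB] Z_meas) auto

lemma cross_part_meas: "0 \<le> s \<Longrightarrow> s \<le> t \<Longrightarrow> cross_part s t n \<in> borel_measurable M"
  unfolding cross_part_def[abs_def]
  by (intro borel_measurable_sum borel_measurable_scaleR dW_meas dZ_meas bl_meas[OF LB]) auto

text \<open>In each coarse cell the fine left-point sum is the freezing error \<open>U\<close> plus
  the coarse increment of \<open>W\<close> times the value of \<open>LB\<close> at the left end.
  Multiplied by that increment once more, the second part contains squared increments, which are
  close to the cell length; this explains the Riemann sum that is subtracted. The bound is uniform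
  in m because m will be chosen after n.\<close>

lemma ito_fine_L1:
  assumes st: "0 \<le> s" "s < t" and e: "0 < e"
  defines "T \<equiv> \<lambda>n m \<omega>. (\<Sum>k<n. \<Delta>W s t n k \<omega> *\<^sub>R ito_part (grid s t n k) (grid s t n (Suc k)) m \<omega>)
     - ((t - s) / real n) *\<^sub>R (\<Sum>k<n. LB (Z (grid s t n k) \<omega>))"
  shows "\<exists>N. \<forall>n\<ge>N. \<forall>m>0. T n m \<in> borel_measurable M \<and> integrable M (\<lambda>\<omega>. norm (T n m \<omega>)) \<and> expectation (\<lambda>\<omega>. norm (T n m \<omega>)) \<le> e"
proof -
  interpret LB: bounded_linear LB by (rule LB)
  obtain c where c: "0 < c" "\<And>v. norm (LB v) \<le> c * norm v" using L_bound[OF LB] by blast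
  define h where "h = t - s"
  have h: "0 < h" using st by (simp add: h_def)
  \<comment> \<open>The final estimate is h * (a + c^2 * a) / 2 + a, which is at most a times this
    denominator.\<close>
  define a where "a = e / (h + c\<^sup>2 * h + 2)"
  have den: "0 < h + c\<^sup>2 * h + 2" using h by (simp add: add_pos_nonneg)
  have a: "0 < a" using e den by (simp add: a_def)
  obtain d where d: "d > 0" "\<And>r r'. 0 \<le> r \<and> r \<le> t \<and> 0 \<le> r' \<and> r' \<le> t \<and> \<bar>r - r'\<bar> < d \<Longrightarrow> expectation (\<lambda>\<omega>. (norm (Z r \<omega> - Z r' \<omega>))\<^sup>2) \<le> a\<^sup>2"
    using L2_modulus[of "a\<^sup>2" t] a by auto
  \<comment> \<open>The first bound puts the mesh below d, so that the mean square oscillation in a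
    cell is at most \<open>a\<^sup>2\<close>; the second makes the contribution of the fluctuating
    squares at most a.\<close>
  obtain N where N: "max (h / d) (2 * h\<^sup>2 * (c * R)\<^sup>2 / a\<^sup>2) < real N" using reals_Archimedean2 by blast
  have "T n m \<in> borel_measurable M \<and> integrable M (\<lambda>\<omega>. norm (T n m \<omega>)) \<and> expectation (\<lambda>\<omega>. norm (T n m \<omega>)) \<le> e"
    if n: "Suc N \<le> n" and m: "0 < m" for n m
  proof -
    have n0: "0 < n" using n by simp
    have nN: "real N \<le> real n" using n by simp
    have hd: "h / real n < d"
    proof -
      have "h / d < real n" using N nN by linarith
      then show ?thesis using d(1) n0 by (simp add: field_simps)
    qed
    have va: "2 * h\<^sup>2 / real n * (c * R)\<^sup>2 / a \<le> a"
    proof -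
      have "2 * h\<^sup>2 * (c * R)\<^sup>2 / a\<^sup>2 < real n" using N nN by linarith
      then have "2 * h\<^sup>2 * (c * R)\<^sup>2 \<le> real n * (a * a)" using a by (simp add: pos_divide_less_eq power2_eq_square)
      then show ?thesis using a n0 by (simp add: field_simps)
    qed
    let ?g = "grid s t n"
    define U where "U k \<omega> = (\<Sum>j<m. \<Delta>W (?g k) (?g (Suc k)) m j \<omega> *\<^sub>R LB (Z (grid (?g k) (?g (Suc k)) m j) \<omega> - Z (?g k) \<omega>))" for k \<omega>
    define V where "V \<omega> = (\<Sum>k<n. ((\<Delta>W s t n k \<omega>)\<^sup>2 - (t - s) / real n) *\<^sub>R LB (Z (grid s t n k) \<omega>))" for \<omega>
    have gn: "0 \<le> ?g k" for k using st by (intro grid_nonneg) auto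
    have gs: "?g k < ?g (Suc k)" for k by (rule grid_strict[OF st(2) n0])
    have U: "U k \<in> borel_measurable M" "integrable M (\<lambda>\<omega>. norm (\<Delta>W s t n k \<omega> *\<^sub>R U k \<omega>))"
      "expectation (\<lambda>\<omega>. norm (\<Delta>W s t n k \<omega> *\<^sub>R U k \<omega>)) \<le> h / real n * (a + c\<^sup>2 * a\<^sup>2 / a) / 2" if k: "k < n" for k
    proof -
      have w: "expectation (\<lambda>\<omega>. (norm (Z r \<omega> - Z (?g k) \<omega>))\<^sup>2) \<le> a\<^sup>2" if "?g k \<le> r" "r \<le> ?g (Suc k)" for r
        using that gn[of k] hd grid_le[of s t "Suc k" n] k st
        by (intro d(2)) (auto simp: grid_Suc h_def)
      note fs = fine_step[OF gn[of k] gs[of k] m a c w]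
      show "U k \<in> borel_measurable M" using fs(1) by (simp add: U_def[abs_def])
      show "integrable M (\<lambda>\<omega>. norm (\<Delta>W s t n k \<omega> *\<^sub>R U k \<omega>))" using fs(4) by (simp add: U_def[abs_def])
      show "expectation (\<lambda>\<omega>. norm (\<Delta>W s t n k \<omega> *\<^sub>R U k \<omega>)) \<le> h / real n * (a + c\<^sup>2 * a\<^sup>2 / a) / 2"
        using fs(5) by (simp add: U_def[abs_def] grid_Suc h_def)
    qed
    note V = square_variation_L1[OF st n0 a c, folded V_def]
    have ip: "ito_part (?g k) (?g (Suc k)) m \<omega> = U k \<omega> + \<Delta>W s t n k \<omega> *\<^sub>R LB (Z (?g k) \<omega>)" for k \<omega>
    proof -
      have "(\<Sum>j<m. \<Delta>W (?g k) (?g (Suc k)) m j \<omega>) = \<Delta>W s t n k \<omega>"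
        using sum_lessThan_telescope[of "\<lambda>j. W (grid (?g k) (?g (Suc k)) m j) \<omega>" m] grid_n[OF m, of "?g k" "?g (Suc k)"] by simp
      then show ?thesis
        by (simp add: ito_part_def U_def LB.diff scaleR_diff_right sum_subtractf scaleR_sum_left[symmetric])
    qed
    have Teq: "T n m \<omega> = (\<Sum>k<n. \<Delta>W s t n k \<omega> *\<^sub>R U k \<omega>) + V \<omega>" for \<omega>
    proof -
      have one: "d *\<^sub>R (u + d *\<^sub>R l) - \<delta> *\<^sub>R l = d *\<^sub>R u + (d\<^sup>2 - \<delta>) *\<^sub>R l" for d \<delta> :: real and u l :: 'b
        by (simp add: scaleR_add_right scaleR_diff_left power2_eq_square)
      show ?thesis unfolding T_def V_def ip scaleR_sum_right sum_subtractf[symmetric] sum.distrib[symmetric] one ..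
    qed
    have dm[measurable]: "\<Delta>W s t n k \<in> borel_measurable M" for k using st by (intro dW_meas) auto
    have Tm: "T n m \<in> borel_measurable M"
      unfolding Teq[abs_def] using V(1) U(1) by (intro borel_measurable_add borel_measurable_sum borel_measurable_scaleR dm) (auto simp: V_def[abs_def])
    have le: "norm (T n m \<omega>) \<le> (\<Sum>k<n. norm (\<Delta>W s t n k \<omega> *\<^sub>R U k \<omega>)) + norm (V \<omega>)" for \<omega>
      unfolding Teq by (rule order_trans[OF norm_triangle_ineq]) (intro add_mono norm_sum order_refl)
    have i2: "integrable M (\<lambda>\<omega>. (\<Sum>k<n. norm (\<Delta>W s t n k \<omega> *\<^sub>R U k \<omega>)) + norm (V \<omega>))"
      using U(2) V(2) by (intro Bochner_Integration.integrable_add Bochner_Integration.integrable_sum) (auto simp: V_def[abs_def])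
    have i: "integrable M (\<lambda>\<omega>. norm (T n m \<omega>))"
      using le Tm by (intro Bochner_Integration.integrable_bound[OF i2] AE_I2) (auto intro: order_trans[OF _ abs_ge_self])
    have "expectation (\<lambda>\<omega>. norm (T n m \<omega>)) \<le> expectation (\<lambda>\<omega>. (\<Sum>k<n. norm (\<Delta>W s t n k \<omega> *\<^sub>R U k \<omega>)) + norm (V \<omega>))"
      by (rule integral_mono[OF i i2 le])
    also have "\<dots> = (\<Sum>k<n. expectation (\<lambda>\<omega>. norm (\<Delta>W s t n k \<omega> *\<^sub>R U k \<omega>))) + expectation (\<lambda>\<omega>. norm (V \<omega>))"
      using U(2) V(2) by (subst Bochner_Integration.integral_add) (auto simp: V_def[abs_def] intro!: Bochner_Integration.integrable_sum simp del: norm_scaleR)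
    also have "\<dots> \<le> (\<Sum>k<n. h / real n * (a + c\<^sup>2 * a\<^sup>2 / a) / 2) + (a + 2 * h\<^sup>2 / real n * (c * R)\<^sup>2 / a) / 2"
      using U(3) V(3) by (intro add_mono sum_mono) (auto simp: V_def[abs_def] h_def simp del: norm_scaleR)
    also have "\<dots> \<le> h * (a + c\<^sup>2 * a) / 2 + (a + a) / 2"
    proof -
      have "(\<Sum>k<n. h / real n * (a + c\<^sup>2 * a\<^sup>2 / a) / 2) = h * (a + c\<^sup>2 * a) / 2"
        using n0 a by (simp add: power2_eq_square)
      then show ?thesis by (simp only:) (intro add_left_mono divide_right_mono, use va in auto)
    qed
    also have "\<dots> \<le> a * (h + c\<^sup>2 * h + 2)" using a h by (simp add: algebra_simps)
    also have "\<dots> = e" using den by (simp add: a_def)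
    finally show ?thesis using Tm i by blast
  qed
  then show ?thesis by blast
qed

text \<open>Every coarse increment is bounded by one factor that tends to 0 in probability. The
  products of fine increments are bounded by the sums of squares of \<open>W\<close> and
  \<open>Z\<close> over the grid with n * m cells, and these are tight.\<close>

lemma cross_fine_bound:
  assumes st: "s < t" and n: "0 < n" and m: "0 < m" and c: "0 < c" "\<And>v. norm (LB v) \<le> c * norm v"
  shows "norm (\<Sum>k<n. \<Delta>W s t n k \<omega> *\<^sub>R cross_part (grid s t n k) (grid s t n (Suc k)) m \<omega>) \<le>
    c * (sqrt (sqrt (\<Sum>k<n. (\<Delta>W s t n k \<omega>)^4)) *
     ((\<Sum>k<n * m. (\<Delta>W s t (n * m) k \<omega>)\<^sup>2) + (\<Sum>k<n * m. (norm (\<Delta>Z s t (n * m) k \<omega>))\<^sup>2)))"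
proof -
  let ?mx = "sqrt (sqrt (\<Sum>k<n. (\<Delta>W s t n k \<omega>)^4))"
  define q where "q i = (\<Delta>W s t (n * m) i \<omega>)\<^sup>2 + (norm (\<Delta>Z s t (n * m) i \<omega>))\<^sup>2" for i
  have gr: "grid (grid s t n k) (grid s t n (Suc k)) m j = grid s t (n * m) (k * m + j)" for k j
    by (rule grid_refine[OF n m])
  have one: "norm (\<Delta>W s t n k \<omega> *\<^sub>R cross_part (grid s t n k) (grid s t n (Suc k)) m \<omega>) \<le> ?mx * (c * (\<Sum>j<m. q (k * m + j)))" if "k < n" for k
  proof -
    have "norm (cross_part (grid s t n k) (grid s t n (Suc k)) m \<omega>) \<le> (\<Sum>j<m. c * q (k * m + j))"
      unfolding cross_part_def
    proof (rule order_trans[OF norm_sum sum_mono])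
      fix j
      let ?d = "\<Delta>W s t (n * m) (k * m + j) \<omega>" and ?z = "\<Delta>Z s t (n * m) (k * m + j) \<omega>"
      have "\<bar>?d\<bar> * norm (LB ?z) \<le> \<bar>?d\<bar> * (c * norm ?z)" by (intro mult_left_mono c(2)) auto
      also have "\<dots> = c * (\<bar>?d\<bar> * norm ?z)" by simp
      also have "\<dots> \<le> c * q (k * m + j)"
      proof (intro mult_left_mono)
        have "\<bar>?d\<bar> * norm ?z \<le> (1 * ?d\<^sup>2 + (norm ?z)\<^sup>2 / 1) / 2" by (rule young) simp
        also have "\<dots> \<le> q (k * m + j)" by (simp add: q_def)
        finally show "\<bar>?d\<bar> * norm ?z \<le> q (k * m + j)" .
      qed (use c in auto)
      finally show "norm (\<Delta>W (grid s t n k) (grid s t n (Suc k)) m j \<omega> *\<^sub>R LB (\<Delta>Z (grid s t n k) (grid s t n (Suc k)) m j \<omega>)) \<le> c * q (k * m + j)"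
        by (simp add: gr)
    qed
    then show ?thesis
      unfolding norm_scaleR by (intro mult_mono dW_le_max[OF that]) (auto simp: sum_distrib_left intro!: sum_nonneg zero_le_even_power)
  qed
  have "norm (\<Sum>k<n. \<Delta>W s t n k \<omega> *\<^sub>R cross_part (grid s t n k) (grid s t n (Suc k)) m \<omega>) \<le>
    (\<Sum>k<n. ?mx * (c * (\<Sum>j<m. q (k * m + j))))"
    by (rule order_trans[OF norm_sum sum_mono]) (use one in auto)
  also have "\<dots> = c * (?mx * (\<Sum>k<n. \<Sum>j<m. q (k * m + j)))"
    by (simp add: sum_distrib_left mult.left_commute)
  also have "(\<Sum>k<n. \<Sum>j<m. q (k * m + j)) = (\<Sum>i<n * m. q i)"
  proof (induction n)
    case (Suc n)
    have "(\<Sum>i<Suc n * m. q i) = (\<Sum>i<n * m + m. q i)" by (simp add: add.commute)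
    then show ?case using Suc by (simp add: sum_lessThan_add)
  qed simp
  also have "\<dots> = (\<Sum>k<n * m. (\<Delta>W s t (n * m) k \<omega>)\<^sup>2) + (\<Sum>k<n * m. (norm (\<Delta>Z s t (n * m) k \<omega>))\<^sup>2)"
    by (simp add: q_def sum.distrib)
  finally show ?thesis .
qed

end

section \<open>The covariation of \<open>W\<close> and \<open>Z\<close>, and the equation in Ito
  form\<close>

context stratonovich_linear begin

lemma null_in_prob_fixed_scaleR:
  fixes X :: "nat \<Rightarrow> 'w \<Rightarrow> 'c::{real_normed_vector, second_countable_topology}"
  assumes X: "null_in_prob X" and d[measurable]: "d \<in> borel_measurable M"
  shows "null_in_prob (\<lambda>n \<omega>. d \<omega> *\<^sub>R X n \<omega>)"
proof -
  have Xm[measurable]: "X n \<in> borel_measurable M" for n using X by (simp add: null_in_prob_def)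
  have "null_in_prob (\<lambda>n \<omega>. norm (X n \<omega>))"
    by (rule null_in_prob_dom[OF X, where C=1]) auto
  from null_in_prob_mult_tight[OF this tight_family_const[OF d]]
  show ?thesis by (rule null_in_prob_dom[where C=1]) (auto simp: abs_mult)
qed

text \<open>The Ito correction is computed here: the covariation of \<open>W\<close> and
  \<open>Z\<close> has density \<open>LB (Z r)\<close> in time. The increments of \<open>Z\<close>
  are replaced by those of the integral \<open>I\<close>, and these, in each of n fixed cells, by
  symmetric sums over m finer cells, with m large depending on n. Their left-point parts are handled
  by \<open>ito_fine_L1\<close> and their cross parts by \<open>cross_fine_bound\<close>, both
  uniformly in m.\<close>

lemma covariation_null:
  assumes st: "0 \<le> s" "s < t"
  shows "null_in_prob (\<lambda>n \<omega>. (\<Sum>k<n. \<Delta>W s t n k \<omega> *\<^sub>R \<Delta>Z s t n k \<omega>) - ((t - s) / real n) *\<^sub>R (\<Sum>k<n. LB (Z (grid s t n k) \<omega>)))"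
proof -
  obtain c where c: "0 < c" "\<And>v. norm (LB v) \<le> c * norm v" using L_bound[OF LB] by blast
  obtain cA where cA: "0 < cA" "\<And>v. norm (LA v) \<le> cA * norm v" using L_bound[OF LA] by blast
  obtain I where Im: "\<And>t. 0 \<le> t \<Longrightarrow> I t \<in> borel_measurable M"
    and Ieq: "\<And>s t. 0 \<le> s \<Longrightarrow> s \<le> t \<Longrightarrow> AE \<omega> in M. Z t \<omega> - Z s \<omega> = integral {s..t} (\<lambda>r. LA (Z r \<omega>)) + (I t \<omega> - I s \<omega>)"
    and Inull: "\<And>s t. 0 \<le> s \<Longrightarrow> s < t \<Longrightarrow> null_in_prob (\<lambda>n \<omega>. strat_sum s t n \<omega> - (I t \<omega> - I s \<omega>))"
    using integral_process by blast
  have st': "s \<le> t" using st by simp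
  let ?g = "grid s t"
  define \<Delta>I where "\<Delta>I n k \<omega> = I (?g n (Suc k)) \<omega> - I (?g n k) \<omega>" for n k \<omega>
  define mx where "mx n \<omega> = sqrt (sqrt (\<Sum>k<n. (\<Delta>W s t n k \<omega>)^4))" for n \<omega>
  have gn: "0 \<le> ?g n k" for n k using st by (intro grid_nonneg) auto
  have gs: "?g n k \<le> ?g n (Suc k)" for n k using st' by (rule grid_mono) simp
  have Wm[measurable]: "W (?g n k) \<in> borel_measurable M" for n k by (intro W_meas gn)
  have Zm[measurable]: "Z (?g n k) \<in> borel_measurable M" for n k by (intro Z_meas gn)
  have LZm[measurable]: "(\<lambda>\<omega>. LB (Z (?g n k) \<omega>)) \<in> borel_measurable M" for n k by (intro bl_meas[OF LB] Zm)
  have \<Delta>Im[measurable]: "\<Delta>I n k \<in> borel_measurable M" for n k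
    unfolding \<Delta>I_def[abs_def] by (intro borel_measurable_diff Im gn)
  have mx: "null_in_prob mx" using null_max_dW[OF st] unfolding mx_def[abs_def] .
  then have mxm[measurable]: "mx n \<in> borel_measurable M" for n by (simp add: null_in_prob_def)
  \<comment> \<open>\<open>Z\<close> and \<open>I\<close> differ by a drift that is Lipschitz in
    time, so the n products are bounded by the largest increment of \<open>W\<close> times the total
    length.\<close>
  have E1: "null_in_prob (\<lambda>n \<omega>. \<Sum>k<n. \<Delta>W s t n k \<omega> *\<^sub>R (\<Delta>Z s t n k \<omega> - \<Delta>I n k \<omega>))"
  proof (rule null_in_prob_dom[OF mx, where C="cA * R * (t - s)"])
    show "(\<lambda>\<omega>. \<Sum>k<n. \<Delta>W s t n k \<omega> *\<^sub>R (\<Delta>Z s t n k \<omega> - \<Delta>I n k \<omega>)) \<in> borel_measurable M" for n by measurable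
    fix n
    have "AE \<omega> in M. \<forall>k. Z (?g n (Suc k)) \<omega> - Z (?g n k) \<omega> = integral {?g n k..?g n (Suc k)} (\<lambda>r. LA (Z r \<omega>)) + (I (?g n (Suc k)) \<omega> - I (?g n k) \<omega>)"
      unfolding AE_all_countable using Ieq[OF gn gs] by blast
    then show "AE \<omega> in M. norm (\<Sum>k<n. \<Delta>W s t n k \<omega> *\<^sub>R (\<Delta>Z s t n k \<omega> - \<Delta>I n k \<omega>)) \<le> cA * R * (t - s) * norm (mx n \<omega>)"
      using Z_cont[unfolded continuous_process_def] AE_space
    proof eventually_elim
      case (elim \<omega>)
      have "norm (\<Delta>Z s t n k \<omega> - \<Delta>I n k \<omega>) \<le> cA * R * ((t - s) / real n)" if "k < n" for k
      proof -
        have c1: "continuous_on {0..} (\<lambda>r. LA (Z r \<omega>))" using elim(2) bounded_linear.continuous_on[OF LA] by blast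
        have "norm (integral {?g n k..?g n (Suc k)} (\<lambda>r. LA (Z r \<omega>))) \<le> cA * R * (?g n (Suc k) - ?g n k)"
        proof (rule integral_bound[OF gs])
          show "continuous_on {?g n k..?g n (Suc k)} (\<lambda>r. LA (Z r \<omega>))"
            by (rule continuous_on_subset[OF c1]) (use gn[of n k] in auto)
          fix r assume r: "r \<in> {?g n k..?g n (Suc k)}"
          then have "norm (Z r \<omega>) \<le> R" using gn[of n k] elim by (intro Z_bd) auto
          then show "norm (LA (Z r \<omega>)) \<le> cA * R" using cA(2)[of "Z r \<omega>"] cA(1) by (meson mult_left_mono order_trans less_imp_le)
        qed
        moreover have "\<Delta>Z s t n k \<omega> - \<Delta>I n k \<omega> = integral {?g n k..?g n (Suc k)} (\<lambda>r. LA (Z r \<omega>))"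
          using elim(1) by (simp add: \<Delta>I_def)
        moreover have "?g n (Suc k) - ?g n k = (t - s) / real n" by (simp add: grid_Suc)
        ultimately show ?thesis by (simp only:)
      qed
      then have "norm (\<Sum>k<n. \<Delta>W s t n k \<omega> *\<^sub>R (\<Delta>Z s t n k \<omega> - \<Delta>I n k \<omega>)) \<le> (\<Sum>k<n. mx n \<omega> * (cA * R * ((t - s) / real n)))"
        unfolding mx_def
        by (intro order_trans[OF norm_sum sum_mono], unfold norm_scaleR)
          (intro mult_mono, use dW_le_max in \<open>auto intro!: sum_nonneg zero_le_even_power\<close>)
      also have "\<dots> \<le> cA * R * (t - s) * norm (mx n \<omega>)"
      proof (cases "n = 0")
        case False
        have "0 \<le> mx n \<omega>" by (auto simp: mx_def intro!: sum_nonneg zero_le_even_power)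
        with False show ?thesis using cA R_nonneg st by (simp add: mult_right_mono mult.commute mult.left_commute)
      qed (use cA R_nonneg st in simp)
      finally show ?case .
    qed
  qed
  have E2: "null_in_prob (\<lambda>n \<omega>. (\<Sum>k<n. \<Delta>W s t n k \<omega> *\<^sub>R \<Delta>I n k \<omega>) - ((t - s) / real n) *\<^sub>R (\<Sum>k<n. LB (Z (?g n k) \<omega>)))"
  proof (rule null_in_probI)
    let ?E = "\<lambda>n \<omega>. (\<Sum>k<n. \<Delta>W s t n k \<omega> *\<^sub>R \<Delta>I n k \<omega>) - ((t - s) / real n) *\<^sub>R (\<Sum>k<n. LB (Z (?g n k) \<omega>))"
    show Em: "?E n \<in> borel_measurable M" for n by measurable
    fix \<epsilon> \<eta> :: real assume e: "0 < \<epsilon>" "0 < \<eta>"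
    \<comment> \<open>The error has three summands. Four events of probability at most
      \<open>h3\<close> each are excluded, which stays below \<open>\<eta>\<close>.\<close>
    define e3 where "e3 = \<epsilon> / 3"
    define h3 where "h3 = \<eta> / 6"
    have e3: "0 < e3" and h3: "0 < h3" using e by (auto simp: e3_def h3_def)
    define T2 where "T2 n m \<omega> = (\<Sum>k<n. \<Delta>W s t n k \<omega> *\<^sub>R ito_part (?g n k) (?g n (Suc k)) m \<omega>)
     - ((t - s) / real n) *\<^sub>R (\<Sum>k<n. LB (Z (?g n k) \<omega>))" for n m \<omega>
    define T3 where "T3 n m \<omega> = (\<Sum>k<n. \<Delta>W s t n k \<omega> *\<^sub>R cross_part (?g n k) (?g n (Suc k)) m \<omega>)" for n m \<omega>
    define T0 where "T0 n m \<omega> = (\<Sum>k<n. \<Delta>W s t n k \<omega> *\<^sub>R (strat_sum (?g n k) (?g n (Suc k)) m \<omega> - \<Delta>I n k \<omega>))" for n m \<omega>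
    have ipm[measurable]: "ito_part (?g n k) (?g n (Suc k)) m \<in> borel_measurable M" for n k m by (intro ito_part_meas gn gs)
    have cpm[measurable]: "cross_part (?g n k) (?g n (Suc k)) m \<in> borel_measurable M" for n k m by (intro cross_part_meas gn gs)
    have ssm[measurable]: "strat_sum (?g n k) (?g n (Suc k)) m \<in> borel_measurable M" for n k m by (intro strat_sum_meas gn gs)
    have T2m[measurable]: "T2 n m \<in> borel_measurable M" and T3m[measurable]: "T3 n m \<in> borel_measurable M"
      and T0m[measurable]: "T0 n m \<in> borel_measurable M" for n m
      unfolding T2_def T3_def T0_def by measurable
    have dec: "?E n \<omega> = - T0 n m \<omega> + (T2 n m \<omega> + (1/2) *\<^sub>R T3 n m \<omega>)" for n m \<omega>
    proof -
      have "T0 n m \<omega> = (\<Sum>k<n. \<Delta>W s t n k \<omega> *\<^sub>R ito_part (?g n k) (?g n (Suc k)) m \<omega>) + (1/2) *\<^sub>R T3 n m \<omega>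
        - (\<Sum>k<n. \<Delta>W s t n k \<omega> *\<^sub>R \<Delta>I n k \<omega>)"
        unfolding T0_def T3_def strat_sum_split scaleR_sum_right sum.distrib[symmetric] sum_subtractf[symmetric]
        by (intro sum.cong refl) (simp add: scaleR_add_right scaleR_diff_right mult.commute)
      then show ?thesis by (simp add: T2_def)
    qed
    define Q where "Q N \<omega> = (\<Sum>k<N. (\<Delta>W s t N k \<omega>)\<^sup>2) + (\<Sum>k<N. (norm (\<Delta>Z s t N k \<omega>))\<^sup>2)" for N \<omega>
    have Qm[measurable]: "Q N \<in> borel_measurable M" for N unfolding Q_def by measurable
    have Qnn: "0 \<le> Q N \<omega>" for N \<omega> unfolding Q_def by (intro add_nonneg_nonneg sum_nonneg) auto
    have Qt: "tight_family Q"
    proof (rule tight_family_dom2[OF tight_QW[OF st] tight_QZ[OF st], where C=1])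
      fix N show "AE \<omega> in M. norm (Q N \<omega>) \<le> 1 * (\<bar>\<Sum>k<N. (\<Delta>W s t N k \<omega>)\<^sup>2\<bar> + \<bar>\<Sum>k<N. (norm (\<Delta>Z s t N k \<omega>))\<^sup>2\<bar>)"
        by (intro AE_I2) (simp add: Q_def)
    qed measurable
    obtain K0 where K0: "\<And>N. prob {\<omega> \<in> space M. norm (Q N \<omega>) > K0} \<le> h3"
      using tight_familyD[OF Qt h3] by blast
    define K where "K = max K0 1"
    have K: "1 \<le> K" "K0 \<le> K" by (auto simp: K_def)
    \<comment> \<open>If the coarse increments are at most \<open>m3\<close> and the tight sum at
      most \<open>K\<close>, the bound of the cross term is c * (m3 * K) = e3.\<close>
    define m3 where "m3 = e3 / (c * K)"
    have m3: "0 < m3" using e3 c K by (simp add: m3_def)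
    have T3p: "prob {\<omega> \<in> space M. norm ((1/2) *\<^sub>R T3 n m \<omega>) > e3} \<le>
       prob {\<omega> \<in> space M. norm (mx n \<omega>) > m3} + prob {\<omega> \<in> space M. norm (Q (n * m) \<omega>) > K0}"
      if nm: "0 < n" "0 < m" for n m
    proof (rule prob_Un_le)
      show "AE \<omega> in M. e3 < norm ((1/2) *\<^sub>R T3 n m \<omega>) \<longrightarrow> m3 < norm (mx n \<omega>) \<or> K0 < norm (Q (n * m) \<omega>)"
      proof (intro AE_I2 impI)
        fix \<omega> assume a: "e3 < norm ((1/2) *\<^sub>R T3 n m \<omega>)"
        show "m3 < norm (mx n \<omega>) \<or> K0 < norm (Q (n * m) \<omega>)"
        proof (rule ccontr)
          assume b: "\<not> (m3 < norm (mx n \<omega>) \<or> K0 < norm (Q (n * m) \<omega>))"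
          then have "mx n \<omega> \<le> m3" "Q (n * m) \<omega> \<le> K" using K by auto
          then have "mx n \<omega> * Q (n * m) \<omega> \<le> m3 * K"
            using Qnn m3 by (intro mult_mono) auto
          then have "c * (mx n \<omega> * Q (n * m) \<omega>) \<le> c * (m3 * K)" using c by (intro mult_left_mono) auto
          also have "c * (m3 * K) = e3" using c K by (simp add: m3_def)
          finally have "norm (T3 n m \<omega>) \<le> e3"
            using cross_fine_bound[OF st(2) nm c, of \<omega>] unfolding T3_def Q_def mx_def by linarith
          then show False using a e3 by simp
        qed
      qed
    qed measurable
    obtain N where N: "\<And>n m. N \<le> n \<Longrightarrow> 0 < m \<Longrightarrow> integrable M (\<lambda>\<omega>. norm (T2 n m \<omega>)) \<and> expectation (\<lambda>\<omega>. norm (T2 n m \<omega>)) \<le> e3 * h3"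
      using ito_fine_L1[OF st mult_pos_pos[OF e3 h3]] unfolding T2_def by blast
    have T2p: "prob {\<omega> \<in> space M. norm (T2 n m \<omega>) > e3} \<le> h3" if "N \<le> n" "0 < m" for n m
    proof -
      have "prob {\<omega> \<in> space M. norm (T2 n m \<omega>) > e3} \<le> expectation (\<lambda>\<omega>. norm (T2 n m \<omega>)) / e3"
        using N[OF that] e3 by (intro markov_prob) auto
      also have "\<dots> \<le> h3" using N[OF that] e3 by (simp add: pos_divide_le_eq mult.commute)
      finally show ?thesis .
    qed
    have "eventually (\<lambda>n. prob {\<omega> \<in> space M. norm (mx n \<omega>) > m3} < h3 \<and> N \<le> n \<and> 0 < n) sequentially"
      using null_in_probD[OF mx m3 h3] eventually_ge_at_top[of N] eventually_gt_at_top[of 0] by eventually_elim auto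
    then show "eventually (\<lambda>n. prob {\<omega> \<in> space M. norm (?E n \<omega>) > \<epsilon>} \<le> \<eta>) sequentially"
    proof eventually_elim
      case (elim n)
      then have n: "0 < n" "N \<le> n" and mxn: "prob {\<omega> \<in> space M. norm (mx n \<omega>) > m3} < h3" by auto
      \<comment> \<open>With n fixed there are finitely many cells, and in each of them the
        symmetric sums converge as m grows.\<close>
      have "null_in_prob (\<lambda>m. T0 n m)"
        unfolding T0_def[abs_def] \<Delta>I_def
        by (intro null_in_prob_sum null_in_prob_fixed_scaleR Inull gn grid_strict st n) auto
      from null_in_probD[OF this e3 h3] have "eventually (\<lambda>m. prob {\<omega> \<in> space M. norm (T0 n m \<omega>) > e3} < h3 \<and> 0 < m) sequentially"
        using eventually_gt_at_top[of 0] by eventually_elim auto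
      then obtain m where T0p: "prob {\<omega> \<in> space M. norm (T0 n m \<omega>) > e3} < h3" and m: "0 < m"
        by (auto simp: eventually_sequentially)
      have s1: "prob {\<omega> \<in> space M. norm (?E n \<omega>) > \<epsilon>} \<le> prob {\<omega> \<in> space M. norm (T0 n m \<omega>) > e3} +
         prob {\<omega> \<in> space M. norm (T2 n m \<omega>) > e3 \<or> norm ((1/2) *\<^sub>R T3 n m \<omega>) > e3}"
      proof (rule prob_Un_le)
        show "AE \<omega> in M. \<epsilon> < norm (?E n \<omega>) \<longrightarrow> e3 < norm (T0 n m \<omega>) \<or> e3 < norm (T2 n m \<omega>) \<or> e3 < norm ((1/2) *\<^sub>R T3 n m \<omega>)"
        proof (intro AE_I2 impI)
          fix \<omega> assume a: "\<epsilon> < norm (?E n \<omega>)"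
          have "norm (?E n \<omega>) \<le> norm (T0 n m \<omega>) + (norm (T2 n m \<omega>) + norm ((1/2) *\<^sub>R T3 n m \<omega>))"
            unfolding dec[of n \<omega> m]
            by (rule order_trans[OF norm_triangle_ineq], unfold norm_minus_cancel) (intro add_left_mono norm_triangle_ineq)
          then show "e3 < norm (T0 n m \<omega>) \<or> e3 < norm (T2 n m \<omega>) \<or> e3 < norm ((1/2) *\<^sub>R T3 n m \<omega>)"
            using a unfolding e3_def by argo
        qed
      qed (use Em in measurable)
      have s2: "prob {\<omega> \<in> space M. norm (T2 n m \<omega>) > e3 \<or> norm ((1/2) *\<^sub>R T3 n m \<omega>) > e3} \<le>
        prob {\<omega> \<in> space M. norm (T2 n m \<omega>) > e3} + prob {\<omega> \<in> space M. norm ((1/2) *\<^sub>R T3 n m \<omega>) > e3}"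
        by (rule prob_Un_le) (auto intro!: AE_I2)
      show ?case
        using e(2) s1 s2 T0p T2p[OF n(2) m] T3p[OF n(1) m] K0[of "n * m"] mxn unfolding h3_def by linarith
    qed
  qed
  show ?thesis
    using null_in_prob_add[OF E1 E2]
    by (simp add: scaleR_diff_right sum_subtractf)
qed

text \<open>The drift of the equation in Ito form.\<close>

definition drift :: "'b \<Rightarrow> 'b" where
  "drift v = LA v + (1/2) *\<^sub>R LB (LB v)"

lemma drift_linear: "bounded_linear drift"
  unfolding drift_def[abs_def]
  by (intro bounded_linear_add LA bounded_linear_scaleR_right[THEN bounded_linear_compose] bounded_linear_compose[OF LB LB])

text \<open>The equation in Ito form, as convergence of Euler sums. By linearity \<open>LB\<close>
  maps the covariation sum of \<open>W\<close> and \<open>Z\<close> to \<open>cross_part\<close>;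
  subtracting half of the resulting null sequence turns the symmetric sums into left-point sums and
  adds half of \<open>LB (LB v)\<close> to the drift.\<close>

lemma euler_null:
  assumes st: "0 \<le> s" "s < t"
  shows "null_in_prob (\<lambda>n \<omega>. (((t - s) / real n) *\<^sub>R (\<Sum>k<n. drift (Z (grid s t n k) \<omega>)) + ito_part s t n \<omega>) - (Z t \<omega> - Z s \<omega>))"
proof -
  interpret LB: bounded_linear LB by (rule LB)
  obtain I where Im: "\<And>t. 0 \<le> t \<Longrightarrow> I t \<in> borel_measurable M"
    and Ieq: "\<And>s t. 0 \<le> s \<Longrightarrow> s \<le> t \<Longrightarrow> AE \<omega> in M. Z t \<omega> - Z s \<omega> = integral {s..t} (\<lambda>r. LA (Z r \<omega>)) + (I t \<omega> - I s \<omega>)"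
    and Inull: "\<And>s t. 0 \<le> s \<Longrightarrow> s < t \<Longrightarrow> null_in_prob (\<lambda>n \<omega>. strat_sum s t n \<omega> - (I t \<omega> - I s \<omega>))"
    using integral_process by blast
  have st': "s \<le> t" and t0: "0 \<le> t" using st by auto
  have gn: "0 \<le> grid s t n k" for n k using st by (intro grid_nonneg) auto
  have Zm[measurable]: "Z (grid s t n k) \<in> borel_measurable M" for n k by (intro Z_meas gn)
  have [measurable]: "Z s \<in> borel_measurable M" "Z t \<in> borel_measurable M" "I s \<in> borel_measurable M" "I t \<in> borel_measurable M"
    using Im Z_meas st(1) t0 by auto
  have LAm[measurable]: "(\<lambda>\<omega>. LA (Z (grid s t n k) \<omega>)) \<in> borel_measurable M" for n k by (intro bl_meas[OF LA] Zm)
  have 1: "null_in_prob (\<lambda>n \<omega>. ((t - s) / real n) *\<^sub>R (\<Sum>k<n. LA (Z (grid s t n k) \<omega>)) - (Z t \<omega> - Z s \<omega> - (I t \<omega> - I s \<omega>)))"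
  proof (rule null_in_prob_AE)
    show "(\<lambda>\<omega>. ((t - s) / real n) *\<^sub>R (\<Sum>k<n. LA (Z (grid s t n k) \<omega>)) - (Z t \<omega> - Z s \<omega> - (I t \<omega> - I s \<omega>))) \<in> borel_measurable M" for n
      by measurable
    show "AE \<omega> in M. (\<lambda>n. ((t - s) / real n) *\<^sub>R (\<Sum>k<n. LA (Z (grid s t n k) \<omega>)) - (Z t \<omega> - Z s \<omega> - (I t \<omega> - I s \<omega>))) \<longlonglongrightarrow> 0"
      using Ieq[OF st(1) st'] Z_cont[unfolded continuous_process_def]
    proof eventually_elim
      case (elim \<omega>)
      have "continuous_on {0..} (\<lambda>r. LA (Z r \<omega>))" using elim(2) bounded_linear.continuous_on[OF LA] by blast
      then have "continuous_on {s..t} (\<lambda>r. LA (Z r \<omega>))" by (rule continuous_on_subset) (use st in auto)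
      from riemann_sum_tendsto[OF st(2) this] show ?case
        using elim(1) by (simp add: LIM_zero_iff)
    qed
  qed
  have 2: "null_in_prob (\<lambda>n \<omega>. strat_sum s t n \<omega> - (I t \<omega> - I s \<omega>))" by (rule Inull[OF st])
  have 3: "null_in_prob (\<lambda>n \<omega>. (- 1/2) *\<^sub>R LB ((\<Sum>k<n. \<Delta>W s t n k \<omega> *\<^sub>R \<Delta>Z s t n k \<omega>) - ((t - s) / real n) *\<^sub>R (\<Sum>k<n. LB (Z (grid s t n k) \<omega>))))"
  proof -
    obtain c where c: "0 < c" "\<And>v. norm (LB v) \<le> c * norm v" using L_bound[OF LB] by blast
    note cn = covariation_null[OF st]
    have "null_in_prob (\<lambda>n \<omega>. LB ((\<Sum>k<n. \<Delta>W s t n k \<omega> *\<^sub>R \<Delta>Z s t n k \<omega>) - ((t - s) / real n) *\<^sub>R (\<Sum>k<n. LB (Z (grid s t n k) \<omega>))))"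
      by (rule null_in_prob_dom[OF cn, where C=c])
        (use cn c in \<open>auto simp: null_in_prob_def intro!: bl_meas[OF LB]\<close>)
    then show ?thesis by (rule null_in_prob_scaleR)
  qed
  have eq: "((t - s) / real n) *\<^sub>R (\<Sum>k<n. LA (Z (grid s t n k) \<omega>)) - (Z t \<omega> - Z s \<omega> - (I t \<omega> - I s \<omega>))
    + ((strat_sum s t n \<omega> - (I t \<omega> - I s \<omega>))
    + (- 1/2) *\<^sub>R LB ((\<Sum>k<n. \<Delta>W s t n k \<omega> *\<^sub>R \<Delta>Z s t n k \<omega>) - ((t - s) / real n) *\<^sub>R (\<Sum>k<n. LB (Z (grid s t n k) \<omega>))))
    = (((t - s) / real n) *\<^sub>R (\<Sum>k<n. drift (Z (grid s t n k) \<omega>)) + ito_part s t n \<omega>) - (Z t \<omega> - Z s \<omega>)" for n \<omega>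
  proof -
    have e1: "LB ((\<Sum>k<n. \<Delta>W s t n k \<omega> *\<^sub>R \<Delta>Z s t n k \<omega>) - ((t - s) / real n) *\<^sub>R (\<Sum>k<n. LB (Z (grid s t n k) \<omega>)))
      = cross_part s t n \<omega> - ((t - s) / real n) *\<^sub>R (\<Sum>k<n. LB (LB (Z (grid s t n k) \<omega>)))"
      unfolding cross_part_def LB.diff LB.sum LB.scaleR ..
    have e2: "(\<Sum>k<n. drift (Z (grid s t n k) \<omega>)) = (\<Sum>k<n. LA (Z (grid s t n k) \<omega>)) + (1/2) *\<^sub>R (\<Sum>k<n. LB (LB (Z (grid s t n k) \<omega>)))"
      by (simp add: drift_def sum.distrib scaleR_sum_right)
    show ?thesis unfolding e1 e2 strat_sum_split
      by (simp add: scaleR_add_right scaleR_diff_right)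
  qed
  show ?thesis using null_in_prob_add[OF 1 null_in_prob_add[OF 2 3]] unfolding eq .
qed

end

section \<open>The generator on polynomials\<close>

text \<open>The derivation along the linear vector field \<open>L\<close>. It maps polynomials to
  polynomials and may therefore be iterated.\<close>

definition lie_deriv :: "('b::real_normed_vector \<Rightarrow> 'b) \<Rightarrow> ('b \<Rightarrow> real) \<Rightarrow> 'b \<Rightarrow> real" where
  "lie_deriv L f z = frechet_derivative f (at z) (L z)"

lemma real_polynomial_function_differentiable:
  "real_polynomial_function f \<Longrightarrow> f differentiable (at z)"
  by (induction f rule: real_polynomial_function.induct)
    (auto intro: bounded_linear_imp_differentiable)

lemma has_derivative_poly:
  "real_polynomial_function f \<Longrightarrow> (f has_derivative frechet_derivative f (at z)) (at z)"
  using real_polynomial_function_differentiable frechet_derivative_works by blast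

lemma lie_deriv_eqI: "(f has_derivative f') (at z) \<Longrightarrow> lie_deriv L f z = f' (L z)"
  unfolding lie_deriv_def using frechet_derivative_at by metis

lemma lie_deriv_const [simp]: "lie_deriv L (\<lambda>z. c) z = 0"
  by (rule lie_deriv_eqI) (rule has_derivative_const)

lemma lie_deriv_linear: "bounded_linear f \<Longrightarrow> lie_deriv L f z = f (L z)"
  by (rule lie_deriv_eqI) (rule bounded_linear_imp_has_derivative)

lemma lie_deriv_add:
  "real_polynomial_function f \<Longrightarrow> real_polynomial_function g \<Longrightarrow>
    lie_deriv L (\<lambda>z. f z + g z) z = lie_deriv L f z + lie_deriv L g z"
  unfolding lie_deriv_def[of L f] lie_deriv_def[of L g]
  by (rule lie_deriv_eqI) (intro has_derivative_add has_derivative_poly)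

lemma lie_deriv_mult:
  "real_polynomial_function f \<Longrightarrow> real_polynomial_function g \<Longrightarrow>
    lie_deriv L (\<lambda>z. f z * g z) z = f z * lie_deriv L g z + lie_deriv L f z * g z"
  unfolding lie_deriv_def[of L f] lie_deriv_def[of L g]
  by (rule lie_deriv_eqI) (intro has_derivative_mult has_derivative_poly)

lemma lie_deriv_cmult:
  "real_polynomial_function f \<Longrightarrow> lie_deriv L (\<lambda>z. c * f z) z = c * lie_deriv L f z"
  using lie_deriv_mult[OF real_polynomial_function.intros(2)[of c], of f L z] by simp

lemma lie_deriv_poly [intro]:
  assumes L: "bounded_linear L" and f: "real_polynomial_function f"
  shows "real_polynomial_function (lie_deriv L f)"
  using f
proof (induction f rule: real_polynomial_function.induct)
  case (linear f)
  have "lie_deriv L f = (\<lambda>z. f (L z))" using linear by (intro ext lie_deriv_linear)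
  then show ?case using bounded_linear_compose[OF linear L] by (simp add: real_polynomial_function.intros(1))
next
  case (const c)
  have "lie_deriv L (\<lambda>z. c) = (\<lambda>z. 0)" by (intro ext lie_deriv_const)
  then show ?case by (simp add: real_polynomial_function.intros(2))
next
  case (add f g)
  have "lie_deriv L (\<lambda>z. f z + g z) = (\<lambda>z. lie_deriv L f z + lie_deriv L g z)"
    using add by (intro ext lie_deriv_add)
  then show ?case using add by auto
next
  case (mult f g)
  have "lie_deriv L (\<lambda>z. f z * g z) = (\<lambda>z. f z * lie_deriv L g z + lie_deriv L f z * g z)"
    using mult by (intro ext lie_deriv_mult)
  then show ?case using mult by auto
qed

definition generator :: "('b::real_normed_vector \<Rightarrow> 'b) \<Rightarrow> ('b \<Rightarrow> 'b) \<Rightarrow> ('b \<Rightarrow> real) \<Rightarrow> 'b \<Rightarrow> real" where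
  "generator LA LB f z = lie_deriv LA f z + 1/2 * lie_deriv LB (lie_deriv LB f) z"

lemma generator_poly [intro]:
  assumes "bounded_linear LA" "bounded_linear LB" "real_polynomial_function f"
  shows "real_polynomial_function (generator LA LB f)"
proof -
  have "real_polynomial_function (\<lambda>z. 1/2 * lie_deriv LB (lie_deriv LB f) z)"
    using assms by (intro real_polynomial_function.intros(4) lie_deriv_poly real_polynomial_function.intros(2))
  then show ?thesis
    unfolding generator_def[abs_def] using assms by (intro real_polynomial_function.intros(3) lie_deriv_poly)
qed

section \<open>Expansions of linear observables in short time\<close>

context stratonovich_linear begin

definition remainder :: "('b \<Rightarrow> real) \<Rightarrow> ('b \<Rightarrow> real) \<Rightarrow> ('b \<Rightarrow> real) \<Rightarrow> real \<Rightarrow> real \<Rightarrow> 'w \<Rightarrow> real" where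
  "remainder f f1 f2 s t \<omega> = f (Z t \<omega>) - f (Z s \<omega>) - f1 (Z s \<omega>) * (W t \<omega> - W s \<omega>) - f2 (Z s \<omega>) * (t - s)"

text \<open>\<open>f(Z)\<close> is an Ito process with diffusion \<open>f1(Z)\<close> and drift \<open>f2(Z)\<close>, in a weak sense that
  is stable under products and needs no stochastic integral.\<close>

definition ito_fun :: "real \<Rightarrow> ('b \<Rightarrow> real) \<Rightarrow> ('b \<Rightarrow> real) \<Rightarrow> ('b \<Rightarrow> real) \<Rightarrow> bool" where
  "ito_fun T f f1 f2 \<longleftrightarrow> continuous_on UNIV f \<and> continuous_on UNIV f1 \<and> continuous_on UNIV f2 \<and>
     (\<exists>c. (c \<longlongrightarrow> 0) (at_right 0) \<and> (\<forall>s t. 0 \<le> s \<and> s < t \<and> t \<le> T \<longrightarrow>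
        integrable M (\<lambda>\<omega>. (remainder f f1 f2 s t \<omega>)\<^sup>2) \<and>
        expectation (\<lambda>\<omega>. (remainder f f1 f2 s t \<omega>)\<^sup>2) \<le> (t - s) * c (t - s) \<and>
        (\<forall>\<xi>. \<xi> \<in> borel_measurable (F s) \<and> (\<forall>\<omega>\<in>space M. \<bar>\<xi> \<omega>\<bar> \<le> 1) \<longrightarrow>
          \<bar>expectation (\<lambda>\<omega>. \<xi> \<omega> * remainder f f1 f2 s t \<omega>)\<bar> \<le> (t - s) * c (t - s))))"

lemma cont_Z_meas: "continuous_on UNIV f \<Longrightarrow> 0 \<le> t \<Longrightarrow> (\<lambda>\<omega>. f (Z t \<omega>)) \<in> borel_measurable M"
  for f :: "'b \<Rightarrow> real"
  using measurable_compose[OF Z_meas[of t] borel_measurable_continuous_onI[of f]] by simp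

lemma cont_Z_F: "continuous_on UNIV f \<Longrightarrow> 0 \<le> t \<Longrightarrow> (\<lambda>\<omega>. f (Z t \<omega>)) \<in> borel_measurable (F t)"
  for f :: "'b \<Rightarrow> real"
  using measurable_compose[OF Z_F[of t] borel_measurable_continuous_onI[of f]] by simp

lemma cont_Z_bd:
  assumes "continuous_on UNIV (f :: 'b \<Rightarrow> real)"
  shows "\<exists>K. \<forall>t\<ge>0. \<forall>\<omega>\<in>space M. \<bar>f (Z t \<omega>)\<bar> \<le> K"
proof -
  have "compact (f ` cball 0 R)"
    by (intro compact_continuous_image continuous_on_subset[OF assms]) auto
  then have "bounded (f ` cball 0 R)" by (rule compact_imp_bounded)
  then obtain K where K: "\<forall>y\<in>f ` cball 0 R. norm y \<le> K" unfolding bounded_iff by blast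
  have "\<bar>f (Z t \<omega>)\<bar> \<le> K" if "0 \<le> t" "\<omega> \<in> space M" for t \<omega>
    using K Z_bd[OF that] by auto
  then show ?thesis by blast
qed

lemma remainder_meas:
  assumes "continuous_on UNIV f" "continuous_on UNIV f1" "continuous_on UNIV f2" "0 \<le> s" "0 \<le> t"
  shows "remainder f f1 f2 s t \<in> borel_measurable M"
  unfolding remainder_def[abs_def] using assms
  by (intro borel_measurable_diff borel_measurable_times cont_Z_meas W_meas borel_measurable_const)

text \<open>\<open>L2_modulus\<close> rewritten as a single function of the time lag, which can
  appear in explicit bounds of remainders.\<close>

lemma modulus:
  "\<exists>w. (w \<longlongrightarrow> 0) (at_right 0) \<and> (\<forall>h>0. 0 \<le> w h) \<and>
     (\<forall>h>0. \<forall>r s. 0 \<le> r \<and> r \<le> T \<and> 0 \<le> s \<and> s \<le> T \<and> \<bar>r - s\<bar> \<le> h \<longrightarrow> expectation (\<lambda>\<omega>. (norm (Z r \<omega> - Z s \<omega>))\<^sup>2) \<le> w h)"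
proof -
  define E where "E r s = expectation (\<lambda>\<omega>. (norm (Z r \<omega> - Z s \<omega>))\<^sup>2)" for r s
  \<comment> \<open>The element 0 keeps the set nonempty and its supremum nonnegative for all T and
    h.\<close>
  define A where "A h = insert 0 ((\<lambda>(r, s). E r s) ` {(r, s). 0 \<le> r \<and> r \<le> T \<and> 0 \<le> s \<and> s \<le> T \<and> \<bar>r - s\<bar> \<le> h})" for h
  have Eb: "E r s \<le> (2 * R)\<^sup>2" if "0 \<le> r" "0 \<le> s" for r s
  proof -
    have "E r s \<le> expectation (\<lambda>\<omega>. (2 * R)\<^sup>2)"
      unfolding E_def using that power_mono[OF Z_diff_bd, of r s _ 2]
      by (intro integral_mono Z_diff_sq_int) auto
    then show ?thesis by (simp add: prob_space)
  qed
  have bdd: "bdd_above (A h)" for h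
  proof (rule bdd_aboveI)
    fix y assume "y \<in> A h"
    then show "y \<le> (2 * R)\<^sup>2" using Eb by (auto simp: A_def)
  qed
  define w where "w h = Sup (A h)" for h
  have w0: "0 \<le> w h" for h unfolding w_def by (rule cSup_upper[OF _ bdd]) (simp add: A_def)
  have wE: "E r s \<le> w h" if "0 \<le> r \<and> r \<le> T \<and> 0 \<le> s \<and> s \<le> T \<and> \<bar>r - s\<bar> \<le> h" for r s h
    unfolding w_def by (rule cSup_upper[OF _ bdd]) (use that in \<open>auto simp: A_def\<close>)
  have "(w \<longlongrightarrow> 0) (at_right 0)"
    unfolding tendsto_iff
  proof (intro allI impI)
    fix e :: real assume e: "0 < e"
    obtain d where d: "d > 0" "\<And>r s. 0 \<le> r \<and> r \<le> T \<and> 0 \<le> s \<and> s \<le> T \<and> \<bar>r - s\<bar> < d \<Longrightarrow> E r s \<le> e / 2"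
      using L2_modulus[OF half_gt_zero[OF e], of T] unfolding E_def by blast
    have "dist (w h) 0 < e" if "h < d" for h
    proof -
      have "w h \<le> e / 2" unfolding w_def
      proof (rule cSup_least)
        fix y assume "y \<in> A h"
        then show "y \<le> e / 2" using d(2) e that by (auto simp: A_def)
      qed (simp add: A_def)
      then show ?thesis using w0[of h] e by simp
    qed
    then show "eventually (\<lambda>h. dist (w h) 0 < e) (at_right 0)"
      unfolding eventually_at_right_field using d(1) by auto
  qed
  then show ?thesis using w0 wE unfolding E_def by blast
qed

lemma expectation_le_sqrt:
  assumes "X \<in> borel_measurable M" "integrable M (\<lambda>\<omega>. (X \<omega>)\<^sup>2)" "expectation (\<lambda>\<omega>. (X \<omega>)\<^sup>2) \<le> c"
  shows "expectation X \<le> sqrt c"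
proof -
  have i: "integrable M X" by (rule sq_int_imp_int[OF assms(1,2)])
  have "0 \<le> variance X" by (rule variance_positive)
  then have "(expectation X)\<^sup>2 \<le> expectation (\<lambda>\<omega>. (X \<omega>)\<^sup>2)"
    using variance_eq[OF i assms(2)] by simp
  then show ?thesis using assms(3) by (intro real_le_rsqrt) simp
qed

text \<open>The remainder is the limit of Euler sums with the coefficients at time s subtracted: a
  drift part \<open>V\<close> and a martingale part \<open>U\<close>, both with second moment o(h)
  for h = t - s. Tested against a variable known at time s, \<open>U\<close> gives exactly 0 and
  \<open>V\<close> gives h times a modulus; this is why the mean of the remainder is of smaller
  order than its root mean square.\<close>

lemma ito_linear:
  assumes f: "bounded_linear (f :: 'b \<Rightarrow> real)"
  shows "ito_fun T f (\<lambda>z. f (LB z)) (\<lambda>z. f (drift z))"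
proof -
  interpret f: bounded_linear f by (rule f)
  interpret LB: bounded_linear LB by (rule LB)
  interpret G: bounded_linear drift by (rule drift_linear)
  obtain c where c: "0 < c" "\<And>v. norm (LB v) \<le> c * norm v" using L_bound[OF LB] by blast
  obtain cG where cG: "0 < cG" "\<And>v. norm (drift v) \<le> cG * norm v" using L_bound[OF drift_linear] by blast
  obtain cf where cf: "0 < cf" "\<And>v. \<bar>f v\<bar> \<le> cf * norm v" using L_bound[OF f] by auto
  obtain w where w: "(w \<longlongrightarrow> 0) (at_right 0)" "\<And>h. h > 0 \<Longrightarrow> 0 \<le> w h"
    "\<And>h r s. h > 0 \<Longrightarrow> 0 \<le> r \<and> r \<le> T \<and> 0 \<le> s \<and> s \<le> T \<and> \<bar>r - s\<bar> \<le> h \<Longrightarrow> expectation (\<lambda>\<omega>. (norm (Z r \<omega> - Z s \<omega>))\<^sup>2) \<le> w h"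
    using modulus[of T] by blast
  \<comment> \<open>h * b h bounds the second moment of the remainder, as twice that of
    \<open>V\<close> plus twice that of \<open>U\<close>. In \<open>C\<close>, the last summand
    bounds the mean and comes from \<open>V\<close> alone.\<close>
  define b where "b h = 2 * h * cG\<^sup>2 * w h + 2 * c\<^sup>2 * w h" for h
  define C where "C h = cf\<^sup>2 * b h + cf * sqrt (cG\<^sup>2 * w h)" for h
  have lim: "(C \<longlongrightarrow> 0) (at_right 0)"
    unfolding C_def b_def by (auto intro!: tendsto_eq_intros w(1) tendsto_ident_at)
  have "integrable M (\<lambda>\<omega>. (remainder f (\<lambda>z. f (LB z)) (\<lambda>z. f (drift z)) s t \<omega>)\<^sup>2) \<and>
        expectation (\<lambda>\<omega>. (remainder f (\<lambda>z. f (LB z)) (\<lambda>z. f (drift z)) s t \<omega>)\<^sup>2) \<le> (t - s) * C (t - s) \<and>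
        (\<forall>\<xi>. \<xi> \<in> borel_measurable (F s) \<and> (\<forall>\<omega>\<in>space M. \<bar>\<xi> \<omega>\<bar> \<le> 1) \<longrightarrow>
          \<bar>expectation (\<lambda>\<omega>. \<xi> \<omega> * remainder f (\<lambda>z. f (LB z)) (\<lambda>z. f (drift z)) s t \<omega>)\<bar> \<le> (t - s) * C (t - s))"
    if stT: "0 \<le> s \<and> s < t \<and> t \<le> T" for s t
  proof -
    have st: "0 \<le> s" "s < t" and tT: "t \<le> T" and t0: "0 \<le> t" using stT by auto
    define h where "h = t - s"
    have h: "0 < h" using st by (simp add: h_def)
    note w0 = w(2)[OF h]
    define Rv where "Rv \<omega> = Z t \<omega> - Z s \<omega> - (W t \<omega> - W s \<omega>) *\<^sub>R LB (Z s \<omega>) - h *\<^sub>R drift (Z s \<omega>)" for \<omega>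
    have rem: "remainder f (\<lambda>z. f (LB z)) (\<lambda>z. f (drift z)) s t \<omega> = f (Rv \<omega>)" for \<omega>
      by (simp add: remainder_def Rv_def f.diff f.scaleR h_def mult.commute)
    have gn: "0 \<le> grid s t n k" for n k using st by (intro grid_nonneg) auto
    have [measurable]: "Z s \<in> borel_measurable M" "Z t \<in> borel_measurable M" "W s \<in> borel_measurable M" "W t \<in> borel_measurable M"
      "Z (grid s t n k) \<in> borel_measurable M" "W (grid s t n k) \<in> borel_measurable M" for n k using Z_meas W_meas st t0 gn by auto
    have [measurable]: "(\<lambda>\<omega>. LB (Z s \<omega>)) \<in> borel_measurable M" "(\<lambda>\<omega>. drift (Z s \<omega>)) \<in> borel_measurable M"
      by (intro bl_meas[OF LB] bl_meas[OF drift_linear]; measurable)+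
    have Rvm[measurable]: "Rv \<in> borel_measurable M" unfolding Rv_def[abs_def] by measurable
    \<comment> \<open>Grids with \<open>Suc n\<close> cells keep the division by the number of cells
      meaningful for every n.\<close>
    define V where "V n \<omega> = (h / real (Suc n)) *\<^sub>R (\<Sum>k<Suc n. drift (Z (grid s t (Suc n) k) \<omega> - Z s \<omega>))" for n \<omega>
    define U where "U n \<omega> = (\<Sum>k<Suc n. \<Delta>W s t (Suc n) k \<omega> *\<^sub>R LB (Z (grid s t (Suc n) k) \<omega> - Z s \<omega>))" for n \<omega>
    have Z2: "expectation (\<lambda>\<omega>. (norm (Z r \<omega> - Z s \<omega>))\<^sup>2) \<le> w h" if "s \<le> r" "r \<le> t" for r
      using that st tT by (intro w(3)[OF h]) (auto simp: h_def)
    note fs = fine_step[OF st zero_less_Suc zero_less_one c Z2]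
    have Um[measurable]: "U n \<in> borel_measurable M" and Ui: "integrable M (\<lambda>\<omega>. (norm (U n \<omega>))\<^sup>2)"
      and Ub: "expectation (\<lambda>\<omega>. (norm (U n \<omega>))\<^sup>2) \<le> h * (c\<^sup>2 * w h)" for n
      using fs(1,2,3)[of n] by (simp_all add: U_def[abs_def] h_def)
    have drm[measurable]: "(\<lambda>\<omega>. drift (Z (grid s t n k) \<omega> - Z s \<omega>)) \<in> borel_measurable M" for n k
      by (intro bl_meas[OF drift_linear]; measurable)
    have Vm[measurable]: "V n \<in> borel_measurable M" for n unfolding V_def[abs_def] by measurable
    have Vle: "(norm (V n \<omega>))\<^sup>2 \<le> (\<Sum>k<Suc n. h\<^sup>2 * cG\<^sup>2 / real (Suc n) * (norm (Z (grid s t (Suc n) k) \<omega> - Z s \<omega>))\<^sup>2)" for n \<omega>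
    proof -
      let ?y = "\<lambda>k. norm (Z (grid s t (Suc n) k) \<omega> - Z s \<omega>)"
      have "norm (V n \<omega>) \<le> h / real (Suc n) * (\<Sum>k<Suc n. cG * ?y k)"
        unfolding V_def norm_scaleR using h
        by (intro mult_mono order_trans[OF norm_sum sum_mono[OF cG(2)]]) auto
      then have "(norm (V n \<omega>))\<^sup>2 \<le> (h / real (Suc n) * (\<Sum>k<Suc n. cG * ?y k))\<^sup>2"
        by (intro power_mono) auto
      also have "\<dots> = (h / real (Suc n))\<^sup>2 * (\<Sum>k<Suc n. cG * ?y k)\<^sup>2" by (simp only: power_mult_distrib)
      also have "\<dots> \<le> (h / real (Suc n))\<^sup>2 * ((\<Sum>k<Suc n. (cG * ?y k)\<^sup>2) * real (card {..<Suc n}))"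
        using sum_squared_le_sum_of_squares[of "\<lambda>k. cG * ?y k" "{..<Suc n}"] by (intro mult_left_mono) auto
      also have "\<dots> = (h\<^sup>2 * cG\<^sup>2 / real (Suc n)) * (\<Sum>k<Suc n. (?y k)\<^sup>2)"
        unfolding power_mult_distrib sum_distrib_left[symmetric] power_divide card_lessThan
        by (simp add: power2_eq_square divide_simps)
      finally show ?thesis by (simp only: sum_distrib_left)
    qed
    have Vi2: "integrable M (\<lambda>\<omega>. \<Sum>k<Suc n. h\<^sup>2 * cG\<^sup>2 / real (Suc n) * (norm (Z (grid s t (Suc n) k) \<omega> - Z s \<omega>))\<^sup>2)" for n
      by (intro Bochner_Integration.integrable_sum integrable_mult_right Z_diff_sq_int gn st)
    have Vi: "integrable M (\<lambda>\<omega>. (norm (V n \<omega>))\<^sup>2)" for n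
      using Vle by (intro Bochner_Integration.integrable_bound[OF Vi2[of n]] AE_I2) (measurable, auto intro: order_trans[OF _ abs_ge_self])
    have Vb: "expectation (\<lambda>\<omega>. (norm (V n \<omega>))\<^sup>2) \<le> h\<^sup>2 * (cG\<^sup>2 * w h)" for n
    proof -
      have "expectation (\<lambda>\<omega>. (norm (V n \<omega>))\<^sup>2) \<le> expectation (\<lambda>\<omega>. \<Sum>k<Suc n. h\<^sup>2 * cG\<^sup>2 / real (Suc n) * (norm (Z (grid s t (Suc n) k) \<omega> - Z s \<omega>))\<^sup>2)"
        by (rule integral_mono[OF Vi Vi2 Vle])
      also have "\<dots> = (\<Sum>k<Suc n. h\<^sup>2 * cG\<^sup>2 / real (Suc n) * expectation (\<lambda>\<omega>. (norm (Z (grid s t (Suc n) k) \<omega> - Z s \<omega>))\<^sup>2))"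
        by (subst Bochner_Integration.integral_sum) (auto intro!: integrable_mult_right Z_diff_sq_int gn st)
      also have "\<dots> \<le> (\<Sum>k<Suc n. h\<^sup>2 * cG\<^sup>2 / real (Suc n) * w h)"
        using st by (intro sum_mono mult_left_mono Z2 grid_ge grid_le) auto
      also have "\<dots> = h\<^sup>2 * (cG\<^sup>2 * w h)" by (simp add: field_simps del: sum.lessThan_Suc of_nat_Suc)
      finally show ?thesis .
    qed
    define Rn where "Rn n \<omega> = V n \<omega> + U n \<omega>" for n \<omega>
    have Rnm[measurable]: "Rn n \<in> borel_measurable M" for n unfolding Rn_def[abs_def] by measurable
    have sq: "(norm (a + b))\<^sup>2 \<le> 2 * (norm a)\<^sup>2 + 2 * (norm b)\<^sup>2" for a b :: 'b
    proof -
      have "(norm (a + b))\<^sup>2 \<le> (norm a + norm b)\<^sup>2" by (intro power_mono norm_triangle_ineq) auto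
      also have "\<dots> \<le> 2 * (norm a)\<^sup>2 + 2 * (norm b)\<^sup>2" using sum_squares_bound[of "norm a" "norm b"] by (simp add: power2_sum)
      finally show ?thesis .
    qed
    have Rni: "integrable M (\<lambda>\<omega>. (norm (Rn n \<omega>))\<^sup>2)" for n
      by (rule Bochner_Integration.integrable_bound[of _ "\<lambda>\<omega>. 2 * (norm (V n \<omega>))\<^sup>2 + 2 * (norm (U n \<omega>))\<^sup>2"])
        (use Vi Ui sq in \<open>auto simp: Rn_def\<close>)
    have Rnb: "expectation (\<lambda>\<omega>. (norm (Rn n \<omega>))\<^sup>2) \<le> h * b h" for n
    proof -
      have "expectation (\<lambda>\<omega>. (norm (Rn n \<omega>))\<^sup>2) \<le> expectation (\<lambda>\<omega>. 2 * (norm (V n \<omega>))\<^sup>2 + 2 * (norm (U n \<omega>))\<^sup>2)"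
        by (rule integral_mono[OF Rni]) (use Vi Ui sq in \<open>auto simp: Rn_def\<close>)
      also have "\<dots> = 2 * expectation (\<lambda>\<omega>. (norm (V n \<omega>))\<^sup>2) + 2 * expectation (\<lambda>\<omega>. (norm (U n \<omega>))\<^sup>2)"
        using Vi Ui by simp
      also have "\<dots> \<le> 2 * (h\<^sup>2 * (cG\<^sup>2 * w h)) + 2 * (h * (c\<^sup>2 * w h))" using Vb[of n] Ub[of n] by simp
      also have "\<dots> = h * b h" by (simp add: b_def power2_eq_square algebra_simps)
      finally show ?thesis .
    qed
    have null: "null_in_prob (\<lambda>n \<omega>. Rn n \<omega> - Rv \<omega>)"
    proof -
      define X where "X n \<omega> = (((t - s) / real n) *\<^sub>R (\<Sum>k<n. drift (Z (grid s t n k) \<omega>)) + ito_part s t n \<omega>) - (Z t \<omega> - Z s \<omega>)" for n \<omega>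
      have "null_in_prob X" unfolding X_def[abs_def] by (rule euler_null[OF st])
      then have "null_in_prob (\<lambda>n. X (Suc n))"
        unfolding null_in_prob_def using LIMSEQ_Suc by blast
      moreover have Xeq: "X (Suc n) \<omega> = Rn n \<omega> - Rv \<omega>" for n \<omega>
      proof -
        have tel: "(\<Sum>k<Suc n. \<Delta>W s t (Suc n) k \<omega>) = W t \<omega> - W s \<omega>"
          using sum_lessThan_telescope[of "\<lambda>k. W (grid s t (Suc n) k) \<omega>" "Suc n"] grid_n[of "Suc n" s t] by simp
        have u: "U n \<omega> = ito_part s t (Suc n) \<omega> - (W t \<omega> - W s \<omega>) *\<^sub>R LB (Z s \<omega>)"
        proof -
          have e: "(W t \<omega> - W s \<omega>) *\<^sub>R LB (Z s \<omega>) = (\<Sum>k<Suc n. \<Delta>W s t (Suc n) k \<omega> *\<^sub>R LB (Z s \<omega>))"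
            unfolding tel[symmetric] scaleR_sum_left ..
          show ?thesis unfolding e U_def ito_part_def LB.diff scaleR_diff_right sum_subtractf ..
        qed
        have v: "V n \<omega> = (h / real (Suc n)) *\<^sub>R (\<Sum>k<Suc n. drift (Z (grid s t (Suc n) k) \<omega>)) - h *\<^sub>R drift (Z s \<omega>)"
          unfolding V_def G.diff sum_subtractf scaleR_diff_right sum_constant_scaleR card_lessThan scaleR_scaleR by simp
        show ?thesis unfolding X_def Rn_def u v Rv_def h_def by (simp add: algebra_simps del: sum.lessThan_Suc of_nat_Suc)
      qed
      moreover have "(\<lambda>n. X (Suc n)) = (\<lambda>n \<omega>. Rn n \<omega> - Rv \<omega>)" by (intro ext Xeq)
      ultimately show ?thesis by simp
    qed
    have Rv2: "integrable M (\<lambda>\<omega>. (norm (Rv \<omega>))\<^sup>2) \<and> expectation (\<lambda>\<omega>. (norm (Rv \<omega>))\<^sup>2) \<le> h * b h"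
      by (rule null_in_prob_Fatou[OF null Rnm Rvm Rni Rnb])
    have fRm[measurable]: "(\<lambda>\<omega>. f (Rv \<omega>)) \<in> borel_measurable M" by (intro bl_meas[OF f] Rvm)
    have fsq: "(f v)\<^sup>2 \<le> cf\<^sup>2 * (norm v)\<^sup>2" for v
      using power_mono[OF cf(2), of v 2] by (simp add: power_mult_distrib)
    have b0: "0 \<le> b h" using w0 h by (auto simp: b_def intro!: add_nonneg_nonneg mult_nonneg_nonneg)
    have fi: "integrable M (\<lambda>\<omega>. (f (Rv \<omega>))\<^sup>2)"
      by (rule Bochner_Integration.integrable_bound[of _ "\<lambda>\<omega>. cf\<^sup>2 * (norm (Rv \<omega>))\<^sup>2"]) (use Rv2 fsq in auto)
    have f2: "expectation (\<lambda>\<omega>. (f (Rv \<omega>))\<^sup>2) \<le> h * C h"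
    proof -
      have "expectation (\<lambda>\<omega>. (f (Rv \<omega>))\<^sup>2) \<le> expectation (\<lambda>\<omega>. cf\<^sup>2 * (norm (Rv \<omega>))\<^sup>2)"
        by (rule integral_mono[OF fi]) (use Rv2 fsq in auto)
      also have "\<dots> \<le> cf\<^sup>2 * (h * b h)" using Rv2 by (simp add: mult_left_mono)
      also have "\<dots> \<le> h * C h" using cf h w0 by (simp add: C_def algebra_simps)
      finally show ?thesis .
    qed
    have \<xi>b: "\<bar>expectation (\<lambda>\<omega>. \<xi> \<omega> * f (Rv \<omega>))\<bar> \<le> h * C h"
      if \<xi>: "\<xi> \<in> borel_measurable (F s)" "\<And>\<omega>. \<omega> \<in> space M \<Longrightarrow> \<bar>\<xi> \<omega>\<bar> \<le> 1" for \<xi>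
    proof -
      have \<xi>m[measurable]: "\<xi> \<in> borel_measurable M" using \<xi> F_meas by blast
      have nV: "expectation (\<lambda>\<omega>. norm (V n \<omega>)) \<le> sqrt (h\<^sup>2 * (cG\<^sup>2 * w h))" for n
        by (rule expectation_le_sqrt) (use Vi Vb in auto)
      have dm[measurable]: "(\<lambda>\<omega>. Rn n \<omega> - Rv \<omega>) \<in> borel_measurable M" for n by measurable
      have di: "integrable M (\<lambda>\<omega>. (norm (Rn n \<omega> - Rv \<omega>))\<^sup>2)" for n
        by (rule Bochner_Integration.integrable_bound[of _ "\<lambda>\<omega>. 2 * (norm (Rn n \<omega>))\<^sup>2 + 2 * (norm (Rv \<omega>))\<^sup>2"])
          (use Rni Rv2 sq[of "Rn n \<omega>" "- Rv \<omega>" for \<omega>] in auto)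
      have db: "expectation (\<lambda>\<omega>. (norm (Rn n \<omega> - Rv \<omega>))\<^sup>2) \<le> 4 * (h * b h)" for n
      proof -
        have "expectation (\<lambda>\<omega>. (norm (Rn n \<omega> - Rv \<omega>))\<^sup>2) \<le> expectation (\<lambda>\<omega>. 2 * (norm (Rn n \<omega>))\<^sup>2 + 2 * (norm (Rv \<omega>))\<^sup>2)"
          by (rule integral_mono[OF di]) (use Rni Rv2 sq[of "Rn n \<omega>" "- Rv \<omega>" for \<omega>] in auto)
        also have "\<dots> = 2 * expectation (\<lambda>\<omega>. (norm (Rn n \<omega>))\<^sup>2) + 2 * expectation (\<lambda>\<omega>. (norm (Rv \<omega>))\<^sup>2)"
          using Rni Rv2 by simp
        also have "\<dots> \<le> 4 * (h * b h)" using Rnb[of n] Rv2 by simp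
        finally show ?thesis .
      qed
      \<comment> \<open>Convergence in probability together with bounded second moments gives
        convergence in L1, which permits passing to the limit in the mean.\<close>
      have L1: "(\<lambda>n. expectation (\<lambda>\<omega>. norm (Rn n \<omega> - Rv \<omega>))) \<longlonglongrightarrow> 0"
        by (rule null_in_prob_imp_L1[OF null di db])
      have i1: "integrable M (\<lambda>\<omega>. norm (V n \<omega>))" "integrable M (\<lambda>\<omega>. norm (Rn n \<omega> - Rv \<omega>))" for n
        by (rule sq_int_imp_int; use Vi di in auto)+
      have \<xi>f: "integrable M (\<lambda>\<omega>. \<xi> \<omega> * f (Y \<omega>))" if "Y \<in> borel_measurable M" "integrable M (\<lambda>\<omega>. norm (Y \<omega>))" for Y
      proof (rule Bochner_Integration.integrable_bound)
        show "integrable M (\<lambda>\<omega>. cf * norm (Y \<omega>))" using that by simp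
        show "(\<lambda>\<omega>. \<xi> \<omega> * f (Y \<omega>)) \<in> borel_measurable M" using bl_meas[OF f that(1)] by measurable
        show "AE \<omega> in M. norm (\<xi> \<omega> * f (Y \<omega>)) \<le> norm (cf * norm (Y \<omega>))"
          using mult_mono[OF \<xi>(2) cf(2)] cf by (intro AE_I2) (auto simp: abs_mult)
      qed
      have \<xi>fb: "\<bar>expectation (\<lambda>\<omega>. \<xi> \<omega> * f (Y \<omega>))\<bar> \<le> cf * expectation (\<lambda>\<omega>. norm (Y \<omega>))"
        if "Y \<in> borel_measurable M" "integrable M (\<lambda>\<omega>. norm (Y \<omega>))" for Y
      proof -
        have "\<bar>expectation (\<lambda>\<omega>. \<xi> \<omega> * f (Y \<omega>))\<bar> \<le> expectation (\<lambda>\<omega>. \<bar>\<xi> \<omega> * f (Y \<omega>)\<bar>)"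
          by (rule integral_abs_bound)
        also have "\<dots> \<le> expectation (\<lambda>\<omega>. cf * norm (Y \<omega>))"
        proof (rule integral_mono)
          show "integrable M (\<lambda>\<omega>. \<bar>\<xi> \<omega> * f (Y \<omega>)\<bar>)" by (intro integrable_abs \<xi>f that)
          show "integrable M (\<lambda>\<omega>. cf * norm (Y \<omega>))" using that by simp
          show "\<bar>\<xi> \<omega> * f (Y \<omega>)\<bar> \<le> cf * norm (Y \<omega>)" if "\<omega> \<in> space M" for \<omega>
            using mult_mono[OF \<xi>(2)[OF that] cf(2)[of "Y \<omega>"]] by (simp add: abs_mult)
        qed
        finally show ?thesis by simp
      qed
      have Uin: "integrable M (\<lambda>\<omega>. norm (U n \<omega>))" for n by (rule sq_int_imp_int) (use Ui in auto)
      \<comment> \<open>\<open>U\<close> is a sum of increments with coefficients known beforehand,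
        hence orthogonal to what is known at time s.\<close>
      have \<xi>U: "expectation (\<lambda>\<omega>. \<xi> \<omega> * f (U n \<omega>)) = 0" for n
      proof -
        have fU: "f (U n \<omega>) = (\<Sum>k<Suc n. f (LB (Z (grid s t (Suc n) k) \<omega> - Z s \<omega>)) * \<Delta>W s t (Suc n) k \<omega>)" for \<omega>
          unfolding U_def f.sum f.scaleR by (simp add: mult.commute del: sum.lessThan_Suc)
        have m: "(\<lambda>\<omega>. f (LB (Z (grid s t (Suc n) k) \<omega> - Z s \<omega>))) \<in> borel_measurable (F (grid s t (Suc n) k))" for k
          using gn[of "Suc n" k] st grid_ge[of s t "Suc n" k]
          by (intro bl_meas[OF f] bl_meas[OF LB] borel_measurable_diff Z_F F_mono[OF Z_F]) auto
        have bd: "\<bar>f (LB (Z (grid s t (Suc n) k) \<omega> - Z s \<omega>))\<bar> \<le> cf * (c * (2 * R))" if "\<omega> \<in> space M" for k \<omega>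
          by (intro order_trans[OF cf(2)] mult_left_mono order_trans[OF c(2)] Z_diff_bd gn st that) (use cf c in auto)
        have "\<forall>\<xi> C. \<xi> \<in> borel_measurable (F (grid s t (Suc n) 0)) \<and> (\<forall>\<omega>\<in>space M. \<bar>\<xi> \<omega>\<bar> \<le> C) \<longrightarrow>
          expectation (\<lambda>\<omega>. \<xi> \<omega> * (\<Sum>k<Suc n. f (LB (Z (grid s t (Suc n) k) \<omega> - Z s \<omega>)) * \<Delta>W s t (Suc n) k \<omega>)) = 0"
          using orth_sum[where \<tau>="grid s t (Suc n)" and \<beta>="\<lambda>k \<omega>. f (LB (Z (grid s t (Suc n) k) \<omega> - Z s \<omega>))" and \<phi>="\<lambda>_ x. x"
              and v="\<lambda>_. (t - s) / real (Suc n)" and n="Suc n", OF _ grid_strict[OF st(2) zero_less_Suc] m bd]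
            grid_dW[OF st zero_less_Suc] st by simp
        then show ?thesis unfolding fU grid_0 using \<xi> by blast
      qed
      have le: "\<bar>expectation (\<lambda>\<omega>. \<xi> \<omega> * f (Rv \<omega>))\<bar> \<le> cf * sqrt (h\<^sup>2 * (cG\<^sup>2 * w h)) + cf * expectation (\<lambda>\<omega>. norm (Rn n \<omega> - Rv \<omega>))" for n
      proof -
        have "\<xi> \<omega> * f (Rv \<omega>) = \<xi> \<omega> * f (V n \<omega>) + \<xi> \<omega> * f (U n \<omega>) - \<xi> \<omega> * f (Rn n \<omega> - Rv \<omega>)" for \<omega>
          by (simp add: Rn_def f.add f.diff algebra_simps)
        then have "expectation (\<lambda>\<omega>. \<xi> \<omega> * f (Rv \<omega>)) =
          expectation (\<lambda>\<omega>. \<xi> \<omega> * f (V n \<omega>)) + expectation (\<lambda>\<omega>. \<xi> \<omega> * f (U n \<omega>)) - expectation (\<lambda>\<omega>. \<xi> \<omega> * f (Rn n \<omega> - Rv \<omega>))"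
          using \<xi>f[OF Vm i1(1)] \<xi>f[OF Um Uin] \<xi>f[OF dm i1(2)] by simp
        then have "\<bar>expectation (\<lambda>\<omega>. \<xi> \<omega> * f (Rv \<omega>))\<bar> \<le> cf * expectation (\<lambda>\<omega>. norm (V n \<omega>)) + cf * expectation (\<lambda>\<omega>. norm (Rn n \<omega> - Rv \<omega>))"
          using \<xi>fb[OF Vm i1(1)[of n]] \<xi>fb[OF dm i1(2)[of n]] \<xi>U[of n] by linarith
        also have "\<dots> \<le> cf * sqrt (h\<^sup>2 * (cG\<^sup>2 * w h)) + cf * expectation (\<lambda>\<omega>. norm (Rn n \<omega> - Rv \<omega>))"
          using nV[of n] cf by (simp add: mult_left_mono)
        finally show ?thesis .
      qed
      have "(\<lambda>n. cf * sqrt (h\<^sup>2 * (cG\<^sup>2 * w h)) + cf * expectation (\<lambda>\<omega>. norm (Rn n \<omega> - Rv \<omega>))) \<longlonglongrightarrow> cf * sqrt (h\<^sup>2 * (cG\<^sup>2 * w h)) + cf * 0"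
        by (intro tendsto_intros L1)
      then have "\<bar>expectation (\<lambda>\<omega>. \<xi> \<omega> * f (Rv \<omega>))\<bar> \<le> cf * sqrt (h\<^sup>2 * (cG\<^sup>2 * w h)) + cf * 0"
        by (rule LIMSEQ_le_const) (use le in blast)
      also have "\<dots> = h * (cf * sqrt (cG\<^sup>2 * w h))" using h by (simp add: real_sqrt_mult)
      also have "\<dots> \<le> h * C h" using h b0 by (simp add: C_def mult_left_mono)
      finally show ?thesis .
    qed
    show ?thesis unfolding rem h_def[symmetric] using fi f2 \<xi>b by blast
  qed
  moreover have "continuous_on UNIV f" "continuous_on UNIV (\<lambda>z. f (LB z))" "continuous_on UNIV (\<lambda>z. f (drift z))"
    by (intro linear_continuous_on f bounded_linear_compose[OF f] LB drift_linear)+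
  ultimately show ?thesis unfolding ito_fun_def using lim by blast
qed

end

section \<open>Products of expansions, and the evolution equation for expectations\<close>

context stratonovich_linear begin

lemma ito_const: "ito_fun T (\<lambda>z. a) (\<lambda>z. 0) (\<lambda>z. 0)"
  unfolding ito_fun_def remainder_def by (auto intro!: exI[of _ "\<lambda>_. 0"])

lemma cont_Z_bd_nonneg:
  assumes "continuous_on UNIV (f :: 'b \<Rightarrow> real)"
  obtains K where "0 \<le> K" "\<And>t \<omega>. 0 \<le> t \<Longrightarrow> \<omega> \<in> space M \<Longrightarrow> \<bar>f (Z t \<omega>)\<bar> \<le> K"
proof -
  obtain K where K: "\<forall>t\<ge>0. \<forall>\<omega>\<in>space M. \<bar>f (Z t \<omega>)\<bar> \<le> K" using cont_Z_bd[OF assms] by blast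
  have "\<bar>f (Z t \<omega>)\<bar> \<le> max 0 K" if "0 \<le> t" "\<omega> \<in> space M" for t \<omega>
    using K[rule_format, OF that] by simp
  then show thesis using that[of "max 0 K"] by simp
qed

lemma ito_add:
  assumes f: "ito_fun T f f1 f2" and g: "ito_fun T g g1 g2"
  shows "ito_fun T (\<lambda>z. f z + g z) (\<lambda>z. f1 z + g1 z) (\<lambda>z. f2 z + g2 z)"
proof -
  have cont: "continuous_on UNIV f" "continuous_on UNIV f1" "continuous_on UNIV f2"
    "continuous_on UNIV g" "continuous_on UNIV g1" "continuous_on UNIV g2"
    using f g unfolding ito_fun_def by auto
  obtain cf where cf: "(cf \<longlongrightarrow> 0) (at_right 0)" and F': "\<And>s t. 0 \<le> s \<and> s < t \<and> t \<le> T \<Longrightarrow>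
        integrable M (\<lambda>\<omega>. (remainder f f1 f2 s t \<omega>)\<^sup>2) \<and>
        expectation (\<lambda>\<omega>. (remainder f f1 f2 s t \<omega>)\<^sup>2) \<le> (t - s) * cf (t - s) \<and>
        (\<forall>\<xi>. \<xi> \<in> borel_measurable (F s) \<and> (\<forall>\<omega>\<in>space M. \<bar>\<xi> \<omega>\<bar> \<le> 1) \<longrightarrow>
          \<bar>expectation (\<lambda>\<omega>. \<xi> \<omega> * remainder f f1 f2 s t \<omega>)\<bar> \<le> (t - s) * cf (t - s))"
    using f unfolding ito_fun_def by blast
  obtain cg where cg: "(cg \<longlongrightarrow> 0) (at_right 0)" and G': "\<And>s t. 0 \<le> s \<and> s < t \<and> t \<le> T \<Longrightarrow>
        integrable M (\<lambda>\<omega>. (remainder g g1 g2 s t \<omega>)\<^sup>2) \<and>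
        expectation (\<lambda>\<omega>. (remainder g g1 g2 s t \<omega>)\<^sup>2) \<le> (t - s) * cg (t - s) \<and>
        (\<forall>\<xi>. \<xi> \<in> borel_measurable (F s) \<and> (\<forall>\<omega>\<in>space M. \<bar>\<xi> \<omega>\<bar> \<le> 1) \<longrightarrow>
          \<bar>expectation (\<lambda>\<omega>. \<xi> \<omega> * remainder g g1 g2 s t \<omega>)\<bar> \<le> (t - s) * cg (t - s))"
    using g unfolding ito_fun_def by blast
  have "integrable M (\<lambda>\<omega>. (remainder (\<lambda>z. f z + g z) (\<lambda>z. f1 z + g1 z) (\<lambda>z. f2 z + g2 z) s t \<omega>)\<^sup>2) \<and>
        expectation (\<lambda>\<omega>. (remainder (\<lambda>z. f z + g z) (\<lambda>z. f1 z + g1 z) (\<lambda>z. f2 z + g2 z) s t \<omega>)\<^sup>2) \<le> (t - s) * (2 * cf (t - s) + 2 * cg (t - s)) \<and>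
        (\<forall>\<xi>. \<xi> \<in> borel_measurable (F s) \<and> (\<forall>\<omega>\<in>space M. \<bar>\<xi> \<omega>\<bar> \<le> 1) \<longrightarrow>
          \<bar>expectation (\<lambda>\<omega>. \<xi> \<omega> * remainder (\<lambda>z. f z + g z) (\<lambda>z. f1 z + g1 z) (\<lambda>z. f2 z + g2 z) s t \<omega>)\<bar> \<le> (t - s) * (2 * cf (t - s) + 2 * cg (t - s)))"
    if stT: "0 \<le> s \<and> s < t \<and> t \<le> T" for s t
  proof -
    let ?Rf = "remainder f f1 f2 s t" and ?Rg = "remainder g g1 g2 s t"
    have st: "0 \<le> s" "s < t" "0 \<le> t" using stT by auto
    have [measurable]: "?Rf \<in> borel_measurable M" "?Rg \<in> borel_measurable M"
      using cont st by (auto intro!: remainder_meas)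
    have rem: "remainder (\<lambda>z. f z + g z) (\<lambda>z. f1 z + g1 z) (\<lambda>z. f2 z + g2 z) s t \<omega> = ?Rf \<omega> + ?Rg \<omega>" for \<omega>
      by (simp add: remainder_def algebra_simps)
    note F = F'[OF stT] and G = G'[OF stT]
    have i1: "integrable M ?Rf" "integrable M ?Rg"
      using sq_int_imp_int[OF _ F[THEN conjunct1]] sq_int_imp_int[OF _ G[THEN conjunct1]] by simp_all
    have nn: "0 \<le> (t - s) * cf (t - s)" "0 \<le> (t - s) * cg (t - s)"
    proof -
      have "0 \<le> expectation (\<lambda>\<omega>. (?Rf \<omega>)\<^sup>2)" "0 \<le> expectation (\<lambda>\<omega>. (?Rg \<omega>)\<^sup>2)" by simp_all
      then show "0 \<le> (t - s) * cf (t - s)" "0 \<le> (t - s) * cg (t - s)"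
        using F[THEN conjunct2, THEN conjunct1] G[THEN conjunct2, THEN conjunct1] by linarith+
    qed
    have sq: "(a + b)\<^sup>2 \<le> 2 * a\<^sup>2 + 2 * b\<^sup>2" for a b :: real
      using sum_squares_bound[of a b] by (simp add: power2_sum)
    have i2: "integrable M (\<lambda>\<omega>. (?Rf \<omega> + ?Rg \<omega>)\<^sup>2)"
      by (rule Bochner_Integration.integrable_bound[of _ "\<lambda>\<omega>. 2 * (?Rf \<omega>)\<^sup>2 + 2 * (?Rg \<omega>)\<^sup>2"]) (use F G sq in auto)
    have "expectation (\<lambda>\<omega>. (?Rf \<omega> + ?Rg \<omega>)\<^sup>2) \<le> expectation (\<lambda>\<omega>. 2 * (?Rf \<omega>)\<^sup>2 + 2 * (?Rg \<omega>)\<^sup>2)"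
      by (rule integral_mono[OF i2]) (use F G sq in auto)
    also have "\<dots> = 2 * expectation (\<lambda>\<omega>. (?Rf \<omega>)\<^sup>2) + 2 * expectation (\<lambda>\<omega>. (?Rg \<omega>)\<^sup>2)" using F G by simp
    also have "\<dots> \<le> 2 * ((t - s) * cf (t - s)) + 2 * ((t - s) * cg (t - s))" using F G by simp
    finally have b: "expectation (\<lambda>\<omega>. (?Rf \<omega> + ?Rg \<omega>)\<^sup>2) \<le> (t - s) * (2 * cf (t - s) + 2 * cg (t - s))"
      by (simp add: algebra_simps)
    have "\<bar>expectation (\<lambda>\<omega>. \<xi> \<omega> * (?Rf \<omega> + ?Rg \<omega>))\<bar> \<le> (t - s) * (2 * cf (t - s) + 2 * cg (t - s))"
      if \<xi>: "\<xi> \<in> borel_measurable (F s)" "\<And>\<omega>. \<omega> \<in> space M \<Longrightarrow> \<bar>\<xi> \<omega>\<bar> \<le> 1" for \<xi>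
    proof -
      have \<xi>m: "\<xi> \<in> borel_measurable M" using \<xi> F_meas by blast
      have "expectation (\<lambda>\<omega>. \<xi> \<omega> * (?Rf \<omega> + ?Rg \<omega>)) = expectation (\<lambda>\<omega>. \<xi> \<omega> * ?Rf \<omega>) + expectation (\<lambda>\<omega>. \<xi> \<omega> * ?Rg \<omega>)"
        unfolding distrib_left by (intro Bochner_Integration.integral_add bdd_mult_int[OF \<xi>m \<xi>(2)] i1)
      moreover have "\<bar>expectation (\<lambda>\<omega>. \<xi> \<omega> * ?Rf \<omega>)\<bar> \<le> (t - s) * cf (t - s)" "\<bar>expectation (\<lambda>\<omega>. \<xi> \<omega> * ?Rg \<omega>)\<bar> \<le> (t - s) * cg (t - s)"
        using F G \<xi> by blast+
      moreover have "(t - s) * (2 * cf (t - s) + 2 * cg (t - s)) = 2 * ((t - s) * cf (t - s)) + 2 * ((t - s) * cg (t - s))"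
        by (simp add: algebra_simps)
      ultimately show ?thesis using nn by linarith
    qed
    then show ?thesis unfolding rem using i2 b by blast
  qed
  moreover have "((\<lambda>h. 2 * cf h + 2 * cg h) \<longlongrightarrow> 0) (at_right 0)"
    by (auto intro!: tendsto_eq_intros cf cg)
  moreover have "continuous_on UNIV (\<lambda>z. f z + g z)" "continuous_on UNIV (\<lambda>z. f1 z + g1 z)" "continuous_on UNIV (\<lambda>z. f2 z + g2 z)"
    using cont by (auto intro: continuous_intros)
  ultimately show ?thesis unfolding ito_fun_def
    by (intro conjI exI[of _ "\<lambda>h. 2 * cf h + 2 * cg h"]) blast+
qed

text \<open>The remainder of the product consists of f times the remainder of g, g times that of f,
  and \<open>P\<close>, the product of the increments minus f1 g1 h. The correction f1 g1 in the
  drift is what makes \<open>P\<close> negligible: its second moment is controlled by fourth moments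
  of the increments, and its mean against test variables by the decomposition
  \<open>Pdec\<close>.\<close>

lemma ito_mult:
  assumes f: "ito_fun T f f1 f2" and g: "ito_fun T g g1 g2"
  shows "ito_fun T (\<lambda>z. f z * g z) (\<lambda>z. f z * g1 z + f1 z * g z) (\<lambda>z. f z * g2 z + f2 z * g z + f1 z * g1 z)"
    (is "ito_fun T ?p ?p1 ?p2")
proof -
  have cont: "continuous_on UNIV f" "continuous_on UNIV f1" "continuous_on UNIV f2"
    "continuous_on UNIV g" "continuous_on UNIV g1" "continuous_on UNIV g2"
    using f g unfolding ito_fun_def by auto
  obtain cf where cf: "(cf \<longlongrightarrow> 0) (at_right 0)" and F': "\<And>s t. 0 \<le> s \<and> s < t \<and> t \<le> T \<Longrightarrow>
        integrable M (\<lambda>\<omega>. (remainder f f1 f2 s t \<omega>)\<^sup>2) \<and>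
        expectation (\<lambda>\<omega>. (remainder f f1 f2 s t \<omega>)\<^sup>2) \<le> (t - s) * cf (t - s) \<and>
        (\<forall>\<xi>. \<xi> \<in> borel_measurable (F s) \<and> (\<forall>\<omega>\<in>space M. \<bar>\<xi> \<omega>\<bar> \<le> 1) \<longrightarrow>
          \<bar>expectation (\<lambda>\<omega>. \<xi> \<omega> * remainder f f1 f2 s t \<omega>)\<bar> \<le> (t - s) * cf (t - s))"
    using f unfolding ito_fun_def by blast
  obtain cg where cg: "(cg \<longlongrightarrow> 0) (at_right 0)" and G': "\<And>s t. 0 \<le> s \<and> s < t \<and> t \<le> T \<Longrightarrow>
        integrable M (\<lambda>\<omega>. (remainder g g1 g2 s t \<omega>)\<^sup>2) \<and>
        expectation (\<lambda>\<omega>. (remainder g g1 g2 s t \<omega>)\<^sup>2) \<le> (t - s) * cg (t - s) \<and>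
        (\<forall>\<xi>. \<xi> \<in> borel_measurable (F s) \<and> (\<forall>\<omega>\<in>space M. \<bar>\<xi> \<omega>\<bar> \<le> 1) \<longrightarrow>
          \<bar>expectation (\<lambda>\<omega>. \<xi> \<omega> * remainder g g1 g2 s t \<omega>)\<bar> \<le> (t - s) * cg (t - s))"
    using g unfolding ito_fun_def by blast
  obtain K where K: "1 \<le> K" and Kb: "\<And>t \<omega>. 0 \<le> t \<Longrightarrow> \<omega> \<in> space M \<Longrightarrow> \<bar>f (Z t \<omega>)\<bar> \<le> K \<and> \<bar>f1 (Z t \<omega>)\<bar> \<le> K \<and> \<bar>f2 (Z t \<omega>)\<bar> \<le> K
     \<and> \<bar>g (Z t \<omega>)\<bar> \<le> K \<and> \<bar>g1 (Z t \<omega>)\<bar> \<le> K \<and> \<bar>g2 (Z t \<omega>)\<bar> \<le> K"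
  proof -
    obtain k1 where k1: "0 \<le> k1" "\<And>t \<omega>. 0 \<le> t \<Longrightarrow> \<omega> \<in> space M \<Longrightarrow> \<bar>f (Z t \<omega>)\<bar> \<le> k1"
      using cont_Z_bd_nonneg[OF cont(1)] by blast
    obtain k2 where k2: "0 \<le> k2" "\<And>t \<omega>. 0 \<le> t \<Longrightarrow> \<omega> \<in> space M \<Longrightarrow> \<bar>f1 (Z t \<omega>)\<bar> \<le> k2"
      using cont_Z_bd_nonneg[OF cont(2)] by blast
    obtain k3 where k3: "0 \<le> k3" "\<And>t \<omega>. 0 \<le> t \<Longrightarrow> \<omega> \<in> space M \<Longrightarrow> \<bar>f2 (Z t \<omega>)\<bar> \<le> k3"
      using cont_Z_bd_nonneg[OF cont(3)] by blast
    obtain k4 where k4: "0 \<le> k4" "\<And>t \<omega>. 0 \<le> t \<Longrightarrow> \<omega> \<in> space M \<Longrightarrow> \<bar>g (Z t \<omega>)\<bar> \<le> k4"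
      using cont_Z_bd_nonneg[OF cont(4)] by blast
    obtain k5 where k5: "0 \<le> k5" "\<And>t \<omega>. 0 \<le> t \<Longrightarrow> \<omega> \<in> space M \<Longrightarrow> \<bar>g1 (Z t \<omega>)\<bar> \<le> k5"
      using cont_Z_bd_nonneg[OF cont(5)] by blast
    obtain k6 where k6: "0 \<le> k6" "\<And>t \<omega>. 0 \<le> t \<Longrightarrow> \<omega> \<in> space M \<Longrightarrow> \<bar>g2 (Z t \<omega>)\<bar> \<le> k6"
      using cont_Z_bd_nonneg[OF cont(6)] by blast
    show thesis
    proof (rule that[of "1 + (k1 + k2 + k3 + k4 + k5 + k6)"])
      have nn: "0 \<le> k1" "0 \<le> k2" "0 \<le> k3" "0 \<le> k4" "0 \<le> k5" "0 \<le> k6" by (rule k1 k2 k3 k4 k5 k6)+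
      show "1 \<le> 1 + (k1 + k2 + k3 + k4 + k5 + k6)" using nn by linarith
      show "\<bar>f (Z t \<omega>)\<bar> \<le> 1 + (k1 + k2 + k3 + k4 + k5 + k6) \<and> \<bar>f1 (Z t \<omega>)\<bar> \<le> 1 + (k1 + k2 + k3 + k4 + k5 + k6) \<and>
        \<bar>f2 (Z t \<omega>)\<bar> \<le> 1 + (k1 + k2 + k3 + k4 + k5 + k6) \<and> \<bar>g (Z t \<omega>)\<bar> \<le> 1 + (k1 + k2 + k3 + k4 + k5 + k6) \<and>
        \<bar>g1 (Z t \<omega>)\<bar> \<le> 1 + (k1 + k2 + k3 + k4 + k5 + k6) \<and> \<bar>g2 (Z t \<omega>)\<bar> \<le> 1 + (k1 + k2 + k3 + k4 + k5 + k6)"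
        if a: "0 \<le> t" "\<omega> \<in> space M" for t \<omega>
        by (intro conjI k1(2)[OF a, THEN order_trans] k2(2)[OF a, THEN order_trans] k3(2)[OF a, THEN order_trans]
            k4(2)[OF a, THEN order_trans] k5(2)[OF a, THEN order_trans] k6(2)[OF a, THEN order_trans]; use nn in linarith)
    qed
  qed
  \<comment> \<open>h times \<open>\<rho> h\<close> bounds the second moments of \<open>vf\<close>
    and \<open>vg\<close>, the increments without their Wiener parts; h times \<open>q h\<close>
    bounds the fourth moments of \<open>Df\<close> and \<open>Dg\<close>. \<open>C1\<close> is for
    the second moment of the remainder and \<open>C2\<close> for its mean against test
    variables.\<close>
  define \<rho> where "\<rho> h = 2 * K\<^sup>2 * h + 2 * (cf h + cg h)" for h
  define q where "q h = 12 * K^4 * h + 16 * K\<^sup>2 * \<rho> h" for h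
  define C1 where "C1 h = 6 * K\<^sup>2 * (cf h + cg h) + 6 * q h + 6 * K^4 * h" for h
  define C2 where "C2 h = 2 * K * (cf h + cg h) + K * sqrt (\<rho> h) + sqrt (\<rho> h) * (2 * K\<^sup>2 + 2 * \<rho> h + 1)" for h
  have lim: "((\<lambda>h. C1 h + C2 h) \<longlongrightarrow> 0) (at_right 0)"
    unfolding C1_def C2_def q_def \<rho>_def
    by (auto intro!: tendsto_eq_intros cf cg tendsto_ident_at)
  have "integrable M (\<lambda>\<omega>. (remainder ?p ?p1 ?p2 s t \<omega>)\<^sup>2) \<and>
        expectation (\<lambda>\<omega>. (remainder ?p ?p1 ?p2 s t \<omega>)\<^sup>2) \<le> (t - s) * (C1 (t - s) + C2 (t - s)) \<and>
        (\<forall>\<xi>. \<xi> \<in> borel_measurable (F s) \<and> (\<forall>\<omega>\<in>space M. \<bar>\<xi> \<omega>\<bar> \<le> 1) \<longrightarrow>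
          \<bar>expectation (\<lambda>\<omega>. \<xi> \<omega> * remainder ?p ?p1 ?p2 s t \<omega>)\<bar> \<le> (t - s) * (C1 (t - s) + C2 (t - s)))"
    if stT: "0 \<le> s \<and> s < t \<and> t \<le> T" for s t
  proof -
    have st: "0 \<le> s" "s < t" and t0: "0 \<le> t" using stT by auto
    note F = F'[OF stT] and G = G'[OF stT]
    define h where "h = t - s"
    have h: "0 < h" using st by (simp add: h_def)
    define \<eta> where "\<eta> = cf h + cg h"
    define d where "d \<omega> = W t \<omega> - W s \<omega>" for \<omega>
    define Rf where "Rf = remainder f f1 f2 s t"
    define Rg where "Rg = remainder g g1 g2 s t"
    define Df where "Df \<omega> = f (Z t \<omega>) - f (Z s \<omega>)" for \<omega>
    define Dg where "Dg \<omega> = g (Z t \<omega>) - g (Z s \<omega>)" for \<omega>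
    define vf where "vf \<omega> = f2 (Z s \<omega>) * h + Rf \<omega>" for \<omega>
    define vg where "vg \<omega> = g2 (Z s \<omega>) * h + Rg \<omega>" for \<omega>
    have Df: "Df \<omega> = f1 (Z s \<omega>) * d \<omega> + vf \<omega>" for \<omega>
      by (simp add: Df_def vf_def Rf_def remainder_def d_def h_def)
    have Dg: "Dg \<omega> = g1 (Z s \<omega>) * d \<omega> + vg \<omega>" for \<omega>
      by (simp add: Dg_def vg_def Rg_def remainder_def d_def h_def)
    define P where "P \<omega> = Df \<omega> * Dg \<omega> - f1 (Z s \<omega>) * g1 (Z s \<omega>) * h" for \<omega>
    have rem: "remainder ?p ?p1 ?p2 s t \<omega> = f (Z s \<omega>) * Rg \<omega> + g (Z s \<omega>) * Rf \<omega> + P \<omega>" for \<omega>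
      by (simp add: remainder_def P_def Df_def Dg_def Rf_def Rg_def h_def algebra_simps)
    have zm[measurable]: "(\<lambda>\<omega>. f (Z s \<omega>)) \<in> borel_measurable M" "(\<lambda>\<omega>. f1 (Z s \<omega>)) \<in> borel_measurable M"
      "(\<lambda>\<omega>. f2 (Z s \<omega>)) \<in> borel_measurable M" "(\<lambda>\<omega>. g (Z s \<omega>)) \<in> borel_measurable M"
      "(\<lambda>\<omega>. g1 (Z s \<omega>)) \<in> borel_measurable M" "(\<lambda>\<omega>. g2 (Z s \<omega>)) \<in> borel_measurable M"
      "(\<lambda>\<omega>. f (Z t \<omega>)) \<in> borel_measurable M" "(\<lambda>\<omega>. g (Z t \<omega>)) \<in> borel_measurable M"
      using cont st t0 by (auto intro!: cont_Z_meas)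
    have dm[measurable]: "d \<in> borel_measurable M"
      using W_meas[of s] W_meas[of t] st t0 unfolding d_def[abs_def] by simp
    have rm[measurable]: "Rf \<in> borel_measurable M" "Rg \<in> borel_measurable M"
      unfolding Rf_def Rg_def using cont st t0 by (auto intro!: remainder_meas)
    have [measurable]: "Df \<in> borel_measurable M" "Dg \<in> borel_measurable M" "vf \<in> borel_measurable M" "vg \<in> borel_measurable M"
      unfolding Df_def[abs_def] Dg_def[abs_def] vf_def[abs_def] vg_def[abs_def] by measurable
    have Pm[measurable]: "P \<in> borel_measurable M" unfolding P_def[abs_def] by measurable
    have d2: "integrable M (\<lambda>\<omega>. (d \<omega>)\<^sup>2)" "expectation (\<lambda>\<omega>. (d \<omega>)\<^sup>2) = h" "integrable M (\<lambda>\<omega>. (d \<omega>)^4)" "expectation (\<lambda>\<omega>. (d \<omega>)^4) = 3 * h\<^sup>2"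
      using dW_int2[OF st] dW_2[OF st] dW_int4[OF st] dW_4[OF st] by (simp_all add: d_def h_def)
    have R2: "integrable M (\<lambda>\<omega>. (Rf \<omega>)\<^sup>2)" "expectation (\<lambda>\<omega>. (Rf \<omega>)\<^sup>2) \<le> h * cf h"
      "integrable M (\<lambda>\<omega>. (Rg \<omega>)\<^sup>2)" "expectation (\<lambda>\<omega>. (Rg \<omega>)\<^sup>2) \<le> h * cg h"
      using F G by (simp_all add: Rf_def Rg_def h_def)
    have "0 \<le> expectation (\<lambda>\<omega>. (Rf \<omega>)\<^sup>2)" "0 \<le> expectation (\<lambda>\<omega>. (Rg \<omega>)\<^sup>2)" by simp_all
    then have "0 \<le> h * cf h" "0 \<le> h * cg h" using R2(2,4) by linarith+
    then have c0: "0 \<le> cf h" "0 \<le> cg h" using h by (auto simp: zero_le_mult_iff)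
    have RR: "expectation (\<lambda>\<omega>. (Rf \<omega>)\<^sup>2) \<le> h * \<eta>" "expectation (\<lambda>\<omega>. (Rg \<omega>)\<^sup>2) \<le> h * \<eta>" and \<eta>0: "0 \<le> \<eta>"
      using R2 c0 h by (auto simp: \<eta>_def distrib_left intro: order_trans)
    have \<rho>: "\<rho> h = 2 * K\<^sup>2 * h + 2 * \<eta>" by (simp add: \<rho>_def \<eta>_def)
    have \<rho>0: "0 < \<rho> h" using \<eta>0 h K by (simp add: \<rho> add_pos_nonneg)
    have Ks: "\<bar>f (Z s \<omega>)\<bar> \<le> K" "\<bar>f1 (Z s \<omega>)\<bar> \<le> K" "\<bar>f2 (Z s \<omega>)\<bar> \<le> K" "\<bar>g (Z s \<omega>)\<bar> \<le> K" "\<bar>g1 (Z s \<omega>)\<bar> \<le> K" "\<bar>g2 (Z s \<omega>)\<bar> \<le> K"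
      "\<bar>f (Z t \<omega>)\<bar> \<le> K" "\<bar>g (Z t \<omega>)\<bar> \<le> K" if "\<omega> \<in> space M" for \<omega>
      using Kb[OF st(1) that] Kb[OF t0 that] by auto
    have sq: "(a + b)\<^sup>2 \<le> 2 * a\<^sup>2 + 2 * b\<^sup>2" for a b :: real
      using sum_squares_bound[of a b] by (simp add: power2_sum)
    have v: "integrable M (\<lambda>\<omega>. (k (Z s \<omega>) * h + Y \<omega>)\<^sup>2) \<and> expectation (\<lambda>\<omega>. (k (Z s \<omega>) * h + Y \<omega>)\<^sup>2) \<le> h * \<rho> h"
      if "integrable M (\<lambda>\<omega>. (Y \<omega>)\<^sup>2)" "expectation (\<lambda>\<omega>. (Y \<omega>)\<^sup>2) \<le> h * \<eta>" and [measurable]: "Y \<in> borel_measurable M" "(\<lambda>\<omega>. k (Z s \<omega>)) \<in> borel_measurable M"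
        and kb: "\<And>\<omega>. \<omega> \<in> space M \<Longrightarrow> \<bar>k (Z s \<omega>)\<bar> \<le> K" for Y and k :: "'b \<Rightarrow> real"
    proof -
      have le: "(k (Z s \<omega>) * h + Y \<omega>)\<^sup>2 \<le> 2 * (K\<^sup>2 * h\<^sup>2) + 2 * (Y \<omega>)\<^sup>2" if "\<omega> \<in> space M" for \<omega>
      proof -
        have "(k (Z s \<omega>) * h)\<^sup>2 \<le> K\<^sup>2 * h\<^sup>2"
          using power_mono[OF kb[OF that], of 2] by (simp add: power_mult_distrib mult_right_mono)
        then show ?thesis using sq[of "k (Z s \<omega>) * h" "Y \<omega>"] by linarith
      qed
      have i: "integrable M (\<lambda>\<omega>. (k (Z s \<omega>) * h + Y \<omega>)\<^sup>2)"
        by (rule Bochner_Integration.integrable_bound[of _ "\<lambda>\<omega>. 2 * (K\<^sup>2 * h\<^sup>2) + 2 * (Y \<omega>)\<^sup>2"])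
          (use that(1) le in \<open>auto intro!: AE_I2\<close>)
      have "expectation (\<lambda>\<omega>. (k (Z s \<omega>) * h + Y \<omega>)\<^sup>2) \<le> expectation (\<lambda>\<omega>. 2 * (K\<^sup>2 * h\<^sup>2) + 2 * (Y \<omega>)\<^sup>2)"
        by (rule integral_mono[OF i]) (use that(1) le in auto)
      also have "\<dots> = 2 * (K\<^sup>2 * h\<^sup>2) + 2 * expectation (\<lambda>\<omega>. (Y \<omega>)\<^sup>2)" using that(1) by (simp add: prob_space)
      also have "\<dots> \<le> 2 * (K\<^sup>2 * h\<^sup>2) + 2 * (h * \<eta>)" using that(2) by simp
      also have "\<dots> = h * \<rho> h" by (simp add: \<rho> power2_eq_square algebra_simps)
      finally show ?thesis using i by blast
    qed
    have vf: "integrable M (\<lambda>\<omega>. (vf \<omega>)\<^sup>2)" "expectation (\<lambda>\<omega>. (vf \<omega>)\<^sup>2) \<le> h * \<rho> h"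
      using v[OF R2(1) RR(1) rm(1) zm(3) Ks(3)] by (simp_all add: vf_def)
    have vg: "integrable M (\<lambda>\<omega>. (vg \<omega>)\<^sup>2)" "expectation (\<lambda>\<omega>. (vg \<omega>)\<^sup>2) \<le> h * \<rho> h"
      using v[OF R2(3) RR(2) rm(2) zm(6) Ks(6)] by (simp_all add: vg_def)
    \<comment> \<open>Only second moments of \<open>V\<close> are known. One factor
      \<open>(Y \<omega>)\<^sup>2\<close> is therefore estimated by \<open>4 * K\<^sup>2\<close>,
      and with u the Wiener part the mixed term is absorbed by 4 Y^2 u^2 \<le> Y^4 + 4 u^4.\<close>
    have D4: "integrable M (\<lambda>\<omega>. (Y \<omega>)^4) \<and> expectation (\<lambda>\<omega>. (Y \<omega>)^4) \<le> h * q h"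
      if Yeq: "\<And>\<omega>. Y \<omega> = k (Z s \<omega>) * d \<omega> + V \<omega>" and Yb: "\<And>\<omega>. \<omega> \<in> space M \<Longrightarrow> \<bar>Y \<omega>\<bar> \<le> 2 * K"
        and kb: "\<And>\<omega>. \<omega> \<in> space M \<Longrightarrow> \<bar>k (Z s \<omega>)\<bar> \<le> K" and [measurable]: "Y \<in> borel_measurable M"
        and V: "integrable M (\<lambda>\<omega>. (V \<omega>)\<^sup>2)" "expectation (\<lambda>\<omega>. (V \<omega>)\<^sup>2) \<le> h * \<rho> h" for Y V and k :: "'b \<Rightarrow> real"
    proof -
      have le: "(Y \<omega>)^4 \<le> 4 * (K^4 * (d \<omega>)^4) + 16 * K\<^sup>2 * (V \<omega>)\<^sup>2" if w: "\<omega> \<in> space M" for \<omega>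
      proof -
        let ?u = "k (Z s \<omega>) * d \<omega>"
        have y2: "(Y \<omega>)\<^sup>2 \<le> 4 * K\<^sup>2" using power_mono[OF Yb[OF w], of 2] by (simp add: power_mult_distrib)
        have a: "(Y \<omega>)\<^sup>2 * (Y \<omega>)\<^sup>2 \<le> (Y \<omega>)\<^sup>2 * (2 * ?u\<^sup>2 + 2 * (V \<omega>)\<^sup>2)"
          by (intro mult_left_mono) (use sq[of ?u "V \<omega>"] Yeq in auto)
        have b: "(Y \<omega>)\<^sup>2 * (V \<omega>)\<^sup>2 \<le> 4 * K\<^sup>2 * (V \<omega>)\<^sup>2" by (intro mult_right_mono y2) auto
        have c: "4 * ((Y \<omega>)\<^sup>2 * ?u\<^sup>2) \<le> (Y \<omega>)\<^sup>2 * (Y \<omega>)\<^sup>2 + 4 * (?u\<^sup>2 * ?u\<^sup>2)"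
          using sum_squares_bound[of "(Y \<omega>)\<^sup>2" "2 * ?u\<^sup>2"] by (simp add: power2_eq_square algebra_simps)
        have e: "?u\<^sup>2 * ?u\<^sup>2 \<le> K^4 * (d \<omega>)^4"
        proof -
          have "(k (Z s \<omega>))^4 \<le> K^4" using power_mono[OF kb[OF w], of 4] by (simp add: power_even_abs_numeral)
          then have "(k (Z s \<omega>))^4 * (d \<omega>)^4 \<le> K^4 * (d \<omega>)^4" by (intro mult_right_mono) (auto simp: zero_le_even_power)
          then show ?thesis by (simp add: power_mult_distrib power4_eq_xxxx power2_eq_square ac_simps)
        qed
        have "(Y \<omega>)^4 = (Y \<omega>)\<^sup>2 * (Y \<omega>)\<^sup>2" by (simp add: power4_eq_xxxx power2_eq_square)
        moreover have "(Y \<omega>)\<^sup>2 * (2 * ?u\<^sup>2 + 2 * (V \<omega>)\<^sup>2) = 2 * ((Y \<omega>)\<^sup>2 * ?u\<^sup>2) + 2 * ((Y \<omega>)\<^sup>2 * (V \<omega>)\<^sup>2)" by (simp add: algebra_simps)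
        ultimately show ?thesis using a b c e by linarith
      qed
      have i: "integrable M (\<lambda>\<omega>. (Y \<omega>)^4)"
        by (rule Bochner_Integration.integrable_bound[of _ "\<lambda>\<omega>. 4 * (K^4 * (d \<omega>)^4) + 16 * K\<^sup>2 * (V \<omega>)\<^sup>2"])
          (use d2 V le in \<open>auto intro!: AE_I2 simp: zero_le_even_power intro: order_trans[OF _ abs_ge_self]\<close>)
      have "expectation (\<lambda>\<omega>. (Y \<omega>)^4) \<le> expectation (\<lambda>\<omega>. 4 * (K^4 * (d \<omega>)^4) + 16 * K\<^sup>2 * (V \<omega>)\<^sup>2)"
        by (rule integral_mono[OF i]) (use d2 V le in auto)
      also have "\<dots> = 4 * (K^4 * (3 * h\<^sup>2)) + 16 * K\<^sup>2 * expectation (\<lambda>\<omega>. (V \<omega>)\<^sup>2)" using d2 V by simp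
      also have "\<dots> \<le> 4 * (K^4 * (3 * h\<^sup>2)) + 16 * K\<^sup>2 * (h * \<rho> h)" using V(2) by (intro add_left_mono mult_left_mono) auto
      also have "\<dots> = h * q h" by (simp add: q_def power2_eq_square algebra_simps)
      finally show ?thesis using i by blast
    qed
    have Db: "\<bar>Df \<omega>\<bar> \<le> 2 * K" "\<bar>Dg \<omega>\<bar> \<le> 2 * K" if "\<omega> \<in> space M" for \<omega>
      using Ks[OF that] unfolding Df_def Dg_def by linarith+
    have Df4: "integrable M (\<lambda>\<omega>. (Df \<omega>)^4)" "expectation (\<lambda>\<omega>. (Df \<omega>)^4) \<le> h * q h"
      using D4[OF Df Db(1) Ks(2) _ vf] by simp_all
    have Dg4: "integrable M (\<lambda>\<omega>. (Dg \<omega>)^4)" "expectation (\<lambda>\<omega>. (Dg \<omega>)^4) \<le> h * q h"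
      using D4[OF Dg Db(2) Ks(5) _ vg] by simp_all
    have Ple: "(P \<omega>)\<^sup>2 \<le> (Df \<omega>)^4 + (Dg \<omega>)^4 + 2 * (K^4 * h\<^sup>2)" if w: "\<omega> \<in> space M" for \<omega>
    proof -
      have a: "(P \<omega>)\<^sup>2 \<le> 2 * (Df \<omega> * Dg \<omega>)\<^sup>2 + 2 * (f1 (Z s \<omega>) * g1 (Z s \<omega>) * h)\<^sup>2"
        using sq[of "Df \<omega> * Dg \<omega>" "- (f1 (Z s \<omega>) * g1 (Z s \<omega>) * h)"] by (simp add: P_def)
      have b: "2 * (Df \<omega> * Dg \<omega>)\<^sup>2 \<le> (Df \<omega>)^4 + (Dg \<omega>)^4"
        using sum_squares_bound[of "(Df \<omega>)\<^sup>2" "(Dg \<omega>)\<^sup>2"] by (simp add: power_mult_distrib)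
      have "\<bar>f1 (Z s \<omega>) * g1 (Z s \<omega>)\<bar> \<le> K * K" unfolding abs_mult using Ks[OF w] K by (intro mult_mono) auto
      from power_mono[OF this, of 2] have "(f1 (Z s \<omega>) * g1 (Z s \<omega>))\<^sup>2 \<le> K^4" by (simp add: power2_eq_square power4_eq_xxxx)
      then have "(f1 (Z s \<omega>) * g1 (Z s \<omega>) * h)\<^sup>2 \<le> K^4 * h\<^sup>2" by (simp add: power_mult_distrib[of _ h] mult_right_mono)
      then show ?thesis using a b by linarith
    qed
    have P2: "integrable M (\<lambda>\<omega>. (P \<omega>)\<^sup>2)"
      by (rule Bochner_Integration.integrable_bound[of _ "\<lambda>\<omega>. (Df \<omega>)^4 + (Dg \<omega>)^4 + 2 * (K^4 * h\<^sup>2)"])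
        (use Df4 Dg4 Ple in \<open>auto intro!: AE_I2 intro: order_trans[OF _ abs_ge_self]\<close>)
    have EP: "expectation (\<lambda>\<omega>. (P \<omega>)\<^sup>2) \<le> h * (2 * q h + 2 * K^4 * h)"
    proof -
      have "expectation (\<lambda>\<omega>. (P \<omega>)\<^sup>2) \<le> expectation (\<lambda>\<omega>. (Df \<omega>)^4 + (Dg \<omega>)^4 + 2 * (K^4 * h\<^sup>2))"
        by (rule integral_mono[OF P2]) (use Df4 Dg4 Ple in auto)
      also have "\<dots> = expectation (\<lambda>\<omega>. (Df \<omega>)^4) + expectation (\<lambda>\<omega>. (Dg \<omega>)^4) + 2 * (K^4 * h\<^sup>2)"
        using Df4 Dg4 by (simp add: prob_space)
      also have "\<dots> \<le> h * q h + h * q h + 2 * (K^4 * h\<^sup>2)" using Df4 Dg4 by simp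
      also have "\<dots> = h * (2 * q h + 2 * K^4 * h)" by (simp add: power2_eq_square algebra_simps)
      finally show ?thesis .
    qed
    have q0: "0 \<le> q h" using \<rho>0 h K by (auto simp: q_def intro!: add_nonneg_nonneg)
    let ?R = "\<lambda>\<omega>. f (Z s \<omega>) * Rg \<omega> + g (Z s \<omega>) * Rf \<omega> + P \<omega>"
    have sq3: "(a + b + c)\<^sup>2 \<le> 3 * a\<^sup>2 + 3 * b\<^sup>2 + 3 * c\<^sup>2" for a b c :: real
    proof -
      have "0 \<le> (a - b)\<^sup>2 + (b - c)\<^sup>2 + (a - c)\<^sup>2" by simp
      then show ?thesis by (simp add: power2_eq_square algebra_simps)
    qed
    have Rle: "(?R \<omega>)\<^sup>2 \<le> 3 * (K\<^sup>2 * (Rg \<omega>)\<^sup>2) + 3 * (K\<^sup>2 * (Rf \<omega>)\<^sup>2) + 3 * (P \<omega>)\<^sup>2" if w: "\<omega> \<in> space M" for \<omega>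
    proof -
      have "(f (Z s \<omega>) * Rg \<omega>)\<^sup>2 \<le> K\<^sup>2 * (Rg \<omega>)\<^sup>2" "(g (Z s \<omega>) * Rf \<omega>)\<^sup>2 \<le> K\<^sup>2 * (Rf \<omega>)\<^sup>2"
        unfolding power_mult_distrib using power_mono[OF Ks(1)[OF w], of 2] power_mono[OF Ks(4)[OF w], of 2]
        by (auto intro!: mult_right_mono)
      then show ?thesis using sq3[of "f (Z s \<omega>) * Rg \<omega>" "g (Z s \<omega>) * Rf \<omega>" "P \<omega>"] by linarith
    qed
    have R2i: "integrable M (\<lambda>\<omega>. (?R \<omega>)\<^sup>2)"
      by (rule Bochner_Integration.integrable_bound[of _ "\<lambda>\<omega>. 3 * (K\<^sup>2 * (Rg \<omega>)\<^sup>2) + 3 * (K\<^sup>2 * (Rf \<omega>)\<^sup>2) + 3 * (P \<omega>)\<^sup>2"])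
        (use R2 P2 Rle in \<open>auto intro!: AE_I2 intro: order_trans[OF _ abs_ge_self]\<close>)
    have ER: "expectation (\<lambda>\<omega>. (?R \<omega>)\<^sup>2) \<le> h * C1 h"
    proof -
      have "expectation (\<lambda>\<omega>. (?R \<omega>)\<^sup>2) \<le> expectation (\<lambda>\<omega>. 3 * (K\<^sup>2 * (Rg \<omega>)\<^sup>2) + 3 * (K\<^sup>2 * (Rf \<omega>)\<^sup>2) + 3 * (P \<omega>)\<^sup>2)"
        by (rule integral_mono[OF R2i]) (use R2 P2 Rle in auto)
      also have "\<dots> = 3 * (K\<^sup>2 * expectation (\<lambda>\<omega>. (Rg \<omega>)\<^sup>2)) + 3 * (K\<^sup>2 * expectation (\<lambda>\<omega>. (Rf \<omega>)\<^sup>2)) + 3 * expectation (\<lambda>\<omega>. (P \<omega>)\<^sup>2)"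
        using R2 P2 by simp
      also have "\<dots> \<le> 3 * (K\<^sup>2 * (h * \<eta>)) + 3 * (K\<^sup>2 * (h * \<eta>)) + 3 * (h * (2 * q h + 2 * K^4 * h))"
        using RR EP by (intro add_mono mult_left_mono) auto
      also have "\<dots> = h * C1 h" by (simp add: C1_def \<eta>_def algebra_simps)
      finally show ?thesis .
    qed
    have C10: "0 \<le> C1 h" using q0 \<eta>0 h K by (auto simp: C1_def \<eta>_def[symmetric] intro!: add_nonneg_nonneg)
    have C20: "0 \<le> C2 h" using \<rho>0 \<eta>0 h K by (auto simp: C2_def \<eta>_def[symmetric] intro!: add_nonneg_nonneg mult_nonneg_nonneg)
    have xb: "\<bar>expectation (\<lambda>\<omega>. \<xi> \<omega> * ?R \<omega>)\<bar> \<le> h * C2 h"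
      if \<xi>: "\<xi> \<in> borel_measurable (F s)" "\<And>\<omega>. \<omega> \<in> space M \<Longrightarrow> \<bar>\<xi> \<omega>\<bar> \<le> 1" for \<xi>
    proof -
      have \<xi>m[measurable]: "\<xi> \<in> borel_measurable M" using \<xi> F_meas by blast
      have K0: "0 < K" using K by simp
      have \<xi>K: "\<bar>\<xi> \<omega> * y\<bar> \<le> K" if "\<omega> \<in> space M" "\<bar>y\<bar> \<le> K" for \<omega> y
        using mult_mono[OF \<xi>(2)[OF that(1)] that(2)] K0 by (simp add: abs_mult)
      \<comment> \<open>The expansions admit test variables bounded by 1, so the coefficient is
        divided by its bound K and joined to \<open>\<xi>\<close>.\<close>
      have lin: "\<bar>expectation (\<lambda>\<omega>. \<xi> \<omega> * (k (Z s \<omega>) * Y \<omega>))\<bar> \<le> K * (h * c)"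
        if k: "continuous_on UNIV k" "\<And>\<omega>. \<omega> \<in> space M \<Longrightarrow> \<bar>k (Z s \<omega>)\<bar> \<le> K"
          and Y: "\<And>\<xi>. \<xi> \<in> borel_measurable (F s) \<Longrightarrow> (\<And>\<omega>. \<omega> \<in> space M \<Longrightarrow> \<bar>\<xi> \<omega>\<bar> \<le> 1) \<Longrightarrow> \<bar>expectation (\<lambda>\<omega>. \<xi> \<omega> * Y \<omega>)\<bar> \<le> h * c"
        for k :: "'b \<Rightarrow> real" and Y c
      proof -
        have "(\<lambda>\<omega>. \<xi> \<omega> * k (Z s \<omega>) / K) \<in> borel_measurable (F s)"
          using \<xi>(1) cont_Z_F[OF k(1) st(1)] by simp
        then have "\<bar>expectation (\<lambda>\<omega>. \<xi> \<omega> * k (Z s \<omega>) / K * Y \<omega>)\<bar> \<le> h * c"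
          by (rule Y) (use \<xi>K k(2) K0 in auto)
        moreover have "expectation (\<lambda>\<omega>. \<xi> \<omega> * (k (Z s \<omega>) * Y \<omega>)) = K * expectation (\<lambda>\<omega>. \<xi> \<omega> * k (Z s \<omega>) / K * Y \<omega>)"
          using K0 by (subst integral_mult_right_zero[symmetric]) (simp add: mult.assoc)
        ultimately show ?thesis using K0 by (simp add: abs_mult pos_divide_le_eq mult.commute)
      qed
      have e1: "\<bar>expectation (\<lambda>\<omega>. \<xi> \<omega> * (f (Z s \<omega>) * Rg \<omega>))\<bar> \<le> K * (h * cg h)"
        using G by (intro lin cont Ks) (auto simp: Rg_def h_def)
      have e2: "\<bar>expectation (\<lambda>\<omega>. \<xi> \<omega> * (g (Z s \<omega>) * Rf \<omega>))\<bar> \<le> K * (h * cf h)"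
        using F by (intro lin cont Ks) (auto simp: Rf_def h_def)
      \<comment> \<open>The leading part of \<open>P\<close> is f1 g1 (d^2 - h), whose mean is 0
        against anything known at time s.\<close>
      define b where "b \<omega> = \<xi> \<omega> * (f1 (Z s \<omega>) * g1 (Z s \<omega>))" for \<omega>
      have bF: "b \<in> borel_measurable (F s)" unfolding b_def[abs_def]
        using \<xi>(1) cont_Z_F[OF cont(2) st(1)] cont_Z_F[OF cont(5) st(1)] by simp
      have bb: "\<bar>b \<omega>\<bar> \<le> K * K" if "\<omega> \<in> space M" for \<omega>
      proof -
        have "\<bar>f1 (Z s \<omega>) * g1 (Z s \<omega>)\<bar> \<le> K * K" unfolding abs_mult using Ks[OF that] K by (intro mult_mono) auto
        then have "\<bar>\<xi> \<omega>\<bar> * \<bar>f1 (Z s \<omega>) * g1 (Z s \<omega>)\<bar> \<le> 1 * (K * K)" using \<xi>(2)[OF that] by (intro mult_mono) auto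
        then show ?thesis by (simp add: b_def abs_mult)
      qed
      have bi: "integrable M b" by (rule bdd_int[where K="K * K"]) (use bF F_meas bb in auto)
      have \<phi>i: "integrable M (\<lambda>\<omega>. (W t \<omega> - W s \<omega>)\<^sup>2 - h)" using dW_int2[OF st] by simp
      have \<phi>m: "(\<lambda>x::real. x\<^sup>2 - h) \<in> borel_measurable borel" by simp
      have b1: "integrable M (\<lambda>\<omega>. b \<omega> * ((d \<omega>)\<^sup>2 - h))" "expectation (\<lambda>\<omega>. b \<omega> * ((d \<omega>)\<^sup>2 - h)) = 0"
        using indep_mult_int[OF st bF bi \<phi>m \<phi>i] indep_mult[OF st bF bi \<phi>m \<phi>i] dW_sq_moments(2)[OF st]
        by (simp_all add: d_def h_def)
      \<comment> \<open>The weight in Young's inequality that balances a factor of second moment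
        O(h) against one of second moment at most \<open>h * \<rho> h\<close>; their product is of
        order \<open>h * sqrt (\<rho> h)\<close>.\<close>
      define r where "r = sqrt (\<rho> h)"
      have r: "0 < r" "r * r = \<rho> h" using \<rho>0 by (auto simp: r_def)
      have prod: "integrable M (\<lambda>\<omega>. \<xi> \<omega> * (X \<omega> * Y \<omega>)) \<and> \<bar>expectation (\<lambda>\<omega>. \<xi> \<omega> * (X \<omega> * Y \<omega>))\<bar> \<le> (r * x + h * \<rho> h / r) / 2"
        if [measurable]: "X \<in> borel_measurable M" "Y \<in> borel_measurable M"
          and X: "integrable M (\<lambda>\<omega>. (X \<omega>)\<^sup>2)" "expectation (\<lambda>\<omega>. (X \<omega>)\<^sup>2) \<le> x"
          and Y: "integrable M (\<lambda>\<omega>. (Y \<omega>)\<^sup>2)" "expectation (\<lambda>\<omega>. (Y \<omega>)\<^sup>2) \<le> h * \<rho> h" for X Y x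
      proof -
        have le: "\<bar>\<xi> \<omega> * (X \<omega> * Y \<omega>)\<bar> \<le> (r * (X \<omega>)\<^sup>2 + (Y \<omega>)\<^sup>2 / r) / 2" if w: "\<omega> \<in> space M" for \<omega>
        proof -
          have "\<bar>\<xi> \<omega> * (X \<omega> * Y \<omega>)\<bar> \<le> 1 * (\<bar>X \<omega>\<bar> * \<bar>Y \<omega>\<bar>)"
            unfolding abs_mult by (intro mult_right_mono \<xi>(2)[OF w]) auto
          also have "\<dots> \<le> (r * (X \<omega>)\<^sup>2 + (\<bar>Y \<omega>\<bar>)\<^sup>2 / r) / 2" using young[OF r(1), of "X \<omega>" "\<bar>Y \<omega>\<bar>"] by simp
          finally show ?thesis by simp
        qed
        have i2: "integrable M (\<lambda>\<omega>. (r * (X \<omega>)\<^sup>2 + (Y \<omega>)\<^sup>2 / r) / 2)" using X Y by simp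
        have i: "integrable M (\<lambda>\<omega>. \<xi> \<omega> * (X \<omega> * Y \<omega>))"
          by (rule Bochner_Integration.integrable_bound[OF i2]) (use le in \<open>auto intro!: AE_I2 intro: order_trans[OF _ abs_ge_self]\<close>)
        have "\<bar>expectation (\<lambda>\<omega>. \<xi> \<omega> * (X \<omega> * Y \<omega>))\<bar> \<le> expectation (\<lambda>\<omega>. \<bar>\<xi> \<omega> * (X \<omega> * Y \<omega>)\<bar>)" by (rule integral_abs_bound)
        also have "\<dots> \<le> expectation (\<lambda>\<omega>. (r * (X \<omega>)\<^sup>2 + (Y \<omega>)\<^sup>2 / r) / 2)"
          by (rule integral_mono[OF _ i2]) (use i le in auto)
        also have "\<dots> = (r * expectation (\<lambda>\<omega>. (X \<omega>)\<^sup>2) + expectation (\<lambda>\<omega>. (Y \<omega>)\<^sup>2) / r) / 2" using X Y by simp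
        also have "\<dots> \<le> (r * x + h * \<rho> h / r) / 2"
          using X(2) Y(2) r(1) by (intro divide_right_mono add_mono mult_left_mono) auto
        finally show ?thesis using i by blast
      qed
      have hr: "h * \<rho> h / r = h * r" using r(1) unfolding r(2)[symmetric] by simp
      have f1d: "integrable M (\<lambda>\<omega>. (f1 (Z s \<omega>) * d \<omega>)\<^sup>2)" "expectation (\<lambda>\<omega>. (f1 (Z s \<omega>) * d \<omega>)\<^sup>2) \<le> K\<^sup>2 * h"
        and g1d: "integrable M (\<lambda>\<omega>. (g1 (Z s \<omega>) * d \<omega>)\<^sup>2)" "expectation (\<lambda>\<omega>. (g1 (Z s \<omega>) * d \<omega>)\<^sup>2) \<le> K\<^sup>2 * h"
      proof -
        have gen: "integrable M (\<lambda>\<omega>. (k (Z s \<omega>) * d \<omega>)\<^sup>2) \<and> expectation (\<lambda>\<omega>. (k (Z s \<omega>) * d \<omega>)\<^sup>2) \<le> K\<^sup>2 * h"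
          if [measurable]: "(\<lambda>\<omega>. k (Z s \<omega>)) \<in> borel_measurable M" and kb: "\<And>\<omega>. \<omega> \<in> space M \<Longrightarrow> \<bar>k (Z s \<omega>)\<bar> \<le> K" for k :: "'b \<Rightarrow> real"
        proof -
          have le: "(k (Z s \<omega>) * d \<omega>)\<^sup>2 \<le> K\<^sup>2 * (d \<omega>)\<^sup>2" if "\<omega> \<in> space M" for \<omega>
            using power_mono[OF kb[OF that], of 2] by (simp add: power_mult_distrib mult_right_mono)
          have i: "integrable M (\<lambda>\<omega>. (k (Z s \<omega>) * d \<omega>)\<^sup>2)"
            by (rule Bochner_Integration.integrable_bound[of _ "\<lambda>\<omega>. K\<^sup>2 * (d \<omega>)\<^sup>2"]) (use le d2 in \<open>auto intro!: AE_I2\<close>)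
          have "expectation (\<lambda>\<omega>. (k (Z s \<omega>) * d \<omega>)\<^sup>2) \<le> expectation (\<lambda>\<omega>. K\<^sup>2 * (d \<omega>)\<^sup>2)"
            by (rule integral_mono[OF i]) (use le d2 in auto)
          then show ?thesis using i d2 by simp
        qed
        show "integrable M (\<lambda>\<omega>. (f1 (Z s \<omega>) * d \<omega>)\<^sup>2)" "expectation (\<lambda>\<omega>. (f1 (Z s \<omega>) * d \<omega>)\<^sup>2) \<le> K\<^sup>2 * h"
          "integrable M (\<lambda>\<omega>. (g1 (Z s \<omega>) * d \<omega>)\<^sup>2)" "expectation (\<lambda>\<omega>. (g1 (Z s \<omega>) * d \<omega>)\<^sup>2) \<le> K\<^sup>2 * h"
          using gen[OF zm(2) Ks(2)] gen[OF zm(5) Ks(5)] by auto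
      qed
      have Dg2: "integrable M (\<lambda>\<omega>. (Dg \<omega>)\<^sup>2)" "expectation (\<lambda>\<omega>. (Dg \<omega>)\<^sup>2) \<le> 2 * (K\<^sup>2 * h) + 2 * (h * \<rho> h)"
      proof -
        have le: "(Dg \<omega>)\<^sup>2 \<le> 2 * (g1 (Z s \<omega>) * d \<omega>)\<^sup>2 + 2 * (vg \<omega>)\<^sup>2" for \<omega> unfolding Dg by (rule sq)
        show i: "integrable M (\<lambda>\<omega>. (Dg \<omega>)\<^sup>2)"
          by (rule Bochner_Integration.integrable_bound[of _ "\<lambda>\<omega>. 2 * (g1 (Z s \<omega>) * d \<omega>)\<^sup>2 + 2 * (vg \<omega>)\<^sup>2"]) (use le g1d vg in \<open>auto intro!: AE_I2\<close>)
        have "expectation (\<lambda>\<omega>. (Dg \<omega>)\<^sup>2) \<le> expectation (\<lambda>\<omega>. 2 * (g1 (Z s \<omega>) * d \<omega>)\<^sup>2 + 2 * (vg \<omega>)\<^sup>2)"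
          by (rule integral_mono[OF i]) (use le g1d vg in auto)
        also have "\<dots> = 2 * expectation (\<lambda>\<omega>. (g1 (Z s \<omega>) * d \<omega>)\<^sup>2) + 2 * expectation (\<lambda>\<omega>. (vg \<omega>)\<^sup>2)" using g1d vg by simp
        also have "\<dots> \<le> 2 * (K\<^sup>2 * h) + 2 * (h * \<rho> h)" using g1d(2) vg(2) by (intro add_mono mult_left_mono) auto
        finally show "expectation (\<lambda>\<omega>. (Dg \<omega>)\<^sup>2) \<le> 2 * (K\<^sup>2 * h) + 2 * (h * \<rho> h)" .
      qed
      have p1: "integrable M (\<lambda>\<omega>. \<xi> \<omega> * ((f1 (Z s \<omega>) * d \<omega>) * vg \<omega>))"
        "\<bar>expectation (\<lambda>\<omega>. \<xi> \<omega> * ((f1 (Z s \<omega>) * d \<omega>) * vg \<omega>))\<bar> \<le> (r * (K\<^sup>2 * h) + h * r) / 2"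
        using prod[OF _ _ f1d vg] unfolding hr by auto
      have p2: "integrable M (\<lambda>\<omega>. \<xi> \<omega> * (Dg \<omega> * vf \<omega>))"
        "\<bar>expectation (\<lambda>\<omega>. \<xi> \<omega> * (Dg \<omega> * vf \<omega>))\<bar> \<le> (r * (2 * (K\<^sup>2 * h) + 2 * (h * \<rho> h)) + h * r) / 2"
        using prod[OF _ _ Dg2 vf] unfolding hr by auto
      \<comment> \<open>\<open>Df\<close> is expanded in both of its parts, \<open>Dg\<close> only
        where it multiplies the Wiener part of \<open>Df\<close>.\<close>
      have Pdec: "\<xi> \<omega> * P \<omega> = b \<omega> * ((d \<omega>)\<^sup>2 - h) + \<xi> \<omega> * ((f1 (Z s \<omega>) * d \<omega>) * vg \<omega>) + \<xi> \<omega> * (Dg \<omega> * vf \<omega>)" for \<omega>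
        by (simp add: P_def Df b_def power2_eq_square algebra_simps) (simp add: Dg algebra_simps)
      have EPb: "\<bar>expectation (\<lambda>\<omega>. \<xi> \<omega> * P \<omega>)\<bar> \<le> (r * (K\<^sup>2 * h) + h * r) / 2 + (r * (2 * (K\<^sup>2 * h) + 2 * (h * \<rho> h)) + h * r) / 2"
      proof -
        have "expectation (\<lambda>\<omega>. \<xi> \<omega> * P \<omega>) = expectation (\<lambda>\<omega>. \<xi> \<omega> * ((f1 (Z s \<omega>) * d \<omega>) * vg \<omega>)) + expectation (\<lambda>\<omega>. \<xi> \<omega> * (Dg \<omega> * vf \<omega>))"
          unfolding Pdec using b1 p1(1) p2(1) by simp
        then show ?thesis using p1(2) p2(2) by linarith
      qed
      have i: "integrable M (\<lambda>\<omega>. \<xi> \<omega> * (f (Z s \<omega>) * Rg \<omega>))" "integrable M (\<lambda>\<omega>. \<xi> \<omega> * (g (Z s \<omega>) * Rf \<omega>))" "integrable M (\<lambda>\<omega>. \<xi> \<omega> * P \<omega>)"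
        using sq_int_imp_int[OF rm(1) R2(1)] sq_int_imp_int[OF rm(2) R2(3)] sq_int_imp_int[OF Pm P2]
        by (auto intro!: bdd_mult_int[OF \<xi>m \<xi>(2)] bdd_mult_int[OF zm(1) Ks(1)] bdd_mult_int[OF zm(4) Ks(4)])
      have "expectation (\<lambda>\<omega>. \<xi> \<omega> * ?R \<omega>) = expectation (\<lambda>\<omega>. \<xi> \<omega> * (f (Z s \<omega>) * Rg \<omega>)) + expectation (\<lambda>\<omega>. \<xi> \<omega> * (g (Z s \<omega>) * Rf \<omega>)) + expectation (\<lambda>\<omega>. \<xi> \<omega> * P \<omega>)"
        unfolding distrib_left using i by simp
      then have "\<bar>expectation (\<lambda>\<omega>. \<xi> \<omega> * ?R \<omega>)\<bar> \<le> K * (h * cg h) + K * (h * cf h) + ((r * (K\<^sup>2 * h) + h * r) / 2 + (r * (2 * (K\<^sup>2 * h) + 2 * (h * \<rho> h)) + h * r) / 2)"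
        using e1 e2 EPb by linarith
      also have "\<dots> = h * (K * \<eta> + r * (K\<^sup>2 * (3/2) + \<rho> h + 1))"
        by (simp add: \<eta>_def field_simps)
      also have "\<dots> \<le> h * C2 h"
      proof (intro mult_left_mono)
        have "K * \<eta> \<le> 2 * K * \<eta>" using K \<eta>0 by simp
        moreover have "r * (K\<^sup>2 * (3/2) + \<rho> h + 1) \<le> r * (2 * K\<^sup>2 + 2 * \<rho> h + 1)"
          using r(1) \<rho>0 by (intro mult_left_mono add_mono) auto
        moreover have "0 \<le> K * r" using K r by simp
        ultimately show "K * \<eta> + r * (K\<^sup>2 * (3/2) + \<rho> h + 1) \<le> C2 h" unfolding C2_def \<eta>_def r_def by linarith
      qed (use h in simp)
      finally show ?thesis .
    qed
    have le: "h * C1 h \<le> h * (C1 h + C2 h)" "h * C2 h \<le> h * (C1 h + C2 h)" using h C10 C20 by auto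
    show ?thesis unfolding rem h_def[symmetric]
      using R2i order_trans[OF ER le(1)] order_trans[OF xb le(2)] by blast
  qed
  moreover have "continuous_on UNIV ?p" "continuous_on UNIV ?p1" "continuous_on UNIV ?p2"
    using cont by (auto intro!: continuous_intros)
  ultimately show ?thesis unfolding ito_fun_def using lim
    by (intro conjI exI[of _ "\<lambda>h. C1 h + C2 h"]) blast+
qed

text \<open>Polynomials arise from linear functions by sums and products. For the generator G and
  the derivation B one has G(fg) = f G g + g G f + (B f)(B g), which is the drift produced by
  \<open>ito_mult\<close>.\<close>

lemma ito_poly:
  assumes "real_polynomial_function f"
  shows "ito_fun T f (lie_deriv LB f) (generator LA LB f)"
  using assms
proof (induction f rule: real_polynomial_function.induct)
  case (linear f)
  have d: "lie_deriv LB f = (\<lambda>z. f (LB z))" using linear by (intro ext lie_deriv_linear)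
  have "generator LA LB f = (\<lambda>z. f (drift z))"
    using linear bounded_linear_compose[OF linear LB]
    by (auto simp: generator_def d lie_deriv_linear drift_def linear_simps intro!: ext)
  then show ?case using ito_linear[OF linear] d by simp
next
  case (const c)
  have "lie_deriv LB (\<lambda>z. c) = (\<lambda>z. 0)" "generator LA LB (\<lambda>z. c) = (\<lambda>z. 0)"
    by (auto simp: generator_def fun_eq_iff lie_deriv_const[abs_def])
  then show ?case using ito_const by simp
next
  case (add f g)
  have d: "lie_deriv LB (\<lambda>z. f z + g z) = (\<lambda>z. lie_deriv LB f z + lie_deriv LB g z)"
    using add.hyps by (intro ext lie_deriv_add)
  have "generator LA LB (\<lambda>z. f z + g z) = (\<lambda>z. generator LA LB f z + generator LA LB g z)"
    using add.hyps LB by (intro ext) (simp add: generator_def d lie_deriv_add lie_deriv_poly field_simps)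
  then show ?case using ito_add[OF add.IH] d by simp
next
  case (mult f g)
  have d: "lie_deriv LB (\<lambda>z. f z * g z) = (\<lambda>z. f z * lie_deriv LB g z + lie_deriv LB f z * g z)"
    using mult.hyps by (intro ext lie_deriv_mult)
  have "generator LA LB (\<lambda>z. f z * g z) = (\<lambda>z. f z * generator LA LB g z + generator LA LB f z * g z + lie_deriv LB f z * lie_deriv LB g z)"
    using mult.hyps LB
    by (intro ext) (simp add: generator_def d lie_deriv_add lie_deriv_mult lie_deriv_poly real_polynomial_function.intros field_simps)
  then show ?case using ito_mult[OF mult.IH] d by simp
qed

lemma poly_cont: "real_polynomial_function f \<Longrightarrow> continuous_on UNIV f"
  for f :: "'c::real_normed_vector \<Rightarrow> real"
  by (simp add: continuous_on_polymonial_function real_polynomial_function_eq)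

lemma expectation_cont:
  assumes "continuous_on UNIV (f :: 'b \<Rightarrow> real)"
  shows "continuous_on {0..} (\<lambda>t. expectation (\<lambda>\<omega>. f (Z t \<omega>)))"
proof (rule continuous_on_sequentiallyI)
  fix u :: "nat \<Rightarrow> real" and a
  assume u: "\<forall>n. u n \<in> {0..}" and a: "a \<in> {0..}" and ua: "u \<longlonglongrightarrow> a"
  obtain K where K: "0 \<le> K" "\<And>t \<omega>. 0 \<le> t \<Longrightarrow> \<omega> \<in> space M \<Longrightarrow> \<bar>f (Z t \<omega>)\<bar> \<le> K"
    using cont_Z_bd_nonneg[OF assms] by blast
  show "(\<lambda>n. expectation (\<lambda>\<omega>. f (Z (u n) \<omega>))) \<longlonglongrightarrow> expectation (\<lambda>\<omega>. f (Z a \<omega>))"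
  proof (rule integral_dominated_convergence[where w="\<lambda>_. K"])
    show "AE \<omega> in M. (\<lambda>n. f (Z (u n) \<omega>)) \<longlonglongrightarrow> f (Z a \<omega>)"
      using Z_cont unfolding continuous_process_def
    proof eventually_elim
      fix \<omega> assume c: "continuous_on {0..} (\<lambda>t. Z t \<omega>)"
      have "(\<lambda>n. Z (u n) \<omega>) \<longlonglongrightarrow> Z a \<omega>"
        using continuous_on_tendsto_compose[OF c ua a] u by simp
      then show "(\<lambda>n. f (Z (u n) \<omega>)) \<longlonglongrightarrow> f (Z a \<omega>)"
        using continuous_on_tendsto_compose[OF assms] by simp
    qed
  qed (use u a K cont_Z_meas[OF assms] in auto)
qed

text \<open>Tested against the constant 1 the remainder is o(h), and the Wiener term has mean 0. To
  the left of t the expansion starts at y < t with the rate at y, and continuity of the rate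
  replaces it by the rate at t.\<close>

theorem expectation_derivative:
  assumes f: "real_polynomial_function f" and t: "0 \<le> t"
  shows "((\<lambda>t. expectation (\<lambda>\<omega>. f (Z t \<omega>))) has_real_derivative expectation (\<lambda>\<omega>. generator LA LB f (Z t \<omega>))) (at t within {0..})"
proof -
  define \<phi> where "\<phi> t = expectation (\<lambda>\<omega>. f (Z t \<omega>))" for t
  define \<psi> where "\<psi> t = expectation (\<lambda>\<omega>. generator LA LB f (Z t \<omega>))" for t
  have gp: "real_polynomial_function (generator LA LB f)" by (intro generator_poly LA LB f)
  have lp: "real_polynomial_function (lie_deriv LB f)" by (intro lie_deriv_poly LB f)
  \<comment> \<open>The expansions are uniform on bounded time intervals; the additional unit leaves
    room for increments to the right of t.\<close>
  define T where "T = t + 1"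
  obtain c where c: "(c \<longlongrightarrow> 0) (at_right 0)" and R': "\<And>s t. 0 \<le> s \<and> s < t \<and> t \<le> T \<Longrightarrow>
        integrable M (\<lambda>\<omega>. (remainder f (lie_deriv LB f) (generator LA LB f) s t \<omega>)\<^sup>2) \<and>
        expectation (\<lambda>\<omega>. (remainder f (lie_deriv LB f) (generator LA LB f) s t \<omega>)\<^sup>2) \<le> (t - s) * c (t - s) \<and>
        (\<forall>\<xi>. \<xi> \<in> borel_measurable (F s) \<and> (\<forall>\<omega>\<in>space M. \<bar>\<xi> \<omega>\<bar> \<le> 1) \<longrightarrow>
          \<bar>expectation (\<lambda>\<omega>. \<xi> \<omega> * remainder f (lie_deriv LB f) (generator LA LB f) s t \<omega>)\<bar> \<le> (t - s) * c (t - s))"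
    using ito_poly[OF f, of T] unfolding ito_fun_def by blast
  have est: "\<bar>\<phi> r - \<phi> s - (r - s) * \<psi> s\<bar> \<le> (r - s) * c (r - s)" if sr: "0 \<le> s \<and> s < r \<and> r \<le> T" for s r
  proof -
    have s: "0 \<le> s" "s < r" and r: "0 \<le> r" using sr by auto
    have int: "integrable M (\<lambda>\<omega>. k (Z u \<omega>))" if k: "real_polynomial_function k" "0 \<le> u" for k u
    proof -
      obtain K where K: "\<forall>t\<ge>0. \<forall>\<omega>\<in>space M. \<bar>k (Z t \<omega>)\<bar> \<le> K" using cont_Z_bd[OF poly_cont[OF k(1)]] by blast
      show ?thesis by (rule bdd_int[where K=K]) (use K k cont_Z_meas[OF poly_cont] in auto)
    qed
    have id: "(\<lambda>x. x) \<in> borel_measurable (borel :: real measure)" by simp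
    note ind = indep_mult_int[OF s cont_Z_F[OF poly_cont[OF lp] s(1)] int[OF lp s(1)] id dW_int1[OF s]]
      indep_mult[OF s cont_Z_F[OF poly_cont[OF lp] s(1)] int[OF lp s(1)] id dW_int1[OF s]]
    have "expectation (remainder f (lie_deriv LB f) (generator LA LB f) s r) = \<phi> r - \<phi> s - (r - s) * \<psi> s"
      unfolding remainder_def[abs_def] \<phi>_def \<psi>_def
      using int[OF f r] int[OF f s(1)] int[OF gp s(1)] ind dW_1[OF s] by (simp add: mult.commute)
    moreover have "\<bar>expectation (\<lambda>\<omega>. 1 * remainder f (lie_deriv LB f) (generator LA LB f) s r \<omega>)\<bar> \<le> (r - s) * c (r - s)"
      using R'[OF sr, THEN conjunct2, THEN conjunct2, rule_format, of "\<lambda>_. 1"] by simp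
    ultimately show ?thesis by simp
  qed
  have "(\<phi> has_derivative (\<lambda>h. h * \<psi> t)) (at t within {0..})"
    unfolding has_derivative_within_alt
  proof (intro conjI allI impI)
    show "bounded_linear (\<lambda>h. h * \<psi> t)" by (rule bounded_linear_mult_left)
    fix e :: real assume e: "0 < e"
    define e2 where "e2 = e / 2"
    have e2: "0 < e2" using e by (simp add: e2_def)
    have "eventually (\<lambda>h. c h < e2) (at_right 0)" using order_tendstoD(2)[OF c e2] .
    then obtain d1 where d1: "0 < d1" "\<And>h. 0 < h \<Longrightarrow> h < d1 \<Longrightarrow> c h < e2"
      unfolding eventually_at_right_field by blast
    have "continuous_on {0..} \<psi>" unfolding \<psi>_def by (rule expectation_cont[OF poly_cont[OF gp]])
    then obtain d2 where d2: "0 < d2" "\<And>y. 0 \<le> y \<Longrightarrow> dist y t < d2 \<Longrightarrow> dist (\<psi> y) (\<psi> t) < e2"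
      using t e2 unfolding continuous_on_iff by (metis atLeast_iff)
    show "\<exists>d>0. \<forall>y\<in>{0..}. norm (y - t) < d \<longrightarrow> norm (\<phi> y - \<phi> t - (y - t) * \<psi> t) \<le> e * norm (y - t)"
    proof (intro exI conjI ballI impI)
      show "0 < min 1 (min d1 d2)" using d1 d2 by simp
      fix y assume y: "y \<in> {0..}" "norm (y - t) < min 1 (min d1 d2)"
      consider "y = t" | "t < y" | "y < t" by linarith
      then show "norm (\<phi> y - \<phi> t - (y - t) * \<psi> t) \<le> e * norm (y - t)"
      proof cases
        case 2
        have "\<bar>\<phi> y - \<phi> t - (y - t) * \<psi> t\<bar> \<le> (y - t) * c (y - t)"
          using 2 y t by (intro est) (auto simp: T_def)
        also have "\<dots> \<le> (y - t) * e" using 2 y d1(2)[of "y - t"] e by (intro mult_left_mono) (auto simp: e2_def)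
        finally show ?thesis using 2 by (simp add: mult.commute)
      next
        case 3
        have a: "\<bar>\<phi> t - \<phi> y - (t - y) * \<psi> y\<bar> \<le> (t - y) * c (t - y)"
          using 3 y t by (intro est) (auto simp: T_def)
        have b: "(t - y) * c (t - y) \<le> (t - y) * e2" using 3 y d1(2)[of "t - y"] by (intro mult_left_mono) auto
        have "\<bar>(t - y) * (\<psi> y - \<psi> t)\<bar> \<le> (t - y) * e2"
          unfolding abs_mult using 3 y d2(2)[of y] by (intro mult_mono) (auto simp: dist_real_def)
        moreover have "\<phi> y - \<phi> t - (y - t) * \<psi> t = - (\<phi> t - \<phi> y - (t - y) * \<psi> y) - (t - y) * (\<psi> y - \<psi> t)"
          by (simp add: algebra_simps)
        ultimately have "\<bar>\<phi> y - \<phi> t - (y - t) * \<psi> t\<bar> \<le> (t - y) * e2 + (t - y) * e2" using a b by linarith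
        also have "\<dots> = e * \<bar>y - t\<bar>" using 3 by (simp add: e2_def)
        finally show ?thesis by simp
      qed simp
    qed
  qed
  moreover have "(\<lambda>h. h * \<psi> t) = (*) (\<psi> t)" by (auto simp: mult.commute)
  ultimately show ?thesis unfolding has_field_derivative_def \<phi>_def \<psi>_def by simp
qed

lemma Z_0: "AE \<omega> in M. Z 0 \<omega> = x"
proof -
  obtain I where I: "has_stratonovich_integral M (\<lambda>s \<omega>. LB (Z s \<omega>)) W 0 I"
    and eq: "AE \<omega> in M. Z 0 \<omega> = x + integral {0..0} (\<lambda>s. LA (Z s \<omega>)) + I \<omega>" using Z_eq[of 0] by auto
  have Im[measurable]: "I \<in> borel_measurable M" using I by (simp add: has_stratonovich_integral_def)
  have "prob {\<omega> \<in> space M. norm (I \<omega>) > \<epsilon>} = 0" if "0 < \<epsilon>" for \<epsilon>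
  proof (rule ccontr)
    assume "prob {\<omega> \<in> space M. norm (I \<omega>) > \<epsilon>} \<noteq> 0"
    then have p: "0 < prob {\<omega> \<in> space M. norm (I \<omega>) > \<epsilon>}" by (simp add: zero_less_measure_iff)
    from I[unfolded has_stratonovich_integral_def, THEN conjunct2, rule_format, OF that p]
    obtain \<delta> where "\<And>n \<pi>. partition_of 0 n \<pi> \<and> (\<forall>i<n. \<pi> (Suc i) - \<pi> i < \<delta>) \<Longrightarrow>
      prob {\<omega> \<in> space M. norm (stratonovich_sum (\<lambda>s \<omega>. LB (Z s \<omega>)) W n \<pi> \<omega> - I \<omega>) > \<epsilon>} < prob {\<omega> \<in> space M. norm (I \<omega>) > \<epsilon>}" by blast
    \<comment> \<open>The partition of [0, 0] without cells is admissible for every mesh and its sum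
      is 0, so the integral at time 0 vanishes almost surely.\<close>
    from this[of 0 "\<lambda>_. 0"] show False by (simp add: partition_of_def stratonovich_sum_def)
  qed
  then have "AE \<omega> in M. \<omega> \<notin> {\<omega> \<in> space M. norm (I \<omega>) > inverse (real (Suc n))}" for n
  proof -
    have m: "{\<omega> \<in> space M. norm (I \<omega>) > inverse (real (Suc n))} \<in> events" by measurable
    have "prob {\<omega> \<in> space M. norm (I \<omega>) > inverse (real (Suc n))} = 0"
      if "\<And>\<epsilon>. 0 < \<epsilon> \<Longrightarrow> prob {\<omega> \<in> space M. norm (I \<omega>) > \<epsilon>} = 0"
      by (rule that) simp
    then show ?thesis using prob_eq_0[OF m] \<open>\<And>\<epsilon>. 0 < \<epsilon> \<Longrightarrow> prob {\<omega> \<in> space M. norm (I \<omega>) > \<epsilon>} = 0\<close> by blast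
  qed
  then have "AE \<omega> in M. \<not> norm (I \<omega>) > inverse (real (Suc n))" for n
    using AE_space by eventually_elim auto
  then have "AE \<omega> in M. \<forall>n. \<not> norm (I \<omega>) > inverse (real (Suc n))"
    unfolding AE_all_countable by blast
  then show ?thesis using eq
  proof eventually_elim
    case (elim \<omega>)
    have "norm (I \<omega>) \<le> 0"
    proof (rule ccontr)
      assume "\<not> norm (I \<omega>) \<le> 0"
      then obtain n where "inverse (real (Suc n)) < norm (I \<omega>)" using reals_Archimedean[of "norm (I \<omega>)"] by auto
      then show False using elim(1) by auto
    qed
    then show ?case using elim(2) by simp
  qed
qed

end

section \<open>Linear vector fields acting on polynomials\<close>

lemma poly_const: "real_polynomial_function (\<lambda>z. c)"
  by (rule real_polynomial_function.intros)

lemma poly_add: "real_polynomial_function f \<Longrightarrow> real_polynomial_function g \<Longrightarrow> real_polynomial_function (\<lambda>z. f z + g z)"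
  by (rule real_polynomial_function.intros)

lemma poly_mult: "real_polynomial_function f \<Longrightarrow> real_polynomial_function g \<Longrightarrow> real_polynomial_function (\<lambda>z. f z * g z)"
  by (rule real_polynomial_function.intros)

lemma poly_cmult: "real_polynomial_function f \<Longrightarrow> real_polynomial_function (\<lambda>z. c * f z)"
  by (intro poly_mult poly_const)

lemma lie_deriv_sum:
  "finite I \<Longrightarrow> (\<And>i. i \<in> I \<Longrightarrow> real_polynomial_function (f i)) \<Longrightarrow>
    lie_deriv L (\<lambda>z. \<Sum>i\<in>I. f i z) z = (\<Sum>i\<in>I. lie_deriv L (f i) z)"
proof (induction I rule: finite_induct)
  case (insert i I)
  have "real_polynomial_function (\<lambda>z. \<Sum>i\<in>I. f i z)" using insert by (intro real_polynomial_function_sum) auto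
  then show ?case using insert by (simp add: lie_deriv_add)
qed simp

lemma lie_deriv_comb:
  assumes "real_polynomial_function f"
  shows "lie_deriv (\<lambda>z. a *\<^sub>R L1 z + b *\<^sub>R L2 z) f z = a * lie_deriv L1 f z + b * lie_deriv L2 f z"
proof -
  interpret bounded_linear "frechet_derivative f (at z)"
    using has_derivative_poly[OF assms] by (rule has_derivative_bounded_linear)
  show ?thesis by (simp add: lie_deriv_def add scaleR)
qed

text \<open>Passing from linear maps to derivations of functions reverses commutators. In the
  product case the mixed terms of the product rule cancel, so induction over polynomials
  suffices.\<close>

lemma lie_deriv_commutator:
  assumes L: "bounded_linear L1" "bounded_linear L2" and f: "real_polynomial_function f"
  shows "lie_deriv L1 (lie_deriv L2 f) z - lie_deriv L2 (lie_deriv L1 f) z = lie_deriv (\<lambda>z. L2 (L1 z) - L1 (L2 z)) f z"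
  using f
proof (induction f rule: real_polynomial_function.induct)
  case (linear f)
  have "lie_deriv L f = (\<lambda>z. f (L z))" for L using linear by (intro ext lie_deriv_linear)
  then show ?case
    using linear bounded_linear_compose[OF linear L(1)] bounded_linear_compose[OF linear L(2)]
    by (simp add: lie_deriv_linear linear_simps)
next
  case (const c)
  have "lie_deriv L (\<lambda>z. c) = (\<lambda>z. 0)" for L :: "'a \<Rightarrow> 'a" by (intro ext lie_deriv_const)
  then show ?case by simp
next
  case (add f g)
  have "lie_deriv L (\<lambda>z. f z + g z) = (\<lambda>z. lie_deriv L f z + lie_deriv L g z)" for L
    using add.hyps by (intro ext lie_deriv_add)
  then show ?case using add L by (simp add: lie_deriv_add lie_deriv_poly)
next
  case (mult f g)
  have d: "lie_deriv L (\<lambda>z. f z * g z) = (\<lambda>z. f z * lie_deriv L g z + lie_deriv L f z * g z)" for L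
    using mult.hyps by (intro ext lie_deriv_mult)
  have "lie_deriv L1 (lie_deriv L2 (\<lambda>z. f z * g z)) z - lie_deriv L2 (lie_deriv L1 (\<lambda>z. f z * g z)) z =
    f z * (lie_deriv L1 (lie_deriv L2 g) z - lie_deriv L2 (lie_deriv L1 g) z) +
    (lie_deriv L1 (lie_deriv L2 f) z - lie_deriv L2 (lie_deriv L1 f) z) * g z"
    unfolding d using mult.hyps L
    by (simp add: lie_deriv_add lie_deriv_mult lie_deriv_poly real_polynomial_function.intros algebra_simps)
  then show ?case unfolding mult.IH d by simp
qed

lemma real_polynomial_function_compose_linear:
  assumes "real_polynomial_function f" "bounded_linear L"
  shows "real_polynomial_function (\<lambda>z. f (L z))"
  using assms(1)
proof (induction f rule: real_polynomial_function.induct)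
  case (linear f)
  then show ?case by (intro real_polynomial_function.intros(1) bounded_linear_compose[OF _ assms(2)])
next
  case (const c)
  show ?case by (rule poly_const)
next
  case (add f g)
  show ?case by (rule poly_add[OF add.IH])
next
  case (mult f g)
  show ?case by (rule poly_mult[OF mult.IH])
qed

lemma lie_deriv_compose_linear:
  assumes f: "real_polynomial_function f" and P: "bounded_linear P"
  shows "lie_deriv L (\<lambda>z. f (P z)) z = frechet_derivative f (at (P z)) (P (L z))"
proof (rule lie_deriv_eqI)
  have "(P has_derivative P) (at z)" by (rule bounded_linear_imp_has_derivative[OF P])
  from diff_chain_at[OF this has_derivative_poly[OF f]]
  show "((\<lambda>z. f (P z)) has_derivative (\<lambda>v. frechet_derivative f (at (P z)) (P v))) (at z)"
    by (simp add: o_def)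
qed

lemma bounded_linear_matrix_left: "bounded_linear (\<lambda>z::real^3^3. X ** z)" for X :: "real^3^3"
  by (rule linear_conv_bounded_linear[THEN iffD1], rule linearI)
    (simp_all add: matrix_add_ldistrib matrix_scalar_ac scalar_matrix_assoc[symmetric])

lemma matrix_add_rdistrib: "(X + Y) ** z = X ** z + Y ** z" for X :: "real^3^3"
  by (simp add: matrix_matrix_mult_def vec_eq_iff sum.distrib distrib_right)

lemma bounded_linear_matrix_right: "bounded_linear (\<lambda>z::real^3^3. z ** X)" for X :: "real^3^3"
  by (rule linear_conv_bounded_linear[THEN iffD1], rule linearI)
    (simp_all add: matrix_add_rdistrib scalar_matrix_assoc[symmetric])

abbreviation lie :: "real^3^3 \<Rightarrow> (real^3^3 \<Rightarrow> real) \<Rightarrow> real^3^3 \<Rightarrow> real" where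
  "lie X f \<equiv> lie_deriv (\<lambda>z. X ** z) f"

lemma lie_poly [intro]: "real_polynomial_function f \<Longrightarrow> real_polynomial_function (lie X f)"
  by (intro lie_deriv_poly bounded_linear_matrix_left)

lemma lie_comb:
  assumes "real_polynomial_function f"
  shows "lie (a *\<^sub>R X + b *\<^sub>R Y) f z = a * lie X f z + b * lie Y f z"
proof -
  have eq: "(a *\<^sub>R X + b *\<^sub>R Y) ** z = a *\<^sub>R (X ** z) + b *\<^sub>R (Y ** z)" for z :: "real^3^3"
    by (simp add: matrix_add_rdistrib scalar_matrix_assoc)
  show ?thesis unfolding eq by (rule lie_deriv_comb[OF assms])
qed

lemma lie_commutator:
  assumes "real_polynomial_function f"
  shows "lie X (lie Y f) z - lie Y (lie X f) z = lie (Y ** X - X ** Y) f z"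
proof -
  have eq: "(Y ** X - X ** Y) ** z = Y ** (X ** z) - X ** (Y ** z)" for z :: "real^3^3"
  proof -
    have "(Y ** X - X ** Y) ** z + (X ** Y) ** z = (Y ** X) ** z"
      using matrix_add_rdistrib[of "Y ** X - X ** Y" "X ** Y" z] by simp
    then show ?thesis by (simp add: matrix_mul_assoc algebra_simps)
  qed
  show ?thesis unfolding eq
    by (rule lie_deriv_commutator[OF bounded_linear_matrix_left bounded_linear_matrix_left assms])
qed

section \<open>Monomials in the matrix entries\<close>

text \<open>Monomials are indexed by words of index pairs, so the same function occurs once for each
  ordering of its factors. These repetitions are the multinomial coefficients that make the sum in
  \<open>monomial_kernel\<close> a pure power.\<close>

fun mon :: "(3 \<times> 3) list \<Rightarrow> real^3^3 \<Rightarrow> real" where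
  "mon [] z = 1"
| "mon ((i, j) # l) z = z $ i $ j * mon l z"

lemma bounded_linear_entry: "bounded_linear (\<lambda>z::real^3^3. z $ i $ j)"
  by (rule bounded_linear_compose[OF bounded_linear_vec_nth bounded_linear_vec_nth])

lemma mon_poly: "real_polynomial_function (mon l)"
proof (induction l)
  case Nil
  have "mon [] = (\<lambda>z. 1)" by auto
  then show ?case by (simp add: real_polynomial_function.intros)
next
  case (Cons p l)
  obtain i j where p: "p = (i, j)" by fastforce
  have "mon (p # l) = (\<lambda>z. z $ i $ j * mon l z)" by (auto simp: p)
  then show ?case using Cons bounded_linear_entry by (simp add: real_polynomial_function.intros)
qed

lemma mon_append: "mon (l @ l') z = mon l z * mon l' z"
  by (induction l) auto

inductive mon_span :: "(real^3^3 \<Rightarrow> real) \<Rightarrow> bool" where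
  mon: "mon_span (mon l)"
| add: "mon_span f \<Longrightarrow> mon_span g \<Longrightarrow> mon_span (\<lambda>z. f z + g z)"
| scale: "mon_span f \<Longrightarrow> mon_span (\<lambda>z. c * f z)"

lemma mon_span_poly: "mon_span f \<Longrightarrow> real_polynomial_function f"
proof (induction rule: mon_span.induct)
  case (mon l)
  show ?case by (rule mon_poly)
next
  case (add f g)
  show ?case by (rule poly_add[OF add.IH])
next
  case (scale f c)
  show ?case by (rule poly_cmult[OF scale.IH])
qed

lemma mon_span_mon_mult: "mon_span g \<Longrightarrow> mon_span (\<lambda>z. mon l z * g z)"
proof (induction rule: mon_span.induct)
  case (mon l')
  have "(\<lambda>z. mon l z * mon l' z) = mon (l @ l')" by (auto simp: mon_append)
  then show ?case by (simp add: mon_span.mon)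
next
  case (add f g)
  then show ?case using mon_span.add[of "\<lambda>z. mon l z * f z" "\<lambda>z. mon l z * g z"] by (simp add: distrib_left)
next
  case (scale f c)
  then show ?case using mon_span.scale[of "\<lambda>z. mon l z * f z" c] by (simp add: mult.left_commute)
qed

lemma mon_span_mult: "mon_span f \<Longrightarrow> mon_span g \<Longrightarrow> mon_span (\<lambda>z. f z * g z)"
proof (induction rule: mon_span.induct)
  case (mon l)
  then show ?case by (rule mon_span_mon_mult)
next
  case (add f f')
  then show ?case using mon_span.add[of "\<lambda>z. f z * g z" "\<lambda>z. f' z * g z"] by (simp add: distrib_right)
next
  case (scale f c)
  then show ?case using mon_span.scale[of "\<lambda>z. f z * g z" c] by (simp add: mult.assoc)
qed

lemma mon_span_const: "mon_span (\<lambda>z. c)"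
  using mon_span.scale[OF mon_span.mon[of "[]"], of c] by simp

lemma mon_span_sum: "finite I \<Longrightarrow> (\<And>i. i \<in> I \<Longrightarrow> mon_span (f i)) \<Longrightarrow> mon_span (\<lambda>z. \<Sum>i\<in>I. f i z)"
proof (induction I rule: finite_induct)
  case empty
  show ?case using mon_span_const[of 0] by simp
next
  case (insert i I)
  have "mon_span (\<lambda>z. f i z + (\<Sum>i\<in>I. f i z))" by (rule mon_span.add) (use insert in auto)
  then show ?case using insert.hyps by simp
qed

text \<open>Linear functions are combinations of entries, and products of monomials are monomials.
  Statements about linear functionals of polynomials can therefore be checked on monomials.\<close>

lemma poly_mon_span: "real_polynomial_function f \<Longrightarrow> mon_span f"
proof (induction f rule: real_polynomial_function.induct)
  case (linear f)
  interpret bounded_linear f by (rule linear)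
  have z: "z = (\<Sum>i\<in>UNIV. \<Sum>j\<in>UNIV. (z $ i $ j) *\<^sub>R axis i (axis j 1))" for z :: "real^3^3"
    by (simp add: vec_eq_iff forall_3 sum_3 axis_def)
  have "f = (\<lambda>z. \<Sum>i\<in>UNIV. \<Sum>j\<in>UNIV. f (axis i (axis j 1)) * mon [(i, j)] z)"
  proof
    fix z
    have "f z = f (\<Sum>i\<in>UNIV. \<Sum>j\<in>UNIV. (z $ i $ j) *\<^sub>R axis i (axis j 1))" using z[of z] by simp
    also have "\<dots> = (\<Sum>i\<in>UNIV. \<Sum>j\<in>UNIV. f (axis i (axis j 1)) * mon [(i, j)] z)"
      by (simp add: sum scaleR mult.commute)
    finally show "f z = (\<Sum>i\<in>UNIV. \<Sum>j\<in>UNIV. f (axis i (axis j 1)) * mon [(i, j)] z)" .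
  qed
  moreover have "mon_span (\<lambda>z. \<Sum>i\<in>UNIV. \<Sum>j\<in>UNIV. f (axis i (axis j 1)) * mon [(i, j)] z)"
    by (rule mon_span_sum[OF finite], rule mon_span_sum[OF finite], rule mon_span.scale, rule mon_span.mon)
  ultimately show ?case by simp
next
  case (const c)
  then show ?case by (rule mon_span_const)
next
  case (add f g)
  then show ?case by (intro mon_span.add)
next
  case (mult f g)
  then show ?case by (intro mon_span_mult)
qed

definition words :: "nat \<Rightarrow> (3 \<times> 3) list set" where
  "words n = {l. length l = n}"

lemma finite_words: "finite (words n)"
  using finite_lists_length_eq[of "UNIV :: (3 \<times> 3) set" n] by (simp add: words_def)

lemma sum_words_Suc: "(\<Sum>l\<in>words (Suc n). f l) = (\<Sum>i\<in>UNIV. \<Sum>j\<in>UNIV. \<Sum>l\<in>words n. f ((i, j) # l))"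
proof -
  have "words (Suc n) = (\<lambda>(p, l). p # l) ` (UNIV \<times> words n)"
    by (auto simp: words_def length_Suc_conv image_iff)
  moreover have "inj_on (\<lambda>(p, l). p # l) (UNIV \<times> words n)" by (auto simp: inj_on_def)
  ultimately have "(\<Sum>l\<in>words (Suc n). f l) = (\<Sum>(p, l)\<in>UNIV \<times> words n. f (p # l))"
    by (simp add: sum.reindex case_prod_unfold)
  also have "\<dots> = (\<Sum>p\<in>UNIV. \<Sum>l\<in>words n. f (p # l))" by (rule sum.cartesian_product[symmetric])
  also have "\<dots> = (\<Sum>(i, j)\<in>UNIV \<times> UNIV. \<Sum>l\<in>words n. f ((i, j) # l))"
    by (simp add: case_prod_unfold)
  also have "\<dots> = (\<Sum>i\<in>UNIV. \<Sum>j\<in>UNIV. \<Sum>l\<in>words n. f ((i, j) # l))"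
    by (rule sum.cartesian_product[symmetric])
  finally show ?thesis .
qed

text \<open>A word of length n selects one summand z_ij w_ij from each of the n factors of the
  expanded power.\<close>

lemma monomial_kernel: "(\<Sum>l\<in>words n. mon l z * mon l w) = (z \<bullet> w) ^ n"
proof (induction n)
  case 0
  have "words 0 = {[]}" by (auto simp: words_def)
  then show ?case by simp
next
  case (Suc n)
  have "(\<Sum>l\<in>words (Suc n). mon l z * mon l w) = (\<Sum>i\<in>UNIV. \<Sum>j\<in>UNIV. \<Sum>l\<in>words n. (z$i$j * w$i$j) * (mon l z * mon l w))"
    unfolding sum_words_Suc by (intro sum.cong refl) (simp add: ac_simps)
  also have "\<dots> = (\<Sum>i\<in>UNIV. \<Sum>j\<in>UNIV. (z$i$j * w$i$j) * (z \<bullet> w) ^ n)"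
    by (simp only: sum_distrib_left[symmetric] Suc)
  also have "\<dots> = (z \<bullet> w) ^ Suc n"
    by (simp add: inner_vec_def sum_distrib_right)
  finally show ?case .
qed

lemma antisymmetric_entry: "antisymmetric X \<Longrightarrow> X $ i $ j = - X $ j $ i"
proof -
  assume "antisymmetric X"
  then have "transpose X $ j $ i = (- X) $ j $ i" by (simp add: antisymmetric_def)
  then show ?thesis by (simp add: transpose_def)
qed

lemma antisymmetric_inner:
  fixes X z w :: "real^3^3"
  assumes "antisymmetric X"
  shows "(X ** z) \<bullet> w = - (z \<bullet> (X ** w))"
proof -
  have "(X ** z) \<bullet> w = (\<Sum>i\<in>UNIV. \<Sum>j\<in>UNIV. \<Sum>k\<in>UNIV. X$i$k * z$k$j * w$i$j)"
    by (simp add: inner_vec_def matrix_matrix_mult_def sum_distrib_right)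
  also have "\<dots> = (\<Sum>i\<in>UNIV. \<Sum>k\<in>UNIV. \<Sum>j\<in>UNIV. X$i$k * z$k$j * w$i$j)"
    by (rule sum.cong[OF refl], rule sum.swap)
  also have "\<dots> = (\<Sum>k\<in>UNIV. \<Sum>i\<in>UNIV. \<Sum>j\<in>UNIV. X$i$k * z$k$j * w$i$j)" by (rule sum.swap)
  also have "\<dots> = (\<Sum>k\<in>UNIV. \<Sum>i\<in>UNIV. \<Sum>j\<in>UNIV. - (z$k$j * (X$k$i * w$i$j)))"
    by (intro sum.cong refl) (subst antisymmetric_entry[OF assms], simp)
  also have "\<dots> = (\<Sum>k\<in>UNIV. \<Sum>j\<in>UNIV. \<Sum>i\<in>UNIV. - (z$k$j * (X$k$i * w$i$j)))"
    by (rule sum.cong[OF refl], rule sum.swap)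
  also have "\<dots> = - (z \<bullet> (X ** w))"
    by (simp add: inner_vec_def matrix_matrix_mult_def sum_distrib_left sum_negf)
  finally show ?thesis .
qed

text \<open>Differentiate \<open>monomial_kernel\<close> in its first argument.\<close>

lemma lie_kernel:
  "(\<Sum>l\<in>words n. lie X (mon l) z * mon l w) = real n * ((X ** z) \<bullet> w) * (z \<bullet> w) ^ (n - 1)"
proof -
  have "(\<Sum>l\<in>words n. lie X (mon l) z * mon l w) = (\<Sum>l\<in>words n. lie X (\<lambda>z. mon l w * mon l z) z)"
    by (intro sum.cong refl) (subst lie_deriv_cmult[OF mon_poly], rule mult.commute)
  also have "\<dots> = lie X (\<lambda>z. \<Sum>l\<in>words n. mon l w * mon l z) z"
    by (rule lie_deriv_sum[OF finite_words poly_cmult[OF mon_poly], symmetric])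
  also have "(\<lambda>z. \<Sum>l\<in>words n. mon l w * mon l z) = (\<lambda>z. (z \<bullet> w) ^ n)"
    using monomial_kernel[of _ w n] by (simp add: mult.commute)
  also have "lie X (\<lambda>z. (z \<bullet> w) ^ n) z = real n * ((X ** z) \<bullet> w) * (z \<bullet> w) ^ (n - 1)"
  proof (rule lie_deriv_eqI)
    show "((\<lambda>z. (z \<bullet> w) ^ n) has_derivative (\<lambda>v. real n * (v \<bullet> w) * (z \<bullet> w) ^ (n - 1))) (at z)"
      by (auto intro!: derivative_eq_intros)
  qed
  finally show ?thesis .
qed

text \<open>The infinitesimal form of the invariance of (z . w)^n under rotations of both arguments:
  the derivation moves from one argument to the other with a change of sign.\<close>

lemma lie_kernel_antisymmetric:
  assumes "antisymmetric X"
  shows "(\<Sum>l\<in>words n. mon l w * lie X (mon l) z) = - (\<Sum>l\<in>words n. lie X (mon l) w * mon l z)"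
proof -
  have "(\<Sum>l\<in>words n. mon l w * lie X (mon l) z) = real n * ((X ** z) \<bullet> w) * (z \<bullet> w) ^ (n - 1)"
    using lie_kernel[where X=X and n=n and z=z and w=w] by (simp add: mult.commute)
  moreover have "(\<Sum>l\<in>words n. lie X (mon l) w * mon l z) = real n * ((X ** w) \<bullet> z) * (w \<bullet> z) ^ (n - 1)"
    by (rule lie_kernel)
  ultimately show ?thesis using antisymmetric_inner[OF assms, of z w] by (simp add: inner_commute)
qed

lemma lie_lie_kernel:
  assumes "antisymmetric X"
  shows "(\<Sum>l\<in>words n. mon l w * lie X (lie X (mon l)) z) = - (\<Sum>l\<in>words n. lie X (mon l) w * lie X (mon l) z)"
proof -
  have p: "real_polynomial_function (\<lambda>z. c * mon l z)" "real_polynomial_function (\<lambda>z. c * lie X (mon l) z)" for c l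
    by (intro poly_cmult mon_poly lie_poly)+
  have "(\<Sum>l\<in>words n. mon l w * lie X (lie X (mon l)) z) = lie X (\<lambda>z. \<Sum>l\<in>words n. mon l w * lie X (mon l) z) z"
    using finite_words p by (subst lie_deriv_sum) (auto simp: lie_deriv_cmult lie_poly mon_poly)
  also have "(\<lambda>z. \<Sum>l\<in>words n. mon l w * lie X (mon l) z) = (\<lambda>z. \<Sum>l\<in>words n. (- lie X (mon l) w) * mon l z)"
    by (intro ext) (simp add: lie_kernel_antisymmetric[OF assms] sum_negf)
  also have "lie X \<dots> z = - (\<Sum>l\<in>words n. lie X (mon l) w * lie X (mon l) z)"
  proof -
    have "lie X (\<lambda>z. \<Sum>l\<in>words n. (- lie X (mon l) w) * mon l z) z = (\<Sum>l\<in>words n. lie X (\<lambda>z. (- lie X (mon l) w) * mon l z) z)"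
      by (rule lie_deriv_sum[OF finite_words p(1)])
    also have "\<dots> = (\<Sum>l\<in>words n. (- lie X (mon l) w) * lie X (mon l) z)"
      by (intro sum.cong refl lie_deriv_cmult mon_poly)
    finally show ?thesis by (simp add: sum_negf)
  qed
  finally show ?thesis .
qed

section \<open>Barbalat's lemma\<close>

lemma mvt_half_line:
  fixes q :: "real \<Rightarrow> real"
  assumes d: "\<And>t. 0 \<le> t \<Longrightarrow> (q has_real_derivative q' t) (at t within {0..})" and st: "0 \<le> s" "s < t"
  obtains \<xi> where "s < \<xi>" "\<xi> < t" "q t - q s = (t - s) * q' \<xi>"
proof -
  have "\<exists>\<xi>\<in>{s<..<t}. q t - q s = (\<lambda>h. q' \<xi> * h) (t - s)"
  proof (rule mvt_simple[OF st(2)])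
    fix x assume x: "s \<le> x" "x \<le> t"
    have "(q has_real_derivative q' x) (at x within {s..t})"
      by (rule DERIV_subset[OF d]) (use x st in auto)
    then show "(q has_derivative (\<lambda>h. q' x * h)) (at x within {s..t})"
      by (simp add: has_field_derivative_def)
  qed
  then show thesis using that by (auto simp: mult.commute)
qed

lemma lipschitz_half_line:
  fixes q :: "real \<Rightarrow> real"
  assumes d: "\<And>t. 0 \<le> t \<Longrightarrow> (q has_real_derivative q' t) (at t within {0..})"
    and b: "\<And>t. 0 \<le> t \<Longrightarrow> \<bar>q' t\<bar> \<le> C" and st: "0 \<le> s" "s \<le> t"
  shows "\<bar>q t - q s\<bar> \<le> C * (t - s)"
proof (cases "s = t")
  case False
  then have "s < t" using st by simp
  from mvt_half_line[OF d st(1) this] obtain \<xi> where \<xi>: "s < \<xi>" "q t - q s = (t - s) * q' \<xi>" by metis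
  then have "\<bar>q t - q s\<bar> = (t - s) * \<bar>q' \<xi>\<bar>" using st by (simp add: abs_mult)
  also have "\<dots> \<le> (t - s) * C" using b[of \<xi>] \<xi> st by (intro mult_left_mono) auto
  finally show ?thesis by (simp add: mult.commute)
qed simp

text \<open>Whenever |q| reaches \<epsilon>, the bound of its derivative keeps it above \<epsilon> /
  2 for a time \<tau>, during which \<Phi> loses a fixed amount c. If this happened at arbitrarily
  late times, \<Phi> would become negative.\<close>

lemma barbalat_lyapunov:
  fixes q \<Phi> :: "real \<Rightarrow> real"
  assumes d: "\<And>t. 0 \<le> t \<Longrightarrow> (q has_real_derivative q' t) (at t within {0..})"
    and b: "\<And>t. 0 \<le> t \<Longrightarrow> \<bar>q' t\<bar> \<le> C"
    and \<Phi>: "\<And>t. 0 \<le> t \<Longrightarrow> (\<Phi> has_real_derivative \<Phi>' t) (at t within {0..})"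
    and le: "\<And>t. 0 \<le> t \<Longrightarrow> \<Phi>' t \<le> - (q t)\<^sup>2" and nn: "\<And>t. 0 \<le> t \<Longrightarrow> 0 \<le> \<Phi> t"
  shows "(q \<longlongrightarrow> 0) at_top"
proof (rule ccontr)
  assume "\<not> ?thesis"
  then obtain \<epsilon> where \<epsilon>: "0 < \<epsilon>" and freq: "\<And>T. \<exists>s\<ge>T. \<epsilon> \<le> \<bar>q s\<bar>"
    unfolding tendsto_iff eventually_at_top_linorder by (force simp: not_less)
  define K where "K = \<bar>C\<bar> + 1"
  have K: "1 \<le> K" "C \<le> K" by (auto simp: K_def)
  \<comment> \<open>In time \<tau> the function q changes by at most K * \<tau> = \<epsilon> /
    2.\<close>
  define \<tau> where "\<tau> = \<epsilon> / (2 * K)"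
  have \<tau>: "0 < \<tau>" using \<epsilon> K by (simp add: \<tau>_def)
  define c where "c = \<tau> * (\<epsilon> / 2)\<^sup>2"
  have c: "0 < c" using \<tau> \<epsilon> by (simp add: c_def)
  have mono: "\<Phi> t \<le> \<Phi> s" if st: "0 \<le> s" "s \<le> t" for s t
  proof (cases "s = t")
    case False
    then have "s < t" using st by simp
    from mvt_half_line[OF \<Phi> st(1) this] obtain \<xi> where \<xi>: "s < \<xi>" "\<Phi> t - \<Phi> s = (t - s) * \<Phi>' \<xi>" by metis
    have "\<Phi>' \<xi> \<le> 0" using le[of \<xi>] \<xi>(1) st(1) zero_le_power2[of "q \<xi>"] by linarith
    then have "(t - s) * \<Phi>' \<xi> \<le> 0" using st by (simp add: mult_nonneg_nonpos)
    then show ?thesis using \<xi>(2) by simp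
  qed simp
  have drop: "\<Phi> (s + \<tau>) \<le> \<Phi> s - c" if s: "0 \<le> s" "\<epsilon> \<le> \<bar>q s\<bar>" for s
  proof -
    from mvt_half_line[OF \<Phi> s(1), of "s + \<tau>"] \<tau>
    obtain \<xi> where \<xi>: "s < \<xi>" "\<xi> < s + \<tau>" "\<Phi> (s + \<tau>) - \<Phi> s = \<tau> * \<Phi>' \<xi>" by auto
    have "\<bar>q \<xi> - q s\<bar> \<le> K * (\<xi> - s)"
      using lipschitz_half_line[OF d b s(1), of \<xi>] \<xi>(1) mult_right_mono[OF K(2), of "\<xi> - s"] by linarith
    also have "\<dots> \<le> K * \<tau>" using \<xi> K by (intro mult_left_mono) auto
    also have "\<dots> = \<epsilon> / 2" using K by (simp add: \<tau>_def)
    finally have "\<epsilon> / 2 \<le> \<bar>q \<xi>\<bar>" using s(2) by linarith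
    then have "(\<epsilon> / 2)\<^sup>2 \<le> (q \<xi>)\<^sup>2" using \<epsilon> power_mono[of "\<epsilon>/2" "\<bar>q \<xi>\<bar>" 2] by simp
    then have "\<Phi>' \<xi> \<le> - ((\<epsilon> / 2)\<^sup>2)" using le[of \<xi>] \<xi>(1) s(1) by linarith
    then have "\<tau> * \<Phi>' \<xi> \<le> \<tau> * (- ((\<epsilon> / 2)\<^sup>2))" using \<tau> by (intro mult_left_mono) auto
    then show ?thesis using \<xi>(3) by (simp add: c_def)
  qed
  have "\<exists>t\<ge>0. \<Phi> t \<le> \<Phi> 0 - real n * c" for n
  proof (induction n)
    case (Suc n)
    then obtain t where t: "0 \<le> t" "\<Phi> t \<le> \<Phi> 0 - real n * c" by blast
    obtain s where s: "t \<le> s" "\<epsilon> \<le> \<bar>q s\<bar>" using freq by blast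
    have "\<Phi> (s + \<tau>) \<le> \<Phi> 0 - real (Suc n) * c"
      using drop[of s] mono[OF t(1) s(1)] s t by (simp add: algebra_simps)
    then show ?case using s t \<tau> by (intro exI[of _ "s + \<tau>"]) auto
  qed auto
  moreover obtain n where "\<Phi> 0 / c < real n" using reals_Archimedean2 by blast
  then have "\<Phi> 0 - real n * c < 0" using c by (simp add: pos_divide_less_eq)
  ultimately show False using nn by (meson not_le order_trans)
qed

text \<open>As q is small at both ends of [t, t + \<tau>], the mean value theorem yields a point
  where r is small, and the bound of r' carries this back to t.\<close>

lemma barbalat_derivative:
  fixes q :: "real \<Rightarrow> real"
  assumes d: "\<And>t. 0 \<le> t \<Longrightarrow> (q has_real_derivative r t) (at t within {0..})"
    and dr: "\<And>t. 0 \<le> t \<Longrightarrow> (r has_real_derivative r' t) (at t within {0..})"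
    and b: "\<And>t. 0 \<le> t \<Longrightarrow> \<bar>r' t\<bar> \<le> C" and q: "(q \<longlongrightarrow> 0) at_top"
  shows "(r \<longlongrightarrow> 0) at_top"
  unfolding tendsto_iff
proof (intro allI impI)
  fix \<epsilon> :: real assume \<epsilon>: "0 < \<epsilon>"
  define K where "K = \<bar>C\<bar> + 1"
  have K: "1 \<le> K" "C \<le> K" by (auto simp: K_def)
  define \<tau> where "\<tau> = \<epsilon> / (2 * K)"
  have \<tau>: "0 < \<tau>" using \<epsilon> K by (simp add: \<tau>_def)
  \<comment> \<open>At the intermediate point |r| is below 2 * \<delta> / \<tau> = \<epsilon> / 2;
    on the way back to t it changes by at most K * \<tau>, again \<epsilon> / 2.\<close>
  define \<delta> where "\<delta> = \<tau> * \<epsilon> / 4"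
  have \<delta>: "0 < \<delta>" using \<tau> \<epsilon> by (simp add: \<delta>_def)
  have "eventually (\<lambda>t. \<bar>q t\<bar> < \<delta>) at_top" using q \<delta> by (auto simp: tendsto_iff)
  then obtain T where T: "\<And>t. T \<le> t \<Longrightarrow> \<bar>q t\<bar> < \<delta>" by (auto simp: eventually_at_top_linorder)
  have "dist (r t) 0 < \<epsilon>" if t: "max T 0 \<le> t" for t
  proof -
    have t0: "0 \<le> t" "T \<le> t" using t by auto
    from mvt_half_line[OF d t0(1), of "t + \<tau>"] \<tau>
    obtain \<xi> where \<xi>: "t < \<xi>" "\<xi> < t + \<tau>" "q (t + \<tau>) - q t = \<tau> * r \<xi>" by auto
    have "\<bar>\<tau> * r \<xi>\<bar> < 2 * \<delta>" using T[of t] T[of "t + \<tau>"] t0 \<tau> \<xi>(3) by linarith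
    then have "\<tau> * \<bar>r \<xi>\<bar> < \<tau> * (\<epsilon> / 2)" using \<tau> by (simp add: abs_mult \<delta>_def)
    then have "\<bar>r \<xi>\<bar> < \<epsilon> / 2" using \<tau> by simp
    moreover have "\<bar>r \<xi> - r t\<bar> \<le> K * (\<xi> - t)"
      using lipschitz_half_line[OF dr b t0(1), of \<xi>] \<xi>(1) mult_right_mono[OF K(2), of "\<xi> - t"] by linarith
    moreover have "K * (\<xi> - t) \<le> K * \<tau>" using \<xi> K by (intro mult_left_mono) auto
    moreover have "K * \<tau> = \<epsilon> / 2" using K by (simp add: \<tau>_def)
    ultimately show ?thesis by (simp add: dist_real_def)
  qed
  then show "eventually (\<lambda>t. dist (r t) 0 < \<epsilon>) at_top" unfolding eventually_at_top_linorder by blast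
qed

section \<open>Evolution of polynomial observables\<close>

lemma SO3_norm: "Q \<in> SO3 \<Longrightarrow> norm Q \<le> 2"
proof -
  assume "Q \<in> SO3"
  then have "transpose Q ** Q = mat 1" by (simp add: SO3_def orthogonal_matrix_def)
  then have e: "(transpose Q ** Q) $ i $ i = 1" for i by (simp add: mat_def)
  have "(norm Q)\<^sup>2 = (\<Sum>i\<in>UNIV. \<Sum>k\<in>UNIV. Q$k$i * Q$k$i)"
    by (subst power2_norm_eq_inner) (simp add: inner_vec_def, rule sum.swap)
  also have "\<dots> = (\<Sum>i\<in>UNIV. (transpose Q ** Q) $ i $ i)"
    by (simp add: matrix_matrix_mult_def transpose_def)
  also have "\<dots> = 3" by (simp add: e)
  finally show ?thesis by (intro power2_le_imp_le[of "norm Q" 2]) auto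
qed

lemma SO3_mult: "P \<in> SO3 \<Longrightarrow> Q \<in> SO3 \<Longrightarrow> P ** Q \<in> SO3"
  by (auto simp: SO3_def orthogonal_matrix_mul det_mul)

lemma SO3_closed: "closed SO3"
proof -
  have eq: "SO3 = {Q. transpose Q ** Q = mat 1} \<inter> {Q. det Q = 1}"
    by (auto simp: SO3_def orthogonal_matrix)
  have "closed {Q :: real^3^3. transpose Q ** Q = mat 1}"
    unfolding transpose_def matrix_matrix_mult_def by (intro closed_Collect_eq continuous_intros)
  moreover have "closed {Q :: real^3^3. det Q = 1}"
    unfolding det_3 by (intro closed_Collect_eq continuous_intros)
  ultimately show ?thesis unfolding eq by (rule closed_Int)
qed

lemma SO3_compact: "compact SO3"
  unfolding compact_eq_bounded_closed using SO3_closed boundedI[of SO3 2] SO3_norm by blast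

lemma poly_SO3_bounded:
  assumes "real_polynomial_function f"
  shows "\<exists>C. \<forall>z\<in>SO3. \<bar>f z\<bar> \<le> C"
proof -
  have "continuous_on SO3 f"
    using assms by (simp add: continuous_on_polymonial_function real_polynomial_function_eq)
  then have "bounded (f ` SO3)" using compact_continuous_image SO3_compact compact_imp_bounded by blast
  then show ?thesis unfolding bounded_iff by auto
qed

text \<open>Linearity, a bound on \<open>SO3\<close> and the evolution equation are demanded, but
  neither positivity nor total mass 1. Hence the difference of two families of expectations is an
  instance as well, and the uniqueness of solutions can be applied to it.\<close>

locale so3_evolution =
  fixes A B :: "real^3^3" and m :: "real \<Rightarrow> (real^3^3 \<Rightarrow> real) \<Rightarrow> real" and \<kappa> :: real
  assumes A: "antisymmetric A" and B: "antisymmetric B"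
    and m_add: "\<And>t f g. 0 \<le> t \<Longrightarrow> real_polynomial_function f \<Longrightarrow> real_polynomial_function g \<Longrightarrow>
      m t (\<lambda>z. f z + g z) = m t f + m t g"
    and m_scale: "\<And>t f c. 0 \<le> t \<Longrightarrow> real_polynomial_function f \<Longrightarrow> m t (\<lambda>z. c * f z) = c * m t f"
    and m_bound: "\<And>t f C. 0 \<le> t \<Longrightarrow> real_polynomial_function f \<Longrightarrow> (\<And>z. z \<in> SO3 \<Longrightarrow> \<bar>f z\<bar> \<le> C) \<Longrightarrow> \<bar>m t f\<bar> \<le> \<kappa> * C"
    and m_deriv: "\<And>t f. 0 \<le> t \<Longrightarrow> real_polynomial_function f \<Longrightarrow>
      ((\<lambda>t. m t f) has_real_derivative m t (generator (\<lambda>z. A ** z) (\<lambda>z. B ** z) f)) (at t within {0..})"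
begin

abbreviation "G \<equiv> generator (\<lambda>z::real^3^3. A ** z) (\<lambda>z. B ** z)"

lemma G_poly: "real_polynomial_function f \<Longrightarrow> real_polynomial_function (G f)"
  by (intro generator_poly bounded_linear_matrix_left)

lemma m_G:
  assumes t: "0 \<le> t" and f: "real_polynomial_function f"
  shows "m t (G f) = m t (lie A f) + 1/2 * m t (lie B (lie B f))"
proof -
  have p: "real_polynomial_function (lie A f)" "real_polynomial_function (lie B (lie B f))"
    by (rule lie_poly[OF f], rule lie_poly[OF lie_poly[OF f]])
  show ?thesis
    unfolding generator_def[abs_def] m_add[OF t p(1) poly_cmult[OF p(2)]] m_scale[OF t p(2)] ..
qed

lemma m_zero: "0 \<le> t \<Longrightarrow> m t (\<lambda>z. 0) = 0"
  using m_scale[of t "\<lambda>z. 0" 0, OF _ poly_const] by simp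

lemma m_sum:
  assumes "finite I" "0 \<le> t" "\<And>i. i \<in> I \<Longrightarrow> real_polynomial_function (f i)"
  shows "m t (\<lambda>z. \<Sum>i\<in>I. c i * f i z) = (\<Sum>i\<in>I. c i * m t (f i))"
  using assms
proof (induction I rule: finite_induct)
  case (insert i I)
  have p: "real_polynomial_function (\<lambda>z. c j * f j z)" if "j \<in> insert i I" for j
    using insert.prems(2)[OF that] by (rule poly_cmult)
  have ps: "real_polynomial_function (\<lambda>z. \<Sum>i\<in>I. c i * f i z)"
    using p insert.hyps by (intro real_polynomial_function_sum) auto
  have "m t (\<lambda>z. \<Sum>i\<in>insert i I. c i * f i z) = m t (\<lambda>z. c i * f i z + (\<Sum>i\<in>I. c i * f i z))"
    using insert.hyps by simp
  also have "\<dots> = c i * m t (f i) + (\<Sum>i\<in>I. c i * m t (f i))"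
    using insert p ps by (subst m_add) (auto simp: m_scale)
  finally show ?case using insert.hyps by simp
qed (simp add: m_zero)

lemma m_bounded:
  assumes "real_polynomial_function f"
  obtains C where "\<And>t. 0 \<le> t \<Longrightarrow> \<bar>m t f\<bar> \<le> C"
proof -
  obtain C where "\<forall>z\<in>SO3. \<bar>f z\<bar> \<le> C" using poly_SO3_bounded[OF assms] by blast
  then show thesis using m_bound[OF _ assms, of _ C] that by blast
qed

text \<open>The kernel identities hold for two free points z and w. The functional
  \<open>m t\<close>, applied in z and then in w, turns them into identities between its values:
  with one derivation a sum equals its own negative, with two derivations it becomes minus a sum of
  squares.\<close>

lemma lyapunov_terms:
  assumes t: "0 \<le> t" and X: "antisymmetric X"
  shows "(\<Sum>l\<in>words n. m t (mon l) * m t (lie X (mon l))) = 0"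
    and "(\<Sum>l\<in>words n. m t (mon l) * m t (lie X (lie X (mon l)))) = - (\<Sum>l\<in>words n. (m t (lie X (mon l)))\<^sup>2)"
proof -
  have p: "real_polynomial_function (mon l)" "real_polynomial_function (lie X (mon l))" "real_polynomial_function (lie X (lie X (mon l)))" for l
    by (rule mon_poly lie_poly)+
  have S1: "m t (\<lambda>z. \<Sum>l\<in>words n. c l * mon l z) = (\<Sum>l\<in>words n. c l * m t (mon l))"
    and S2: "m t (\<lambda>z. \<Sum>l\<in>words n. c l * lie X (mon l) z) = (\<Sum>l\<in>words n. c l * m t (lie X (mon l)))"
    and S3: "m t (\<lambda>z. \<Sum>l\<in>words n. c l * lie X (lie X (mon l)) z) = (\<Sum>l\<in>words n. c l * m t (lie X (lie X (mon l))))" for c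
    using m_sum[where f="\<lambda>l. mon l" and I="words n" and c=c, OF finite_words t p(1)]
      m_sum[where f="\<lambda>l. lie X (mon l)" and I="words n" and c=c, OF finite_words t p(2)]
      m_sum[where f="\<lambda>l. lie X (lie X (mon l))" and I="words n" and c=c, OF finite_words t p(3)]
    by blast+
  have neg: "(\<lambda>z. - (\<Sum>l\<in>words n. c l * f l z)) = (\<lambda>z. \<Sum>l\<in>words n. - c l * f l z)" for c and f :: "_ \<Rightarrow> real^3^3 \<Rightarrow> real"
    by (simp add: sum_negf)
  \<comment> \<open>\<open>m t\<close> is applied in the variable z, with w fixed.\<close>
  have 1: "(\<Sum>l\<in>words n. mon l w * m t (lie X (mon l))) = (\<Sum>l\<in>words n. - lie X (mon l) w * m t (mon l))" for w
  proof -
    have "(\<lambda>z. \<Sum>l\<in>words n. mon l w * lie X (mon l) z) = (\<lambda>z. \<Sum>l\<in>words n. - lie X (mon l) w * mon l z)"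
      unfolding neg[symmetric] using lie_kernel_antisymmetric[OF X] by blast
    then have "m t (\<lambda>z. \<Sum>l\<in>words n. mon l w * lie X (mon l) z) = m t (\<lambda>z. \<Sum>l\<in>words n. - lie X (mon l) w * mon l z)" by simp
    then show ?thesis unfolding S1 S2 .
  qed
  \<comment> \<open>\<open>m t\<close> is applied a second time, now in w.\<close>
  have "m t (\<lambda>w. \<Sum>l\<in>words n. m t (lie X (mon l)) * mon l w) = m t (\<lambda>w. \<Sum>l\<in>words n. - m t (mon l) * lie X (mon l) w)"
    using 1 by (intro arg_cong[where f="m t"] ext) (simp add: mult.commute)
  then have "(\<Sum>l\<in>words n. m t (lie X (mon l)) * m t (mon l)) = (\<Sum>l\<in>words n. - m t (mon l) * m t (lie X (mon l)))"
    unfolding S1 S2 .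
  then show "(\<Sum>l\<in>words n. m t (mon l) * m t (lie X (mon l))) = 0"
    by (simp add: sum_negf mult.commute)
  have 2: "(\<Sum>l\<in>words n. mon l w * m t (lie X (lie X (mon l)))) = (\<Sum>l\<in>words n. - lie X (mon l) w * m t (lie X (mon l)))" for w
  proof -
    have "(\<lambda>z. \<Sum>l\<in>words n. mon l w * lie X (lie X (mon l)) z) = (\<lambda>z. \<Sum>l\<in>words n. - lie X (mon l) w * lie X (mon l) z)"
      unfolding neg[symmetric] using lie_lie_kernel[OF X] by blast
    then have "m t (\<lambda>z. \<Sum>l\<in>words n. mon l w * lie X (lie X (mon l)) z) = m t (\<lambda>z. \<Sum>l\<in>words n. - lie X (mon l) w * lie X (mon l) z)" by simp
    then show ?thesis unfolding S2 S3 .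
  qed
  have "m t (\<lambda>w. \<Sum>l\<in>words n. m t (lie X (lie X (mon l))) * mon l w) = m t (\<lambda>w. \<Sum>l\<in>words n. - m t (lie X (mon l)) * lie X (mon l) w)"
    using 2 by (intro arg_cong[where f="m t"] ext) (simp add: mult.commute)
  then have "(\<Sum>l\<in>words n. m t (lie X (lie X (mon l))) * m t (mon l)) = (\<Sum>l\<in>words n. - m t (lie X (mon l)) * m t (lie X (mon l)))"
    unfolding S1 S2 .
  then show "(\<Sum>l\<in>words n. m t (mon l) * m t (lie X (lie X (mon l)))) = - (\<Sum>l\<in>words n. (m t (lie X (mon l)))\<^sup>2)"
    by (simp add: sum_negf mult.commute power2_eq_square)
qed

text \<open>This is \<open>m t\<close> applied in both variables to the kernel (z . w)^n.\<close>

definition lyapunov :: "nat \<Rightarrow> real \<Rightarrow> real" where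
  "lyapunov n t = (\<Sum>l\<in>words n. (m t (mon l))\<^sup>2)"

text \<open>The contribution of \<open>A\<close> is zero, and the factor 2 from differentiating the
  squares cancels the 1/2 of the generator.\<close>

lemma lyapunov_deriv:
  assumes t: "0 \<le> t"
  shows "(lyapunov n has_real_derivative - (\<Sum>l\<in>words n. (m t (lie B (mon l)))\<^sup>2)) (at t within {0..})"
proof -
  have "(lyapunov n has_real_derivative (\<Sum>l\<in>words n. 2 * (m t (mon l) * m t (G (mon l))))) (at t within {0..})"
    unfolding lyapunov_def[abs_def]
    by (auto intro!: derivative_eq_intros m_deriv[OF t mon_poly] simp: ac_simps)
  also have "(\<Sum>l\<in>words n. 2 * (m t (mon l) * m t (G (mon l)))) =
    2 * (\<Sum>l\<in>words n. m t (mon l) * m t (lie A (mon l))) + (\<Sum>l\<in>words n. m t (mon l) * m t (lie B (lie B (mon l))))"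
    unfolding sum_distrib_left sum.distrib[symmetric] m_G[OF t mon_poly]
    by (intro sum.cong refl) (simp add: algebra_simps)
  also have "\<dots> = - (\<Sum>l\<in>words n. (m t (lie B (mon l)))\<^sup>2)"
    using lyapunov_terms(1)[OF t A] lyapunov_terms(2)[OF t B] by simp
  finally show ?thesis .
qed

lemma m_vanishes_poly:
  assumes t: "0 \<le> t" and z: "\<And>l. m t (mon l) = 0" and f: "real_polynomial_function f"
  shows "m t f = 0"
proof -
  have "mon_span f" by (rule poly_mon_span[OF f])
  then show ?thesis
    by (induction rule: mon_span.induct) (auto simp: z m_add[OF t] m_scale[OF t] mon_span_poly)
qed

text \<open>A sum of squares that starts at 0 and does not increase stays 0.\<close>

lemma m_uniqueness:
  assumes z: "\<And>l. m 0 (mon l) = 0" and f: "real_polynomial_function f" and t: "0 \<le> t"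
  shows "m t f = 0"
proof (rule m_vanishes_poly[OF t _ f])
  fix l :: "(3 \<times> 3) list"
  define n where "n = length l"
  have l: "l \<in> words n" by (simp add: words_def n_def)
  have "lyapunov n t \<le> lyapunov n 0"
  proof (cases "t = 0")
    case False
    then have "0 < t" using t by simp
    from mvt_half_line[OF lyapunov_deriv order_refl this] obtain \<xi> where
      "lyapunov n t - lyapunov n 0 = (t - 0) * - (\<Sum>l\<in>words n. (m \<xi> (lie B (mon l)))\<^sup>2)" by metis
    moreover have "0 \<le> t * (\<Sum>l\<in>words n. (m \<xi> (lie B (mon l)))\<^sup>2)" using t by (intro mult_nonneg_nonneg sum_nonneg) auto
    ultimately show ?thesis by simp
  qed simp
  also have "lyapunov n 0 = 0" by (simp add: lyapunov_def z)
  finally have "(\<Sum>l\<in>words n. (m t (mon l))\<^sup>2) \<le> 0" by (simp add: lyapunov_def)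
  moreover have "(m t (mon l))\<^sup>2 \<le> (\<Sum>l\<in>words n. (m t (mon l))\<^sup>2)"
    by (rule member_le_sum[OF l]) (auto simp: finite_words)
  ultimately have "(m t (mon l))\<^sup>2 \<le> 0" by linarith
  then show "m t (mon l) = 0" by simp
qed

text \<open>A single square is at most the whole dissipation, so each term qualifies for
  \<open>barbalat_lyapunov\<close>; the bound of its derivative comes from compactness of
  \<open>SO3\<close>.\<close>

lemma decay_B_mon: "((\<lambda>t. m t (lie B (mon l))) \<longlongrightarrow> 0) at_top"
proof -
  define n where "n = length l"
  have l: "l \<in> words n" by (simp add: words_def n_def)
  have p: "real_polynomial_function (lie B (mon l))" by (intro lie_poly mon_poly)
  obtain C where C: "\<And>t. 0 \<le> t \<Longrightarrow> \<bar>m t (G (lie B (mon l)))\<bar> \<le> C" using m_bounded[OF G_poly[OF p]] by blast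
  show ?thesis
  proof (rule barbalat_lyapunov[OF m_deriv[OF _ p] C lyapunov_deriv[of _ n]])
    show "- (\<Sum>l\<in>words n. (m t (lie B (mon l)))\<^sup>2) \<le> - (m t (lie B (mon l)))\<^sup>2" for t
      using member_le_sum[OF l, of "\<lambda>l. (m t (lie B (mon l)))\<^sup>2"] finite_words by simp
    show "0 \<le> lyapunov n t" for t by (simp add: lyapunov_def sum_nonneg)
  qed
qed

lemma eventually_nonneg: "eventually (\<lambda>t::real. 0 \<le> t) at_top"
  by (rule eventually_ge_at_top)

lemma decay_B:
  assumes "real_polynomial_function f"
  shows "((\<lambda>t. m t (lie B f)) \<longlongrightarrow> 0) at_top"
proof -
  have "mon_span f" by (rule poly_mon_span[OF assms])
  then show ?thesis
  proof (induction rule: mon_span.induct)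
    case (mon l)
    show ?case by (rule decay_B_mon)
  next
    case (add f g)
    have p: "real_polynomial_function f" "real_polynomial_function g" using add mon_span_poly by auto
    have e: "lie B (\<lambda>z. f z + g z) = (\<lambda>z. lie B f z + lie B g z)" using p by (intro ext lie_deriv_add)
    have "eventually (\<lambda>t. m t (lie B f) + m t (lie B g) = m t (lie B (\<lambda>z. f z + g z))) at_top"
      using eventually_nonneg by eventually_elim (simp add: e m_add lie_poly p)
    from tendsto_cong[OF this] show ?case using tendsto_add[OF add.IH] by simp
  next
    case (scale f c)
    have p: "real_polynomial_function f" using scale mon_span_poly by auto
    have e: "lie B (\<lambda>z. c * f z) = (\<lambda>z. c * lie B f z)" using p by (intro ext lie_deriv_cmult)
    have "eventually (\<lambda>t. c * m t (lie B f) = m t (lie B (\<lambda>z. c * f z))) at_top"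
      using eventually_nonneg by eventually_elim (simp add: e m_scale lie_poly p)
    from tendsto_cong[OF this] show ?case using tendsto_mult_left[OF scale.IH, of c] by simp
  qed
qed

text \<open>In the time derivative, the summand with three derivations along \<open>B\<close> decays
  by \<open>decay_B\<close>, applied to the polynomial \<open>lie B (lie B f)\<close>.\<close>

lemma decay_AB:
  assumes f: "real_polynomial_function f"
  shows "((\<lambda>t. m t (lie A (lie B f))) \<longlongrightarrow> 0) at_top"
proof -
  have p: "real_polynomial_function (lie B f)" by (rule lie_poly[OF f])
  obtain C where C: "\<And>t. 0 \<le> t \<Longrightarrow> \<bar>m t (G (G (lie B f)))\<bar> \<le> C" using m_bounded[OF G_poly[OF G_poly[OF p]]] by blast
  have "((\<lambda>t. m t (G (lie B f))) \<longlongrightarrow> 0) at_top"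
    by (rule barbalat_derivative[OF m_deriv[OF _ p] m_deriv[OF _ G_poly[OF p]] C decay_B[OF f]])
  then have "((\<lambda>t. m t (G (lie B f)) - 1/2 * m t (lie B (lie B (lie B f)))) \<longlongrightarrow> 0 - 1/2 * 0) at_top"
    by (intro tendsto_intros decay_B lie_poly f)
  moreover have "eventually (\<lambda>t. m t (G (lie B f)) - 1/2 * m t (lie B (lie B (lie B f))) = m t (lie A (lie B f))) at_top"
    using eventually_nonneg by eventually_elim (simp add: m_G p)
  ultimately show ?thesis using tendsto_cong by fastforce
qed

lemma m_lie_commutator:
  assumes t: "0 \<le> t" and f: "real_polynomial_function f"
  shows "m t (lie (Y ** X - X ** Y) f) = m t (lie X (lie Y f)) - m t (lie Y (lie X f))"
proof -
  have p: "real_polynomial_function (lie X (lie Y f))" "real_polynomial_function (lie Y (lie X f))" by (intro lie_poly f)+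
  have e: "lie (Y ** X - X ** Y) f = (\<lambda>z. lie X (lie Y f) z + (-1) * lie Y (lie X f) z)"
    using lie_commutator[OF f, of X Y] by (simp add: fun_eq_iff)
  show ?thesis unfolding e m_add[OF t p(1) poly_cmult[OF p(2)]] m_scale[OF t p(2)] by simp
qed

text \<open>One product in the commutator decays by assumption, the other because
  \<open>lie X f\<close> is a polynomial to which the decay along \<open>Y\<close> applies. Decay
  along \<open>X\<close> itself cannot be assumed: it is not yet known for the drift matrix
  \<open>A\<close>.\<close>

lemma decay_commutator:
  assumes X: "\<And>f. real_polynomial_function f \<Longrightarrow> ((\<lambda>t. m t (lie X (lie Y f))) \<longlongrightarrow> 0) at_top"
    and Y: "\<And>f. real_polynomial_function f \<Longrightarrow> ((\<lambda>t. m t (lie Y f)) \<longlongrightarrow> 0) at_top"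
    and f: "real_polynomial_function f"
  shows "((\<lambda>t. m t (lie (Y ** X - X ** Y) f)) \<longlongrightarrow> 0) at_top"
proof -
  have "((\<lambda>t. m t (lie X (lie Y f)) - m t (lie Y (lie X f))) \<longlongrightarrow> 0 - 0) at_top"
    by (intro tendsto_diff X Y lie_poly f)
  moreover have "eventually (\<lambda>t. m t (lie X (lie Y f)) - m t (lie Y (lie X f)) = m t (lie (Y ** X - X ** Y) f)) at_top"
    using eventually_nonneg by eventually_elim (simp add: m_lie_commutator f)
  ultimately show ?thesis using tendsto_cong by fastforce
qed

lemma decay_comb:
  assumes X: "((\<lambda>t. m t (lie X f)) \<longlongrightarrow> 0) at_top" and Y: "((\<lambda>t. m t (lie Y f)) \<longlongrightarrow> 0) at_top"
    and f: "real_polynomial_function f"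
  shows "((\<lambda>t. m t (lie (a *\<^sub>R X + b *\<^sub>R Y) f)) \<longlongrightarrow> 0) at_top"
proof -
  have e: "lie (a *\<^sub>R X + b *\<^sub>R Y) f = (\<lambda>z. a * lie X f z + b * lie Y f z)" by (intro ext lie_comb f)
  have "((\<lambda>t. a * m t (lie X f) + b * m t (lie Y f)) \<longlongrightarrow> a * 0 + b * 0) at_top"
    by (intro tendsto_intros X Y)
  moreover have "eventually (\<lambda>t. a * m t (lie X f) + b * m t (lie Y f) = m t (lie (a *\<^sub>R X + b *\<^sub>R Y) f)) at_top"
    using eventually_nonneg by eventually_elim (simp add: e m_add m_scale lie_poly f poly_cmult)
  ultimately show ?thesis using tendsto_cong by fastforce
qed

end

section \<open>Rotations and the Cayley transform\<close>

unbundle cross3_syntax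

text \<open>The matrix of the cross product with \<open>x\<close> from the left; commutators of such
  matrices become cross products.\<close>

definition hat :: "real^3 \<Rightarrow> real^3^3" where
  "hat x = vector [vector [0, - x$3, x$2], vector [x$3, 0, - x$1], vector [- x$2, x$1, 0]]"

lemma hat_entries [simp]:
  "hat x $ 1 $ 1 = 0" "hat x $ 1 $ 2 = - x$3" "hat x $ 1 $ 3 = x$2"
  "hat x $ 2 $ 1 = x$3" "hat x $ 2 $ 2 = 0" "hat x $ 2 $ 3 = - x$1"
  "hat x $ 3 $ 1 = - x$2" "hat x $ 3 $ 2 = x$1" "hat x $ 3 $ 3 = 0"
  by (simp_all add: hat_def)

definition vee :: "real^3^3 \<Rightarrow> real^3" where
  "vee X = vector [X$3$2, X$1$3, X$2$1]"

lemma vee_entries [simp]: "vee X $ 1 = X$3$2" "vee X $ 2 = X$1$3" "vee X $ 3 = X$2$1"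
  by (simp_all add: vee_def)

lemma vee_hat [simp]: "vee (hat x) = x"
  by (simp add: vec_eq_iff forall_3)

lemma antisymmetric_hat: "antisymmetric (hat x)"
  by (simp add: antisymmetric_def vec_eq_iff forall_3 transpose_def)

lemma hat_vee: "antisymmetric X \<Longrightarrow> hat (vee X) = X"
proof -
  assume a: "antisymmetric X"
  note e = antisymmetric_entry[OF a]
  have "X$1$1 = 0" "X$2$2 = 0" "X$3$3 = 0" using e[of 1 1] e[of 2 2] e[of 3 3] by auto
  then show ?thesis using e[of 1 2] e[of 1 3] e[of 2 3] by (simp add: vec_eq_iff forall_3)
qed

lemma bounded_linear_hat: "bounded_linear hat"
  by (rule linear_conv_bounded_linear[THEN iffD1], rule linearI) (simp_all add: vec_eq_iff forall_3)

lemma bounded_linear_vee: "bounded_linear vee"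
  by (rule linear_conv_bounded_linear[THEN iffD1], rule linearI) (simp_all add: vec_eq_iff forall_3)

lemma matrix3_entry: "(X ** Y) $ i $ j = X$i$1 * Y$1$j + X$i$2 * Y$2$j + X$i$3 * Y$3$j" for X Y :: "real^3^3"
  by (simp add: matrix_matrix_mult_def sum_3)

lemma hat_commutator: "hat x ** hat y - hat y ** hat x = hat (x \<times> y)"
  by (simp add: vec_eq_iff forall_3 matrix3_entry cross3_def algebra_simps)

text \<open>The common form of Rodrigues' rotation formula and of the Cayley transform. As the cube
  of \<open>hat u\<close> is a multiple of \<open>hat u\<close>, every polynomial in
  \<open>hat u\<close> with constant term 1 can be written so.\<close>

definition quad :: "real \<Rightarrow> real \<Rightarrow> real^3 \<Rightarrow> real^3^3" where
  "quad a b u = mat 1 + a *\<^sub>R hat u + b *\<^sub>R (hat u ** hat u)"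

lemma quad_entries:
  "quad a b u $ 1 $ 1 = 1 - b * (u$2 * u$2 + u$3 * u$3)" "quad a b u $ 1 $ 2 = b * (u$1 * u$2) - a * u$3" "quad a b u $ 1 $ 3 = b * (u$1 * u$3) + a * u$2"
  "quad a b u $ 2 $ 1 = b * (u$1 * u$2) + a * u$3" "quad a b u $ 2 $ 2 = 1 - b * (u$1 * u$1 + u$3 * u$3)" "quad a b u $ 2 $ 3 = b * (u$2 * u$3) - a * u$1"
  "quad a b u $ 3 $ 1 = b * (u$1 * u$3) - a * u$2" "quad a b u $ 3 $ 2 = b * (u$2 * u$3) + a * u$1" "quad a b u $ 3 $ 3 = 1 - b * (u$1 * u$1 + u$2 * u$2)"
  by (simp_all add: quad_def matrix3_entry mat_def algebra_simps)

text \<open>The defect of orthogonality and that of the determinant are both multiples of a^2 + b^2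
  |u|^2 - 2 b, so one condition settles both.\<close>

lemma quad_SO3:
  assumes ab: "a\<^sup>2 + b\<^sup>2 * (u \<bullet> u) = 2 * b"
  shows "quad a b u \<in> SO3"
proof -
  define n where "n = u \<bullet> u"
  have n: "n = u$1 * u$1 + u$2 * u$2 + u$3 * u$3" by (simp add: n_def inner_vec_def sum_3)
  have k: "a * a = 2 * b - b * b * n" using ab by (simp add: n_def power2_eq_square)
  have "transpose (quad a b u) ** quad a b u = mat 1 + (a * a + b * b * n - 2 * b) *\<^sub>R (n *\<^sub>R mat 1 - (\<chi> i j. u$i * u$j))"
    by (simp add: vec_eq_iff forall_3 matrix3_entry transpose_def quad_entries mat_def n) (simp add: algebra_simps)
  moreover have "det (quad a b u) = 1 + n * (a * a + b * b * n - 2 * b)"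
    by (simp add: det_3 quad_entries n) (simp add: algebra_simps)
  ultimately show ?thesis using k by (simp add: SO3_def orthogonal_matrix)
qed

text \<open>Rodrigues' formula: for a unit vector \<open>u\<close> this is the rotation by the angle
  \<open>\<theta>\<close> about \<open>u\<close>, the exponential of
  \<open>\<theta> *\<^sub>R hat u\<close>.\<close>

definition rot :: "real^3 \<Rightarrow> real \<Rightarrow> real^3^3" where
  "rot u \<theta> = quad (sin \<theta>) (1 - cos \<theta>) u"

lemma rot_SO3: "u \<bullet> u = 1 \<Longrightarrow> rot u \<theta> \<in> SO3"
  unfolding rot_def
proof (rule quad_SO3)
  assume "u \<bullet> u = 1"
  then show "(sin \<theta>)\<^sup>2 + (1 - cos \<theta>)\<^sup>2 * (u \<bullet> u) = 2 * (1 - cos \<theta>)"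
    using sin_cos_squared_add[of \<theta>] by (simp add: power2_diff)
qed

lemma rot_0: "rot u 0 = mat 1"
  by (simp add: rot_def quad_def)

lemma hat_cube: "hat u ** (hat u ** hat u) = - (u \<bullet> u) *\<^sub>R hat u"
  by (simp add: vec_eq_iff forall_3 matrix3_entry inner_vec_def sum_3 algebra_simps)

lemma hat_rot:
  assumes "u \<bullet> u = 1"
  shows "hat u ** rot u \<theta> = cos \<theta> *\<^sub>R hat u + sin \<theta> *\<^sub>R (hat u ** hat u)"
proof -
  have "hat u ** rot u \<theta> = hat u + sin \<theta> *\<^sub>R (hat u ** hat u) + (1 - cos \<theta>) *\<^sub>R (hat u ** (hat u ** hat u))"
    by (simp add: rot_def quad_def matrix_add_ldistrib matrix_scalar_ac scalar_matrix_assoc[symmetric])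
  also have "\<dots> = cos \<theta> *\<^sub>R hat u + sin \<theta> *\<^sub>R (hat u ** hat u)"
    by (simp add: hat_cube assms algebra_simps)
  finally show ?thesis .
qed

lemma rot_hat_commute: "hat u ** rot u \<theta> = rot u \<theta> ** hat u"
  by (simp add: rot_def quad_def matrix_add_ldistrib matrix_add_rdistrib matrix_scalar_ac scalar_matrix_assoc[symmetric] matrix_mul_assoc)

lemma rot_deriv:
  fixes z :: "real^3^3"
  assumes "u \<bullet> u = 1"
  shows "((\<lambda>\<theta>. rot u \<theta> ** z) has_vector_derivative (hat u ** (rot u \<theta> ** z))) (at \<theta>)"
proof -
  have e: "rot u \<theta> ** z = z + sin \<theta> *\<^sub>R (hat u ** z) + (1 - cos \<theta>) *\<^sub>R (hat u ** hat u ** z)" for \<theta>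
    by (simp add: rot_def quad_def matrix_add_rdistrib scalar_matrix_assoc)
  have e': "hat u ** (rot u \<theta> ** z) = cos \<theta> *\<^sub>R (hat u ** z) + sin \<theta> *\<^sub>R (hat u ** hat u ** z)"
    by (simp add: matrix_mul_assoc hat_rot[OF assms] matrix_add_rdistrib scalar_matrix_assoc)
  have "((\<lambda>\<theta>. z + sin \<theta> *\<^sub>R (hat u ** z) + (1 - cos \<theta>) *\<^sub>R (hat u ** hat u ** z)) has_vector_derivative
      hat u ** (rot u \<theta> ** z)) (at \<theta>)"
    unfolding e' by (auto intro!: derivative_eq_intros)
  then show ?thesis by (simp only: e)
qed

text \<open>The Cayley transform (1 + hat x)(1 - hat x)^(-1), written without an inverse. The vector
  x points along the axis, and its length is the tangent of half the angle. As the map and its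
  inverse are rational, derivatives and traces are explicit.\<close>

definition cayley :: "real^3 \<Rightarrow> real^3^3" where
  "cayley x = quad (2 / (1 + x \<bullet> x)) (2 / (1 + x \<bullet> x)) x"

lemma one_plus_inner_pos: "0 < 1 + x \<bullet> (x :: real^3)"
  by (simp add: add_pos_nonneg)

lemma cayley_SO3: "cayley x \<in> SO3"
  unfolding cayley_def
proof (rule quad_SO3)
  define n where "n = x \<bullet> x"
  have n: "0 < 1 + n" using one_plus_inner_pos by (simp add: n_def)
  have "(2 / (1 + n))\<^sup>2 + (2 / (1 + n))\<^sup>2 * n = (2 / (1 + n))\<^sup>2 * (1 + n)" by (simp add: algebra_simps)
  also have "\<dots> = 2 * (2 / (1 + n))" using n by (simp add: power2_eq_square divide_simps)
  finally show "(2 / (1 + x \<bullet> x))\<^sup>2 + (2 / (1 + x \<bullet> x))\<^sup>2 * (x \<bullet> x) = 2 * (2 / (1 + x \<bullet> x))" by (simp add: n_def)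
qed

text \<open>Half-angle substitution: with tan (\<theta> / 2) = |x| one has sin \<theta> = 2 |x| / (1
  + |x|^2) and 1 - cos \<theta> = 2 |x|^2 / (1 + |x|^2). For x = 0 any axis with angle 0 will
  do.\<close>

lemma cayley_rot: "\<exists>u \<theta>. u \<bullet> u = 1 \<and> cayley x = rot u \<theta>"
proof (cases "x = 0")
  case True
  have "axis 1 1 \<bullet> (axis 1 1 :: real^3) = 1" by (simp add: inner_axis_axis)
  moreover have "cayley x = rot (axis 1 1) 0" by (simp add: True cayley_def rot_0 quad_def hat_def vec_eq_iff forall_3 matrix3_entry)
  ultimately show ?thesis by blast
next
  case False
  define n where "n = norm x"
  have n: "0 < n" using False by (simp add: n_def)
  have nn: "x \<bullet> x = n\<^sup>2" by (simp add: n_def power2_norm_eq_inner)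
  define u where "u = (1 / n) *\<^sub>R x"
  have u: "u \<bullet> u = 1" using n by (simp add: u_def nn power2_eq_square)
  define \<theta> where "\<theta> = 2 * arctan n"
  have p: "0 < 1 + n\<^sup>2" by (simp add: add_pos_nonneg)
  have s: "sqrt (1 + n\<^sup>2) * sqrt (1 + n\<^sup>2) = 1 + n\<^sup>2" using p by simp
  have sin: "sin \<theta> = 2 * n / (1 + n\<^sup>2)"
    unfolding \<theta>_def sin_double sin_arctan cos_arctan using s by simp
  have cos: "1 - cos \<theta> = 2 * n\<^sup>2 / (1 + n\<^sup>2)"
    unfolding \<theta>_def cos_double_sin sin_arctan using s p by (simp add: power_divide)
  have hu: "hat x = n *\<^sub>R hat u" using n by (simp add: u_def vec_eq_iff forall_3)
  have "cayley x = rot u \<theta>"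
    unfolding cayley_def rot_def quad_def sin cos nn hu
    by (simp add: matrix_scalar_ac scalar_matrix_assoc[symmetric] power2_eq_square mult.commute)
  then show ?thesis using u by blast
qed

text \<open>\<open>SO3_cofactor\<close> expresses that a rotation equals its cofactor matrix and is
  read off from the cross products of its columns. These quadratic relations reduce the polynomial
  identities behind the inverse of the Cayley transform.\<close>

lemma SO3_identities:
  assumes Q: "Q \<in> SO3"
  shows SO3_cols: "Q$1$i * Q$1$j + Q$2$i * Q$2$j + Q$3$i * Q$3$j = (if i = j then 1 else 0)"
    and SO3_rows: "Q$i$1 * Q$j$1 + Q$i$2 * Q$j$2 + Q$i$3 * Q$j$3 = (if i = j then 1 else 0)"
    and SO3_cofactor: "Q$1$1 = Q$2$2 * Q$3$3 - Q$3$2 * Q$2$3" "Q$2$1 = Q$3$2 * Q$1$3 - Q$1$2 * Q$3$3" "Q$3$1 = Q$1$2 * Q$2$3 - Q$2$2 * Q$1$3"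
      "Q$1$2 = Q$2$3 * Q$3$1 - Q$3$3 * Q$2$1" "Q$2$2 = Q$3$3 * Q$1$1 - Q$1$3 * Q$3$1" "Q$3$2 = Q$1$3 * Q$2$1 - Q$2$3 * Q$1$1"
      "Q$1$3 = Q$2$1 * Q$3$2 - Q$3$1 * Q$2$2" "Q$2$3 = Q$3$1 * Q$1$2 - Q$1$1 * Q$3$2" "Q$3$3 = Q$1$1 * Q$2$2 - Q$2$1 * Q$1$2"
proof -
  have o: "transpose Q ** Q = mat 1" "Q ** transpose Q = mat 1" and r: "rotation_matrix Q"
    using Q by (auto simp: SO3_def orthogonal_matrix_def rotation_matrix_def)
  show "Q$1$i * Q$1$j + Q$2$i * Q$2$j + Q$3$i * Q$3$j = (if i = j then 1 else 0)"
    using arg_cong[OF o(1), of "\<lambda>X. X $ i $ j"] by (simp add: matrix3_entry transpose_def mat_def)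
  show "Q$i$1 * Q$j$1 + Q$i$2 * Q$j$2 + Q$i$3 * Q$j$3 = (if i = j then 1 else 0)"
    using arg_cong[OF o(2), of "\<lambda>X. X $ i $ j"] by (simp add: matrix3_entry transpose_def mat_def)
  have col: "Q *v axis j 1 = column j Q" for j by (simp add: matrix_vector_mul_component vec_eq_iff column_def matrix_vector_mult_basis)
  have c: "column 2 Q \<times> column 3 Q = column 1 Q" "column 3 Q \<times> column 1 Q = column 2 Q" "column 1 Q \<times> column 2 Q = column 3 Q"
  proof -
    have "(axis 2 1 :: real^3) \<times> axis 3 1 = axis 1 1" "(axis 3 1 :: real^3) \<times> axis 1 1 = axis 2 1" "(axis 1 1 :: real^3) \<times> axis 2 1 = axis 3 1"
      by (simp_all add: cross3_simps axis_def forall_3)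
    then show "column 2 Q \<times> column 3 Q = column 1 Q" "column 3 Q \<times> column 1 Q = column 2 Q" "column 1 Q \<times> column 2 Q = column 3 Q"
      using cross_rotation_matrix[OF r, of "axis 2 1" "axis 3 1"] cross_rotation_matrix[OF r, of "axis 3 1" "axis 1 1"]
        cross_rotation_matrix[OF r, of "axis 1 1" "axis 2 1"] by (simp_all add: col)
  qed
  show "Q$1$1 = Q$2$2 * Q$3$3 - Q$3$2 * Q$2$3" "Q$2$1 = Q$3$2 * Q$1$3 - Q$1$2 * Q$3$3" "Q$3$1 = Q$1$2 * Q$2$3 - Q$2$2 * Q$1$3"
      "Q$1$2 = Q$2$3 * Q$3$1 - Q$3$3 * Q$2$1" "Q$2$2 = Q$3$3 * Q$1$1 - Q$1$3 * Q$3$1" "Q$3$2 = Q$1$3 * Q$2$1 - Q$2$3 * Q$1$1"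
      "Q$1$3 = Q$2$1 * Q$3$2 - Q$3$1 * Q$2$2" "Q$2$3 = Q$3$1 * Q$1$2 - Q$1$1 * Q$3$2" "Q$3$3 = Q$1$1 * Q$2$2 - Q$2$1 * Q$1$2"
    using c by (simp_all add: vec_eq_iff forall_3 cross3_def column_def)
qed

text \<open>For the rotation by \<theta> about u, the vector of Q - transpose Q is 2 sin \<theta> u
  and 1 + trace Q is 2 (1 + cos \<theta>); the quotient is tan (\<theta> / 2) u.\<close>

definition cayley_inv :: "real^3^3 \<Rightarrow> real^3" where
  "cayley_inv Q = (1 / (1 + trace Q)) *\<^sub>R vee (Q - transpose Q)"

lemma trace3: "trace Q = Q$1$1 + Q$2$2 + Q$3$3" for Q :: "real^3^3"
  by (simp add: trace_def sum_3)

lemma trace_cayley: "1 + trace (cayley x) = 4 / (1 + x \<bullet> x)"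
proof -
  define n where "n = x \<bullet> x"
  have n: "n = x$1 * x$1 + x$2 * x$2 + x$3 * x$3" "0 < 1 + n" using one_plus_inner_pos[of x] by (simp_all add: n_def inner_vec_def sum_3)
  have "1 + trace (cayley x) = 4 - 2 * (2 / (1 + n)) * n"
    unfolding trace3 cayley_def quad_entries n_def[symmetric] by (simp add: n(1) algebra_simps add_divide_distrib)
  also have "\<dots> = 4 / (1 + n)" using n(2) by (simp add: field_simps)
  finally show ?thesis by (simp add: n_def)
qed

lemma cayley_inv_cayley: "cayley_inv (cayley x) = x"
proof -
  define n where "n = x \<bullet> x"
  have n: "0 < 1 + n" using one_plus_inner_pos[of x] by (simp add: n_def)
  have "vee (cayley x - transpose (cayley x)) = (4 / (1 + n)) *\<^sub>R x"
    by (simp add: vec_eq_iff forall_3 transpose_def cayley_def quad_entries n_def)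
  then show ?thesis unfolding cayley_inv_def trace_cayley n_def[symmetric] using n by (simp add: vec_eq_iff forall_3)
qed

text \<open>With d the vector of Q - transpose Q and T = 1 + trace Q, the off-diagonal products of
  entries of d, and the pairwise sums of their squares, are T times expressions linear in Q, by
  orthogonality and the cofactor relations. Division by T thus recovers the symmetric part of Q from
  the antisymmetric part.\<close>

lemma cayley_cayley_inv:
  assumes Q: "Q \<in> SO3" and tr: "1 + trace Q \<noteq> 0"
  shows "cayley (cayley_inv Q) = Q"
proof -
  define q where "q i j = Q $ i $ j" for i j
  note cols = SO3_cols[OF Q, folded q_def] and rows = SO3_rows[OF Q, folded q_def] and cof = SO3_cofactor[OF Q, folded q_def]
  define T where "T = 1 + (q 1 1 + q 2 2 + q 3 3)"
  have T: "T = 1 + trace Q" by (simp add: T_def trace3 q_def)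
  define d1 where "d1 = q 3 2 - q 2 3"
  define d2 where "d2 = q 1 3 - q 3 1"
  define d3 where "d3 = q 2 1 - q 1 2"
  have x: "cayley_inv Q $ 1 = d1 / T" "cayley_inv Q $ 2 = d2 / T" "cayley_inv Q $ 3 = d3 / T"
    by (simp_all add: cayley_inv_def T d1_def d2_def d3_def q_def transpose_def)
  have D: "d2 * d2 + d3 * d3 = 2 * T * (1 - q 1 1)" "d1 * d1 + d3 * d3 = 2 * T * (1 - q 2 2)" "d1 * d1 + d2 * d2 = 2 * T * (1 - q 3 3)"
    unfolding T_def d1_def d2_def d3_def
    using cols[of 1 1] cols[of 2 2] cols[of 3 3] rows[of 1 1] rows[of 2 2] rows[of 3 3] cof
    by (simp_all (no_asm_use) add: algebra_simps)
  have O: "d1 * d2 = T * (q 1 2 + q 2 1)" "d1 * d3 = T * (q 1 3 + q 3 1)" "d2 * d3 = T * (q 2 3 + q 3 2)"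
    unfolding T_def d1_def d2_def d3_def
    using cols[of 1 2] cols[of 1 3] cols[of 2 3] rows[of 1 2] rows[of 1 3] rows[of 2 3] cof
    by (simp_all (no_asm_use) add: algebra_simps)
  have sum: "d1 * d1 + d2 * d2 + d3 * d3 = T * (4 - T)"
    using D by (simp add: T_def algebra_simps)
  have T0: "T \<noteq> 0" using tr by (simp add: T)
  have inn: "1 + cayley_inv Q \<bullet> cayley_inv Q = 4 / T"
  proof -
    have "cayley_inv Q \<bullet> cayley_inv Q = (d1 * d1 + d2 * d2 + d3 * d3) / (T * T)"
      by (simp add: inner_vec_def sum_3 x add_divide_distrib)
    also have "\<dots> = (4 - T) / T" using T0 by (simp add: sum)
    finally show ?thesis using T0 by (simp add: field_simps)
  qed
  have h: "2 / (1 + cayley_inv Q \<bullet> cayley_inv Q) = T / 2" unfolding inn by simp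
  have y: "T / 2 * (r / T * (s / T)) = r * s / (2 * T)" "T / 2 * (r / T * (s / T) + r' / T * (s' / T)) = (r * s + r' * s') / (2 * T)"
    "T / 2 * (r / T) = r / 2" for r s r' s'
    using T0 by (simp_all add: field_simps)
  have "quad (T / 2) (T / 2) (cayley_inv Q) = Q"
    unfolding vec_eq_iff forall_3 quad_entries x y D O
    using T0 by (simp add: q_def[symmetric] d1_def d2_def d3_def field_simps)
  then show ?thesis unfolding cayley_def h .
qed

section \<open>The antisymmetric matrices generated by \<open>A\<close> and \<open>B\<close>, and
  the covering by half turns\<close>

lemma cross_orth_zero:
  fixes u e :: "real^3"
  assumes "u \<times> e = 0" "u \<bullet> e = 0" "e \<noteq> 0"
  shows "u = 0"
proof -
  have "(norm u)\<^sup>2 * (norm e)\<^sup>2 = 0" using norm_cross_dot[of u e] assms by simp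
  then show ?thesis using assms(3) by simp
qed

text \<open>In terms of vectors, c is the cross product of a and b and e that of b and c. As c is
  nonzero, b, c and e are nonzero and pairwise orthogonal, so coefficients are found by
  projection.\<close>

lemma antisymmetric_basis:
  fixes A B :: "real^3^3"
  assumes A: "antisymmetric A" and B: "antisymmetric B" and C: "C = A ** B - B ** A" "C \<noteq> 0"
    and X: "antisymmetric X"
  obtains \<alpha> \<beta> \<gamma> where "X = \<alpha> *\<^sub>R B + \<beta> *\<^sub>R C + \<gamma> *\<^sub>R (B ** C - C ** B)"
proof -
  define a b c e where "a = vee A" and "b = vee B" and "c = a \<times> b" and "e = b \<times> c"
  have h: "A = hat a" "B = hat b" by (simp_all add: a_def b_def hat_vee A B)
  have hc: "C = hat c" unfolding C(1) h hat_commutator c_def ..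
  have he: "B ** C - C ** B = hat e" unfolding hc h(2) hat_commutator e_def ..
  have c0: "c \<noteq> 0" using C(2) linear_0[OF bounded_linear.linear[OF bounded_linear_hat]] by (auto simp: hc)
  have b0: "b \<noteq> 0" using c0 by (auto simp: c_def)
  have bc: "b \<bullet> c = 0" by (simp add: c_def dot_cross_self)
  have e0: "e \<noteq> 0" using cross_orth_zero[of b c] b0 c0 bc by (auto simp: e_def)
  have be: "b \<bullet> e = 0" "c \<bullet> e = 0" by (simp_all add: e_def dot_cross_self)
  define x where "x = vee X"
  define \<alpha> \<beta> \<gamma> where "\<alpha> = (x \<bullet> b) / (b \<bullet> b)" and "\<beta> = (x \<bullet> c) / (c \<bullet> c)" and "\<gamma> = (x \<bullet> e) / (e \<bullet> e)"
  define u where "u = x - \<alpha> *\<^sub>R b - \<beta> *\<^sub>R c - \<gamma> *\<^sub>R e"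
  have cb: "c \<bullet> b = 0" "e \<bullet> b = 0" "e \<bullet> c = 0" using bc be by (simp_all add: inner_commute)
  have u: "u \<bullet> b = 0" "u \<bullet> c = 0" "u \<bullet> e = 0"
    using b0 c0 e0 bc be cb by (simp_all add: u_def \<alpha>_def \<beta>_def \<gamma>_def inner_diff_left)
  \<comment> \<open>u is what the projections leave over. Being orthogonal to b and c it is parallel
    to e by Lagrange's formula, and being orthogonal to e as well it is 0.\<close>
  have "u \<times> e = (u \<bullet> c) *\<^sub>R b - (u \<bullet> b) *\<^sub>R c" unfolding e_def by (rule Lagrange)
  then have "u \<times> e = 0" using u by simp
  then have "u = 0" using cross_orth_zero e0 u(3) by blast
  then have "x = \<alpha> *\<^sub>R b + \<beta> *\<^sub>R c + \<gamma> *\<^sub>R e" by (simp add: u_def algebra_simps)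
  then have "hat x = \<alpha> *\<^sub>R hat b + \<beta> *\<^sub>R hat c + \<gamma> *\<^sub>R hat e" 
    by (simp add: linear_add[OF bounded_linear.linear[OF bounded_linear_hat]] linear_scale[OF bounded_linear.linear[OF bounded_linear_hat]])
  then have "X = \<alpha> *\<^sub>R B + \<beta> *\<^sub>R C + \<gamma> *\<^sub>R (B ** C - C ** B)" unfolding x_def hat_vee[OF X] h(2)[symmetric] hc[symmetric] he[symmetric] .
  then show ?thesis by (rule that)
qed

text \<open>Rotations without the eigenvalue \<open>-1\<close> are Cayley transforms. The traces of the four products of
  \<open>Q\<close> with the identity and the half turns about the axes add up to zero, so that one of these products is
  a Cayley transform.\<close>

definition flips :: "(real^3^3) set" where
  "flips = insert (mat 1) (range (\<lambda>k. rot (axis k 1) pi))"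

lemma flip_entries: "rot (axis k 1) pi $ i $ j = (if i = j then (if i = k then 1 else - 1) else 0)"
  using exhaust_3[of i] exhaust_3[of j] exhaust_3[of k]
  by (auto simp: rot_def quad_entries axis_def)

lemma flips_SO3: "R \<in> flips \<Longrightarrow> R \<in> SO3"
proof -
  have "mat 1 \<in> SO3" by (simp add: SO3_def orthogonal_matrix_id)
  moreover have "rot (axis k 1) pi \<in> SO3" for k by (rule rot_SO3) (simp add: inner_axis_axis)
  ultimately show "R \<in> flips \<Longrightarrow> R \<in> SO3" by (auto simp: flips_def)
qed

lemma flips_involution: "R \<in> flips \<Longrightarrow> R ** R = mat 1"
  by (auto simp: flips_def vec_eq_iff matrix3_entry flip_entries mat_def) (metis exhaust_3)+

lemma flips_cover:
  obtains R where "R \<in> flips" "0 \<le> trace (Q ** R)"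
proof -
  have R: "rot (axis k 1) pi \<in> flips" "mat 1 \<in> flips" for k by (auto simp: flips_def)
  have "trace (Q ** mat 1) + trace (Q ** rot (axis 1 1) pi) + trace (Q ** rot (axis 2 1) pi) + trace (Q ** rot (axis 3 1) pi) = 0"
    by (simp add: trace3 matrix3_entry flip_entries)
  then have "0 \<le> trace (Q ** mat 1) \<or> 0 \<le> trace (Q ** rot (axis 1 1) pi) \<or> 0 \<le> trace (Q ** rot (axis 2 1) pi) \<or> 0 \<le> trace (Q ** rot (axis 3 1) pi)"
    by linarith
  then show thesis using R that by metis
qed

section \<open>Asymptotic left invariance\<close>

context so3_evolution
begin

lemma decay_antisymmetric:
  assumes nc: "A ** B - B ** A \<noteq> 0" and X: "antisymmetric X" and f: "real_polynomial_function f"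
  shows "((\<lambda>t. m t (lie X f)) \<longlongrightarrow> 0) at_top"
proof -
  define C where "C = A ** B - B ** A"
  have C: "((\<lambda>t. m t (lie C f)) \<longlongrightarrow> 0) at_top" if "real_polynomial_function f" for f
  proof -
    have "((\<lambda>t. m t (lie (B ** A - A ** B) f)) \<longlongrightarrow> 0) at_top"
      by (rule decay_commutator[OF decay_AB decay_B that])
    \<comment> \<open>The decay just obtained is along B A - A B; the coefficients -1 and 0 change
      its sign.\<close>
    from decay_comb[OF this this that, of "-1" 0] show ?thesis by (simp add: C_def)
  qed
  have D: "((\<lambda>t. m t (lie (C ** B - B ** C) f)) \<longlongrightarrow> 0) at_top"
    by (rule decay_commutator[OF decay_B[OF lie_poly] C f])
  obtain \<alpha> \<beta> \<gamma> where e: "X = \<alpha> *\<^sub>R B + \<beta> *\<^sub>R C + \<gamma> *\<^sub>R (B ** C - C ** B)"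
    using antisymmetric_basis[OF A B C_def nc[folded C_def] X] by blast
  have e': "X = 1 *\<^sub>R (\<alpha> *\<^sub>R B + \<beta> *\<^sub>R C) + (- \<gamma>) *\<^sub>R (C ** B - B ** C)" unfolding e by (simp add: algebra_simps)
  show ?thesis unfolding e' by (rule decay_comb[OF decay_comb[OF decay_B[OF f] C[OF f] f] D f])
qed

end

text \<open>Rotations about u commute with \<open>hat u\<close>, hence so do translation by them and
  the derivation. Derivatives of f along the orbit are thereby derivations of translated
  polynomials, to which the decay applies.\<close>

lemma lie_rot:
  assumes f: "real_polynomial_function f"
  shows "lie (hat u) (\<lambda>z. f (rot u s ** z)) z = lie (hat u) f (rot u s ** z)"
  unfolding lie_deriv_compose_linear[OF f bounded_linear_matrix_left]
  by (simp add: lie_deriv_def matrix_mul_assoc rot_hat_commute)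

lemma rot_curve_deriv:
  assumes f: "real_polynomial_function f" and u: "u \<bullet> u = 1"
  shows "((\<lambda>s. f (rot u s ** z)) has_real_derivative lie (hat u) f (rot u s ** z)) (at s)"
proof -
  have "((\<lambda>s. rot u s ** z) has_derivative (\<lambda>h. h *\<^sub>R (hat u ** (rot u s ** z)))) (at s)"
    using rot_deriv[OF u] by (simp add: has_vector_derivative_def)
  from diff_chain_at[OF this has_derivative_poly[OF f]]
  have "((\<lambda>s. f (rot u s ** z)) has_derivative (\<lambda>h. frechet_derivative f (at (rot u s ** z)) (h *\<^sub>R (hat u ** (rot u s ** z))))) (at s)"
    by (simp add: o_def)
  then show ?thesis
    using linear_scale[OF bounded_linear.linear[OF has_derivative_bounded_linear[OF has_derivative_poly[OF f]]]]
    by (simp add: has_field_derivative_def lie_deriv_def mult_commute_abs)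
qed

text \<open>Taylor's formula of second order along the orbit of z. The error is uniform in z because
  the orbit stays in \<open>SO3\<close>, where the second derivative is bounded.\<close>

lemma rot_taylor:
  assumes f: "real_polynomial_function f" and u: "u \<bullet> u = 1" and z: "z \<in> SO3"
    and C: "\<And>z. z \<in> SO3 \<Longrightarrow> \<bar>lie (hat u) (lie (hat u) f) z\<bar> \<le> C"
  shows "\<bar>f (rot u (s + h) ** z) - f (rot u s ** z) - h * lie (hat u) f (rot u s ** z)\<bar> \<le> C * h\<^sup>2"
proof -
  let ?S = "{- \<bar>h\<bar>..\<bar>h\<bar>}"
  have SO: "rot u s ** z \<in> SO3" for s by (intro SO3_mult rot_SO3 u z)
  have d1: "\<bar>lie (hat u) f (rot u (y + s) ** z) - lie (hat u) f (rot u s ** z)\<bar> \<le> C * \<bar>y\<bar>" for y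
    using field_differentiable_bound[of UNIV "\<lambda>y. lie (hat u) f (rot u y ** z)" "\<lambda>y. lie (hat u) (lie (hat u) f) (rot u y ** z)" C "y + s" s]
      rot_curve_deriv[OF lie_poly[OF f] u] C[OF SO] by simp
  have C0: "0 \<le> C" using C[OF z] by linarith
  define q where "q y = f (rot u (y + s) ** z) - y * lie (hat u) f (rot u s ** z)" for y
  have q: "(q has_real_derivative lie (hat u) f (rot u (y + s) ** z) - lie (hat u) f (rot u s ** z)) (at y within ?S)" for y
  proof -
    have "((\<lambda>y. f (rot u (y + s) ** z)) has_real_derivative lie (hat u) f (rot u (y + s) ** z)) (at y)"
      using rot_curve_deriv[OF f u, of z "y + s"] by (simp only: DERIV_shift)
    then have "(q has_real_derivative lie (hat u) f (rot u (y + s) ** z) - lie (hat u) f (rot u s ** z)) (at y)"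
      unfolding q_def by (auto intro!: derivative_eq_intros)
    then show ?thesis by (rule has_field_derivative_at_within)
  qed
  have "norm (q h - q 0) \<le> (C * \<bar>h\<bar>) * norm (h - 0)"
  proof (rule field_differentiable_bound[OF _ q])
    fix y assume y: "y \<in> ?S"
    then have "C * \<bar>y\<bar> \<le> C * \<bar>h\<bar>" by (intro mult_left_mono C0) auto
    then show "norm (lie (hat u) f (rot u (y + s) ** z) - lie (hat u) f (rot u s ** z)) \<le> C * \<bar>h\<bar>" using d1[of y] by simp
  qed auto
  then show ?thesis by (simp add: q_def power2_eq_square algebra_simps)
qed

context so3_evolution
begin

lemma m_diff:
  assumes t: "0 \<le> t" and f: "real_polynomial_function f" and g: "real_polynomial_function g"
  shows "m t (\<lambda>z. f z - g z) = m t f - m t g"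
  using m_add[OF t f poly_cmult[OF g, of "-1"]] m_scale[OF t g, of "-1"] by simp

lemma poly_left: "real_polynomial_function f \<Longrightarrow> real_polynomial_function (\<lambda>z. f (P ** z))" for P :: "real^3^3" and f :: "real^3^3 \<Rightarrow> real"
  by (rule real_polynomial_function_compose_linear[OF _ bounded_linear_matrix_left])

text \<open>The derivative with respect to the angle s tends to 0 as t grows, for each s but without
  known uniformity in s. The angle is therefore divided into N steps: the first-order terms of
  finitely many steps become small together, and the accumulated second-order error is of order
  \<open>\<theta>\<^sup>2 / N\<close>.\<close>

lemma asymptotic_rot_invariance:
  assumes nc: "A ** B - B ** A \<noteq> 0" and f: "real_polynomial_function f" and u: "u \<bullet> u = 1"
  shows "((\<lambda>t. m t (\<lambda>z. f (rot u \<theta> ** z)) - m t f) \<longlongrightarrow> 0) at_top"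
proof -
  define D where "D t s = m t (\<lambda>z. f (rot u s ** z))" for t s
  have p: "real_polynomial_function (\<lambda>z. f (rot u s ** z))" for s by (rule poly_left[OF f])
  obtain C where C: "\<And>z. z \<in> SO3 \<Longrightarrow> \<bar>lie (hat u) (lie (hat u) f) z\<bar> \<le> C"
    using poly_SO3_bounded[OF lie_poly[OF lie_poly[OF f]]] by blast
  define K where "K = \<bar>\<kappa> * C\<bar> + 1"
  have K: "0 < K" by (simp add: K_def)
  \<comment> \<open>One half of the bound is the Taylor error; the other half is met by the
    first-order term once t is large.\<close>
  have step: "eventually (\<lambda>t. \<bar>D t (s + h) - D t s\<bar> \<le> 2 * K * h\<^sup>2) at_top" if h: "h \<noteq> 0" for s h
  proof -
    have L: "real_polynomial_function (lie (hat u) (\<lambda>z. f (rot u s ** z)))" by (rule lie_poly[OF p])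
    have "((\<lambda>t. m t (lie (hat u) (\<lambda>z. f (rot u s ** z)))) \<longlongrightarrow> 0) at_top"
      by (rule decay_antisymmetric[OF nc antisymmetric_hat p])
    from tendstoD[OF this, of "K * \<bar>h\<bar>"] have "eventually (\<lambda>t. \<bar>m t (lie (hat u) (\<lambda>z. f (rot u s ** z)))\<bar> < K * \<bar>h\<bar>) at_top"
      using K h by simp
    then show ?thesis using eventually_nonneg
    proof eventually_elim
      case (elim t)
      let ?r = "\<lambda>z. (f (rot u (s + h) ** z) - f (rot u s ** z)) - h * lie (hat u) (\<lambda>z. f (rot u s ** z)) z"
      have p1: "real_polynomial_function (\<lambda>z. f (rot u (s + h) ** z) - f (rot u s ** z))"
        using poly_add[OF p poly_cmult[OF p, of "-1"], of "s + h" s] by simp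
      have "real_polynomial_function ?r" using poly_add[OF p1 poly_cmult[OF L, of "- h"]] by simp
      then have "\<bar>m t ?r\<bar> \<le> \<kappa> * (C * h\<^sup>2)"
        by (rule m_bound[OF elim(2)]) (simp add: lie_rot[OF f], rule rot_taylor[OF f u _ C])
      also have "\<dots> \<le> K * h\<^sup>2" by (simp add: K_def mult.assoc[symmetric] mult_right_mono)
      finally have r: "\<bar>m t ?r\<bar> \<le> K * h\<^sup>2" .
      have "m t ?r = D t (s + h) - D t s - h * m t (lie (hat u) (\<lambda>z. f (rot u s ** z)))"
        unfolding m_diff[OF elim(2) p1 poly_cmult[OF L]] m_scale[OF elim(2) L] m_diff[OF elim(2) p p] D_def by simp
      moreover have "\<bar>h * m t (lie (hat u) (\<lambda>z. f (rot u s ** z)))\<bar> \<le> \<bar>h\<bar> * (K * \<bar>h\<bar>)"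
        unfolding abs_mult using elim(1) by (intro mult_left_mono) auto
      moreover have "\<bar>h\<bar> * (K * \<bar>h\<bar>) = K * h\<^sup>2" by (simp add: power2_eq_square)
      ultimately show ?case using r by linarith
    qed
  qed
  have steps: "eventually (\<lambda>t. \<bar>D t (real k * h) - D t 0\<bar> \<le> real k * (2 * K * h\<^sup>2)) at_top" if h: "h \<noteq> 0" for k h
  proof (induction k)
    case (Suc k)
    have e: "real (Suc k) * h = real k * h + h" by (simp add: algebra_simps)
    from Suc step[OF h, of "real k * h"] show ?case
      unfolding e by eventually_elim (simp add: algebra_simps)
  qed simp
  have "((\<lambda>t. D t \<theta> - D t 0) \<longlongrightarrow> 0) at_top"
  proof (cases "\<theta> = 0")
    case False
    show ?thesis
    proof (rule tendstoI)
      fix e :: real assume e: "0 < e"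
      obtain N :: nat where N: "2 * K * \<theta>\<^sup>2 / e < real N" using reals_Archimedean2 by blast
      moreover have "0 < 2 * K * \<theta>\<^sup>2 / e" using K False e by simp
      ultimately have N0: "0 < real N" by linarith
      have "2 * K * \<theta>\<^sup>2 < e * real N" using N e by (simp add: field_simps)
      then have lt: "real N * (2 * K * (\<theta> / real N)\<^sup>2) < e" using N0 by (simp add: power2_eq_square field_simps)
      have "\<theta> / real N \<noteq> 0" using False N0 by simp
      from steps[OF this, of N] show "eventually (\<lambda>t. dist (D t \<theta> - D t 0) 0 < e) at_top"
        by eventually_elim (use lt N0 in simp)
    qed
  qed simp
  then show ?thesis by (simp add: D_def rot_0)
qed

text \<open>Invariance passes to products, so rotations about an axis suffice. With R from
  \<open>flips_cover\<close>, Q is the product of the Cayley transform Q R and of R itself, and both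
  are rotations about an axis.\<close>

theorem asymptotic_invariance:
  assumes nc: "A ** B - B ** A \<noteq> 0" and f: "real_polynomial_function f" and Q: "Q \<in> SO3"
  shows "((\<lambda>t. m t (\<lambda>z. f (Q ** z)) - m t f) \<longlongrightarrow> 0) at_top"
proof -
  define I where "I P \<longleftrightarrow> (\<forall>f. real_polynomial_function f \<longrightarrow> ((\<lambda>t. m t (\<lambda>z. f (P ** z)) - m t f) \<longlongrightarrow> 0) at_top)" for P
  have rot: "I (rot u \<theta>)" if "u \<bullet> u = 1" for u \<theta>
    unfolding I_def using asymptotic_rot_invariance[OF nc _ that] by blast
  have prod: "I (P ** R)" if P: "I P" and R: "I R" for P R
    unfolding I_def
  proof (intro allI impI)
    fix f :: "real^3^3 \<Rightarrow> real" assume f: "real_polynomial_function f"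
    have "((\<lambda>t. m t (\<lambda>z. f (P ** (R ** z))) - m t (\<lambda>z. f (P ** z))) \<longlongrightarrow> 0) at_top"
      using R[unfolded I_def, rule_format, OF poly_left[OF f]] .
    moreover have "((\<lambda>t. m t (\<lambda>z. f (P ** z)) - m t f) \<longlongrightarrow> 0) at_top"
      using P[unfolded I_def, rule_format, OF f] .
    ultimately show "((\<lambda>t. m t (\<lambda>z. f (P ** R ** z)) - m t f) \<longlongrightarrow> 0) at_top"
      using tendsto_add[of "\<lambda>t. m t (\<lambda>z. f (P ** (R ** z))) - m t (\<lambda>z. f (P ** z))" 0 at_top "\<lambda>t. m t (\<lambda>z. f (P ** z)) - m t f" 0]
      by (simp add: matrix_mul_assoc)
  qed
  obtain R where R: "R \<in> flips" "0 \<le> trace (Q ** R)" by (rule flips_cover)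
  have one: "I (mat 1)" using rot[of "axis 1 1" 0] by (simp add: rot_0 inner_axis_axis)
  have IR: "I R" using R(1) rot[of "axis k 1" pi for k] one by (auto simp: flips_def inner_axis_axis)
  have QR: "Q ** R \<in> SO3" by (intro SO3_mult Q flips_SO3 R)
  have "cayley (cayley_inv (Q ** R)) = Q ** R" by (rule cayley_cayley_inv[OF QR]) (use R(2) in simp)
  then have "I (Q ** R)" using cayley_rot[of "cayley_inv (Q ** R)"] rot by auto
  then have "I (Q ** R ** R)" using IR by (rule prod)
  then have "I Q" by (simp add: matrix_mul_assoc[symmetric] flips_involution[OF R(1)])
  then show ?thesis unfolding I_def using f by blast
qed

end

section \<open>Riemannian volume\<close>

lemma bounded_bilinear_matrix: "bounded_bilinear ((**) :: real^3^3 \<Rightarrow> real^3^3 \<Rightarrow> real^3^3)"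
  unfolding bilinear_conv_bounded_bilinear[symmetric] bilinear_def
  using bounded_linear_matrix_left bounded_linear_matrix_right by (auto simp: linear_conv_bounded_linear)

lemma bounded_linear_transpose: "bounded_linear (transpose :: real^3^3 \<Rightarrow> real^3^3)"
  by (rule linear_conv_bounded_linear[THEN iffD1], rule linearI) (simp_all add: transpose_def vec_eq_iff)

lemmas continuous_on_matrix [continuous_intros] = bounded_bilinear.continuous_on[OF bounded_bilinear_matrix]
lemmas continuous_on_transpose [continuous_intros] = bounded_linear.continuous_on[OF bounded_linear_transpose]
lemmas continuous_on_hat [continuous_intros] = bounded_linear.continuous_on[OF bounded_linear_hat]
lemmas continuous_on_vee [continuous_intros] = bounded_linear.continuous_on[OF bounded_linear_vee]

lemma SO3_transpose: "Q \<in> SO3 \<Longrightarrow> transpose Q \<in> SO3"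
  by (auto simp: SO3_def orthogonal_matrix_def)

lemma SO3_inverse: "Q \<in> SO3 \<Longrightarrow> transpose Q ** Q = mat 1" "Q \<in> SO3 \<Longrightarrow> Q ** transpose Q = mat 1"
  by (auto simp: SO3_def orthogonal_matrix_def)

lemma SO3_cancel:
  assumes "P \<in> SO3"
  shows "transpose P ** (P ** X) = X" "P ** (transpose P ** X) = X" "X ** P ** transpose P = X" "X ** transpose P ** P = X"
proof -
  show "transpose P ** (P ** X) = X" "P ** (transpose P ** X) = X"
    by (simp_all only: matrix_mul_assoc SO3_inverse[OF assms] matrix_mul_lid)
  show "X ** P ** transpose P = X" "X ** transpose P ** P = X"
    by (simp_all only: matrix_mul_assoc[symmetric] SO3_inverse[OF assms] matrix_mul_rid)
qed

lemma linear_axis_expansion: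
  fixes L :: "real^3 \<Rightarrow> 'b::real_vector"
  assumes "linear L"
  shows "L x = (\<Sum>i\<in>UNIV. (x $ i) *\<^sub>R L (axis i 1))"
proof -
  have "x = (\<Sum>i\<in>UNIV. (x $ i) *\<^sub>R axis i 1)" using basis_expansion[of x] by (simp add: scalar_mult_eq_scaleR)
  then have "L x = L (\<Sum>i\<in>UNIV. (x $ i) *\<^sub>R axis i 1)" by simp
  then show ?thesis by (simp add: linear_sum[OF assms] linear_scale[OF assms])
qed

text \<open>The leading minors are positive because they occur, up to factors already known to be
  positive, as values of the quadratic form at vectors of cofactors.\<close>

lemma det_pos_definite:
  fixes H :: "real^3^3"
  assumes sym: "\<And>i j. H $ i $ j = H $ j $ i" and pos: "\<And>a. a \<noteq> 0 \<Longrightarrow> 0 < (\<Sum>i\<in>UNIV. \<Sum>j\<in>UNIV. a $ i * a $ j * H $ i $ j)"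
  shows "0 < det H"
proof -
  define a b c d e f where "a = H$1$1" and "b = H$1$2" and "c = H$1$3" and "d = H$2$2" and "e = H$2$3" and "f = H$3$3"
  have H: "H$1$1 = a" "H$1$2 = b" "H$1$3 = c" "H$2$1 = b" "H$2$2 = d" "H$2$3 = e" "H$3$1 = c" "H$3$2 = e" "H$3$3 = f"
    using sym by (simp_all add: a_def b_def c_def d_def e_def f_def)
  have q: "0 < x * x * a + 2 * x * y * b + 2 * x * z * c + y * y * d + 2 * y * z * e + z * z * f" if "\<not> (x = 0 \<and> y = 0 \<and> z = 0)" for x y z
  proof -
    have "(vector [x, y, z] :: real^3) \<noteq> 0" using that by (auto simp: vec_eq_iff forall_3)
    from pos[OF this] show ?thesis by (simp add: sum_3 H algebra_simps)
  qed
  have a: "0 < a" using q[of 1 0 0] by simp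
  have "0 < a * (a * d - b * b)" using q[of "- b" a 0] a by (simp add: algebra_simps)
  then have m: "0 < a * d - b * b" using a by (simp add: zero_less_mult_iff)
  have D: "det H = a * d * f + b * e * c + c * b * e - a * e * e - b * b * f - c * d * c" by (simp add: det_3 H)
  \<comment> \<open>At the vector of cofactors of the last row the form takes the value det H times
    the last of these cofactors.\<close>
  have "0 < det H * (a * d - b * b)"
    using q[of "b * e - c * d" "b * c - a * e" "a * d - b * b"] m unfolding D by (simp add: algebra_simps)
  then show ?thesis using m by (simp add: zero_less_mult_iff)
qed

section \<open>The Cayley map and its translates as parametrizations\<close>

definition cayley_deriv :: "real^3 \<Rightarrow> real^3 \<Rightarrow> real^3^3" where
  "cayley_deriv x v = (- 4 * (x \<bullet> v) / (1 + x \<bullet> x)\<^sup>2) *\<^sub>R (hat x + hat x ** hat x)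
     + (2 / (1 + x \<bullet> x)) *\<^sub>R (hat v + (hat x ** hat v + hat v ** hat x))"

lemma has_derivative_cayley: "(cayley has_derivative cayley_deriv x) (at x)"
proof -
  have c: "cayley = (\<lambda>x. mat 1 + (2 / (1 + x \<bullet> x)) *\<^sub>R (hat x + hat x ** hat x))"
    by (auto simp: cayley_def quad_def algebra_simps)
  have h: "(hat has_derivative hat) (at x)" by (rule bounded_linear_imp_has_derivative[OF bounded_linear_hat])
  have hh: "((\<lambda>x. hat x ** hat x) has_derivative (\<lambda>v. hat x ** hat v + hat v ** hat x)) (at x)"
    by (rule bounded_bilinear.FDERIV[OF bounded_bilinear_matrix h h])
  have n: "1 + x \<bullet> x \<noteq> 0" using one_plus_inner_pos[of x] by simp
  have s: "((\<lambda>x. 2 / (1 + x \<bullet> x)) has_derivative (\<lambda>v. - 4 * (x \<bullet> v) / (1 + x \<bullet> x)\<^sup>2)) (at x)"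
    by (rule derivative_eq_intros refl n | simp)+ (auto simp: fun_eq_iff inner_commute power2_eq_square n divide_simps)
  show ?thesis unfolding c
    by (rule has_derivative_eq_rhs[OF has_derivative_add[OF has_derivative_const has_derivative_scaleR[OF s has_derivative_add[OF h hh]]]])
      (auto simp: cayley_deriv_def fun_eq_iff)
qed

lemma linear_cayley_deriv: "linear (cayley_deriv x)"
  using has_derivative_bounded_linear[OF has_derivative_cayley] by (rule bounded_linear.linear)

text \<open>For v in the kernel, the trace gives x . v = 0, which removes the first summand of the
  derivative. What remains is a multiple of the antisymmetric \<open>hat v\<close> plus a symmetric
  matrix, so it vanishes only for v = 0.\<close>

lemma inj_cayley_deriv: "inj (cayley_deriv x)"
  unfolding linear_injective_0[OF linear_cayley_deriv]
proof (intro allI impI)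
  fix v assume z: "cayley_deriv x v = 0"
  define n where "n = x \<bullet> x"
  have n: "0 < 1 + n" using one_plus_inner_pos[of x] by (simp add: n_def)
  define \<alpha> where "\<alpha> = - 4 * (x \<bullet> v) / (1 + n)\<^sup>2"
  define w where "w = 2 / (1 + n)"
  have e: "cayley_deriv x v $ i $ j = \<alpha> * (hat x + hat x ** hat x) $ i $ j + w * (hat v + (hat x ** hat v + hat v ** hat x)) $ i $ j" for i j
    by (simp add: cayley_deriv_def \<alpha>_def w_def n_def)
  have "trace (cayley_deriv x v) = \<alpha> * (- 2 * n) + w * (- 4 * (x \<bullet> v))"
    unfolding trace3 e by (simp add: matrix3_entry n_def inner_vec_def sum_3 algebra_simps)
  also have "\<dots> = - 8 * (x \<bullet> v) / (1 + n)\<^sup>2"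
    using n by (simp add: \<alpha>_def w_def power2_eq_square divide_simps) (simp add: algebra_simps)
  finally have "x \<bullet> v = 0" using z n by (simp add: trace3)
  then have "\<alpha> = 0" by (simp add: \<alpha>_def)
  then have e': "w * (hat v + (hat x ** hat v + hat v ** hat x)) $ i $ j = 0" for i j
    using e[of i j] z by simp
  have w: "w \<noteq> 0" using n by (simp add: w_def)
  then have e'': "(hat v + (hat x ** hat v + hat v ** hat x)) $ i $ j = 0" for i j using e'[of i j] by simp
  show "v = 0"
    using e''[of 3 2] e''[of 2 3] e''[of 1 3] e''[of 3 1] e''[of 2 1] e''[of 1 2]
    by (simp add: vec_eq_iff forall_3 matrix3_entry algebra_simps)
qed

text \<open>Differentiate the identity
  \<open>transpose (cayley x) ** cayley x = mat 1\<close>.\<close>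

lemma cayley_deriv_tangent: "cayley_deriv x v \<in> tangent_SO3 (cayley x)"
proof -
  have d: "((\<lambda>x. transpose (cayley x) ** cayley x) has_derivative
     (\<lambda>v. transpose (cayley x) ** cayley_deriv x v + transpose (cayley_deriv x v) ** cayley x)) (at x)"
    by (intro bounded_bilinear.FDERIV[OF bounded_bilinear_matrix] has_derivative_cayley
        bounded_linear.has_derivative[OF bounded_linear_transpose])
  have "(\<lambda>x. transpose (cayley x) ** cayley x) = (\<lambda>x. mat 1)" by (simp add: SO3_inverse cayley_SO3)
  then have "((\<lambda>x. transpose (cayley x) ** cayley x) has_derivative (\<lambda>v. 0)) (at x)" by simp
  from has_derivative_unique[OF d this]
  have "transpose (cayley x) ** cayley_deriv x v + transpose (cayley_deriv x v) ** cayley x = 0" by (rule fun_cong)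
  moreover have "transpose (transpose (cayley x) ** cayley_deriv x v) = transpose (cayley_deriv x v) ** cayley x"
    by (simp add: matrix_transpose_mul)
  ultimately have "antisymmetric (transpose (cayley x) ** cayley_deriv x v)"
    unfolding antisymmetric_def by (simp add: add_eq_0_iff add.commute)
  then show ?thesis unfolding tangent_SO3_def using SO3_cancel(2)[OF cayley_SO3, of x "cayley_deriv x v"] by (metis (mono_tags, lifting) mem_Collect_eq)
qed

lemma continuous_on_cayley [continuous_intros]: "continuous_on S f \<Longrightarrow> continuous_on S (\<lambda>x. cayley (f x))"
proof -
  assume f: "continuous_on S f"
  have "continuous_on UNIV cayley"
    using has_derivative_continuous[OF has_derivative_cayley] by (simp add: continuous_on_eq_continuous_at)
  then show "continuous_on S (\<lambda>x. cayley (f x))" by (rule continuous_on_compose2[OF _ f]) auto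
qed

lemma continuous_on_cayley_deriv: "continuous_on S (\<lambda>x. cayley_deriv x v)"
proof -
  have "1 + x \<bullet> x \<noteq> 0" for x :: "real^3" using one_plus_inner_pos[of x] by simp
  then show ?thesis unfolding cayley_deriv_def by (intro continuous_intros) auto
qed

lemma matrix_neg: "(- X) ** Y = - (X ** Y)" "X ** (- Y) = - (X ** Y)" for X Y :: "real^3^3"
  by (simp_all add: vec_eq_iff matrix3_entry)

text \<open>Translation from the right conjugates the antisymmetric factor by R, and conjugation by
  a rotation preserves antisymmetry.\<close>

lemma tangent_SO3_mult:
  assumes X: "X \<in> tangent_SO3 Q" and R: "R \<in> SO3"
  shows "P ** X ** R \<in> tangent_SO3 (P ** Q ** R)"
proof -
  obtain Y where Y: "X = Q ** Y" "antisymmetric Y" using X by (auto simp: tangent_SO3_def)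
  have "P ** X ** R = (P ** Q ** R) ** (transpose R ** Y ** R)"
    unfolding Y by (simp add: matrix_mul_assoc SO3_cancel[OF R])
  moreover have "transpose (transpose R ** Y ** R) = - (transpose R ** Y ** R)"
    using Y(2) by (simp add: antisymmetric_def matrix_transpose_mul matrix_mul_assoc[symmetric] matrix_neg)
  ultimately show ?thesis unfolding tangent_SO3_def antisymmetric_def by blast
qed

lemma continuous_on_trace: "continuous_on S f \<Longrightarrow> continuous_on S (\<lambda>x. trace (f x :: real^3^3))"
  unfolding trace3 by (intro continuous_intros)

text \<open>The two-sided translates of the Cayley chart are permuted by the translations of the
  group, so the invariance of the volume reduces to comparing its values in these charts. The image
  of a chart is the open set on which the translated trace differs from -1.\<close>

lemma local_parametrization_cayley:
  assumes P: "P \<in> SO3" and R: "R \<in> SO3"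
  shows "local_parametrization_SO3 UNIV (\<lambda>x. P ** cayley x ** R) (\<lambda>x v. P ** cayley_deriv x v ** R)"
proof -
  let ?\<phi> = "\<lambda>x. P ** cayley x ** R" and ?\<psi> = "\<lambda>Q. cayley_inv (transpose P ** Q ** transpose R)"
  let ?T = "{Q. 1 + trace (transpose P ** Q ** transpose R) \<noteq> 0}"
  have inv: "transpose P ** ?\<phi> x ** transpose R = cayley x" for x
    by (simp add: matrix_mul_assoc[symmetric] SO3_cancel[OF P] SO3_inverse[OF R])
  have inv': "P ** (transpose P ** Q ** transpose R) ** R = Q" for Q
    by (simp add: matrix_mul_assoc[symmetric] SO3_cancel[OF P] SO3_inverse[OF R])
  have pos: "1 + trace (cayley x) \<noteq> 0" for x using one_plus_inner_pos[of x] unfolding trace_cayley by simp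
  have img: "?\<phi> ` UNIV = SO3 \<inter> ?T"
  proof (intro equalityI subsetI)
    fix Q assume "Q \<in> ?\<phi> ` UNIV"
    then obtain x where Q: "Q = ?\<phi> x" by blast
    show "Q \<in> SO3 \<inter> ?T" using pos[of x] unfolding Q by (simp add: inv SO3_mult P R cayley_SO3)
  next
    fix Q assume Q: "Q \<in> SO3 \<inter> ?T"
    then have "cayley (?\<psi> Q) = transpose P ** Q ** transpose R"
      by (intro cayley_cayley_inv) (auto intro!: SO3_mult SO3_transpose P R)
    then have "Q = ?\<phi> (?\<psi> Q)" by (simp only: inv')
    then show "Q \<in> ?\<phi> ` UNIV" by blast
  qed
  have "open ?T" by (intro open_Collect_neq continuous_intros continuous_on_trace)
  then have op: "openin (top_of_set SO3) (SO3 \<inter> ?T)" by (intro openin_open_Int)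
  have \<psi>: "continuous_on (SO3 \<inter> ?T) ?\<psi>"
    unfolding cayley_inv_def by (intro continuous_intros continuous_on_trace) auto
  have hom: "homeomorphism UNIV (?\<phi> ` UNIV) ?\<phi> ?\<psi>"
    by (rule homeomorphismI) (use \<psi> in \<open>auto simp: inv cayley_inv_cayley img[symmetric] intro!: continuous_intros\<close>)
  have der: "(?\<phi> has_derivative (\<lambda>v. P ** cayley_deriv x v ** R)) (at x)" for x
    by (intro bounded_linear.has_derivative[OF bounded_linear_matrix_right]
        bounded_linear.has_derivative[OF bounded_linear_matrix_left] has_derivative_cayley)
  have inj: "inj (\<lambda>v. P ** cayley_deriv x v ** R)" for x
  proof (rule injI)
    fix v w assume "P ** cayley_deriv x v ** R = P ** cayley_deriv x w ** R"
    then have "transpose P ** (P ** cayley_deriv x v ** R) ** transpose R = transpose P ** (P ** cayley_deriv x w ** R) ** transpose R" by simp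
    then have "cayley_deriv x v = cayley_deriv x w"
      by (simp add: matrix_mul_assoc[symmetric] SO3_cancel[OF P] SO3_inverse[OF R])
    then show "v = w" using inj_cayley_deriv by (auto dest: injD)
  qed
  show ?thesis
    unfolding local_parametrization_SO3_def
    using hom der inj op img by (auto intro!: continuous_intros continuous_on_cayley_deriv)
qed

text \<open>The sets of the cover are peeled off one after the other, with additivity applied to the
  parts of J inside and outside.\<close>

lemma measure_eqI_cover:
  assumes sets: "sets N = sets M" and fin: "finite I" and cov: "space M \<subseteq> (\<Union>i\<in>I. S i)"
    and S: "\<And>i. i \<in> I \<Longrightarrow> S i \<inter> space M \<in> sets M"
    and eq: "\<And>i J. i \<in> I \<Longrightarrow> J \<in> sets M \<Longrightarrow> J \<subseteq> S i \<Longrightarrow> emeasure M J = emeasure N J"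
  shows "M = N"
proof (rule measure_eqI)
  have "emeasure M J = emeasure N J" if "finite I'" "I' \<subseteq> I" "J \<in> sets M" "J \<subseteq> (\<Union>i\<in>I'. S i)" for I' J
    using that
  proof (induction I' arbitrary: J)
    case (insert i I')
    have Si: "S i \<inter> space M \<in> sets M" using insert.prems S by auto
    have e: "J \<inter> S i = J \<inter> (S i \<inter> space M)" "J - S i = J - (S i \<inter> space M)"
      using sets.sets_into_space[OF insert.prems(2)] by auto
    have m: "J \<inter> S i \<in> sets M" "J - S i \<in> sets M" unfolding e using insert.prems(2) Si by auto
    have J: "J = (J \<inter> S i) \<union> (J - S i)" "(J \<inter> S i) \<inter> (J - S i) = {}" by auto
    have "emeasure M J = emeasure M (J \<inter> S i) + emeasure M (J - S i)"
      using plus_emeasure[OF m J(2)] J(1) by simp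
    also have "emeasure M (J \<inter> S i) = emeasure N (J \<inter> S i)" by (rule eq[OF _ m(1)]) (use insert.prems in auto)
    also have "emeasure M (J - S i) = emeasure N (J - S i)" by (rule insert.IH) (use insert.prems m in auto)
    also have "emeasure N (J \<inter> S i) + emeasure N (J - S i) = emeasure N J"
      using plus_emeasure[of "J \<inter> S i" N "J - S i"] J m by (simp add: sets)
    finally show ?case .
  qed simp
  note on_union = this
  show "emeasure M J = emeasure N J" if "J \<in> sets M" for J
    by (rule on_union[OF fin subset_refl that order_trans[OF sets.sets_into_space[OF that] cov]])
qed (rule sets[symmetric])

section \<open>The volume of a bi-invariant metric\<close>

locale biinvariant_volume =
  fixes g :: "real^3^3 \<Rightarrow> real^3^3 \<Rightarrow> real^3^3 \<Rightarrow> real" and vol :: "(real^3^3) measure"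
  assumes g: "biinvariant_metric_SO3 g" and vol: "riemannian_volume_SO3 g vol"
begin

lemma g_linear: "Q \<in> SO3 \<Longrightarrow> \<xi> \<in> tangent_SO3 Q \<Longrightarrow> \<eta> \<in> tangent_SO3 Q \<Longrightarrow> \<zeta> \<in> tangent_SO3 Q \<Longrightarrow>
    g Q (a *\<^sub>R \<xi> + b *\<^sub>R \<eta>) \<zeta> = a * g Q \<xi> \<zeta> + b * g Q \<eta> \<zeta>"
  by (rule g[unfolded biinvariant_metric_SO3_def, THEN conjunct1, rule_format])

lemma g_sym: "Q \<in> SO3 \<Longrightarrow> \<xi> \<in> tangent_SO3 Q \<Longrightarrow> \<eta> \<in> tangent_SO3 Q \<Longrightarrow> g Q \<xi> \<eta> = g Q \<eta> \<xi>"
  by (rule g[unfolded biinvariant_metric_SO3_def, THEN conjunct2, THEN conjunct1, rule_format])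

lemma g_pos: "Q \<in> SO3 \<Longrightarrow> \<xi> \<in> tangent_SO3 Q \<Longrightarrow> \<xi> \<noteq> 0 \<Longrightarrow> 0 < g Q \<xi> \<xi>"
  by (rule g[unfolded biinvariant_metric_SO3_def, THEN conjunct2, THEN conjunct2, THEN conjunct1, rule_format])

lemma g_invariant: "P \<in> SO3 \<Longrightarrow> Q \<in> SO3 \<Longrightarrow> R \<in> SO3 \<Longrightarrow> \<xi> \<in> tangent_SO3 Q \<Longrightarrow> \<eta> \<in> tangent_SO3 Q \<Longrightarrow>
    g (P ** Q ** R) (P ** \<xi> ** R) (P ** \<eta> ** R) = g Q \<xi> \<eta>"
  by (rule g[unfolded biinvariant_metric_SO3_def, THEN conjunct2, THEN conjunct2, THEN conjunct2, rule_format])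

lemma tangent_SO3_comb:
  assumes "\<xi> \<in> tangent_SO3 Q" "\<eta> \<in> tangent_SO3 Q"
  shows "a *\<^sub>R \<xi> + b *\<^sub>R \<eta> \<in> tangent_SO3 Q"
proof -
  obtain X Y where X: "\<xi> = Q ** X" "\<eta> = Q ** Y" "antisymmetric X" "antisymmetric Y" using assms by (auto simp: tangent_SO3_def)
  have L: "linear ((**) Q :: real^3^3 \<Rightarrow> real^3^3)" by (rule bounded_linear.linear[OF bounded_linear_matrix_left])
  have T: "linear (transpose :: real^3^3 \<Rightarrow> real^3^3)" by (rule bounded_linear.linear[OF bounded_linear_transpose])
  have "antisymmetric (a *\<^sub>R X + b *\<^sub>R Y)" using X(3,4) by (simp add: antisymmetric_def linear_add[OF T] linear_scale[OF T])
  moreover have "a *\<^sub>R \<xi> + b *\<^sub>R \<eta> = Q ** (a *\<^sub>R X + b *\<^sub>R Y)"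
    unfolding X(1,2) by (simp only: linear_add[OF L] linear_scale[OF L])
  ultimately show ?thesis unfolding tangent_SO3_def by (intro CollectI exI[of _ "a *\<^sub>R X + b *\<^sub>R Y"] conjI)
qed

lemma g_sum:
  assumes Q: "Q \<in> SO3" and \<xi>: "\<And>i. \<xi> i \<in> tangent_SO3 Q" and \<zeta>: "\<zeta> \<in> tangent_SO3 Q" and "finite I"
  shows "(\<Sum>i\<in>I. a i *\<^sub>R \<xi> i) \<in> tangent_SO3 Q \<and> g Q (\<Sum>i\<in>I. a i *\<^sub>R \<xi> i) \<zeta> = (\<Sum>i\<in>I. a i * g Q (\<xi> i) \<zeta>)"
  using \<open>finite I\<close>
proof induction
  case empty
  show ?case using g_linear[OF Q \<zeta> \<zeta> \<zeta>, of 0 0] tangent_SO3_comb[OF \<zeta> \<zeta>, of 0 0] by simp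
next
  case (insert i I)
  have "g Q (a i *\<^sub>R \<xi> i + 1 *\<^sub>R (\<Sum>i\<in>I. a i *\<^sub>R \<xi> i)) \<zeta> = a i * g Q (\<xi> i) \<zeta> + 1 * g Q (\<Sum>i\<in>I. a i *\<^sub>R \<xi> i) \<zeta>"
    by (rule g_linear[OF Q \<xi> _ \<zeta>]) (use insert in auto)
  moreover have "a i *\<^sub>R \<xi> i + 1 *\<^sub>R (\<Sum>i\<in>I. a i *\<^sub>R \<xi> i) \<in> tangent_SO3 Q"
    by (rule tangent_SO3_comb[OF \<xi>]) (use insert in auto)
  ultimately show ?case using insert by simp
qed

lemma g_double_sum:
  fixes \<xi> \<eta> :: "3 \<Rightarrow> real^3^3"
  assumes Q: "Q \<in> SO3" and \<xi>: "\<And>i. \<xi> i \<in> tangent_SO3 Q" and \<eta>: "\<And>i. \<eta> i \<in> tangent_SO3 Q"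
  shows "g Q (\<Sum>i\<in>UNIV. a i *\<^sub>R \<xi> i) (\<Sum>j\<in>UNIV. b j *\<^sub>R \<eta> j) = (\<Sum>i\<in>UNIV. \<Sum>j\<in>UNIV. a i * b j * g Q (\<xi> i) (\<eta> j))"
proof -
  have t: "(\<Sum>j\<in>UNIV. b j *\<^sub>R \<eta> j) \<in> tangent_SO3 Q" using g_sum[OF Q \<eta> \<eta>[of 1], of UNIV b] by simp
  have "g Q (\<Sum>i\<in>UNIV. a i *\<^sub>R \<xi> i) (\<Sum>j\<in>UNIV. b j *\<^sub>R \<eta> j) = (\<Sum>i\<in>UNIV. a i * g Q (\<xi> i) (\<Sum>j\<in>UNIV. b j *\<^sub>R \<eta> j))"
    using g_sum[OF Q \<xi> t, of UNIV a] by simp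
  also have "\<dots> = (\<Sum>i\<in>UNIV. a i * (\<Sum>j\<in>UNIV. b j * g Q (\<xi> i) (\<eta> j)))"
    using g_sum[OF Q \<eta> \<xi>, of UNIV b] g_sym[OF Q \<xi> t] g_sym[OF Q \<xi> \<eta>] by simp
  finally show ?thesis by (simp only: sum_distrib_left mult.assoc)
qed

definition gram :: "real^3 \<Rightarrow> real^3^3" where
  "gram x = (\<chi> i j. g (cayley x) (cayley_deriv x (axis i 1)) (cayley_deriv x (axis j 1)))"

definition vol_density :: "real^3 \<Rightarrow> real" where
  "vol_density x = sqrt (det (gram x))"

text \<open>The matrix is the Gram matrix of the images of the unit vectors, which are linearly
  independent by \<open>inj_cayley_deriv\<close>.\<close>

lemma vol_density_pos: "0 < vol_density x"
proof -
  have "0 < det (gram x)"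
  proof (rule det_pos_definite)
    show "gram x $ i $ j = gram x $ j $ i" for i j
      by (simp add: gram_def g_sym[OF cayley_SO3 cayley_deriv_tangent cayley_deriv_tangent])
    fix a :: "real^3" assume a: "a \<noteq> 0"
    have "cayley_deriv x a \<noteq> 0"
      using a inj_cayley_deriv[of x] unfolding linear_injective_0[OF linear_cayley_deriv] by blast
    then have "0 < g (cayley x) (cayley_deriv x a) (cayley_deriv x a)"
      by (intro g_pos cayley_SO3 cayley_deriv_tangent)
    also have "\<dots> = (\<Sum>i\<in>UNIV. \<Sum>j\<in>UNIV. a $ i * a $ j * gram x $ i $ j)"
      unfolding linear_axis_expansion[OF linear_cayley_deriv, of x a]
      by (simp add: g_double_sum[OF cayley_SO3 cayley_deriv_tangent cayley_deriv_tangent] gram_def)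
    finally show "0 < (\<Sum>i\<in>UNIV. \<Sum>j\<in>UNIV. a $ i * a $ j * gram x $ i $ j)" .
  qed
  then show ?thesis by (simp add: vol_density_def)
qed

text \<open>Continuity of the metric follows from its invariance: left translation moves the tangent
  vectors to the identity, where the metric is one fixed bilinear form and only its arguments depend
  on x.\<close>

lemma gram_continuous: "continuous_on UNIV (\<lambda>x. gram x $ i $ j)"
proof -
  define u where "u i x = vee (transpose (cayley x) ** cayley_deriv x (axis i 1))" for i x
  have one: "mat 1 \<in> SO3" by (simp add: SO3_def orthogonal_matrix_id)
  have t1: "hat v \<in> tangent_SO3 (mat 1)" for v using antisymmetric_hat by (auto simp: tangent_SO3_def)
  have u: "transpose (cayley x) ** cayley_deriv x (axis i 1) ** mat 1 = hat (u i x)" for i x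
  proof -
    have "transpose (cayley x) ** cayley_deriv x (axis i 1) ** mat 1 \<in> tangent_SO3 (transpose (cayley x) ** cayley x ** mat 1)"
      by (rule tangent_SO3_mult[OF cayley_deriv_tangent one])
    then have "antisymmetric (transpose (cayley x) ** cayley_deriv x (axis i 1))"
      by (auto simp: SO3_inverse cayley_SO3 tangent_SO3_def)
    then show ?thesis by (simp add: u_def hat_vee)
  qed
  have "gram x $ i $ j = (\<Sum>k\<in>UNIV. \<Sum>l\<in>UNIV. u i x $ k * u j x $ l * g (mat 1) (hat (axis k 1)) (hat (axis l 1)))" for x
  proof -
    have "gram x $ i $ j = g (transpose (cayley x) ** cayley x ** mat 1) (transpose (cayley x) ** cayley_deriv x (axis i 1) ** mat 1)
        (transpose (cayley x) ** cayley_deriv x (axis j 1) ** mat 1)"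
      unfolding gram_def by (simp only: vec_lambda_beta
          g_invariant[OF SO3_transpose[OF cayley_SO3] cayley_SO3 one cayley_deriv_tangent cayley_deriv_tangent])
    also have "\<dots> = g (mat 1) (hat (u i x)) (hat (u j x))"
      unfolding u by (simp add: SO3_inverse cayley_SO3)
    also have "\<dots> = (\<Sum>k\<in>UNIV. \<Sum>l\<in>UNIV. u i x $ k * u j x $ l * g (mat 1) (hat (axis k 1)) (hat (axis l 1)))"
      unfolding linear_axis_expansion[OF bounded_linear.linear[OF bounded_linear_hat], of "u i x"]
        linear_axis_expansion[OF bounded_linear.linear[OF bounded_linear_hat], of "u j x"]
      by (rule g_double_sum[OF one t1 t1])
    finally show ?thesis .
  qed
  moreover have "continuous_on UNIV (u i)" for i
    unfolding u_def by (intro continuous_intros continuous_on_cayley_deriv)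
  ultimately show ?thesis by (simp only:) (intro continuous_intros)
qed

lemma vol_density_continuous: "continuous_on UNIV vol_density"
  unfolding vol_density_def det_3
  by (intro continuous_on_real_sqrt continuous_on_diff continuous_on_add continuous_on_mult gram_continuous)

lemma sets_vol: "sets vol = sets (restrict_space borel SO3)"
  by (rule vol[unfolded riemannian_volume_SO3_def, THEN conjunct1])

lemma space_vol: "space vol = SO3"
  using sets_eq_imp_space_eq[OF sets_vol] by (simp add: space_restrict_space)

lemma SO3_borel [measurable]: "SO3 \<in> sets borel"
  using SO3_closed by (rule borel_closed)

lemma sets_vol_iff: "J \<in> sets vol \<longleftrightarrow> J \<in> sets borel \<and> J \<subseteq> SO3"
  unfolding sets_vol by (subst sets_restrict_space_iff) auto

text \<open>The coordinate vector fields of a translated chart are the translates of those of the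
  Cayley chart, and the metric is unchanged by translations from either side. Hence the density is
  the same for all P and R.\<close>

lemma chart_volume:
  assumes P: "P \<in> SO3" and R: "R \<in> SO3" and V: "V \<in> sets borel"
  shows "emeasure vol ((\<lambda>x. P ** cayley x ** R) ` V) = (\<integral>\<^sup>+x\<in>V. ennreal (vol_density x) \<partial>lborel)"
proof -
  have "emeasure vol ((\<lambda>x. P ** cayley x ** R) ` V) =
    (\<integral>\<^sup>+x\<in>V. ennreal (sqrt (det ((\<chi> i j. g (P ** cayley x ** R) (P ** cayley_deriv x (axis i 1) ** R) (P ** cayley_deriv x (axis j 1) ** R)) :: real^3^3))) \<partial>lborel)"
    by (rule vol[unfolded riemannian_volume_SO3_def, THEN conjunct2, rule_format, OF local_parametrization_cayley[OF P R]])
      (simp_all add: V)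
  then show ?thesis
    by (simp only: g_invariant[OF P cayley_SO3 R cayley_deriv_tangent cayley_deriv_tangent] vol_density_def gram_def)
qed

definition chart_domain :: "real^3^3 \<Rightarrow> (real^3^3) set" where
  "chart_domain R = (\<lambda>x. cayley x ** R) ` UNIV"

text \<open>A nonnegative trace means 4 / (1 + |x|^2) \<ge> 1 by \<open>trace_cayley\<close>, so
  |x|^2 \<le> 3. Coordinates in a fixed compact ball therefore suffice.\<close>

lemma chart_domain_cover:
  assumes "Q \<in> SO3"
  obtains R x where "R \<in> flips" "Q = cayley x ** R" "norm x \<le> 2"
proof -
  obtain R where R: "R \<in> flips" "0 \<le> trace (Q ** R)" by (rule flips_cover)
  define x where "x = cayley_inv (Q ** R)"
  have x: "cayley x = Q ** R" unfolding x_def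
    by (rule cayley_cayley_inv) (use R in \<open>auto intro: SO3_mult flips_SO3 assms\<close>)
  have "1 \<le> 4 / (1 + x \<bullet> x)" using R(2) trace_cayley[of x] by (simp add: x)
  then have "x \<bullet> x \<le> 3" using one_plus_inner_pos[of x] by (simp add: field_simps)
  then have "(norm x)\<^sup>2 \<le> 2\<^sup>2" by (simp add: power2_norm_eq_inner)
  then have n: "norm x \<le> 2" by (rule power2_le_imp_le) simp
  have "Q = cayley x ** R" by (simp add: x matrix_mul_assoc[symmetric] flips_involution[OF R(1)])
  then show thesis using that R n by blast
qed

lemma finite_flips: "finite flips"
  by (simp add: flips_def)

lemma chart_domain_sets: "R \<in> flips \<Longrightarrow> chart_domain R \<in> sets vol"
proof -
  assume R: "R \<in> flips"
  have one: "mat 1 \<in> SO3" by (simp add: SO3_def orthogonal_matrix_id)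
  have "openin (top_of_set SO3) (chart_domain R)"
    using local_parametrization_cayley[OF one flips_SO3[OF R]] by (simp add: local_parametrization_SO3_def chart_domain_def)
  then obtain T where "open T" "chart_domain R = SO3 \<inter> T" by (auto simp: openin_open)
  then show ?thesis by (auto simp: sets_vol_iff)
qed

lemma translation_measurable: "P \<in> SO3 \<Longrightarrow> R \<in> SO3 \<Longrightarrow> (\<lambda>Q. P ** Q ** R) \<in> measurable vol vol"
proof -
  assume P: "P \<in> SO3" and R: "R \<in> SO3"
  have "(\<lambda>Q. P ** Q ** R) \<in> borel_measurable borel"
    by (rule borel_measurable_continuous_onI) (intro continuous_intros)
  then have "(\<lambda>Q. P ** Q ** R) \<in> measurable (restrict_space borel SO3) (restrict_space borel SO3)"
    by (intro measurable_restrict_space3) (auto intro: SO3_mult P R)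
  then show ?thesis by (simp cong: measurable_cong_sets add: sets_vol)
qed

text \<open>A set with coordinates V in one translated Cayley chart has as preimage under a
  translation the set with the same coordinates V in another such chart, and
  \<open>chart_volume\<close> assigns the same value to both.\<close>

lemma vol_translation:
  assumes P: "P \<in> SO3" and R: "R \<in> SO3"
  shows "distr vol vol (\<lambda>Q. P ** Q ** R) = vol"
proof -
  have one: "mat 1 \<in> SO3" by (simp add: SO3_def orthogonal_matrix_id)
  have "vol = distr vol vol (\<lambda>Q. P ** Q ** R)"
  proof (rule measure_eqI_cover[where I = flips and S = chart_domain])
    show "space vol \<subseteq> (\<Union>R\<in>flips. chart_domain R)"
    proof
      fix Q assume "Q \<in> space vol"
      then obtain R x where "R \<in> flips" "Q = cayley x ** R" unfolding space_vol by (rule chart_domain_cover)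
      then show "Q \<in> (\<Union>R\<in>flips. chart_domain R)" by (auto simp: chart_domain_def)
    qed
    fix F J assume F: "F \<in> flips" and J: "J \<in> sets vol" "J \<subseteq> chart_domain F"
    define V where "V = {x. cayley x ** F \<in> J}"
    have Jb: "J \<in> sets borel" using J by (simp add: sets_vol_iff)
    have "(\<lambda>x. cayley x ** F) \<in> borel_measurable borel"
      by (rule borel_measurable_continuous_onI) (intro continuous_intros)
    from measurable_sets[OF this Jb] have V: "V \<in> sets borel" by (simp add: V_def vimage_def)
    have J1: "J = (\<lambda>x. mat 1 ** cayley x ** F) ` V" using J(2) by (auto simp: V_def chart_domain_def)
    have J2: "(\<lambda>Q. P ** Q ** R) -` J \<inter> space vol = (\<lambda>x. transpose P ** cayley x ** (F ** transpose R)) ` V"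
    proof (intro equalityI subsetI)
      fix Q assume "Q \<in> (\<lambda>Q. P ** Q ** R) -` J \<inter> space vol"
      then obtain x where x: "x \<in> V" "P ** Q ** R = cayley x ** F" by (auto simp: J1)
      have "Q = transpose P ** (P ** Q ** R) ** transpose R"
        by (simp add: matrix_mul_assoc[symmetric] SO3_cancel[OF P] SO3_inverse[OF R])
      then show "Q \<in> (\<lambda>x. transpose P ** cayley x ** (F ** transpose R)) ` V" unfolding x(2) using x(1) by (auto simp: matrix_mul_assoc)
    next
      fix Q assume "Q \<in> (\<lambda>x. transpose P ** cayley x ** (F ** transpose R)) ` V"
      then obtain x where x: "x \<in> V" "Q = transpose P ** cayley x ** (F ** transpose R)" by blast
      have "P ** Q ** R = cayley x ** F"
        by (simp add: x(2) matrix_mul_assoc[symmetric] SO3_cancel[OF P] SO3_inverse[OF R])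
      then show "Q \<in> (\<lambda>Q. P ** Q ** R) -` J \<inter> space vol"
        using x by (auto simp: V_def space_vol intro!: SO3_mult SO3_transpose P R cayley_SO3 flips_SO3[OF F])
    qed
    have "emeasure (distr vol vol (\<lambda>Q. P ** Q ** R)) J = emeasure vol ((\<lambda>Q. P ** Q ** R) -` J \<inter> space vol)"
      by (rule emeasure_distr[OF translation_measurable[OF P R] J(1)])
    also have "\<dots> = emeasure vol J"
      unfolding J2 chart_volume[OF SO3_transpose[OF P] SO3_mult[OF flips_SO3[OF F] SO3_transpose[OF R]] V]
      using chart_volume[OF one flips_SO3[OF F] V] by (simp only: J1[symmetric])
    finally show "emeasure vol J = emeasure (distr vol vol (\<lambda>Q. P ** Q ** R)) J" by simp
  next
    fix R assume "R \<in> flips"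
    then show "chart_domain R \<inter> space vol \<in> sets vol" by (intro sets.Int chart_domain_sets sets.top)
  qed (simp_all add: finite_flips)
  then show ?thesis by simp
qed

text \<open>The images of the closed ball of radius 2 under finitely many charts cover the group,
  and the continuous density is bounded on that ball.\<close>

lemma vol_finite: "emeasure vol (space vol) < \<infinity>"
proof -
  have one: "mat 1 \<in> SO3" by (simp add: SO3_def orthogonal_matrix_id)
  obtain K where K: "\<And>x. x \<in> cball 0 2 \<Longrightarrow> vol_density x \<le> K"
    using compact_imp_bounded[OF compact_continuous_image[OF continuous_on_subset[OF vol_density_continuous] compact_cball[of 0 2]]]
    by (auto simp: bounded_iff image_iff) (meson abs_le_D1 mem_cball_0)
  let ?J = "\<lambda>R. (\<lambda>x. mat 1 ** cayley x ** R) ` cball 0 2"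
  have J: "?J R \<in> sets vol" if "R \<in> flips" for R
  proof -
    have "compact (?J R)" by (intro compact_continuous_image continuous_intros compact_cball)
    then have "?J R \<in> sets borel" by (intro borel_compact)
    then show ?thesis using that by (auto simp: sets_vol_iff intro: SO3_mult cayley_SO3 flips_SO3)
  qed
  have fin: "emeasure vol (?J R) < \<infinity>" if R: "R \<in> flips" for R
  proof -
    have "emeasure vol (?J R) = (\<integral>\<^sup>+x\<in>cball 0 2. ennreal (vol_density x) \<partial>lborel)"
      by (rule chart_volume[OF one flips_SO3[OF R]]) simp
    also have "\<dots> \<le> (\<integral>\<^sup>+(x::real^3). ennreal K * indicator (cball 0 2) x \<partial>lborel)"
      by (intro nn_integral_mono) (auto simp: indicator_def intro!: ennreal_leI K)
    also have "\<dots> = ennreal K * emeasure lborel (cball (0::real^3) 2)" by (subst nn_integral_cmult_indicator) auto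
    also have "\<dots> < \<infinity>" using emeasure_bounded_finite[OF bounded_cball, of "0::real^3" 2] by (simp add: ennreal_mult_less_top)
    finally show ?thesis .
  qed
  have "space vol \<subseteq> (\<Union>R\<in>flips. ?J R)"
  proof
    fix Q assume "Q \<in> space vol"
    then obtain R x where "R \<in> flips" "Q = cayley x ** R" "norm x \<le> 2" unfolding space_vol by (rule chart_domain_cover)
    then show "Q \<in> (\<Union>R\<in>flips. ?J R)" by (intro UN_I[of R] image_eqI[of _ _ x]) auto
  qed
  then have "emeasure vol (space vol) \<le> emeasure vol (\<Union>R\<in>flips. ?J R)"
    by (intro emeasure_mono sets.finite_UN finite_flips J)
  also have "\<dots> \<le> (\<Sum>R\<in>flips. emeasure vol (?J R))"
    by (intro emeasure_subadditive_finite finite_flips) (use J in auto)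
  also have "\<dots> < \<infinity>" using fin finite_flips by (simp add: ennreal_sum_less_top)
  finally show ?thesis .
qed

lemma vol_positive: "0 < emeasure vol (space vol)"
proof -
  have one: "mat 1 \<in> SO3" by (simp add: SO3_def orthogonal_matrix_id)
  have meas: "vol_density \<in> borel_measurable borel" by (rule borel_measurable_continuous_onI[OF vol_density_continuous])
  have "(\<integral>\<^sup>+x. ennreal (vol_density x) \<partial>lborel) \<noteq> 0"
  proof
    assume "(\<integral>\<^sup>+x. ennreal (vol_density x) \<partial>lborel) = 0"
    then have "AE x in lborel. ennreal (vol_density x) = 0" using meas by (subst (asm) nn_integral_0_iff_AE) auto
    moreover have "(ennreal (vol_density x) = 0) = False" for x using vol_density_pos[of x] by (simp add: ennreal_eq_0_iff not_le)
    ultimately have "AE x in (lborel :: (real^3) measure). False" by simp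
    then obtain N :: "(real^3) set" where "{x \<in> space lborel. \<not> False} \<subseteq> N" "emeasure lborel N = 0" by (rule AE_E)
    then have "emeasure lborel (UNIV :: (real^3) set) = 0" by (simp add: top.extremum_unique)
    then show False by simp
  qed
  then have "emeasure vol (chart_domain (mat 1)) \<noteq> 0"
    using chart_volume[OF one one, of UNIV] by (simp add: chart_domain_def)
  moreover have "emeasure vol (chart_domain (mat 1)) \<le> emeasure vol (space vol)" by (rule emeasure_space)
  ultimately show ?thesis by (metis le_zero_eq not_gr_zero)
qed

text \<open>Normalization is meaningful because the total volume is neither 0 nor infinite; a
  constant factor does not affect invariance.\<close>

lemma
  defines "lam \<equiv> normalized_measure vol"
  shows sets_lam: "sets lam = sets (restrict_space borel SO3)"
    and prob_lam: "prob_space lam"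
    and lam_translation: "P \<in> SO3 \<Longrightarrow> R \<in> SO3 \<Longrightarrow> distr lam lam (\<lambda>Q. P ** Q ** R) = lam"
proof -
  show "sets lam = sets (restrict_space borel SO3)" by (simp add: lam_def normalized_measure_def sets_vol)
  show "prob_space lam"
    by (rule prob_spaceI) (use vol_positive vol_finite in \<open>simp add: lam_def normalized_measure_def space_scale_measure ennreal_divide_times divide_self less_top\<close>)
  assume P: "P \<in> SO3" and R: "R \<in> SO3"
  have m: "(\<lambda>Q. P ** Q ** R) \<in> measurable lam lam"
    using translation_measurable[OF P R] by (simp add: lam_def normalized_measure_def cong: measurable_cong_sets)
  show "distr lam lam (\<lambda>Q. P ** Q ** R) = lam"
  proof (rule measure_eqI)
    fix J assume "J \<in> sets (distr lam lam (\<lambda>Q. P ** Q ** R))"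
    then have J: "J \<in> sets vol" by (simp add: lam_def normalized_measure_def)
    have "emeasure vol ((\<lambda>Q. P ** Q ** R) -` J \<inter> space vol) = emeasure vol J"
      using emeasure_distr[OF translation_measurable[OF P R] J] vol_translation[OF P R] by simp
    then show "emeasure (distr lam lam (\<lambda>Q. P ** Q ** R)) J = emeasure lam J"
      using emeasure_distr[OF m, of J] J by (simp add: lam_def normalized_measure_def space_scale_measure)
  qed simp
qed

end

section \<open>Invariance and attraction\<close>

text \<open>Closed sets are stable under intersection and generate the Borel sets, and the indicator
  of a closed set C is the pointwise limit of the continuous functions
  \<open>max 0 (1 - real n * infdist z C)\<close>, which take values in [0, 1].\<close>

lemma measure_eqI_continuous:
  fixes T :: "'b::{metric_space, second_countable_topology} set"
  assumes T: "T \<in> sets borel" and sets: "sets \<mu> = sets (restrict_space borel T)" "sets \<nu> = sets (restrict_space borel T)"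
    and fin: "finite_measure \<mu>" "finite_measure \<nu>"
    and eq: "\<And>f. continuous_on UNIV f \<Longrightarrow> (\<And>z. 0 \<le> f z \<and> f z \<le> 1) \<Longrightarrow> (\<integral>z. f z \<partial>\<mu>) = (\<integral>z. f z \<partial>\<nu> :: real)"
  shows "\<mu> = \<nu>"
proof -
  have id: "(\<lambda>z. z) \<in> measurable N borel" if N: "sets N = sets (restrict_space borel T)" for N
    using measurable_restrict_space1[of "\<lambda>z. z" borel borel T] by (simp add: measurable_cong_sets[OF N refl])
  have lim: "(\<lambda>n. \<integral>z. max 0 (1 - real n * infdist z C) \<partial>N) \<longlonglongrightarrow> measure (distr N borel (\<lambda>z. z)) C"
    if N: "sets N = sets (restrict_space borel T)" "finite_measure N" and C: "closed C" "C \<noteq> {}" for N C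
  proof -
    have c: "(\<lambda>z. max 0 (1 - real n * infdist z C)) \<in> borel_measurable borel" for n
      by (intro borel_measurable_continuous_onI continuous_intros)
    have cb: "C \<in> sets borel" using C(1) by (rule borel_closed)
    have "(\<lambda>n. \<integral>z. max 0 (1 - real n * infdist z C) \<partial>N) \<longlonglongrightarrow> (\<integral>z. indicator C z \<partial>N)"
    proof (rule integral_dominated_convergence[where w = "\<lambda>_. 1"])
      show "indicator C \<in> borel_measurable N" using measurable_compose[OF id[OF N(1)], of "indicator C" borel] cb by simp
      show "(\<lambda>z. max 0 (1 - real n * infdist z C)) \<in> borel_measurable N" for n by (rule measurable_compose[OF id[OF N(1)] c])
      show "integrable N (\<lambda>_. 1 :: real)" using N(2) by (simp add: finite_measure.integrable_const)
      show "AE z in N. norm (max 0 (1 - real n * infdist z C)) \<le> 1" for n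
        by (simp add: infdist_nonneg)
      show "AE z in N. (\<lambda>n. max 0 (1 - real n * infdist z C)) \<longlonglongrightarrow> indicator C z"
      proof (rule AE_I2)
        fix z
        show "(\<lambda>n. max 0 (1 - real n * infdist z C)) \<longlonglongrightarrow> indicator C z"
        proof (cases "z \<in> C")
          case False
          then have d: "0 < infdist z C" using in_closed_iff_infdist_zero[OF C, of z] infdist_nonneg[of z C] by linarith
          obtain m :: nat where m: "1 / infdist z C < real m" using reals_Archimedean2 by blast
          have "max 0 (1 - real n * infdist z C) = 0" if "m \<le> n" for n
          proof -
            have "1 < real m * infdist z C" using m d by (simp add: field_simps)
            also have "\<dots> \<le> real n * infdist z C" using that d by (simp add: mult_right_mono)
            finally show ?thesis by simp
          qed
          then have "eventually (\<lambda>n. max 0 (1 - real n * infdist z C) = 0) sequentially"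
            unfolding eventually_sequentially by blast
          then show ?thesis using False by (simp add: tendsto_eventually)
        qed simp
      qed
    qed
    moreover have "(\<integral>z. indicator C z \<partial>N) = measure (distr N borel (\<lambda>z. z)) C"
      using cb id[OF N(1)] by (simp add: measure_distr Int_commute)
    ultimately show ?thesis by simp
  qed
  \<comment> \<open>The measures live on the subspace \<open>T\<close>. They are compared after
    being pushed forward to the whole space, where the closed sets are the generator.\<close>
  have "distr \<mu> borel (\<lambda>z. z) = distr \<nu> borel (\<lambda>z. z)"
  proof (rule measure_eqI_generator_eq[where \<Omega> = UNIV and E = "Collect closed" and A = "\<lambda>_. UNIV"])
    interpret \<mu>: finite_measure "distr \<mu> borel (\<lambda>z. z)" by (rule finite_measure.finite_measure_distr[OF fin(1) id[OF sets(1)]])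
    interpret \<nu>: finite_measure "distr \<nu> borel (\<lambda>z. z)" by (rule finite_measure.finite_measure_distr[OF fin(2) id[OF sets(2)]])
    show "emeasure (distr \<mu> borel (\<lambda>z. z)) C = emeasure (distr \<nu> borel (\<lambda>z. z)) C" if "C \<in> Collect closed" for C
    proof (cases "C = {}")
      case False
      have C: "closed C" using that by simp
      have "(\<integral>z. max 0 (1 - real n * infdist z C) \<partial>\<mu>) = (\<integral>z. max 0 (1 - real n * infdist z C) \<partial>\<nu>)" for n
        by (rule eq) (auto intro!: continuous_intros simp: infdist_nonneg)
      then have "measure (distr \<mu> borel (\<lambda>z. z)) C = measure (distr \<nu> borel (\<lambda>z. z)) C"
        using LIMSEQ_unique[OF lim[OF sets(1) fin(1) C False]] lim[OF sets(2) fin(2) C False] by simp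
      then show ?thesis by (simp add: \<mu>.emeasure_eq_measure \<nu>.emeasure_eq_measure)
    qed simp
    show "emeasure (distr \<mu> borel (\<lambda>z. z)) UNIV \<noteq> \<infinity>" by simp
    show "Int_stable (Collect closed)" by (auto simp: Int_stable_def)
  qed (auto simp: borel_eq_closed)
  then have e: "emeasure (distr \<mu> borel (\<lambda>z. z)) J = emeasure (distr \<nu> borel (\<lambda>z. z)) J" for J by simp
  show ?thesis
  proof (rule measure_eqI)
    fix J assume "J \<in> sets \<mu>"
    then have J: "J \<in> sets borel" "J \<subseteq> T" using T by (simp_all add: sets sets_restrict_space_iff)
    have "space \<mu> = T" "space \<nu> = T" using sets[THEN sets_eq_imp_space_eq] by (simp_all add: space_restrict_space)
    then have "J \<inter> space \<mu> = J" "J \<inter> space \<nu> = J" using J(2) by auto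
    then show "emeasure \<mu> J = emeasure \<nu> J" using e[of J] J(1) id[OF sets(1)] id[OF sets(2)] by (simp add: emeasure_distr)
  qed (simp add: sets)
qed

section \<open>Measurability and integration on \<open>SO3\<close>\<close>

abbreviation "SO3_space \<equiv> restrict_space borel SO3"

lemma SO3_borel: "SO3 \<in> sets borel"
  using SO3_closed by (rule borel_closed)

lemma SO3_one: "mat 1 \<in> SO3"
  by (simp add: SO3_def orthogonal_matrix_id)

lemma measurable_SO3_mult:
  assumes u: "u \<in> measurable N SO3_space" and v: "v \<in> measurable N SO3_space"
  shows "(\<lambda>x. u x ** v x) \<in> measurable N SO3_space"
proof (rule measurable_restrict_space2)
  have "u x \<in> SO3" "v x \<in> SO3" if "x \<in> space N" for x
    using measurable_space[OF u that] measurable_space[OF v that] by (auto simp: space_restrict_space)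
  then show "(\<lambda>x. u x ** v x) \<in> space N \<rightarrow> SO3" by (auto intro: SO3_mult)
  have b: "u \<in> borel_measurable N" "v \<in> borel_measurable N"
    using u v by (simp_all add: measurable_restrict_space2_iff)
  have "continuous_on UNIV (\<lambda>p :: (real^3^3) \<times> (real^3^3). fst p ** snd p)" by (intro continuous_intros)
  then show "(\<lambda>x. u x ** v x) \<in> borel_measurable N" by (rule borel_measurable_continuous_Pair[OF b])
qed

lemma continuous_SO3_bounded:
  assumes "continuous_on SO3 (f :: real^3^3 \<Rightarrow> real)"
  shows "\<exists>K. \<forall>z\<in>SO3. \<bar>f z\<bar> \<le> K"
proof -
  have "bounded (f ` SO3)" by (intro compact_imp_bounded compact_continuous_image assms SO3_compact)
  then show ?thesis by (simp add: bounded_iff)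
qed

lemma continuous_SO3_measurable: "continuous_on SO3 f \<Longrightarrow> f \<in> borel_measurable SO3_space"
  by (rule borel_measurable_continuous_on_restrict)

text \<open>Expectations are nonexpansive for the supremum norm on \<open>SO3\<close>. This is what
  extends statements from polynomials to continuous functions by the Stone-Weierstrass
  theorem.\<close>

lemma integral_SO3_close:
  assumes "prob_space N" and u: "u \<in> measurable N SO3_space" and f: "continuous_on SO3 f" and h: "continuous_on SO3 h"
    and e: "\<And>z. z \<in> SO3 \<Longrightarrow> \<bar>f z - h z\<bar> \<le> (e :: real)"
  shows "integrable N (\<lambda>\<omega>. f (u \<omega>))" "\<bar>(\<integral>\<omega>. f (u \<omega>) \<partial>N) - (\<integral>\<omega>. h (u \<omega>) \<partial>N)\<bar> \<le> e"
proof -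
  interpret prob_space N by fact
  have us: "u \<omega> \<in> SO3" if "\<omega> \<in> space N" for \<omega> using measurable_space[OF u that] by (simp add: space_restrict_space)
  have int: "integrable N (\<lambda>\<omega>. f (u \<omega>))" if f: "continuous_on SO3 f" for f :: "real^3^3 \<Rightarrow> real"
  proof -
    obtain K where "\<forall>z\<in>SO3. \<bar>f z\<bar> \<le> K" using continuous_SO3_bounded[OF f] by blast
  then have K: "\<And>z. z \<in> SO3 \<Longrightarrow> \<bar>f z\<bar> \<le> K" by blast
    show ?thesis
      by (rule integrable_const_bound[of _ K]) (use K us measurable_compose[OF u continuous_SO3_measurable[OF f]] in auto)
  qed
  show "integrable N (\<lambda>\<omega>. f (u \<omega>))" by (rule int[OF f])
  have d: "integrable N (\<lambda>\<omega>. f (u \<omega>) - h (u \<omega>))" by (intro Bochner_Integration.integrable_diff int f h)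
  have b: "f (u \<omega>) - h (u \<omega>) \<le> e" "- e \<le> f (u \<omega>) - h (u \<omega>)" if "\<omega> \<in> space N" for \<omega>
    using e[OF us[OF that]] by linarith+
  have "(\<integral>\<omega>. f (u \<omega>) - h (u \<omega>) \<partial>N) \<le> e" by (rule integral_le_const[OF d]) (use b in auto)
  moreover have "- e \<le> (\<integral>\<omega>. f (u \<omega>) - h (u \<omega>) \<partial>N)" by (rule integral_ge_const[OF d]) (use b in auto)
  ultimately show "\<bar>(\<integral>\<omega>. f (u \<omega>) \<partial>N) - (\<integral>\<omega>. h (u \<omega>) \<partial>N)\<bar> \<le> e"
    by (simp add: Bochner_Integration.integral_diff int f h)
qed

text \<open>Intended for the products of a starting point with one fixed random rotation, which are
  jointly measurable.\<close>

lemma fubini_SO3: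
  assumes "prob_space N" "prob_space M" and u: "(\<lambda>(y, \<omega>). u y \<omega>) \<in> measurable (N \<Otimes>\<^sub>M M) SO3_space"
    and f: "f \<in> borel_measurable SO3_space" and K: "\<And>z. z \<in> SO3 \<Longrightarrow> \<bar>f z :: real\<bar> \<le> K"
  shows "(\<integral>y. (\<integral>\<omega>. f (u y \<omega>) \<partial>M) \<partial>N) = (\<integral>\<omega>. (\<integral>y. f (u y \<omega>) \<partial>N) \<partial>M)"
    and "(\<lambda>y. \<integral>\<omega>. f (u y \<omega>) \<partial>M) \<in> borel_measurable N"
    and "(\<integral>y. (\<integral>\<omega>. f (u y \<omega>) \<partial>M) \<partial>N) = (\<integral>p. f (case p of (y, \<omega>) \<Rightarrow> u y \<omega>) \<partial>(N \<Otimes>\<^sub>M M))"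
proof -
  interpret N: prob_space N by fact
  interpret M: prob_space M by fact
  interpret pair_prob_space N M ..
  have m: "(\<lambda>p. f (case p of (y, \<omega>) \<Rightarrow> u y \<omega>)) \<in> borel_measurable (N \<Otimes>\<^sub>M M)"
    by (rule measurable_compose[OF u f])
  have e: "(\<lambda>p. f (case p of (y, \<omega>) \<Rightarrow> u y \<omega>)) = (\<lambda>(y, \<omega>). f (u y \<omega>))" by auto
  have us: "(case p of (y, \<omega>) \<Rightarrow> u y \<omega>) \<in> SO3" if "p \<in> space (N \<Otimes>\<^sub>M M)" for p
    using measurable_space[OF u that] by (simp add: space_restrict_space)
  have int: "integrable (N \<Otimes>\<^sub>M M) (\<lambda>(y, \<omega>). f (u y \<omega>))"
    unfolding e[symmetric] by (rule integrable_const_bound[of _ K]) (use K us m in auto)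
  show "(\<integral>y. (\<integral>\<omega>. f (u y \<omega>) \<partial>M) \<partial>N) = (\<integral>\<omega>. (\<integral>y. f (u y \<omega>) \<partial>N) \<partial>M)"
    by (rule Fubini_integral[OF int, symmetric])
  show "(\<lambda>y. \<integral>\<omega>. f (u y \<omega>) \<partial>M) \<in> borel_measurable N"
    by (rule M.borel_measurable_lebesgue_integral) (use m in \<open>simp only: e\<close>)
  show "(\<integral>y. (\<integral>\<omega>. f (u y \<omega>) \<partial>M) \<partial>N) = (\<integral>p. f (case p of (y, \<omega>) \<Rightarrow> u y \<omega>) \<partial>(N \<Otimes>\<^sub>M M))"
    unfolding e using integral_fst'[OF int] by simp
qed

section \<open>Expectations and laws along the solutions\<close>

locale so3_sde = brownian M F W for M :: "'w measure" and F W +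
  fixes A B :: "real^3^3" and Z :: "real^3^3 \<Rightarrow> real \<Rightarrow> 'w \<Rightarrow> real^3^3"
  assumes A: "antisymmetric A" and B: "antisymmetric B"
    and sol: "\<And>x. x \<in> SO3 \<Longrightarrow> solution_SO3 M F W A B x (Z x)"
begin

lemma stratonovich: "x \<in> SO3 \<Longrightarrow> stratonovich_linear M F W ((**) A) ((**) B) x (Z x) 2"
proof (intro stratonovich_linear.intro brownian_axioms stratonovich_linear_axioms.intro)
  assume "x \<in> SO3"
  note s = sol[OF this, unfolded solution_SO3_def]
  show "bounded_linear ((**) A :: real^3^3 \<Rightarrow> real^3^3)" "bounded_linear ((**) B :: real^3^3 \<Rightarrow> real^3^3)"
    by (rule bounded_linear_matrix_left)+
  show "norm (Z x t \<omega>) \<le> 2" if "0 \<le> t" "\<omega> \<in> space M" for t \<omega> using s that SO3_norm by blast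
  show "adapted F (Z x)" "continuous_process M (Z x)" using s by blast+
  show "continuous_semimartingale M F (\<lambda>t \<omega>. Z x t \<omega> \<bullet> b)" if b: "b \<in> Basis" for b
  proof -
    obtain i j where "b = axis i (axis j 1)" using b by (auto simp: Basis_vec_def)
    then have "(\<lambda>t \<omega>. Z x t \<omega> \<bullet> b) = (\<lambda>t \<omega>. Z x t \<omega> $ i $ j)" by (simp add: inner_axis)
    then show ?thesis using s by simp
  qed
  show "\<exists>I. has_stratonovich_integral M (\<lambda>s \<omega>. B ** Z x s \<omega>) W t I \<and>
      (AE \<omega> in M. Z x t \<omega> = x + integral {0..t} (\<lambda>s. A ** Z x s \<omega>) + I \<omega>)" if "0 \<le> t" for t
    using s that by blast
qed

lemma Z_SO3: "x \<in> SO3 \<Longrightarrow> 0 \<le> t \<Longrightarrow> \<omega> \<in> space M \<Longrightarrow> Z x t \<omega> \<in> SO3"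
  using sol[unfolded solution_SO3_def] by blast

lemma Z_measurable: "x \<in> SO3 \<Longrightarrow> 0 \<le> t \<Longrightarrow> Z x t \<in> measurable M SO3_space"
  by (rule measurable_restrict_space2) (auto intro: Z_SO3 stratonovich_linear.Z_meas[OF stratonovich])

definition E :: "real^3^3 \<Rightarrow> real \<Rightarrow> (real^3^3 \<Rightarrow> real) \<Rightarrow> real" where
  "E x t f = expectation (\<lambda>\<omega>. f (Z x t \<omega>))"

lemma E_int: "x \<in> SO3 \<Longrightarrow> 0 \<le> t \<Longrightarrow> continuous_on SO3 f \<Longrightarrow> integrable M (\<lambda>\<omega>. f (Z x t \<omega>) :: real)"
  by (rule integral_SO3_close(1)[where h = f and e = 0, OF prob_space_axioms Z_measurable]) auto

lemma E_close: "x \<in> SO3 \<Longrightarrow> 0 \<le> t \<Longrightarrow> continuous_on SO3 f \<Longrightarrow> continuous_on SO3 h \<Longrightarrow>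
    (\<And>z. z \<in> SO3 \<Longrightarrow> \<bar>f z - h z\<bar> \<le> e) \<Longrightarrow> \<bar>E x t f - E x t h\<bar> \<le> e"
  unfolding E_def by (rule integral_SO3_close(2)[OF prob_space_axioms Z_measurable])

lemma E_bound: "x \<in> SO3 \<Longrightarrow> 0 \<le> t \<Longrightarrow> continuous_on SO3 f \<Longrightarrow> (\<And>z. z \<in> SO3 \<Longrightarrow> \<bar>f z\<bar> \<le> C) \<Longrightarrow> \<bar>E x t f\<bar> \<le> C"
  using E_close[of x t f "\<lambda>_. 0" C] by (simp add: E_def)

lemma poly_on_SO3: "real_polynomial_function f \<Longrightarrow> continuous_on SO3 (f :: real^3^3 \<Rightarrow> real)"
  by (simp add: continuous_on_polymonial_function real_polynomial_function_eq)

lemma E_add: "x \<in> SO3 \<Longrightarrow> 0 \<le> t \<Longrightarrow> continuous_on SO3 f \<Longrightarrow> continuous_on SO3 h \<Longrightarrow> E x t (\<lambda>z. f z + h z) = E x t f + E x t h"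
  unfolding E_def by (intro Bochner_Integration.integral_add E_int)

lemma E_scale: "E x t (\<lambda>z. c * f z) = c * E x t f"
  by (simp add: E_def)

lemma E_deriv: "x \<in> SO3 \<Longrightarrow> 0 \<le> t \<Longrightarrow> real_polynomial_function f \<Longrightarrow>
    ((\<lambda>t. E x t f) has_real_derivative E x t (generator ((**) A) ((**) B) f)) (at t within {0..})"
  unfolding E_def by (rule stratonovich_linear.expectation_derivative[OF stratonovich])

lemma evolution: "x \<in> SO3 \<Longrightarrow> so3_evolution A B (E x) 1"
  by unfold_locales (auto intro: A B E_add E_scale E_bound E_deriv poly_on_SO3)

lemma poly_right: "real_polynomial_function f \<Longrightarrow> real_polynomial_function (\<lambda>z. f (z ** x))" for f :: "real^3^3 \<Rightarrow> real" and x :: "real^3^3"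
  by (rule real_polynomial_function_compose_linear[OF _ bounded_linear_matrix_right])

lemma lie_right: "real_polynomial_function f \<Longrightarrow> lie X (\<lambda>z. f (z ** x)) = (\<lambda>z. lie X f (z ** x))" for x :: "real^3^3"
  by (rule ext) (simp only: lie_deriv_compose_linear[OF _ bounded_linear_matrix_right], simp add: lie_deriv_def matrix_mul_assoc)

lemma generator_right:
  fixes x :: "real^3^3"
  assumes f: "real_polynomial_function f"
  shows "generator ((**) A) ((**) B) (\<lambda>z. f (z ** x)) = (\<lambda>z. generator ((**) A) ((**) B) f (z ** x))"
  unfolding generator_def lie_right[OF f] lie_right[OF lie_poly[OF f]] ..

lemma SO3_right: "x \<in> SO3 \<Longrightarrow> continuous_on SO3 f \<Longrightarrow> continuous_on SO3 (\<lambda>z. f (z ** x))" for f :: "real^3^3 \<Rightarrow> real"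
  by (rule continuous_on_compose2[of SO3 f]) (auto intro!: continuous_intros SO3_mult)

text \<open>Right multiplication by x commutes with left multiplication by A and B and hence with
  the generator, so both expectations obey the same evolution equation. The constant 2 is the sum of
  the two bounds.\<close>

lemma evolution_difference: "x \<in> SO3 \<Longrightarrow> so3_evolution A B (\<lambda>t f. E x t f - E (mat 1) t (\<lambda>z. f (z ** x))) 2"
proof
  assume x: "x \<in> SO3"
  note one = SO3_one
  show "antisymmetric A" "antisymmetric B" by (rule A, rule B)
  fix t :: real and f h :: "real^3^3 \<Rightarrow> real" and c C :: real
  assume t: "0 \<le> t" and f: "real_polynomial_function f"
  show "E x t (\<lambda>z. f z + h z) - E (mat 1) t (\<lambda>z. f (z ** x) + h (z ** x)) =
      E x t f - E (mat 1) t (\<lambda>z. f (z ** x)) + (E x t h - E (mat 1) t (\<lambda>z. h (z ** x)))" if h: "real_polynomial_function h"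
    using E_add[OF x t poly_on_SO3[OF f] poly_on_SO3[OF h]]
      E_add[OF one t poly_on_SO3[OF poly_right[OF f]] poly_on_SO3[OF poly_right[OF h]], of x x] by simp
  show "E x t (\<lambda>z. c * f z) - E (mat 1) t (\<lambda>z. c * f (z ** x)) = c * (E x t f - E (mat 1) t (\<lambda>z. f (z ** x)))"
    by (simp add: E_scale right_diff_distrib)
  show "\<bar>E x t f - E (mat 1) t (\<lambda>z. f (z ** x))\<bar> \<le> 2 * C" if C: "\<And>z. z \<in> SO3 \<Longrightarrow> \<bar>f z\<bar> \<le> C"
  proof -
    have "\<bar>E x t f\<bar> \<le> C" by (rule E_bound[OF x t poly_on_SO3[OF f] C])
    moreover have "\<bar>E (mat 1) t (\<lambda>z. f (z ** x))\<bar> \<le> C"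
      by (rule E_bound[OF one t poly_on_SO3[OF poly_right[OF f]]]) (intro C SO3_mult x)
    ultimately show ?thesis by linarith
  qed
  show "((\<lambda>t. E x t f - E (mat 1) t (\<lambda>z. f (z ** x))) has_real_derivative
      E x t (generator ((**) A) ((**) B) f) - E (mat 1) t (\<lambda>z. generator ((**) A) ((**) B) f (z ** x))) (at t within {0..})"
    using DERIV_diff[OF E_deriv[OF x t f] E_deriv[OF one t poly_right[OF f, of x]]] unfolding generator_right[OF f] .
qed

lemma E_start:
  assumes x: "x \<in> SO3" and f: "continuous_on SO3 f"
  shows "E x 0 f = f x"
proof -
  have ae: "AE \<omega> in M. f (Z x 0 \<omega>) = f x"
    using stratonovich_linear.Z_0[OF stratonovich[OF x]] by eventually_elim simp
  have "E x 0 f = expectation (\<lambda>\<omega>. f x)" unfolding E_def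
    by (rule integral_cong_AE[OF borel_measurable_integrable[OF E_int[OF x order_refl f]] _ ae]) simp
  then show ?thesis by (simp add: prob_space)
qed

lemma E_translate_poly:
  assumes x: "x \<in> SO3" and t: "0 \<le> t" and f: "real_polynomial_function f"
  shows "E x t f = E (mat 1) t (\<lambda>z. f (z ** x))"
proof -
  have "E x t f - E (mat 1) t (\<lambda>z. f (z ** x)) = 0"
    by (rule so3_evolution.m_uniqueness[OF evolution_difference[OF x] _ f t]) (simp add: E_start x SO3_one mon_poly poly_right poly_on_SO3)
  then show ?thesis by simp
qed

text \<open>Uniform approximation by polynomials on the compact group; right translation by x
  preserves the quality of the approximation.\<close>

lemma E_translate:
  assumes x: "x \<in> SO3" and t: "0 \<le> t" and f: "continuous_on SO3 f"
  shows "E x t f = E (mat 1) t (\<lambda>z. f (z ** x))"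
proof -
  have "\<bar>E x t f - E (mat 1) t (\<lambda>z. f (z ** x))\<bar> \<le> 0 + e" if e: "0 < e" for e
  proof -
    obtain h where h: "real_polynomial_function h" "\<And>z. z \<in> SO3 \<Longrightarrow> \<bar>f z - h z\<bar> < e / 2"
      using Stone_Weierstrass_real_polynomial_function[OF SO3_compact f, of "e / 2"] e by auto
    have "\<bar>E x t f - E x t h\<bar> \<le> e / 2" by (rule E_close[OF x t f poly_on_SO3[OF h(1)]]) (use h(2) in force)
    moreover have "\<bar>E (mat 1) t (\<lambda>z. f (z ** x)) - E (mat 1) t (\<lambda>z. h (z ** x))\<bar> \<le> e / 2"
      by (rule E_close[OF SO3_one t SO3_right[OF x f] poly_on_SO3[OF poly_right[OF h(1)]]]) (intro less_imp_le h(2) SO3_mult x)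
    ultimately show ?thesis using E_translate_poly[OF x t h(1)] by linarith
  qed
  then have "\<bar>E x t f - E (mat 1) t (\<lambda>z. f (z ** x))\<bar> \<le> 0" by (rule field_le_epsilon)
  then show ?thesis by simp
qed

lemma right_Z_measurable: "x \<in> SO3 \<Longrightarrow> 0 \<le> t \<Longrightarrow> (\<lambda>\<omega>. Z (mat 1) t \<omega> ** x) \<in> measurable M SO3_space"
  by (intro measurable_SO3_mult Z_measurable SO3_one measurable_const) (auto simp: space_restrict_space)

lemma law_translate:
  assumes x: "x \<in> SO3" and t: "0 \<le> t"
  shows "distr M SO3_space (Z x t) = distr M SO3_space (\<lambda>\<omega>. Z (mat 1) t \<omega> ** x)"
proof (rule measure_eqI_continuous[OF SO3_borel])
  show "finite_measure (distr M SO3_space (Z x t))" "finite_measure (distr M SO3_space (\<lambda>\<omega>. Z (mat 1) t \<omega> ** x))"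
    by (intro finite_measure_distr Z_measurable right_Z_measurable x t)+
  fix f :: "real^3^3 \<Rightarrow> real" assume "continuous_on UNIV f"
  then have f: "continuous_on SO3 f" by (rule continuous_on_subset) simp
  then have m: "f \<in> borel_measurable SO3_space" by (rule continuous_SO3_measurable)
  show "(\<integral>z. f z \<partial>distr M SO3_space (Z x t)) = (\<integral>z. f z \<partial>distr M SO3_space (\<lambda>\<omega>. Z (mat 1) t \<omega> ** x))"
    unfolding integral_distr[OF Z_measurable[OF x t] m] integral_distr[OF right_Z_measurable[OF x t] m]
    using E_translate[OF x t f] by (simp add: E_def)
qed simp_all

text \<open>On the right-hand side the integrand is jointly measurable in x and \<omega>, whereas
  the solutions are chosen for each starting point separately. In this form the kernel is accessible
  to Fubini's theorem.\<close>

lemma kernel_translate: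
  assumes x: "x \<in> SO3" and t: "0 \<le> t" and J: "J \<in> sets SO3_space"
  shows "transition_kernel M Z t x J = expectation (\<lambda>\<omega>. indicator J (Z (mat 1) t \<omega> ** x))"
proof -
  have "transition_kernel M Z t x J = measure (distr M SO3_space (Z x t)) J"
    unfolding transition_kernel_def measure_distr[OF Z_measurable[OF x t] J] by (intro arg_cong[of _ _ prob]) auto
  also have "\<dots> = (\<integral>z. indicator J z \<partial>distr M SO3_space (\<lambda>\<omega>. Z (mat 1) t \<omega> ** x))"
    unfolding law_translate[OF x t] using J sets.sets_into_space[OF J] by (simp add: Int_absorb2)
  also have "\<dots> = expectation (\<lambda>\<omega>. indicator J (Z (mat 1) t \<omega> ** x))"
    by (rule integral_distr[OF right_Z_measurable[OF x t]]) (use J in simp)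
  finally show ?thesis .
qed

end

section \<open>Attraction, invariance and uniqueness\<close>

locale so3_haar = so3_sde M F W A B Z for M :: "'w measure" and F W A B Z +
  fixes lam :: "(real^3^3) measure"
  assumes noncommuting: "A ** B - B ** A \<noteq> 0"
    and sets_lam: "sets lam = sets SO3_space" and prob_lam: "prob_space lam"
    and lam_translation: "\<And>P R. P \<in> SO3 \<Longrightarrow> R \<in> SO3 \<Longrightarrow> distr lam lam (\<lambda>Q. P ** Q ** R) = lam"
begin

lemma space_lam: "space lam = SO3"
  using sets_eq_imp_space_eq[OF sets_lam] by (simp add: space_restrict_space)

lemma measurable_lam: "f \<in> measurable SO3_space N \<Longrightarrow> f \<in> measurable lam N"
  using measurable_cong_sets[OF sets_lam refl] by blast

lemma integral_lam_translate:
  assumes P: "P \<in> SO3" and R: "R \<in> SO3" and f: "f \<in> borel_measurable SO3_space"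
  shows "(\<integral>y. f (P ** y ** R) \<partial>lam) = (\<integral>y. f y \<partial>lam :: real)"
proof -
  have i: "(\<lambda>y. y) \<in> measurable lam SO3_space" by (rule measurable_lam) simp
  have c: "(\<lambda>y. P) \<in> measurable lam SO3_space" "(\<lambda>y. R) \<in> measurable lam SO3_space" using P R by (simp_all add: space_restrict_space)
  have "(\<lambda>y. P ** y ** R) \<in> measurable lam SO3_space" by (intro measurable_SO3_mult i c)
  then have m: "(\<lambda>y. P ** y ** R) \<in> measurable lam lam" using measurable_cong_sets[OF refl sets_lam] by blast
  show ?thesis using integral_distr[OF m measurable_lam[OF f]] by (simp add: lam_translation P R)
qed

lemma left_pair_measurable:
  assumes N: "sets N = sets SO3_space" and x: "x \<in> SO3" and t: "0 \<le> t"
  shows "(\<lambda>(y, \<omega>). y ** Z x t \<omega>) \<in> measurable (N \<Otimes>\<^sub>M M) SO3_space" "(\<lambda>(y, \<omega>). Z x t \<omega> ** y) \<in> measurable (N \<Otimes>\<^sub>M M) SO3_space"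
proof -
  have "fst \<in> measurable (N \<Otimes>\<^sub>M M) SO3_space" using measurable_fst[of N M] measurable_cong_sets[OF refl N] by blast
  moreover have "(\<lambda>p. Z x t (snd p)) \<in> measurable (N \<Otimes>\<^sub>M M) SO3_space" by (rule measurable_compose[OF measurable_snd Z_measurable[OF x t]])
  ultimately show "(\<lambda>(y, \<omega>). y ** Z x t \<omega>) \<in> measurable (N \<Otimes>\<^sub>M M) SO3_space" "(\<lambda>(y, \<omega>). Z x t \<omega> ** y) \<in> measurable (N \<Otimes>\<^sub>M M) SO3_space"
    unfolding case_prod_unfold by (auto intro: measurable_SO3_mult)
qed

text \<open>The asymptotic invariance is averaged over the translating rotation y with respect to
  \<open>lam\<close>. By Fubini's theorem and right invariance of \<open>lam\<close>, the averaged
  expectation equals the integral of f for every t; dominated convergence in y turns the pointwise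
  decay into decay of the average.\<close>

lemma attraction_poly:
  assumes x: "x \<in> SO3" and f: "real_polynomial_function f"
  shows "((\<lambda>t. E x t f) \<longlongrightarrow> (\<integral>y. f y \<partial>lam)) at_top"
proof -
  interpret lam: prob_space lam by (rule prob_lam)
  interpret evo: so3_evolution A B "E x" 1 by (rule evolution[OF x])
  have c: "continuous_on SO3 f" by (rule poly_on_SO3[OF f])
  obtain K where "\<forall>z\<in>SO3. \<bar>f z\<bar> \<le> K" using continuous_SO3_bounded[OF c] by blast
  then have K: "\<And>z. z \<in> SO3 \<Longrightarrow> \<bar>f z\<bar> \<le> K" by blast
  have m: "f \<in> borel_measurable SO3_space" by (rule continuous_SO3_measurable[OF c])
  \<comment> \<open>The value 0 for negative t keeps \<open>D t\<close> measurable and bounded for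
    every real t.\<close>
  define D where "D t y = (if 0 \<le> t then E x t (\<lambda>z. f (y ** z)) - E x t f else 0)" for t y
  have Dm: "(\<lambda>y. E x t (\<lambda>z. f (y ** z))) \<in> borel_measurable lam" if t: "0 \<le> t" for t
    unfolding E_def by (rule fubini_SO3(2)[OF prob_lam prob_space_axioms left_pair_measurable(1)[OF sets_lam x t] m K])
  have bd: "\<bar>E x t (\<lambda>z. f (y ** z))\<bar> \<le> K" if t: "0 \<le> t" and y: "y \<in> SO3" for t y
    by (rule E_bound[OF x t poly_on_SO3[OF evo.poly_left[OF f]]]) (intro K SO3_mult y)
  have bd': "\<bar>E x t f\<bar> \<le> K" if t: "0 \<le> t" for t by (rule E_bound[OF x t c K])
  have K0: "0 \<le> K" using K[OF SO3_one] by linarith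
  have "((\<lambda>t. \<integral>y. D t y \<partial>lam) \<longlongrightarrow> (\<integral>y. 0 \<partial>lam)) at_top"
  proof (rule integral_dominated_convergence_at_top[where w = "\<lambda>_. 2 * K"])
    show "D t \<in> borel_measurable lam" for t unfolding D_def using Dm by (cases "0 \<le> t") auto
    show "eventually (\<lambda>t. AE y in lam. norm (D t y) \<le> 2 * K) at_top"
    proof (rule always_eventually, intro allI AE_I2)
      fix t y assume "y \<in> space lam"
      then have y: "y \<in> SO3" by (simp add: space_lam)
      show "norm (D t y) \<le> 2 * K"
      proof (cases "0 \<le> t")
        case True
        then show ?thesis using bd[OF True y] bd'[OF True] by (simp add: D_def)
      qed (simp add: D_def K0)
    qed
    show "AE y in lam. ((\<lambda>t. D t y) \<longlongrightarrow> 0) at_top"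
    proof (rule AE_I2)
      fix y assume "y \<in> space lam"
      then have y: "y \<in> SO3" by (simp add: space_lam)
      have "eventually (\<lambda>t. E x t (\<lambda>z. f (y ** z)) - E x t f = D t y) at_top"
        using eventually_ge_at_top[of "0::real"] by eventually_elim (simp add: D_def)
      then show "((\<lambda>t. D t y) \<longlongrightarrow> 0) at_top"
        by (rule Lim_transform_eventually[OF evo.asymptotic_invariance[OF noncommuting f y]])
    qed
  qed auto
  moreover have "eventually (\<lambda>t. (\<integral>y. D t y \<partial>lam) = (\<integral>y. f y \<partial>lam) - E x t f) at_top"
    using eventually_ge_at_top[of "0::real"]
  proof eventually_elim
    case (elim t)
    have i: "integrable lam (\<lambda>y. E x t (\<lambda>z. f (y ** z)))"
      by (rule lam.integrable_const_bound[of _ K]) (use Dm elim bd in \<open>auto simp: space_lam\<close>)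
    have "(\<integral>y. E x t (\<lambda>z. f (y ** z)) \<partial>lam) = expectation (\<lambda>\<omega>. \<integral>y. f (y ** Z x t \<omega>) \<partial>lam)"
      unfolding E_def by (rule fubini_SO3(1)[OF prob_lam prob_space_axioms left_pair_measurable(1)[OF sets_lam x elim] m K])
    also have "\<dots> = expectation (\<lambda>\<omega>. \<integral>y. f y \<partial>lam)"
      by (rule Bochner_Integration.integral_cong[OF refl])
        (use integral_lam_translate[OF SO3_one Z_SO3[OF x elim] m] in simp)
    finally have "(\<integral>y. E x t (\<lambda>z. f (y ** z)) \<partial>lam) = (\<integral>y. f y \<partial>lam)" by (simp add: prob_space)
    then show ?case using elim i by (simp add: D_def lam.prob_space)
  qed
  ultimately have "((\<lambda>t. (\<integral>y. f y \<partial>lam) - E x t f) \<longlongrightarrow> 0) at_top" by (auto elim: Lim_transform_eventually)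
  from tendsto_diff[OF tendsto_const this, of "\<integral>y. f y \<partial>lam"] show ?thesis by simp
qed

lemma attraction:
  assumes x: "x \<in> SO3" and f: "continuous_on SO3 f"
  shows "((\<lambda>t. E x t f) \<longlongrightarrow> (\<integral>y. f y \<partial>lam)) at_top"
proof (rule tendstoI)
  fix e :: real assume e: "0 < e"
  define d where "d = e / 3"
  have d: "0 < d" "e = 3 * d" using e by (simp_all add: d_def)
  obtain h where h: "real_polynomial_function h" "\<And>z. z \<in> SO3 \<Longrightarrow> \<bar>f z - h z\<bar> < d"
    using Stone_Weierstrass_real_polynomial_function[OF SO3_compact f d(1)] by auto
  have h': "\<bar>f z - h z\<bar> \<le> d" if "z \<in> SO3" for z using h(2)[OF that] by simp
  have i: "(\<lambda>y. y) \<in> measurable lam SO3_space" by (rule measurable_lam) simp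
  have L: "\<bar>(\<integral>y. f y \<partial>lam) - (\<integral>y. h y \<partial>lam)\<bar> \<le> d"
    by (rule integral_SO3_close(2)[OF prob_lam i f poly_on_SO3[OF h(1)] h'])
  have "eventually (\<lambda>t. dist (E x t h) (\<integral>y. h y \<partial>lam) < d) at_top" by (rule tendstoD[OF attraction_poly[OF x h(1)] d(1)])
  then show "eventually (\<lambda>t. dist (E x t f) (\<integral>y. f y \<partial>lam) < e) at_top"
    using eventually_ge_at_top[of "0::real"]
  proof eventually_elim
    case (elim t)
    have "\<bar>E x t f - E x t h\<bar> \<le> d" by (rule E_close[OF x elim(2) f poly_on_SO3[OF h(1)] h'])
    then show ?case using elim(1) L d(2) by (simp add: dist_real_def)
  qed
qed

text \<open>Here it is left invariance of \<open>lam\<close> that counts: for each \<omega> the map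
  taking x to \<open>Z (mat 1) t \<omega> ** x\<close> preserves it.\<close>

lemma invariance:
  assumes t: "0 \<le> t" and J: "J \<in> sets SO3_space"
  shows "(\<integral>x. transition_kernel M Z t x J \<partial>lam) = measure lam J"
proof -
  interpret lam: prob_space lam by (rule prob_lam)
  have m: "indicator J \<in> borel_measurable SO3_space" using J by simp
  have "(\<integral>x. transition_kernel M Z t x J \<partial>lam) = (\<integral>x. expectation (\<lambda>\<omega>. indicator J (Z (mat 1) t \<omega> ** x)) \<partial>lam)"
    by (intro Bochner_Integration.integral_cong refl kernel_translate t J) (simp add: space_lam)
  also have "\<dots> = expectation (\<lambda>\<omega>. \<integral>x. indicator J (Z (mat 1) t \<omega> ** x) \<partial>lam)"
    by (rule fubini_SO3(1)[OF prob_lam prob_space_axioms left_pair_measurable(2)[OF sets_lam SO3_one t] m, of 1])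
      (simp add: indicator_def)
  also have "\<dots> = expectation (\<lambda>\<omega>. \<integral>x. indicator J x \<partial>lam)"
    by (rule Bochner_Integration.integral_cong[OF refl])
      (use integral_lam_translate[OF Z_SO3[OF SO3_one t] SO3_one m] in simp)
  also have "\<dots> = measure lam J"
    using J sets.sets_into_space[of J lam] by (simp add: prob_space sets_lam Int_absorb2)
  finally show ?thesis .
qed

text \<open>Under an invariant measure the mean of f at time t does not depend on t, while
  attraction from every starting point drives it to the integral with respect to
  \<open>lam\<close>.\<close>

lemma uniqueness:
  assumes inv: "invariant_measure SO3 (transition_kernel M Z) \<nu>"
  shows "\<nu> = lam"
proof (rule measure_eqI_continuous[OF SO3_borel])
  show sets: "sets \<nu> = sets SO3_space" "sets lam = sets SO3_space"
    using inv by (simp_all add: invariant_measure_def borel_probability_on_def sets_lam)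
  have p: "prob_space \<nu>" using inv by (simp add: invariant_measure_def borel_probability_on_def)
  interpret \<nu>: prob_space \<nu> by (rule p)
  interpret lam: prob_space lam by (rule prob_lam)
  interpret pp: pair_prob_space \<nu> M ..
  show "finite_measure \<nu>" "finite_measure lam" by unfold_locales
  have space: "space \<nu> = SO3" using sets_eq_imp_space_eq[OF sets(1)] by (simp add: space_restrict_space)
  \<comment> \<open>Invariance is given for the kernel, set by set. It is restated as an equality of
    laws for a jointly measurable map, so that it applies to functions as well.\<close>
  have law: "distr (\<nu> \<Otimes>\<^sub>M M) SO3_space (\<lambda>(y, \<omega>). Z (mat 1) t \<omega> ** y) = \<nu>" if t: "0 \<le> t" for t
  proof (rule measure_eqI)
    note u = left_pair_measurable(2)[OF sets(1) SO3_one t]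
    interpret d: prob_space "distr (\<nu> \<Otimes>\<^sub>M M) SO3_space (\<lambda>(y, \<omega>). Z (mat 1) t \<omega> ** y)" by (rule pp.prob_space_distr[OF u])
    fix J assume "J \<in> sets (distr (\<nu> \<Otimes>\<^sub>M M) SO3_space (\<lambda>(y, \<omega>). Z (mat 1) t \<omega> ** y))"
    then have J: "J \<in> sets SO3_space" by simp
    have m: "indicator J \<in> borel_measurable SO3_space" using J by simp
    have "measure (distr (\<nu> \<Otimes>\<^sub>M M) SO3_space (\<lambda>(y, \<omega>). Z (mat 1) t \<omega> ** y)) J
        = (\<integral>z. indicator J z \<partial>distr (\<nu> \<Otimes>\<^sub>M M) SO3_space (\<lambda>(y, \<omega>). Z (mat 1) t \<omega> ** y))"
      using J sets.sets_into_space[OF J] by (simp add: Int_absorb2)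
    also have "\<dots> = (\<integral>p. indicator J (case p of (y, \<omega>) \<Rightarrow> Z (mat 1) t \<omega> ** y) \<partial>(\<nu> \<Otimes>\<^sub>M M))"
      by (rule integral_distr[OF u m])
    also have "\<dots> = (\<integral>y. expectation (\<lambda>\<omega>. indicator J (Z (mat 1) t \<omega> ** y)) \<partial>\<nu>)"
      by (rule fubini_SO3(3)[OF p prob_space_axioms u m, of 1, symmetric]) (simp add: indicator_def)
    also have "\<dots> = (\<integral>y. transition_kernel M Z t y J \<partial>\<nu>)"
      by (intro Bochner_Integration.integral_cong refl kernel_translate[symmetric] t J) (simp add: space)
    also have "\<dots> = measure \<nu> J" using inv t J by (simp add: invariant_measure_def)
    finally show "emeasure (distr (\<nu> \<Otimes>\<^sub>M M) SO3_space (\<lambda>(y, \<omega>). Z (mat 1) t \<omega> ** y)) J = emeasure \<nu> J"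
      by (simp add: d.emeasure_eq_measure \<nu>.emeasure_eq_measure)
  qed (simp add: sets)
  fix f :: "real^3^3 \<Rightarrow> real" assume "continuous_on UNIV f"
  then have f: "continuous_on SO3 f" by (rule continuous_on_subset) simp
  have m: "f \<in> borel_measurable SO3_space" by (rule continuous_SO3_measurable[OF f])
  obtain K where "\<forall>z\<in>SO3. \<bar>f z\<bar> \<le> K" using continuous_SO3_bounded[OF f] by blast
  then have K: "\<And>z. z \<in> SO3 \<Longrightarrow> \<bar>f z\<bar> \<le> K" by blast
  have K0: "0 \<le> K" using K[OF SO3_one] by linarith
  \<comment> \<open>Written with the solution from the identity, because this version is measurable
    in y.\<close>
  define D where "D t y = (if 0 \<le> t then E (mat 1) t (\<lambda>z. f (z ** y)) else 0)" for t y
  have De: "D t y = E y t f" if "0 \<le> t" "y \<in> SO3" for t y using E_translate[OF that(2,1) f] that by (simp add: D_def)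
  have eq: "(\<integral>y. D t y \<partial>\<nu>) = (\<integral>y. f y \<partial>\<nu>)" if t: "0 \<le> t" for t
  proof -
    note u = left_pair_measurable(2)[OF sets(1) SO3_one t]
    have "(\<integral>y. D t y \<partial>\<nu>) = (\<integral>y. expectation (\<lambda>\<omega>. f (Z (mat 1) t \<omega> ** y)) \<partial>\<nu>)" using t by (simp add: D_def E_def)
    also have "\<dots> = (\<integral>p. f (case p of (y, \<omega>) \<Rightarrow> Z (mat 1) t \<omega> ** y) \<partial>(\<nu> \<Otimes>\<^sub>M M))"
      by (rule fubini_SO3(3)[OF p prob_space_axioms u m K])
    also have "\<dots> = (\<integral>z. f z \<partial>distr (\<nu> \<Otimes>\<^sub>M M) SO3_space (\<lambda>(y, \<omega>). Z (mat 1) t \<omega> ** y))"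
      by (rule integral_distr[OF u m, symmetric])
    finally show ?thesis by (simp only: law[OF t])
  qed
  have "((\<lambda>t. \<integral>y. D t y \<partial>\<nu>) \<longlongrightarrow> (\<integral>y. (\<integral>z. f z \<partial>lam) \<partial>\<nu>)) at_top"
  proof (rule integral_dominated_convergence_at_top[where w = "\<lambda>_. K"])
    show "D t \<in> borel_measurable \<nu>" for t
    proof (cases "0 \<le> t")
      case True
      then show ?thesis unfolding D_def E_def
        using fubini_SO3(2)[OF p prob_space_axioms left_pair_measurable(2)[OF sets(1) SO3_one True] m K] by simp
    next
      case False
      then have "D t = (\<lambda>y. 0)" by (simp add: D_def fun_eq_iff)
      then show ?thesis by simp
    qed
    show "eventually (\<lambda>t. AE y in \<nu>. norm (D t y) \<le> K) at_top"
    proof (rule always_eventually, intro allI AE_I2)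
      fix t y assume "y \<in> space \<nu>"
      then have y: "y \<in> SO3" by (simp add: space)
      show "norm (D t y) \<le> K"
      proof (cases "0 \<le> t")
        case True
        then show ?thesis using E_bound[OF y True f K] by (simp add: De[OF True y])
      qed (simp add: D_def K0)
    qed
    show "AE y in \<nu>. ((\<lambda>t. D t y) \<longlongrightarrow> (\<integral>z. f z \<partial>lam)) at_top"
    proof (rule AE_I2)
      fix y assume "y \<in> space \<nu>"
      then have y: "y \<in> SO3" by (simp add: space)
      have "eventually (\<lambda>t. E y t f = D t y) at_top" using eventually_ge_at_top[of "0::real"] by eventually_elim (simp add: De y)
      then show "((\<lambda>t. D t y) \<longlongrightarrow> (\<integral>z. f z \<partial>lam)) at_top" by (rule Lim_transform_eventually[OF attraction[OF y f]])
    qed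
  qed auto
  then have "((\<lambda>t. \<integral>y. D t y \<partial>\<nu>) \<longlongrightarrow> (\<integral>z. f z \<partial>lam)) at_top" by (simp add: \<nu>.prob_space)
  moreover have "((\<lambda>t. \<integral>y. D t y \<partial>\<nu>) \<longlongrightarrow> (\<integral>y. f y \<partial>\<nu>)) at_top"
    by (rule tendsto_eventually) (use eventually_ge_at_top[of "0::real"] in eventually_elim, simp add: eq)
  ultimately show "(\<integral>z. f z \<partial>\<nu>) = (\<integral>z. f z \<partial>lam)"
    by (intro tendsto_unique[OF _ _ _]) (auto simp: trivial_limit_at_top_linorder)
qed

end

theorem theorem3p4:
  fixes A B :: "real^3^3"
    and M :: "'w measure" and F :: "real \<Rightarrow> 'w measure" and W :: "real \<Rightarrow> 'w \<Rightarrow> real"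
    and Z :: "real^3^3 \<Rightarrow> real \<Rightarrow> 'w \<Rightarrow> real^3^3"
    and g :: "real^3^3 \<Rightarrow> real^3^3 \<Rightarrow> real^3^3 \<Rightarrow> real"
    and vol lam :: "(real^3^3) measure"
  assumes "antisymmetric A" and "antisymmetric B" and "B \<noteq> 0"
    and "prob_space M" and "filtration_on M F" and "wiener_process M F W"
    and "\<forall>x\<in>SO3. solution_SO3 M F W A B x (Z x)"
    and "biinvariant_metric_SO3 g" and "riemannian_volume_SO3 g vol"
    and "lam = normalized_measure vol"
    and "A ** B - B ** A \<noteq> 0"
  shows "attractive_measure SO3 (feller_semigroup M Z) lam \<and>
         invariant_measure SO3 (transition_kernel M Z) lam \<and>
         (\<forall>\<nu>. invariant_measure SO3 (transition_kernel M Z) \<nu> \<longrightarrow> \<nu> = lam)"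
proof -
  have bv: "biinvariant_volume g vol" using assms(8,9) by (rule biinvariant_volume.intro)
  have br: "brownian M F W" by (intro brownian.intro brownian_axioms.intro assms)
  interpret so3_haar M F W A B Z lam
    unfolding assms(10)
    by (intro so3_haar.intro so3_sde.intro so3_sde_axioms.intro so3_haar_axioms.intro br assms
        assms(7)[rule_format] biinvariant_volume.sets_lam[OF bv] biinvariant_volume.prob_lam[OF bv] biinvariant_volume.lam_translation[OF bv])
  have p: "borel_probability_on SO3 lam" using sets_lam prob_lam by (simp add: borel_probability_on_def)
  have "attractive_measure SO3 (feller_semigroup M Z) lam"
    using p attraction by (simp add: attractive_measure_def feller_semigroup_def E_def)
  moreover have "invariant_measure SO3 (transition_kernel M Z) lam"
    using p invariance by (simp add: invariant_measure_def)
  ultimately show ?thesis using uniqueness by blast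
qed

end
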